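(* Let $X=\{X(t),t\in\mathbb{R}^N\}$ be an $(N,d)$-Gaussian random field whose coordinates are independent copies of a real-valued centered Gaussian random field $X_0$ with continuous covariance function, where $X_0$ satisfies Conditions (C1) and (C3) with index $H=(H_1,\ldots,H_N)\in(0,1)^N$. Let $I=[0,1]^N$ and let $L_S(X,I\times I)$ be the self-intersection local time of $X$ on $I\times I$. Then: (i) $L_S(X,I\times I)\in L^2(\Omega,\mathbb{P})$ if and only if $\sum_{j=1}^N\frac1{H_j}>d$. (ii) $L_S(X,I\times I)\in D_1$ if $\sum_{j=1}^N\frac1{H_j}>d+2$. (iii) $L_S(X,I\times I)\notin D_1$ if $$\sum_{j=1}^N\frac1{H_j}\le\max\Big\{\frac{d+2}{2},\,\frac{2d}{3}\Big\}.$$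
   Context: $N,d\ge1$ are integers. An $(N,d)$-Gaussian random field is $X(t)=(X_1(t),\ldots,X_d(t))\in\mathbb{R}^d$, where $X_1,\ldots,X_d$ are independent copies of $X_0$. Sample paths are taken to be continuous on $[0,1]^N$. Condition (C1): there is a constant $0<c_1<\infty$ such that $\mathbb{E}[(X_0(s)-X_0(t))^2]\le c_1\sum_{j=1}^N|s_j-t_j|^{2H_j}$ for all $s,t\in[0,1]^N$. Condition (C3): there is a constant $c>0$ such that for all $u,t^1,t^2,t^3\in[0,1]^N$, $\mathrm{Var}(X_0(u)\mid X_0(t^1),X_0(t^2),X_0(t^3))\ge c\sum_{j=1}^N\min_{0\le k\le3}|u_j-t_j^k|^{2H_j}$, where $t_j^0=0$ for $j=1,\ldots,N$ (the left side is the conditional variance). The self-intersection local time is formally $L_S(X,I\times I)=\int_{I\times I}\delta(X(s)-X(t))\,ds\,dt$; that is, it is the local time at $0$ on $I\times I$ of the field $V(s,t)=X(s)-X(t)$, defined as the limit in $L^2(\Omega,\mathbb{P})$ as $\varepsilon\to0$ of $\int_{I\times I}p_\varepsilon(X(s)-X(t))\,ds\,dt$, where $p_\varepsilon(x)=(2\pi\varepsilon)^{-d/2}\exp(-\|x\|^2/(2\varepsilon))$, $x\in\mathbb{R}^d$. The assertion $L_S(X,I\times I)\in L^2(\Omega,\mathbb{P})$ means that this $L^2$ limit exists, and $L_S(X,I\times I)\in D_1$ means that it exists and belongs to $D_1$; $\notin$ denotes the negation. Chaos expansion and $D_1$: let $\mathcal{P}_n$ be the closure in $L^2(\Omega,\mathbb{P})$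 of the set of all polynomials of degree at most $n$ in finitely many of the underlying Gaussian variables $X_i(t)$, and let $\mathcal{C}_n$ be the orthogonal complement of $\mathcal{P}_{n-1}$ in $\mathcal{P}_n$ (with $\mathcal{C}_0$ the constants). Every square-integrable functional $F$ of $X$ has a unique chaos expansion $F=\sum_{n\ge0}F_n$, $F_n\in\mathcal{C}_n$, and $D_1=\{F\in L^2(\Omega,\mathbb{P}):\ \sum_{n\ge0}n\,\mathbb{E}(|F_n|^2)<\infty\}$. *)

theory Defs
  imports "HOL-Probability.Probability"
begin

text \<open>
  Indices: \<^typ>\<open>real ^ 'n\<close> is the parameter space, with \<open>N = CARD('n)\<close>, and \<^typ>\<open>real ^ 'd\<close> the
  state space, with \<open>d = CARD('d)\<close>. The unit cube is \<open>cbox 0 1\<close>.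
\<close>

subsection \<open>Gaussian random fields\<close>

text \<open>The case \<open>\<sigma> = 0\<close> allows degenerate linear combinations.\<close>

definition centered_gaussian_field :: "'w measure \<Rightarrow> ('t \<Rightarrow> 'w \<Rightarrow> real) \<Rightarrow> bool" where
  "centered_gaussian_field M Y \<longleftrightarrow>
     (\<forall>t. Y t \<in> borel_measurable M) \<and>
     (\<forall>S a. finite S \<longrightarrow>
        (\<exists>\<sigma>\<ge>0. distr M borel (\<lambda>\<omega>. \<Sum>t\<in>S. a t * Y t \<omega>) =
           (if \<sigma> = 0 then return borel 0 else density lborel (normal_density 0 \<sigma>))))"

text \<open>
  Each coordinate process is regarded as one random element of the product space \<open>\<real>\<^sup>T\<close>: independence
  is that of the whole processes, and equality in law on the product \<open>\<sigma>\<close>-algebra is equality of all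
  finite-dimensional distributions. The field \<open>Y\<close> may live on a different probability space.
\<close>

definition independent_copies ::
  "'w measure \<Rightarrow> ('t \<Rightarrow> 'w \<Rightarrow> real ^ 'd) \<Rightarrow> 'v measure \<Rightarrow> ('t \<Rightarrow> 'v \<Rightarrow> real) \<Rightarrow> bool" where
  "independent_copies M X M0 Y \<longleftrightarrow>
     prob_space.indep_vars M (\<lambda>_. Pi\<^sub>M UNIV (\<lambda>_. borel)) (\<lambda>i \<omega> t. X t \<omega> $ i) UNIV \<and>
     (\<forall>i. distr M (Pi\<^sub>M UNIV (\<lambda>_. borel)) (\<lambda>\<omega> t. X t \<omega> $ i) =
          distr M0 (Pi\<^sub>M UNIV (\<lambda>_. borel)) (\<lambda>\<omega> t. Y t \<omega>))"

definition continuous_covariance ::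
  "'w measure \<Rightarrow> ('t::topological_space \<Rightarrow> 'w \<Rightarrow> real) \<Rightarrow> bool" where
  "continuous_covariance M Y \<longleftrightarrow>
     continuous_on UNIV (\<lambda>(s, t). integral\<^sup>L M (\<lambda>\<omega>. Y s \<omega> * Y t \<omega>))"

definition cond_C1 :: "'w measure \<Rightarrow> (real ^ 'n \<Rightarrow> 'w \<Rightarrow> real) \<Rightarrow> real ^ 'n \<Rightarrow> bool" where
  "cond_C1 M Y H \<longleftrightarrow>
     (\<exists>c>0. \<forall>s\<in>cbox 0 1. \<forall>t\<in>cbox 0 1.
        integral\<^sup>L M (\<lambda>\<omega>. (Y s \<omega> - Y t \<omega>)\<^sup>2) \<le> c * (\<Sum>j\<in>UNIV. \<bar>s $ j - t $ j\<bar> powr (2 * H $ j)))"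

text \<open>The conditional variance of \<open>Y\<close> given the \<open>\<sigma>\<close>-algebra generated by \<open>Z\<close>, a random variable.\<close>

definition cond_variance ::
  "'w measure \<Rightarrow> ('w \<Rightarrow> real) \<Rightarrow> ('w \<Rightarrow> 'z::topological_space) \<Rightarrow> 'w \<Rightarrow> real" where
  "cond_variance M Y Z =
     (let G = vimage_algebra (space M) Z borel
      in real_cond_exp M G (\<lambda>\<omega>. (Y \<omega> - real_cond_exp M G Y \<omega>)\<^sup>2))"

definition cond_C3 :: "'w measure \<Rightarrow> (real ^ 'n \<Rightarrow> 'w \<Rightarrow> real) \<Rightarrow> real ^ 'n \<Rightarrow> bool" where
  "cond_C3 M Y H \<longleftrightarrow>
     (\<exists>c>0. \<forall>u\<in>cbox 0 1. \<forall>t1\<in>cbox 0 1. \<forall>t2\<in>cbox 0 1. \<forall>t3\<in>cbox 0 1.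
        AE \<omega> in M. cond_variance M (Y u) (\<lambda>\<omega>. (Y t1 \<omega>, Y t2 \<omega>, Y t3 \<omega>)) \<omega> \<ge>
          c * (\<Sum>j\<in>UNIV. Min ((\<lambda>x. \<bar>u $ j - x\<bar> powr (2 * H $ j)) ` {0, t1 $ j, t2 $ j, t3 $ j})))"


subsection \<open>Square-integrable random variables\<close>

text \<open>
  Elements of \<open>L\<^sup>2\<close> are represented by measurable functions, determined only up to almost sure
  equality. The squared distance is taken in \<^typ>\<open>ennreal\<close>, so it cannot be
  spuriously zero for non-integrable differences.
\<close>

definition L2 :: "'w measure \<Rightarrow> ('w \<Rightarrow> real) set" where
  "L2 M = {F \<in> borel_measurable M. integrable M (\<lambda>\<omega>. (F \<omega>)\<^sup>2)}"

definition L2_sqdist :: "'w measure \<Rightarrow> ('w \<Rightarrow> real) \<Rightarrow> ('w \<Rightarrow> real) \<Rightarrow> ennreal" where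
  "L2_sqdist M F G = (\<integral>\<^sup>+\<omega>. ennreal ((F \<omega> - G \<omega>)\<^sup>2) \<partial>M)"


subsection \<open>Self-intersection local time\<close>

definition heat_kernel :: "real \<Rightarrow> real ^ 'd \<Rightarrow> real" where
  "heat_kernel \<epsilon> x = (2 * pi * \<epsilon>) powr (- real CARD('d) / 2) * exp (- (norm x)\<^sup>2 / (2 * \<epsilon>))"

definition is_local_time_at_0 ::
  "'w measure \<Rightarrow> ('r::euclidean_space \<Rightarrow> 'w \<Rightarrow> real ^ 'd) \<Rightarrow> 'r set \<Rightarrow> ('w \<Rightarrow> real) \<Rightarrow> bool" where
  "is_local_time_at_0 M V B F \<longleftrightarrow>
     F \<in> L2 M \<and>
     ((\<lambda>\<epsilon>. L2_sqdist M (\<lambda>\<omega>. LINT r:B|lborel. heat_kernel \<epsilon> (V r \<omega>)) F) \<longlongrightarrow> 0) (at_right 0)"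

text \<open>\<open>F\<close> is (a version of) \<open>L\<^sub>S(X, I \<times> I)\<close>; no such \<open>F\<close> exists if the \<open>L\<^sup>2\<close> limit does not exist.\<close>

definition is_self_intersection_local_time ::
  "'w measure \<Rightarrow> (real ^ 'n \<Rightarrow> 'w \<Rightarrow> real ^ 'd) \<Rightarrow> (real ^ 'n) set \<Rightarrow> ('w \<Rightarrow> real) \<Rightarrow> bool" where
  "is_self_intersection_local_time M X I F \<longleftrightarrow>
     is_local_time_at_0 M (\<lambda>(s, t) \<omega>. X s \<omega> - X t \<omega>) (I \<times> I) F"


subsection \<open>Chaos expansion\<close>

text \<open>
  A monomial in the variables \<open>X\<^sub>i(t)\<close> is encoded by the multiset \<open>m\<close> of the pairs \<open>(t, i)\<close>, its
  degree being \<open>size m\<close>.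
\<close>

definition field_polynomials ::
  "('t \<Rightarrow> 'w \<Rightarrow> real ^ 'd) \<Rightarrow> nat \<Rightarrow> ('w \<Rightarrow> real) set" where
  "field_polynomials X n =
     {(\<lambda>\<omega>. \<Sum>m\<in>S. a m * (\<Prod>(t, i)\<in>#m. X t \<omega> $ i)) | S a. finite S \<and> (\<forall>m\<in>S. size m \<le> n)}"

definition poly_closure ::
  "'w measure \<Rightarrow> ('t \<Rightarrow> 'w \<Rightarrow> real ^ 'd) \<Rightarrow> nat \<Rightarrow> ('w \<Rightarrow> real) set" where
  "poly_closure M X n = {F \<in> L2 M. \<forall>e>0. \<exists>G\<in>field_polynomials X n. L2_sqdist M F G < e}"

definition chaos ::
  "'w measure \<Rightarrow> ('t \<Rightarrow> 'w \<Rightarrow> real ^ 'd) \<Rightarrow> nat \<Rightarrow> ('w \<Rightarrow> real) set" where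
  "chaos M X n =
     (if n = 0 then {F \<in> L2 M. \<exists>c. AE \<omega> in M. F \<omega> = c}
      else {F \<in> poly_closure M X n. \<forall>G\<in>poly_closure M X (n - 1). integral\<^sup>L M (\<lambda>\<omega>. F \<omega> * G \<omega>) = 0})"

definition is_chaos_expansion ::
  "'w measure \<Rightarrow> ('t \<Rightarrow> 'w \<Rightarrow> real ^ 'd) \<Rightarrow> ('w \<Rightarrow> real) \<Rightarrow> (nat \<Rightarrow> 'w \<Rightarrow> real) \<Rightarrow> bool" where
  "is_chaos_expansion M X F Fs \<longleftrightarrow>
     (\<forall>n. Fs n \<in> chaos M X n) \<and>
     (\<lambda>k. L2_sqdist M F (\<lambda>\<omega>. \<Sum>n<k. Fs n \<omega>)) \<longlonglongrightarrow> 0"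

text \<open>The expansion is unique up to almost sure equality of the terms, when it exists.\<close>

definition D1 :: "'w measure \<Rightarrow> ('t \<Rightarrow> 'w \<Rightarrow> real ^ 'd) \<Rightarrow> ('w \<Rightarrow> real) set" where
  "D1 M X = {F \<in> L2 M. \<exists>Fs. is_chaos_expansion M X F Fs \<and>
     summable (\<lambda>n. real n * integral\<^sup>L M (\<lambda>\<omega>. (Fs n \<omega>)\<^sup>2))}"

end

theory Submission
  imports Defs "HOL-Analysis.Generalised_Binomial_Theorem"
begin

text \<open>
  The approximations \<open>\<integral>\<integral> p\<^sub>\<epsilon> (X(s) - X(t)) ds dt\<close> of the local time are positive, and their inner products in
  \<open>L\<^sup>2\<close> are explicit: for two pairs \<open>r = (s, t)\<close> and \<open>r' = (s', t')\<close> of parameters, with \<open>v\<close>, \<open>v'\<close> the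
  variances and \<open>\<rho>\<close> the covariance of the increments of \<open>X\<^sub>0\<close> over \<open>r\<close> and \<open>r'\<close>, the expectation of
  \<open>p\<^sub>\<epsilon> (X(s) - X(t)) p\<^sub>\<delta> (X(s') - X(t'))\<close> is \<open>(2 \<pi>)\<^sup>-\<^sup>d\<close> times the power \<open>- d / 2\<close> of the
  determinant \<open>(v + \<epsilon>) (v' + \<delta>) - \<rho>\<^sup>2\<close> (lemma \<open>local_kernel_inner\<close>). This increases as the parameters
  decrease, so that convergence in \<open>L\<^sup>2\<close> is equivalent to boundedness of the integral of this kernel
  over all \<open>(r, r')\<close> (lemma \<open>L2_limit_of_monotone_inner_products\<close>).

  The chaos expansion comes from the same formula. Expanding the kernel in powers of \<open>\<rho>\<^sup>2\<close> by the
  binomial series, the \<open>m\<close>-th term is the covariance kernel of a Laguerre polynomial of degree \<open>m\<close> in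
  \<open>\<bar>X(s) - X(t)\<bar>\<^sup>2\<close>, which is orthogonal to all polynomials in \<open>X\<close> of degree less than \<open>2 m\<close>
  (lemmas \<open>laguerre_inner\<close> and \<open>laguerre_orthogonal_field_polynomials\<close>). It is thus the energy of the
  component in the chaos of order \<open>2 m\<close>, and the components of odd order vanish. Multiplying the
  terms by \<open>m\<close> and summing, the series that defines \<open>D\<^sub>1\<close> becomes a multiple of the integral of
  \<open>\<rho>\<^sup>2\<close> times the power \<open>- (d / 2 + 1)\<close> of the determinant (lemma \<open>weighted_energy\<close>).

  It remains to decide when negative powers of the determinant are integrable; put
  \<open>Q = \<Sum>\<^sub>j 1 / H\<^sub>j\<close>. By (C3) the determinant is at least a product of two prediction errors,
  one involving \<open>s\<close> and one involving \<open>s'\<close> (lemma \<open>determinant_ge\<close>). Each is bounded below by an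
  anisotropic distance whose sublevel sets \<open>{\<le> u}\<close> have measure of order at most \<open>u\<close> to the power
  \<open>Q / 2\<close>, so that the power \<open>- q\<close> of the determinant is integrable for \<open>q < Q / 2\<close>. Taking \<open>q = d / 2\<close>
  gives the existence of the local time for \<open>Q > d\<close>, and \<open>q = d / 2 + 1\<close> gives (ii).

  For the converse directions (C1) is used. The term \<open>m = 0\<close> alone, the square of the integral of
  \<open>v\<close> to the power \<open>- d / 2\<close>, diverges for \<open>Q \<le> d\<close>, because \<open>v\<close> is at most of the order of an
  anisotropic distance of \<open>s\<close> and \<open>t\<close>. This completes (i), and it contains the case \<open>Q \<le> 2 d / 3\<close> of
  (iii). In the case \<open>Q \<le> (d + 2) / 2\<close> the weighted integral diverges near the diagonal \<open>r = r'\<close>, with \<open>s\<close>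
  and \<open>t\<close> kept apart: there \<open>\<rho>\<close> is bounded below, while the determinant is at most of the order of an
  anisotropic distance of \<open>(s, t)\<close> and \<open>(s', t')\<close>, whose sublevel sets have measure of order \<open>u\<^sup>Q\<close>
  (lemma \<open>weighted_determinant_power_integral_unbounded\<close>).
\<close>

section \<open>Limits in mean square\<close>

lemma L2_measurable [measurable_dest]: "F \<in> L2 M \<Longrightarrow> F \<in> borel_measurable M"
  by (simp add: L2_def)

lemma L2_square_integrable: "F \<in> L2 M \<Longrightarrow> integrable M (\<lambda>\<omega>. (F \<omega>)\<^sup>2)"
  by (simp add: L2_def)

lemma L2_mult_integrable:
  assumes "F \<in> L2 M" "G \<in> L2 M"
  shows "integrable M (\<lambda>\<omega>. F \<omega> * G \<omega>)"
proof (rule Bochner_Integration.integrable_bound)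
  show "integrable M (\<lambda>\<omega>. (F \<omega>)\<^sup>2 + (G \<omega>)\<^sup>2)"
    using assms by (intro Bochner_Integration.integrable_add L2_square_integrable)
  show "(\<lambda>\<omega>. F \<omega> * G \<omega>) \<in> borel_measurable M"
    using assms by measurable
  have "\<bar>x * y\<bar> \<le> x\<^sup>2 + y\<^sup>2" for x y :: real
  proof -
    have "2 * (\<bar>x\<bar> * \<bar>y\<bar>) \<le> \<bar>x\<bar>\<^sup>2 + \<bar>y\<bar>\<^sup>2"
      using sum_squares_bound[of "\<bar>x\<bar>" "\<bar>y\<bar>"] by simp
    moreover have "0 \<le> \<bar>x\<bar> * \<bar>y\<bar>" by simp
    ultimately show ?thesis by (simp only: abs_mult power2_abs)
  qed
  then show "AE \<omega> in M. norm (F \<omega> * G \<omega>) \<le> norm ((F \<omega>)\<^sup>2 + (G \<omega>)\<^sup>2)"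
    by auto
qed

lemma L2_scale: "F \<in> L2 M \<Longrightarrow> (\<lambda>\<omega>. c * F \<omega>) \<in> L2 M"
  unfolding L2_def by (auto simp: power_mult_distrib)

lemma L2_add:
  assumes "F \<in> L2 M" "G \<in> L2 M"
  shows "(\<lambda>\<omega>. F \<omega> + G \<omega>) \<in> L2 M"
proof -
  have "(F \<omega> + G \<omega>)\<^sup>2 = (F \<omega>)\<^sup>2 + 2 * (F \<omega> * G \<omega>) + (G \<omega>)\<^sup>2" for \<omega>
    by (simp add: power2_sum)
  moreover have "integrable M (\<lambda>\<omega>. (F \<omega>)\<^sup>2 + 2 * (F \<omega> * G \<omega>) + (G \<omega>)\<^sup>2)"
    using assms by (intro Bochner_Integration.integrable_add L2_square_integrable
        integrable_mult_right L2_mult_integrable)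
  moreover have "(\<lambda>\<omega>. F \<omega> + G \<omega>) \<in> borel_measurable M"
    using assms by measurable
  ultimately show ?thesis
    by (simp add: L2_def)
qed

lemma L2_diff:
  assumes "F \<in> L2 M" "G \<in> L2 M"
  shows "(\<lambda>\<omega>. F \<omega> - G \<omega>) \<in> L2 M"
  using L2_add[OF assms(1) L2_scale[OF assms(2), of "-1"]] by simp

lemma L2_sum:
  "(\<And>i. i \<in> I \<Longrightarrow> F i \<in> L2 M) \<Longrightarrow> (\<lambda>\<omega>. \<Sum>i\<in>I. F i \<omega>) \<in> L2 M"
proof (induction I rule: infinite_finite_induct)
  case (insert i I)
  then show ?case using L2_add[of "F i" M] by simp
qed (auto simp: L2_def)

lemma (in finite_measure) L2_const: "(\<lambda>\<omega>. c) \<in> L2 M"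
  by (simp add: L2_def)

lemma (in finite_measure) L2_integrable: "F \<in> L2 M \<Longrightarrow> integrable M F"
  using L2_mult_integrable[OF _ L2_const, of F 1] by simp

lemma L2_sqdist_eq:
  assumes "F \<in> L2 M" "G \<in> L2 M"
  shows "L2_sqdist M F G = ennreal (\<integral>\<omega>. (F \<omega> - G \<omega>)\<^sup>2 \<partial>M)"
  unfolding L2_sqdist_def
  by (intro nn_integral_eq_integral L2_square_integrable[OF L2_diff] assms AE_I2) simp

lemma L2_sqdist_commute: "L2_sqdist M F G = L2_sqdist M G F"
  unfolding L2_sqdist_def by (simp add: power2_commute)

lemma L2_tendsto_iff:
  assumes "eventually (\<lambda>x. f x \<in> L2 M) \<F>" "F \<in> L2 M"
  shows "((\<lambda>x. L2_sqdist M (f x) F) \<longlongrightarrow> 0) \<F> \<longleftrightarrow>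
         ((\<lambda>x. \<integral>\<omega>. (f x \<omega> - F \<omega>)\<^sup>2 \<partial>M) \<longlongrightarrow> 0) \<F>"
proof -
  have "((\<lambda>x. L2_sqdist M (f x) F) \<longlongrightarrow> 0) \<F> \<longleftrightarrow>
      ((\<lambda>x. ennreal (\<integral>\<omega>. (f x \<omega> - F \<omega>)\<^sup>2 \<partial>M)) \<longlongrightarrow> ennreal 0) \<F>"
    unfolding ennreal_0
    by (rule tendsto_cong, use assms(1) in eventually_elim)
      (simp add: L2_sqdist_eq assms(2))
  also have "\<dots> \<longleftrightarrow> ((\<lambda>x. \<integral>\<omega>. (f x \<omega> - F \<omega>)\<^sup>2 \<partial>M) \<longlongrightarrow> 0) \<F>"
    by (rule tendsto_ennreal_iff) (auto intro!: always_eventually Bochner_Integration.integral_nonneg)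
  finally show ?thesis .
qed

text \<open>The discriminant of the nonnegative quadratic polynomial \<open>t \<mapsto> E (F - t G)\<^sup>2\<close> is not positive.\<close>

lemma L2_Cauchy_Schwarz:
  assumes F: "F \<in> L2 M" and G: "G \<in> L2 M"
  shows "(\<integral>\<omega>. F \<omega> * G \<omega> \<partial>M)\<^sup>2 \<le> (\<integral>\<omega>. (F \<omega>)\<^sup>2 \<partial>M) * (\<integral>\<omega>. (G \<omega>)\<^sup>2 \<partial>M)"
proof -
  let ?a = "\<integral>\<omega>. (G \<omega>)\<^sup>2 \<partial>M" and ?b = "\<integral>\<omega>. F \<omega> * G \<omega> \<partial>M" and ?c = "\<integral>\<omega>. (F \<omega>)\<^sup>2 \<partial>M"
  have "?a * t\<^sup>2 + (- 2 * ?b) * t + ?c \<ge> 0" for t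
  proof -
    have "0 \<le> (\<integral>\<omega>. (F \<omega> - t * G \<omega>)\<^sup>2 \<partial>M)"
      by (intro Bochner_Integration.integral_nonneg) simp
    also have "\<dots> = (\<integral>\<omega>. (F \<omega>)\<^sup>2 - 2 * t * (F \<omega> * G \<omega>) + t\<^sup>2 * (G \<omega>)\<^sup>2 \<partial>M)"
      by (intro Bochner_Integration.integral_cong) (auto simp: power2_diff power_mult_distrib)
    also have "\<dots> = ?c - 2 * t * ?b + t\<^sup>2 * ?a"
      using assms by (simp add: L2_square_integrable L2_mult_integrable)
    finally show ?thesis by (simp add: algebra_simps)
  qed
  then have q: "?a * t\<^sup>2 + (- 2 * ?b) * t + ?c \<ge> 0" for t .
  show ?thesis
  proof (cases "?a = 0")
    case True
    have "?b = 0"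
    proof (rule ccontr)
      assume "?b \<noteq> 0"
      with q[of "(?c + 1) / (2 * ?b)"] True show False by (simp add: field_simps)
    qed
    then show ?thesis using True by simp
  next
    case False
    then have "?a > 0"
      using Bochner_Integration.integral_nonneg[of M "\<lambda>\<omega>. (G \<omega>)\<^sup>2"] by (simp add: less_le)
    with q[of "?b / ?a"] have "?a * (?b / ?a)\<^sup>2 - 2 * ?b * (?b / ?a) + ?c \<ge> 0"
      by simp
    moreover have "?a * (?b / ?a)\<^sup>2 - 2 * ?b * (?b / ?a) = - (?b\<^sup>2 / ?a)"
      using \<open>?a > 0\<close> by (simp add: field_simps power2_eq_square)
    ultimately have "?b\<^sup>2 / ?a \<le> ?c" by simp
    then show ?thesis
      using \<open>?a > 0\<close> by (simp add: field_simps)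
  qed
qed

lemma L2_abs_inner_le:
  assumes "F \<in> L2 M" "G \<in> L2 M"
  shows "\<bar>\<integral>\<omega>. F \<omega> * G \<omega> \<partial>M\<bar> \<le> sqrt (\<integral>\<omega>. (F \<omega>)\<^sup>2 \<partial>M) * sqrt (\<integral>\<omega>. (G \<omega>)\<^sup>2 \<partial>M)"
proof -
  have "\<bar>\<integral>\<omega>. F \<omega> * G \<omega> \<partial>M\<bar> = sqrt ((\<integral>\<omega>. F \<omega> * G \<omega> \<partial>M)\<^sup>2)" by simp
  also have "\<dots> \<le> sqrt ((\<integral>\<omega>. (F \<omega>)\<^sup>2 \<partial>M) * (\<integral>\<omega>. (G \<omega>)\<^sup>2 \<partial>M))"
    by (intro real_sqrt_le_mono L2_Cauchy_Schwarz assms)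
  finally show ?thesis by (simp add: real_sqrt_mult)
qed

lemma L2_tendsto_inner:
  assumes f: "eventually (\<lambda>x. f x \<in> L2 M) \<F>" and F: "F \<in> L2 M"
    and g: "eventually (\<lambda>x. g x \<in> L2 M) \<F>" and G: "G \<in> L2 M"
    and "((\<lambda>x. L2_sqdist M (f x) F) \<longlongrightarrow> 0) \<F>" "((\<lambda>x. L2_sqdist M (g x) G) \<longlongrightarrow> 0) \<F>"
  shows "((\<lambda>x. \<integral>\<omega>. f x \<omega> * g x \<omega> \<partial>M) \<longlongrightarrow> (\<integral>\<omega>. F \<omega> * G \<omega> \<partial>M)) \<F>"
proof -
  define A where "A x = sqrt (\<integral>\<omega>. (f x \<omega> - F \<omega>)\<^sup>2 \<partial>M)" for x
  define B where "B x = sqrt (\<integral>\<omega>. (g x \<omega> - G \<omega>)\<^sup>2 \<partial>M)" for x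
  let ?a = "sqrt (\<integral>\<omega>. (F \<omega>)\<^sup>2 \<partial>M)" and ?b = "sqrt (\<integral>\<omega>. (G \<omega>)\<^sup>2 \<partial>M)"
  have A: "(A \<longlongrightarrow> 0) \<F>" and B: "(B \<longlongrightarrow> 0) \<F>"
    using assms tendsto_real_sqrt[of "\<lambda>x. \<integral>\<omega>. (f x \<omega> - F \<omega>)\<^sup>2 \<partial>M" 0 \<F>]
      tendsto_real_sqrt[of "\<lambda>x. \<integral>\<omega>. (g x \<omega> - G \<omega>)\<^sup>2 \<partial>M" 0 \<F>]
    by (simp_all add: L2_tendsto_iff A_def[abs_def] B_def[abs_def])
  have lim: "((\<lambda>x. A x * B x + ?a * B x + A x * ?b) \<longlongrightarrow> 0) \<F>"
    by (rule tendsto_eq_intros A B refl)+ simp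
  have "((\<lambda>x. (\<integral>\<omega>. f x \<omega> * g x \<omega> \<partial>M) - (\<integral>\<omega>. F \<omega> * G \<omega> \<partial>M)) \<longlongrightarrow> 0) \<F>"
  proof (rule Lim_null_comparison[OF _ lim])
    show "\<forall>\<^sub>F x in \<F>. norm ((\<integral>\<omega>. f x \<omega> * g x \<omega> \<partial>M) - (\<integral>\<omega>. F \<omega> * G \<omega> \<partial>M))
        \<le> A x * B x + ?a * B x + A x * ?b"
      using f g
    proof eventually_elim
      case (elim x)
      have df: "(\<lambda>\<omega>. f x \<omega> - F \<omega>) \<in> L2 M" and dg: "(\<lambda>\<omega>. g x \<omega> - G \<omega>) \<in> L2 M"
        using elim F G by (auto intro: L2_diff)
      have "(\<integral>\<omega>. f x \<omega> * g x \<omega> \<partial>M) - (\<integral>\<omega>. F \<omega> * G \<omega> \<partial>M) = (\<integral>\<omega>. f x \<omega> * g x \<omega> - F \<omega> * G \<omega> \<partial>M)"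
        using elim F G by (simp add: L2_mult_integrable)
      also have "\<dots> = (\<integral>\<omega>. (f x \<omega> - F \<omega>) * (g x \<omega> - G \<omega>) + F \<omega> * (g x \<omega> - G \<omega>) + (f x \<omega> - F \<omega>) * G \<omega> \<partial>M)"
        by (intro Bochner_Integration.integral_cong) (auto simp: algebra_simps)
      also have "\<dots> = (\<integral>\<omega>. (f x \<omega> - F \<omega>) * (g x \<omega> - G \<omega>) \<partial>M) + (\<integral>\<omega>. F \<omega> * (g x \<omega> - G \<omega>) \<partial>M) + (\<integral>\<omega>. (f x \<omega> - F \<omega>) * G \<omega> \<partial>M)"
        using df dg F G by (simp add: L2_mult_integrable)
      finally show ?case
        using L2_abs_inner_le[OF df dg] L2_abs_inner_le[OF F dg] L2_abs_inner_le[OF df G]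
        unfolding A_def B_def real_norm_def by linarith
    qed
  qed
  then show ?thesis by (simp add: LIM_zero_iff)
qed

lemma L2_triangle2:
  assumes "F \<in> L2 M" "G \<in> L2 M" "H \<in> L2 M"
  shows "(\<integral>\<omega>. (F \<omega> - H \<omega>)\<^sup>2 \<partial>M) \<le> 2 * (\<integral>\<omega>. (F \<omega> - G \<omega>)\<^sup>2 \<partial>M) + 2 * (\<integral>\<omega>. (G \<omega> - H \<omega>)\<^sup>2 \<partial>M)"
proof -
  have i: "integrable M (\<lambda>\<omega>. (F \<omega> - G \<omega>)\<^sup>2)" "integrable M (\<lambda>\<omega>. (G \<omega> - H \<omega>)\<^sup>2)"
    "integrable M (\<lambda>\<omega>. (F \<omega> - H \<omega>)\<^sup>2)"
    using assms by (auto intro!: L2_square_integrable L2_diff)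
  have "(\<integral>\<omega>. (F \<omega> - H \<omega>)\<^sup>2 \<partial>M) \<le> (\<integral>\<omega>. 2 * (F \<omega> - G \<omega>)\<^sup>2 + 2 * (G \<omega> - H \<omega>)\<^sup>2 \<partial>M)"
  proof (rule integral_mono)
    fix \<omega>
    have "0 \<le> ((F \<omega> - G \<omega>) - (G \<omega> - H \<omega>))\<^sup>2" by simp
    then show "(F \<omega> - H \<omega>)\<^sup>2 \<le> 2 * (F \<omega> - G \<omega>)\<^sup>2 + 2 * (G \<omega> - H \<omega>)\<^sup>2"
      by (simp add: power2_eq_square algebra_simps)
  qed (use i in auto)
  then show ?thesis using i by simp
qed

text \<open>
  Completeness (Riesz--Fischer): a subsequence with summable increments converges almost surely,
  and Fatou's lemma turns the Cauchy property into convergence in mean square to its limit.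
\<close>

lemma (in prob_space) L2_complete:
  fixes f :: "nat \<Rightarrow> 'a \<Rightarrow> real"
  assumes f: "\<And>n. f n \<in> L2 M"
    and cauchy: "\<And>e. e > 0 \<Longrightarrow> \<exists>N. \<forall>m\<ge>N. \<forall>n\<ge>N. (\<integral>\<omega>. (f m \<omega> - f n \<omega>)\<^sup>2 \<partial>M) < e"
  obtains F where "F \<in> L2 M" "(\<lambda>n. L2_sqdist M (f n) F) \<longlonglongrightarrow> 0"
proof -
  have [measurable]: "f n \<in> borel_measurable M" for n using f by (simp add: L2_measurable)
  from cauchy have "\<forall>k. \<exists>N. \<forall>m\<ge>N. \<forall>n\<ge>N. (\<integral>\<omega>. (f m \<omega> - f n \<omega>)\<^sup>2 \<partial>M) < (1/4)^k"
    by auto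
  then obtain N where N: "\<And>k m n. m \<ge> N k \<Longrightarrow> n \<ge> N k \<Longrightarrow> (\<integral>\<omega>. (f m \<omega> - f n \<omega>)\<^sup>2 \<partial>M) < (1/4)^k"
    by metis
  \<comment> \<open>a subsequence beyond every threshold \<open>N i\<close>, \<open>i \<le> k\<close>, with \<open>r k \<ge> k\<close>\<close>
  define r where "r k = k + (\<Sum>i\<le>k. N i)" for k
  have rN: "r k \<ge> N k" for k
    unfolding r_def using member_le_sum[of k "{..k}" N] by simp
  have rSuc: "r (Suc k) \<ge> N k" for k
    unfolding r_def using member_le_sum[of k "{..k}" N] by simp
  have r_ge: "r k \<ge> k" for k by (simp add: r_def)
  define g where "g k \<omega> = \<bar>f (r (Suc k)) \<omega> - f (r k) \<omega>\<bar>" for k \<omega>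
  have g_meas [measurable]: "g k \<in> borel_measurable M" for k unfolding g_def by measurable
  have gL2: "g k \<in> L2 M" for k
    using L2_square_integrable[OF L2_diff[OF f f]] by (auto simp: L2_def g_def)
  have g_int: "(\<integral>\<omega>. g k \<omega> \<partial>M) \<le> (1/2)^k" for k
  proof -
    have "(\<integral>\<omega>. g k \<omega> * 1 \<partial>M)\<^sup>2 \<le> (\<integral>\<omega>. (g k \<omega>)\<^sup>2 \<partial>M) * (\<integral>\<omega>. 1\<^sup>2 \<partial>M)"
      by (rule L2_Cauchy_Schwarz[OF gL2 L2_const])
    also have "\<dots> = (\<integral>\<omega>. (f (r (Suc k)) \<omega> - f (r k) \<omega>)\<^sup>2 \<partial>M)"
      by (simp add: g_def prob_space)
    also have "\<dots> \<le> (1/4)^k" using N[OF rSuc rN] by (simp add: less_imp_le)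
    also have "\<dots> = ((1/2)^k)\<^sup>2" by (simp add: power2_eq_square flip: power_mult_distrib)
    finally have "(\<integral>\<omega>. g k \<omega> \<partial>M)\<^sup>2 \<le> ((1/2)^k)\<^sup>2" by simp
    then show ?thesis by (rule power2_le_imp_le) simp
  qed
  have "(\<integral>\<^sup>+\<omega>. (\<Sum>k. ennreal (g k \<omega>)) \<partial>M) = (\<Sum>k. \<integral>\<^sup>+\<omega>. ennreal (g k \<omega>) \<partial>M)"
    by (rule nn_integral_suminf) measurable
  also have "\<dots> \<le> (\<Sum>k. ennreal ((1/2)^k))"
  proof (intro suminf_le)
    fix k
    have "(\<integral>\<^sup>+\<omega>. ennreal (g k \<omega>) \<partial>M) = ennreal (\<integral>\<omega>. g k \<omega> \<partial>M)"
      by (intro nn_integral_eq_integral L2_integrable gL2) (simp add: g_def)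
    then show "(\<integral>\<^sup>+\<omega>. ennreal (g k \<omega>) \<partial>M) \<le> ennreal ((1/2)^k)" using g_int by simp
  qed auto
  also have "\<dots> = ennreal (\<Sum>k. (1/2)^k)" by (intro suminf_ennreal2) (auto simp: summable_geometric)
  also have "\<dots> < \<infinity>" by simp
  finally have "AE \<omega> in M. (\<Sum>k. ennreal (g k \<omega>)) \<noteq> \<infinity>"
    by (intro nn_integral_PInf_AE) (auto simp: less_top)
  then have conv: "AE \<omega> in M. convergent (\<lambda>k. f (r k) \<omega>)"
  proof eventually_elim
    case (elim \<omega>)
    have "summable (\<lambda>k. g k \<omega>)"
      using elim by (intro summable_suminf_not_top) (auto simp: g_def)
    then have "summable (\<lambda>k. f (r (Suc k)) \<omega> - f (r k) \<omega>)"
      unfolding g_def by (rule summable_rabs_cancel)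
    then have "convergent (\<lambda>n. \<Sum>k<n. f (r (Suc k)) \<omega> - f (r k) \<omega>)"
      by (simp add: summable_iff_convergent)
    then have "convergent (\<lambda>n. f (r n) \<omega> - f (r 0) \<omega>)"
      by (simp only: sum_lessThan_telescope[of "\<lambda>k. f (r k) \<omega>"])
    then show ?case using convergent_add[OF _ convergent_const[of "f (r 0) \<omega>"]] by fastforce
  qed
  define F where "F \<omega> = lim (\<lambda>k. f (r k) \<omega>)" for \<omega>
  have [measurable]: "F \<in> borel_measurable M"
    unfolding F_def by (rule borel_measurable_lim_metric) measurable
  have lim: "AE \<omega> in M. (\<lambda>k. f (r k) \<omega>) \<longlonglongrightarrow> F \<omega>"
    using conv unfolding F_def by eventually_elim (simp add: convergent_LIMSEQ_iff)
  have bound: "L2_sqdist M (f n) F \<le> ennreal ((1/4)^k)" if "n \<ge> N k" for n k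
  proof -
    have "L2_sqdist M (f n) F = (\<integral>\<^sup>+\<omega>. liminf (\<lambda>j. ennreal ((f n \<omega> - f (r j) \<omega>)\<^sup>2)) \<partial>M)"
      unfolding L2_sqdist_def
    proof (rule nn_integral_cong_AE, use lim in eventually_elim)
      case (elim \<omega>)
      have "(\<lambda>j. ennreal ((f n \<omega> - f (r j) \<omega>)\<^sup>2)) \<longlonglongrightarrow> ennreal ((f n \<omega> - F \<omega>)\<^sup>2)"
        by (intro tendsto_intros elim)
      then show ?case by (intro lim_imp_Liminf[symmetric]) simp_all
    qed
    also have "\<dots> \<le> liminf (\<lambda>j. \<integral>\<^sup>+\<omega>. ennreal ((f n \<omega> - f (r j) \<omega>)\<^sup>2) \<partial>M)"
      by (rule nn_integral_liminf) measurable
    also have "\<dots> \<le> ennreal ((1/4)^k)"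
    proof (rule Liminf_le)
      have "\<forall>\<^sub>F j in sequentially. (\<integral>\<^sup>+\<omega>. ennreal ((f n \<omega> - f (r j) \<omega>)\<^sup>2) \<partial>M) \<le> ennreal ((1/4)^k)"
        using eventually_ge_at_top[of "N k"]
      proof eventually_elim
        case (elim j)
        have "(\<integral>\<^sup>+\<omega>. ennreal ((f n \<omega> - f (r j) \<omega>)\<^sup>2) \<partial>M) = ennreal (\<integral>\<omega>. (f n \<omega> - f (r j) \<omega>)\<^sup>2 \<partial>M)"
          using L2_sqdist_eq[OF f f] by (simp add: L2_sqdist_def)
        also have "\<dots> \<le> ennreal ((1/4)^k)"
          using N[OF that, of "r j"] r_ge[of j] elim by (intro ennreal_leI) auto
        finally show ?case .
      qed
      then show "\<forall>\<^sub>F j in sequentially. (\<integral>\<^sup>+\<omega>. ennreal ((f n \<omega> - f (r j) \<omega>)\<^sup>2) \<partial>M) \<le> ennreal ((1/4)^k)" .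
    qed simp
    finally show ?thesis .
  qed
  have "(\<lambda>\<omega>. f (N 0) \<omega> - F \<omega>) \<in> L2 M"
  proof -
    have "(\<integral>\<^sup>+\<omega>. ennreal ((f (N 0) \<omega> - F \<omega>)\<^sup>2) \<partial>M) < \<infinity>"
      using bound[of 0 "N 0"] by (auto simp: L2_sqdist_def intro: le_less_trans)
    then show ?thesis
      by (auto simp: L2_def intro!: integrableI_bounded)
  qed
  from L2_diff[OF f[of "N 0"] this] have FL2: "F \<in> L2 M" by simp
  have "(\<lambda>n. \<integral>\<omega>. (f n \<omega> - F \<omega>)\<^sup>2 \<partial>M) \<longlonglongrightarrow> 0"
  proof (rule LIMSEQ_I)
    fix e :: real assume "e > 0"
    then obtain k where k: "(1/4)^k < e" using real_arch_pow_inv[of e "1/4"] by auto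
    have "norm ((\<integral>\<omega>. (f n \<omega> - F \<omega>)\<^sup>2 \<partial>M) - 0) < e" if "n \<ge> N k" for n
      using bound[OF that] k by (simp add: L2_sqdist_eq f FL2)
    then show "\<exists>no. \<forall>n\<ge>no. norm ((\<integral>\<omega>. (f n \<omega> - F \<omega>)\<^sup>2 \<partial>M) - 0) < e" by blast
  qed
  then have "(\<lambda>n. L2_sqdist M (f n) F) \<longlonglongrightarrow> 0"
    by (subst L2_tendsto_iff) (auto simp: f FL2)
  then show ?thesis using that FL2 by blast
qed

text \<open>
  The common mechanism behind the existence of all mean-square limits below: if the inner products
  \<open>b e d\<close> increase to a finite limit as the regularisation parameters decrease, then
  \<open>E (f e - f d)\<^sup>2 = b e e - 2 b e d + b d d\<close> is squeezed between increments of \<open>b\<close>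
  along the diagonal.
\<close>

lemma (in prob_space) L2_limit_of_monotone_inner_products:
  fixes f :: "real \<Rightarrow> 'a \<Rightarrow> real"
  assumes f: "\<And>e. 0 < e \<Longrightarrow> f e \<in> L2 M"
    and inner: "\<And>e d. 0 < e \<Longrightarrow> 0 < d \<Longrightarrow> (\<integral>\<omega>. f e \<omega> * f d \<omega> \<partial>M) = b e d"
    and mono: "\<And>e d e' d'. 0 < e' \<Longrightarrow> e' \<le> e \<Longrightarrow> 0 < d' \<Longrightarrow> d' \<le> d \<Longrightarrow> b e d \<le> b e' d'"
    and bounded: "\<And>e. 0 < e \<Longrightarrow> b e e \<le> B"
  obtains F where "F \<in> L2 M" "((\<lambda>e. L2_sqdist M (f e) F) \<longlongrightarrow> 0) (at_right 0)"
proof -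
  define S where "S = (SUP e\<in>{0<..}. b e e)"
  have bdd: "bdd_above ((\<lambda>e. b e e) ` {0<..})"
    using bounded by (auto simp: bdd_above_def)
  have le_S: "b e e \<le> S" if "0 < e" for e
    unfolding S_def using that by (intro cSUP_upper bdd) auto
  have diff: "(\<integral>\<omega>. (f e \<omega> - f d \<omega>)\<^sup>2 \<partial>M) = b e e - 2 * b e d + b d d" if "0 < e" "0 < d" for e d
  proof -
    have "(\<integral>\<omega>. (f e \<omega> - f d \<omega>)\<^sup>2 \<partial>M) = (\<integral>\<omega>. f e \<omega> * f e \<omega> - 2 * (f e \<omega> * f d \<omega>) + f d \<omega> * f d \<omega> \<partial>M)"
      by (intro Bochner_Integration.integral_cong) (auto simp: power2_eq_square algebra_simps)
    then show ?thesis
      using that f by (simp add: L2_mult_integrable inner)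
  qed
  have small: "\<exists>e0>0. \<forall>e d. 0 < e \<longrightarrow> e \<le> e0 \<longrightarrow> 0 < d \<longrightarrow> d \<le> e0 \<longrightarrow> (\<integral>\<omega>. (f e \<omega> - f d \<omega>)\<^sup>2 \<partial>M) < h"
    if "h > 0" for h
  proof -
    have "S - h/2 < S" using that by simp
    then obtain e0 where e0: "0 < e0" "S - h/2 < b e0 e0"
      using less_cSUP_iff[OF _ bdd, of "S - h/2"] by (auto simp: S_def)
    have "(\<integral>\<omega>. (f e \<omega> - f d \<omega>)\<^sup>2 \<partial>M) < h" if "0 < e" "e \<le> e0" "0 < d" "d \<le> e0" for e d
      using mono[of e e0 d e0] that e0 le_S[of e] le_S[of d] diff[of e d] by linarith
    with e0 show ?thesis by blast
  qed
  define g where "g n = f (1 / real (Suc n))" for n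
  have gL2: "g n \<in> L2 M" for n by (simp add: g_def f)
  have inv_small: "\<exists>N. \<forall>n\<ge>N. 1 / real (Suc n) \<le> e0" if "e0 > 0" for e0
  proof -
    obtain N where N: "1 / real (Suc N) < e0" using reals_Archimedean[OF \<open>e0 > 0\<close>] by (auto simp: inverse_eq_divide)
    have "1 / real (Suc n) \<le> e0" if "n \<ge> N" for n
    proof -
      have "1 / real (Suc n) \<le> 1 / real (Suc N)" using that by (intro divide_left_mono) auto
      with N show ?thesis by linarith
    qed
    then show ?thesis by blast
  qed
  have "\<exists>N. \<forall>m\<ge>N. \<forall>n\<ge>N. (\<integral>\<omega>. (g m \<omega> - g n \<omega>)\<^sup>2 \<partial>M) < h" if h: "h > 0" for h
  proof -
    obtain e0 where "e0 > 0" and e0: "\<And>e d. 0 < e \<Longrightarrow> e \<le> e0 \<Longrightarrow> 0 < d \<Longrightarrow> d \<le> e0 \<Longrightarrow> (\<integral>\<omega>. (f e \<omega> - f d \<omega>)\<^sup>2 \<partial>M) < h"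
      using small[OF h] by blast
    then obtain N where "\<forall>n\<ge>N. 1 / real (Suc n) \<le> e0" using inv_small by blast
    then show ?thesis unfolding g_def by (intro exI[of _ N] allI impI e0) auto
  qed
  then obtain F where F: "F \<in> L2 M" and lim: "(\<lambda>n. L2_sqdist M (g n) F) \<longlonglongrightarrow> 0"
    using L2_complete[of g] gL2 by blast
  have lim': "(\<lambda>n. \<integral>\<omega>. (g n \<omega> - F \<omega>)\<^sup>2 \<partial>M) \<longlonglongrightarrow> 0"
    using lim gL2 F by (subst (asm) L2_tendsto_iff) auto
  have ev: "\<forall>\<^sub>F e in at_right 0. f e \<in> L2 M"
    using f by (auto simp: eventually_at_right_field intro: exI[of _ 1])
  have "((\<lambda>e. \<integral>\<omega>. (f e \<omega> - F \<omega>)\<^sup>2 \<partial>M) \<longlongrightarrow> 0) (at_right 0)"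
  proof (rule tendstoI)
    fix h :: real assume h: "h > 0"
    obtain e0 where "e0 > 0" and e0: "\<And>e d. 0 < e \<Longrightarrow> e \<le> e0 \<Longrightarrow> 0 < d \<Longrightarrow> d \<le> e0 \<Longrightarrow> (\<integral>\<omega>. (f e \<omega> - f d \<omega>)\<^sup>2 \<partial>M) < h/4"
      using small[of "h/4"] h by auto
    obtain N where N: "\<forall>n\<ge>N. 1 / real (Suc n) \<le> e0" using inv_small \<open>e0 > 0\<close> by blast
    obtain N' where N': "\<forall>n\<ge>N'. norm ((\<integral>\<omega>. (g n \<omega> - F \<omega>)\<^sup>2 \<partial>M) - 0) < h/4"
      using LIMSEQ_D[OF lim', of "h/4"] h by auto
    define n where "n = max N N'"
    have n: "1 / real (Suc n) \<le> e0" "(\<integral>\<omega>. (g n \<omega> - F \<omega>)\<^sup>2 \<partial>M) < h/4"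
      using N N' by (auto simp: n_def)
    have "(\<integral>\<omega>. (f e \<omega> - F \<omega>)\<^sup>2 \<partial>M) < h" if "0 < e" "e < e0" for e
      using L2_triangle2[OF f[OF that(1)] gL2[of n] F] e0[of e "1 / real (Suc n)"] that n
      by (simp add: g_def)
    moreover have "0 \<le> (\<integral>\<omega>. (f e \<omega> - F \<omega>)\<^sup>2 \<partial>M)" for e
      by (intro Bochner_Integration.integral_nonneg) simp
    ultimately show "\<forall>\<^sub>F e in at_right 0. dist (\<integral>\<omega>. (f e \<omega> - F \<omega>)\<^sup>2 \<partial>M) 0 < h"
      unfolding eventually_at_right_field using \<open>e0 > 0\<close> by (auto intro!: exI[of _ e0])
  qed
  then have "((\<lambda>e. L2_sqdist M (f e) F) \<longlongrightarrow> 0) (at_right 0)"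
    by (subst L2_tendsto_iff[OF ev F])
  with F show ?thesis by (rule that)
qed

section \<open>Gaussian pairs and Laguerre polynomials\<close>

text \<open>
  Completing the square makes the integrand a multiple of a normal density.
\<close>

lemma std_normal_exp_quadratic:
  assumes "A \<ge> 0"
  shows "integrable std_normal_distribution (\<lambda>g. exp (- (A * g\<^sup>2 / 2) - B * g))" (is ?int)
    and "(\<integral>g. exp (- (A * g\<^sup>2 / 2) - B * g) \<partial>std_normal_distribution) =
           exp (B\<^sup>2 / (2 * (1 + A))) / sqrt (1 + A)" (is ?val)
proof -
  let ?C = "exp (B\<^sup>2 / (2 * (1 + A))) / sqrt (1 + A)"
  have A1: "1 + A > 0" using assms by simp
  have sq: "(1 / sqrt (1 + A))\<^sup>2 = 1 / (1 + A)" using A1 by (simp add: power_divide)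
  have pt: "std_normal_density g * exp (- (A * g\<^sup>2 / 2) - B * g) =
      ?C * normal_density (- B / (1 + A)) (1 / sqrt (1 + A)) g" for g
  proof -
    have *: "- g\<^sup>2 / 2 + (- (A * g\<^sup>2 / 2) - B * g) =
        B\<^sup>2 / (2 * (1 + A)) + (- (g - - B / (1 + A))\<^sup>2 / (2 * (1 / (1 + A))))"
    proof -
      define k where "k = 1 + A"
      then have k: "k > 0" "A = k - 1" using A1 by auto
      have "- g\<^sup>2 / 2 + (- ((k - 1) * g\<^sup>2 / 2) - B * g) = - (k * g\<^sup>2 / 2) - B * g"
        by (simp add: field_simps)
      moreover have "B\<^sup>2 / (2 * k) + (- (g - - B / k)\<^sup>2 / (2 * (1 / k))) = - (k * g\<^sup>2 / 2) - B * g"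
        using k(1) by (simp add: field_simps power2_eq_square)
      ultimately show ?thesis unfolding k(2) by simp
    qed
    have n: "1 / sqrt (2 * pi) = 1 / sqrt (1 + A) * (1 / sqrt (2 * pi * (1 / (1 + A))))"
      using A1 by (simp add: real_sqrt_divide real_sqrt_mult)
    have "std_normal_density g * exp (- (A * g\<^sup>2 / 2) - B * g) =
        (1 / sqrt (2 * pi)) * exp (- g\<^sup>2 / 2 + (- (A * g\<^sup>2 / 2) - B * g))"
      unfolding exp_add by (simp add: std_normal_density_def)
    also have "\<dots> = (1 / sqrt (1 + A) * (1 / sqrt (2 * pi * (1 / (1 + A))))) *
        (exp (B\<^sup>2 / (2 * (1 + A))) * exp (- (g - - B / (1 + A))\<^sup>2 / (2 * (1 / (1 + A)))))"
      by (simp only: n * exp_add)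
    also have "\<dots> = ?C * normal_density (- B / (1 + A)) (1 / sqrt (1 + A)) g"
      unfolding normal_density_def sq by simp
    finally show ?thesis .
  qed
  have i: "integrable lborel (\<lambda>g. ?C * normal_density (- B / (1 + A)) (1 / sqrt (1 + A)) g)"
    using A1 by (intro integrable_mult_right integrable_normal_density) simp
  show ?int using i by (simp add: integrable_density pt)
  have "(\<integral>g. exp (- (A * g\<^sup>2 / 2) - B * g) \<partial>std_normal_distribution) =
      (\<integral>g. ?C * normal_density (- B / (1 + A)) (1 / sqrt (1 + A)) g \<partial>lborel)"
    by (simp add: integral_density pt)
  also have "\<dots> = ?C" using A1 by simp
  finally show ?val .
qed

lemma exp_neg_square_as_std_normal_char:
  assumes "\<tau> \<ge> 0"
  shows "complex_of_real (exp (- (\<tau> * x\<^sup>2 / 2))) = (CLINT g|std_normal_distribution. iexp (sqrt \<tau> * g * x))"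
proof -
  have "char std_normal_distribution (sqrt \<tau> * x) = of_real (exp (- ((sqrt \<tau> * x)\<^sup>2) / 2))"
    by (simp add: char_std_normal_distribution)
  then show ?thesis
    using assms by (simp add: char_def power_mult_distrib mult_ac)
qed

text \<open>
  For a centred Gaussian pair \<open>(V, Y)\<close> with \<open>Var V = s\<close>, \<open>Cov (V, Y) = c\<close>, \<open>Var Y = w\<close>. Only the
  characteristic function of linear combinations is available for the pair, so the factor
  \<open>exp (- \<tau> V\<^sup>2 / 2)\<close> is written as the characteristic function of an auxiliary standard normal
  variable at \<open>\<surd>\<tau> V\<close>, which reduces the integral to a one-dimensional Gaussian integral.
\<close>

lemma (in prob_space) gaussian_pair_damped_char:
  assumes V [measurable]: "V \<in> borel_measurable M" and Y [measurable]: "Y \<in> borel_measurable M"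
    and char: "\<And>\<alpha> \<beta>. (CLINT \<omega>|M. iexp (\<alpha> * V \<omega> + \<beta> * Y \<omega>)) =
      of_real (exp (- ((\<alpha>\<^sup>2 * s + 2 * \<alpha> * \<beta> * c + \<beta>\<^sup>2 * w) / 2)))"
    and s: "s \<ge> 0" and \<tau>: "\<tau> \<ge> 0"
  shows "(CLINT \<omega>|M. of_real (exp (- (\<tau> * (V \<omega>)\<^sup>2 / 2))) * iexp (\<theta> * Y \<omega>)) =
    of_real (exp (- (\<theta>\<^sup>2 * (w - \<tau> * c\<^sup>2 / (1 + \<tau> * s)) / 2)) / sqrt (1 + \<tau> * s))"
proof -
  let ?N = std_normal_distribution
  interpret N: real_distribution ?N by (rule real_dist_normal_dist)
  interpret P: pair_prob_space ?N M ..
  have int: "integrable (?N \<Otimes>\<^sub>M M) (\<lambda>(g, \<omega>). iexp (sqrt \<tau> * g * V \<omega> + \<theta> * Y \<omega>))"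
    unfolding split_beta' by (rule P.P.integrable_iexp) measurable
  have "(CLINT \<omega>|M. of_real (exp (- (\<tau> * (V \<omega>)\<^sup>2 / 2))) * iexp (\<theta> * Y \<omega>)) =
      (CLINT \<omega>|M. (CLINT g|?N. iexp (sqrt \<tau> * g * V \<omega> + \<theta> * Y \<omega>)))"
  proof (rule Bochner_Integration.integral_cong[OF refl])
    fix \<omega>
    have "of_real (exp (- (\<tau> * (V \<omega>)\<^sup>2 / 2))) * iexp (\<theta> * Y \<omega>) =
        (CLINT g|?N. iexp (sqrt \<tau> * g * V \<omega>)) * iexp (\<theta> * Y \<omega>)"
      by (simp only: exp_neg_square_as_std_normal_char[OF \<tau>])
    also have "\<dots> = (CLINT g|?N. iexp (sqrt \<tau> * g * V \<omega>) * iexp (\<theta> * Y \<omega>))"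
      by simp
    also have "\<dots> = (CLINT g|?N. iexp (sqrt \<tau> * g * V \<omega> + \<theta> * Y \<omega>))"
      by (simp add: exp_add[symmetric] ring_distribs)
    finally show "of_real (exp (- (\<tau> * (V \<omega>)\<^sup>2 / 2))) * iexp (\<theta> * Y \<omega>) =
        (CLINT g|?N. iexp (sqrt \<tau> * g * V \<omega> + \<theta> * Y \<omega>))" .
  qed
  also have "\<dots> = (CLINT g|?N. (CLINT \<omega>|M. iexp (sqrt \<tau> * g * V \<omega> + \<theta> * Y \<omega>)))"
    by (rule P.Fubini_integral[OF int])
  also have "\<dots> = (CLINT g|?N. of_real (exp (- (\<theta>\<^sup>2 * w / 2)) * exp (- (\<tau> * s * g\<^sup>2 / 2) - sqrt \<tau> * \<theta> * c * g)))"
  proof (rule Bochner_Integration.integral_cong[OF refl])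
    fix g
    have "(CLINT \<omega>|M. iexp (sqrt \<tau> * g * V \<omega> + \<theta> * Y \<omega>)) =
        of_real (exp (- (((sqrt \<tau> * g)\<^sup>2 * s + 2 * (sqrt \<tau> * g) * \<theta> * c + \<theta>\<^sup>2 * w) / 2)))"
      using char[of "sqrt \<tau> * g" \<theta>] by simp
    also have "- (((sqrt \<tau> * g)\<^sup>2 * s + 2 * (sqrt \<tau> * g) * \<theta> * c + \<theta>\<^sup>2 * w) / 2) =
        - (\<theta>\<^sup>2 * w / 2) + (- (\<tau> * s * g\<^sup>2 / 2) - sqrt \<tau> * \<theta> * c * g)"
      using \<tau> by (simp add: power_mult_distrib field_simps)
    finally show "(CLINT \<omega>|M. iexp (sqrt \<tau> * g * V \<omega> + \<theta> * Y \<omega>)) =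
       of_real (exp (- (\<theta>\<^sup>2 * w / 2)) * exp (- (\<tau> * s * g\<^sup>2 / 2) - sqrt \<tau> * \<theta> * c * g))"
      by (simp only: exp_add)
  qed
  also have "\<dots> = of_real (exp (- (\<theta>\<^sup>2 * w / 2)) * (\<integral>g. exp (- (\<tau> * s * g\<^sup>2 / 2) - sqrt \<tau> * \<theta> * c * g) \<partial>?N))"
    by (simp only: integral_complex_of_real integral_mult_right_zero)
  also have "(\<integral>g. exp (- (\<tau> * s * g\<^sup>2 / 2) - sqrt \<tau> * \<theta> * c * g) \<partial>?N) =
      exp ((sqrt \<tau> * \<theta> * c)\<^sup>2 / (2 * (1 + \<tau> * s))) / sqrt (1 + \<tau> * s)"
    using s \<tau> by (intro std_normal_exp_quadratic) simp
  also have "exp (- (\<theta>\<^sup>2 * w / 2)) * (exp ((sqrt \<tau> * \<theta> * c)\<^sup>2 / (2 * (1 + \<tau> * s))) / sqrt (1 + \<tau> * s)) =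
      exp (- (\<theta>\<^sup>2 * w / 2) + (sqrt \<tau> * \<theta> * c)\<^sup>2 / (2 * (1 + \<tau> * s))) / sqrt (1 + \<tau> * s)"
    by (simp only: exp_add times_divide_eq_right)
  also have "- (\<theta>\<^sup>2 * w / 2) + (sqrt \<tau> * \<theta> * c)\<^sup>2 / (2 * (1 + \<tau> * s)) =
      - (\<theta>\<^sup>2 * (w - \<tau> * c\<^sup>2 / (1 + \<tau> * s)) / 2)"
  proof -
    have "1 + \<tau> * s > 0" using s \<tau> by (simp add: add_pos_nonneg)
    then show ?thesis using \<tau> by (simp add: power_mult_distrib field_simps)
  qed
  finally show ?thesis .
qed

text \<open>
  The second factor is written as a characteristic function as well, which leaves an integral of
  the formula of the preceding lemma against a standard normal variable.
\<close>

lemma (in prob_space) gaussian_pair_damped_twice: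
  assumes V [measurable]: "V \<in> borel_measurable M" and Y [measurable]: "Y \<in> borel_measurable M"
    and char: "\<And>\<alpha> \<beta>. (CLINT \<omega>|M. iexp (\<alpha> * V \<omega> + \<beta> * Y \<omega>)) =
      of_real (exp (- ((\<alpha>\<^sup>2 * s + 2 * \<alpha> * \<beta> * c + \<beta>\<^sup>2 * w) / 2)))"
    and s: "s \<ge> 0" and w: "w \<ge> 0" and cs: "c\<^sup>2 \<le> s * w" and \<tau>: "\<tau> \<ge> 0" and \<tau>': "\<tau>' \<ge> 0"
  shows "(\<integral>\<omega>. exp (- (\<tau> * (V \<omega>)\<^sup>2 / 2)) * exp (- (\<tau>' * (Y \<omega>)\<^sup>2 / 2)) \<partial>M) =
    1 / sqrt ((1 + \<tau> * s) * (1 + \<tau>' * w) - \<tau> * \<tau>' * c\<^sup>2)"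
proof -
  let ?N = std_normal_distribution
  let ?\<kappa> = "w - \<tau> * c\<^sup>2 / (1 + \<tau> * s)"
  interpret N: real_distribution ?N by (rule real_dist_normal_dist)
  interpret P: pair_prob_space ?N M ..
  have pos: "1 + \<tau> * s > 0" using s \<tau> by (simp add: add_pos_nonneg)
  have "\<tau> * c\<^sup>2 \<le> \<tau> * (s * w)" using cs \<tau> by (rule mult_left_mono)
  then have "\<tau> * c\<^sup>2 \<le> (1 + \<tau> * s) * w" using w by (simp add: algebra_simps)
  then have \<kappa>: "?\<kappa> \<ge> 0" using pos by (simp add: field_simps)
  have int: "integrable (?N \<Otimes>\<^sub>M M) (\<lambda>(g, \<omega>). of_real (exp (- (\<tau> * (V \<omega>)\<^sup>2 / 2))) * iexp (sqrt \<tau>' * g * Y \<omega>))"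
    unfolding split_beta'
    by (rule P.P.integrable_const_bound[where B = 1]) (use \<tau> in \<open>auto simp: norm_mult\<close>)
  have "complex_of_real (\<integral>\<omega>. exp (- (\<tau> * (V \<omega>)\<^sup>2 / 2)) * exp (- (\<tau>' * (Y \<omega>)\<^sup>2 / 2)) \<partial>M) =
      (CLINT \<omega>|M. of_real (exp (- (\<tau> * (V \<omega>)\<^sup>2 / 2))) * (CLINT g|?N. iexp (sqrt \<tau>' * g * Y \<omega>)))"
    by (simp only: integral_complex_of_real[symmetric] of_real_mult exp_neg_square_as_std_normal_char[OF \<tau>'])
  also have "\<dots> = (CLINT \<omega>|M. (CLINT g|?N. of_real (exp (- (\<tau> * (V \<omega>)\<^sup>2 / 2))) * iexp (sqrt \<tau>' * g * Y \<omega>)))"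
    by simp
  also have "\<dots> = (CLINT g|?N. (CLINT \<omega>|M. of_real (exp (- (\<tau> * (V \<omega>)\<^sup>2 / 2))) * iexp (sqrt \<tau>' * g * Y \<omega>)))"
    by (rule P.Fubini_integral[OF int])
  also have "\<dots> = (CLINT g|?N. of_real (exp (- ((sqrt \<tau>' * g)\<^sup>2 * ?\<kappa> / 2)) / sqrt (1 + \<tau> * s)))"
    by (simp only: gaussian_pair_damped_char[OF V Y char s \<tau>])
  also have "\<dots> = (CLINT g|?N. of_real (exp (- ((\<tau>' * ?\<kappa>) * g\<^sup>2 / 2) - 0 * g) / sqrt (1 + \<tau> * s)))"
    using \<tau>' by (intro Bochner_Integration.integral_cong refl) (simp add: power_mult_distrib mult_ac)
  also have "\<dots> = of_real ((\<integral>g. exp (- ((\<tau>' * ?\<kappa>) * g\<^sup>2 / 2) - 0 * g) \<partial>?N) / sqrt (1 + \<tau> * s))"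
    by (simp only: integral_complex_of_real integral_divide_zero)
  also have "(\<integral>g. exp (- ((\<tau>' * ?\<kappa>) * g\<^sup>2 / 2) - 0 * g) \<partial>?N) = exp (0\<^sup>2 / (2 * (1 + \<tau>' * ?\<kappa>))) / sqrt (1 + \<tau>' * ?\<kappa>)"
    using \<kappa> \<tau>' by (intro std_normal_exp_quadratic) simp
  also have "\<dots> / sqrt (1 + \<tau> * s) = 1 / sqrt ((1 + \<tau> * s) * (1 + \<tau>' * ?\<kappa>))"
    by (simp add: real_sqrt_mult)
  also have "(1 + \<tau> * s) * (1 + \<tau>' * ?\<kappa>) = (1 + \<tau> * s) * (1 + \<tau>' * w) - \<tau> * \<tau>' * c\<^sup>2"
    using pos by (simp add: field_simps)
  finally show ?thesis by (simp only: of_real_eq_iff)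
qed

text \<open>
  By Levy's uniqueness theorem the law of \<open>Y\<close> is that of \<open>\<surd>v\<close> times a standard normal variable.
\<close>

lemma (in prob_space) gaussian_moments:
  assumes Y [measurable]: "Y \<in> borel_measurable M" and v: "v \<ge> 0"
    and char: "\<And>\<theta>. (CLINT \<omega>|M. iexp (\<theta> * Y \<omega>)) = of_real (exp (- (\<theta>\<^sup>2 * v / 2)))"
  shows "integrable M (\<lambda>\<omega>. Y \<omega> ^ k)"
    and "(\<integral>\<omega>. Y \<omega> ^ (2 * k) \<partial>M) = fact (2 * k) / (2 ^ k * fact k) * v ^ k"
    and "(\<integral>\<omega>. Y \<omega> ^ (2 * k + 1) \<partial>M) = 0"
proof -
  let ?N = std_normal_distribution
  interpret N: real_distribution ?N by (rule real_dist_normal_dist)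
  have eq: "distr M borel Y = distr ?N borel (\<lambda>x. sqrt v * x)"
  proof (rule Levy_uniqueness)
    show "real_distribution (distr M borel Y)" by (rule real_distribution_distr) measurable
    show "real_distribution (distr ?N borel (\<lambda>x. sqrt v * x))"
      by (rule N.real_distribution_distr) measurable
    show "char (distr M borel Y) = char (distr ?N borel (\<lambda>x. sqrt v * x))"
    proof
      fix t
      have "char (distr ?N borel (\<lambda>x. sqrt v * x)) t = char ?N (t * sqrt v)"
        by (simp add: char_def integral_distr mult_ac)
      also have "\<dots> = of_real (exp (- (t\<^sup>2 * v / 2)))"
        using v by (simp add: char_std_normal_distribution power_mult_distrib)
      also have "\<dots> = char (distr M borel Y) t"
        unfolding char[symmetric] by (simp add: char_def integral_distr)
      finally show "char (distr M borel Y) t = char (distr ?N borel (\<lambda>x. sqrt v * x)) t" ..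
    qed
  qed
  have i: "integrable M (\<lambda>\<omega>. Y \<omega> ^ j) \<longleftrightarrow> integrable ?N (\<lambda>x. (sqrt v * x) ^ j)" for j
    using arg_cong[OF eq, of "\<lambda>D. integrable D (\<lambda>x. x ^ j)"] by (simp add: integrable_distr_eq)
  have e: "(\<integral>\<omega>. Y \<omega> ^ j \<partial>M) = sqrt v ^ j * (\<integral>x. x ^ j \<partial>?N)" for j
    using arg_cong[OF eq, of "\<lambda>D. integral\<^sup>L D (\<lambda>x. x ^ j)"]
    by (simp add: integral_distr power_mult_distrib)
  show "integrable M (\<lambda>\<omega>. Y \<omega> ^ k)"
    unfolding i using integrable_std_normal_distribution_moment[of k] by (simp add: power_mult_distrib)
  show "(\<integral>\<omega>. Y \<omega> ^ (2 * k) \<partial>M) = fact (2 * k) / (2 ^ k * fact k) * v ^ k"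
  proof -
    have "sqrt v ^ (2 * k) = v ^ k" using v by (simp add: power_mult)
    then show ?thesis unfolding e std_normal_distribution_even_moments(1) by simp
  qed
  show "(\<integral>\<omega>. Y \<omega> ^ (2 * k + 1) \<partial>M) = 0"
    unfolding e using integral_std_normal_distribution_moment_odd[of "2 * k + 1"] by simp
qed

text \<open>
  This provides the dominating function for differentiating a Laplace transform.
\<close>

lemma abs_exp_neg_diff_le: "x \<ge> 0 \<Longrightarrow> y \<ge> 0 \<Longrightarrow> \<bar>exp (- x) - exp (- y)\<bar> \<le> \<bar>x - y\<bar>" for x y :: real
proof (induction x y rule: linorder_wlog)
  case (le x y)
  have "exp (- x) * (1 - (y - x)) \<le> exp (- x) * exp (- (y - x))"
  proof (rule mult_left_mono)
    show "1 - (y - x) \<le> exp (- (y - x))" using exp_ge_add_one_self[of "- (y - x)"] by linarith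
  qed simp
  also have "\<dots> = exp (- y)" by (simp add: exp_add[symmetric])
  finally have "exp (- x) - exp (- y) \<le> exp (- x) * (y - x)" by (simp add: algebra_simps)
  also have "\<dots> \<le> 1 * (y - x)" using le by (intro mult_right_mono) auto
  finally show ?case using le by (simp add: abs_if)
next
  case (sym a b)
  then show ?case by (simp add: abs_minus_commute)
qed

text \<open>
  The weight \<open>G\<close> may change sign, so these are Laplace transforms of signed measures.
\<close>

lemma laplace_has_derivative:
  fixes U G :: "'a \<Rightarrow> real"
  assumes [measurable]: "U \<in> borel_measurable M" "G \<in> borel_measurable M"
    and U: "\<And>\<omega>. U \<omega> \<ge> 0"
    and int: "integrable M G" "integrable M (\<lambda>\<omega>. G \<omega> * U \<omega>)" and \<tau>: "\<tau> > 0"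
  shows "((\<lambda>t. \<integral>\<omega>. G \<omega> * exp (- (t * U \<omega>)) \<partial>M) has_real_derivative
      - (\<integral>\<omega>. G \<omega> * U \<omega> * exp (- (\<tau> * U \<omega>)) \<partial>M)) (at \<tau>)"
proof -
  define f where "f t = (\<integral>\<omega>. G \<omega> * exp (- (t * U \<omega>)) \<partial>M)" for t
  have integ: "integrable M (\<lambda>\<omega>. G \<omega> * exp (- (t * U \<omega>)))" if "t > 0" for t
    using int(1) by (rule Bochner_Integration.integrable_bound)
      (use that U in \<open>auto simp: abs_mult intro!: mult_left_le\<close>)
  have "((\<lambda>y. (f y - f \<tau>) / (y - \<tau>)) \<longlongrightarrow> - (\<integral>\<omega>. G \<omega> * U \<omega> * exp (- (\<tau> * U \<omega>)) \<partial>M)) (at \<tau> within {0<..})"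
    unfolding tendsto_at_iff_sequentially
  proof (intro allI impI)
    fix X :: "nat \<Rightarrow> real" assume X: "\<forall>i. X i \<in> {0<..} - {\<tau>}" and lim: "X \<longlonglongrightarrow> \<tau>"
    have "(\<lambda>i. \<integral>\<omega>. G \<omega> * ((exp (- (X i * U \<omega>)) - exp (- (\<tau> * U \<omega>))) / (X i - \<tau>)) \<partial>M) \<longlonglongrightarrow>
        (\<integral>\<omega>. G \<omega> * (- U \<omega> * exp (- (\<tau> * U \<omega>))) \<partial>M)"
    proof (rule integral_dominated_convergence[where w = "\<lambda>\<omega>. norm (G \<omega> * U \<omega>)"])
      show "AE \<omega> in M. (\<lambda>i. G \<omega> * ((exp (- (X i * U \<omega>)) - exp (- (\<tau> * U \<omega>))) / (X i - \<tau>))) \<longlonglongrightarrow>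
          G \<omega> * (- U \<omega> * exp (- (\<tau> * U \<omega>)))"
      proof (rule AE_I2)
        fix \<omega>
        have "((\<lambda>t. exp (- (t * U \<omega>))) has_real_derivative - U \<omega> * exp (- (\<tau> * U \<omega>))) (at \<tau>)"
          by (auto intro!: derivative_eq_intros)
        then have "((\<lambda>y. (exp (- (y * U \<omega>)) - exp (- (\<tau> * U \<omega>))) / (y - \<tau>)) \<longlongrightarrow> - U \<omega> * exp (- (\<tau> * U \<omega>))) (at \<tau>)"
          by (simp add: has_field_derivative_iff)
        then have "((\<lambda>y. (exp (- (y * U \<omega>)) - exp (- (\<tau> * U \<omega>))) / (y - \<tau>)) \<circ> X) \<longlonglongrightarrow> - U \<omega> * exp (- (\<tau> * U \<omega>))"
          using X lim unfolding tendsto_at_iff_sequentially by blast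
        then show "(\<lambda>i. G \<omega> * ((exp (- (X i * U \<omega>)) - exp (- (\<tau> * U \<omega>))) / (X i - \<tau>))) \<longlonglongrightarrow>
          G \<omega> * (- U \<omega> * exp (- (\<tau> * U \<omega>)))"
          by (intro tendsto_mult tendsto_const) (simp add: o_def)
      qed
      show "AE \<omega> in M. norm (G \<omega> * ((exp (- (X i * U \<omega>)) - exp (- (\<tau> * U \<omega>))) / (X i - \<tau>))) \<le> norm (G \<omega> * U \<omega>)" for i
      proof (rule AE_I2)
        fix \<omega>
        have Xi: "X i > 0" "X i \<noteq> \<tau>" using X by auto
        have "\<bar>exp (- (X i * U \<omega>)) - exp (- (\<tau> * U \<omega>))\<bar> \<le> \<bar>X i * U \<omega> - \<tau> * U \<omega>\<bar>"
          using Xi \<tau> U by (intro abs_exp_neg_diff_le) auto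
        also have "\<dots> = \<bar>X i - \<tau>\<bar> * U \<omega>" using U[of \<omega>] by (simp add: left_diff_distrib[symmetric] abs_mult)
        finally have "\<bar>(exp (- (X i * U \<omega>)) - exp (- (\<tau> * U \<omega>))) / (X i - \<tau>)\<bar> \<le> U \<omega>"
          using Xi by (simp add: abs_divide field_simps)
        then show "norm (G \<omega> * ((exp (- (X i * U \<omega>)) - exp (- (\<tau> * U \<omega>))) / (X i - \<tau>))) \<le> norm (G \<omega> * U \<omega>)"
          unfolding real_norm_def abs_mult using U[of \<omega>] by (intro mult_left_mono) auto
      qed
      show "integrable M (\<lambda>\<omega>. norm (G \<omega> * U \<omega>))" using int(2) by (rule integrable_norm)
    qed measurable
    moreover have eq: "(\<integral>\<omega>. G \<omega> * ((exp (- (X i * U \<omega>)) - exp (- (\<tau> * U \<omega>))) / (X i - \<tau>)) \<partial>M) =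
        (f (X i) - f \<tau>) / (X i - \<tau>)" for i
    proof -
      have "X i > 0" using X by auto
      have "(\<integral>\<omega>. G \<omega> * ((exp (- (X i * U \<omega>)) - exp (- (\<tau> * U \<omega>))) / (X i - \<tau>)) \<partial>M) =
         (\<integral>\<omega>. (G \<omega> * exp (- (X i * U \<omega>)) - G \<omega> * exp (- (\<tau> * U \<omega>))) / (X i - \<tau>) \<partial>M)"
        by (simp add: algebra_simps)
      then show ?thesis
        unfolding f_def using integ[OF \<open>X i > 0\<close>] integ[OF \<tau>] by simp
    qed
    moreover have "(\<integral>\<omega>. G \<omega> * (- U \<omega> * exp (- (\<tau> * U \<omega>))) \<partial>M) = - (\<integral>\<omega>. G \<omega> * U \<omega> * exp (- (\<tau> * U \<omega>)) \<partial>M)"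
      by (simp add: mult.assoc)
    ultimately show "((\<lambda>y. (f y - f \<tau>) / (y - \<tau>)) \<circ> X) \<longlonglongrightarrow> - (\<integral>\<omega>. G \<omega> * U \<omega> * exp (- (\<tau> * U \<omega>)) \<partial>M)"
      by (simp only: o_def)
  qed
  moreover have "at \<tau> within {0<..} = at \<tau>" using \<tau> by (intro at_within_open) auto
  ultimately show ?thesis unfolding has_field_derivative_iff f_def by simp
qed

text \<open>
  The Laplace transform can be differentiated for \<open>\<tau> > 0\<close>, and the moments are the limits of the
  derivatives as \<open>\<tau>\<close> tends to \<open>0\<close>. The terms of the transform are those of Gamma distributions with
  shapes \<open>a + j\<close> and scale \<open>s\<close>.
\<close>

lemma moments_from_laplace_transform:
  fixes U \<Lambda> :: "'a \<Rightarrow> real"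
  assumes [measurable]: "U \<in> borel_measurable M" "\<Lambda> \<in> borel_measurable M"
    and U: "\<And>\<omega>. U \<omega> \<ge> 0"
    and int: "\<And>q. integrable M (\<lambda>\<omega>. \<Lambda> \<omega> * U \<omega> ^ q)"
    and s: "s \<ge> 0"
    and lap: "\<And>\<tau>. \<tau> > 0 \<Longrightarrow> (\<integral>\<omega>. \<Lambda> \<omega> * exp (- (\<tau> * U \<omega>)) \<partial>M) = (\<Sum>j\<le>J. c j * (1 + \<tau> * s) powr (- (a + real j)))"
  shows "(\<integral>\<omega>. \<Lambda> \<omega> * U \<omega> ^ q \<partial>M) = s ^ q * (\<Sum>j\<le>J. c j * pochhammer (a + real j) q)"
proof -
  define R where "R q \<tau> = (\<Sum>j\<le>J. c j * pochhammer (a + real j) q * s ^ q * (1 + \<tau> * s) powr (- (a + real j + real q)))" for q \<tau>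
  have pos: "1 + \<tau> * s > 0" if "\<tau> \<ge> 0" for \<tau> using s that by (simp add: add_pos_nonneg)
  have L: "(\<integral>\<omega>. \<Lambda> \<omega> * U \<omega> ^ q * exp (- (\<tau> * U \<omega>)) \<partial>M) = R q \<tau>" if "\<tau> > 0" for q \<tau>
    using that
  proof (induction q arbitrary: \<tau>)
    case 0
    then show ?case using lap by (simp add: R_def)
  next
    case (Suc q)
    have "((\<lambda>t. \<integral>\<omega>. (\<Lambda> \<omega> * U \<omega> ^ q) * exp (- (t * U \<omega>)) \<partial>M) has_real_derivative
      - (\<integral>\<omega>. (\<Lambda> \<omega> * U \<omega> ^ q) * U \<omega> * exp (- (\<tau> * U \<omega>)) \<partial>M)) (at \<tau>)"
      using U int[of q] int[of "Suc q"] Suc.prems by (intro laplace_has_derivative) (auto simp: mult_ac)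
    then have "(R q has_real_derivative - (\<integral>\<omega>. (\<Lambda> \<omega> * U \<omega> ^ q) * U \<omega> * exp (- (\<tau> * U \<omega>)) \<partial>M)) (at \<tau>)"
      by (rule DERIV_cong_ev[OF refl _ refl, THEN iffD1, rotated])
        (use Suc.prems in \<open>auto intro!: eventually_mono[OF eventually_nhds_in_open[of "{0<..}"]] Suc.IH\<close>)
    moreover have "(R q has_real_derivative - R (Suc q) \<tau>) (at \<tau>)"
    proof -
      have "((\<lambda>\<tau>. c j * pochhammer (a + real j) q * s ^ q * (1 + \<tau> * s) powr (- (a + real j + real q))) has_real_derivative
          - (c j * pochhammer (a + real j) (Suc q) * s ^ Suc q * (1 + \<tau> * s) powr (- (a + real j + real (Suc q))))) (at \<tau>)" for j
      proof -
        have e: "- (a + real j + real q) - 1 = - (a + real j + real (Suc q))" by simp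
        have "((\<lambda>\<tau>. (1 + \<tau> * s) powr (- (a + real j + real q))) has_real_derivative
            (- (a + real j + real q)) * (1 + \<tau> * s) powr (- (a + real j + real q) - 1) * s) (at \<tau>)"
          using pos[of \<tau>] Suc.prems by (auto intro!: derivative_eq_intros)
        from DERIV_cmult[OF this, of "c j * pochhammer (a + real j) q * s ^ q"]
        show ?thesis unfolding e by (rule DERIV_cong) (simp add: pochhammer_Suc algebra_simps)
      qed
      then show ?thesis unfolding R_def sum_negf[symmetric] by (intro DERIV_sum) auto
    qed
    ultimately have "- (\<integral>\<omega>. (\<Lambda> \<omega> * U \<omega> ^ q) * U \<omega> * exp (- (\<tau> * U \<omega>)) \<partial>M) = - R (Suc q) \<tau>"
      by (rule DERIV_unique)
    then show ?case by (simp add: mult_ac)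
  qed
  define h where "h n = 1 / real (Suc n)" for n
  have h0: "h n > 0" for n by (simp add: h_def)
  have hlim: "h \<longlonglongrightarrow> 0" using LIMSEQ_inverse_real_of_nat by (simp add: h_def[abs_def] inverse_eq_divide)
  have "(\<lambda>n. \<integral>\<omega>. \<Lambda> \<omega> * U \<omega> ^ q * exp (- (h n * U \<omega>)) \<partial>M) \<longlonglongrightarrow> (\<integral>\<omega>. \<Lambda> \<omega> * U \<omega> ^ q \<partial>M)"
  proof (rule integral_dominated_convergence[where w = "\<lambda>\<omega>. norm (\<Lambda> \<omega> * U \<omega> ^ q)"])
    show "integrable M (\<lambda>\<omega>. norm (\<Lambda> \<omega> * U \<omega> ^ q))" by (intro integrable_norm int)
    show "AE \<omega> in M. (\<lambda>n. \<Lambda> \<omega> * U \<omega> ^ q * exp (- (h n * U \<omega>))) \<longlonglongrightarrow> \<Lambda> \<omega> * U \<omega> ^ q"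
      by (rule AE_I2) (auto intro!: tendsto_eq_intros hlim)
    show "AE \<omega> in M. norm (\<Lambda> \<omega> * U \<omega> ^ q * exp (- (h n * U \<omega>))) \<le> norm (\<Lambda> \<omega> * U \<omega> ^ q)" for n
      unfolding norm_mult using h0[of n] U by (intro AE_I2 mult_left_le) (auto simp: less_imp_le)
  qed measurable
  moreover have "(\<lambda>n. R q (h n)) \<longlonglongrightarrow> (\<Sum>j\<le>J. c j * pochhammer (a + real j) q * s ^ q * (1 + 0 * s) powr (- (a + real j + real q)))"
    unfolding R_def by (intro tendsto_intros hlim) auto
  ultimately have "(\<integral>\<omega>. \<Lambda> \<omega> * U \<omega> ^ q \<partial>M) = (\<Sum>j\<le>J. c j * pochhammer (a + real j) q * s ^ q * (1 + 0 * s) powr (- (a + real j + real q)))"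
    using LIMSEQ_unique by (simp add: L[OF h0])
  then show ?thesis by (simp add: sum_distrib_left mult_ac)
qed

text \<open>
  Up to sign the sum is the \<open>m\<close>-th difference of a monic polynomial of degree \<open>j\<close> in \<open>q\<close>. The
  induction uses that the first difference of a rising factorial is a rising factorial of one degree
  less.
\<close>

lemma alternating_binomial_sum_pochhammer:
  fixes a :: real
  shows "j \<le> m \<Longrightarrow> (\<Sum>q\<le>m. (-1) ^ q * real (m choose q) * pochhammer (a + real q) j) =
    (if j = m then (-1) ^ m * fact m else 0)"
proof (induction m arbitrary: j a)
  case 0
  then show ?case by simp
next
  case (Suc m)
  define S where "S m j a = (\<Sum>q\<le>m. (-1) ^ q * real (m choose q) * pochhammer (a + real q) j)" for m j and a :: real
  have rec: "S (Suc m) j a = S m j a - S m j (a + 1)"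
  proof -
    have "S (Suc m) j a = pochhammer a j + (\<Sum>q\<le>m. (-1) ^ Suc q * real (Suc m choose Suc q) * pochhammer (a + real (Suc q)) j)"
      unfolding S_def by (subst sum.atMost_Suc_shift) simp
    also have "(\<Sum>q\<le>m. (-1) ^ Suc q * real (Suc m choose Suc q) * pochhammer (a + real (Suc q)) j) =
        (\<Sum>q\<le>m. (-1) ^ Suc q * real (m choose q) * pochhammer (a + real (Suc q)) j) +
        (\<Sum>q\<le>m. (-1) ^ Suc q * real (m choose Suc q) * pochhammer (a + real (Suc q)) j)"
      by (simp add: sum.distrib[symmetric] algebra_simps)
    also have "(\<Sum>q\<le>m. (-1) ^ Suc q * real (m choose q) * pochhammer (a + real (Suc q)) j) = - S m j (a + 1)"
      unfolding S_def sum_negf[symmetric] by (intro sum.cong) (auto simp: algebra_simps)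
    also have "pochhammer a j + (- S m j (a + 1) + (\<Sum>q\<le>m. (-1) ^ Suc q * real (m choose Suc q) * pochhammer (a + real (Suc q)) j)) =
        (\<Sum>q\<le>Suc m. (-1) ^ q * real (m choose q) * pochhammer (a + real q) j) - S m j (a + 1)"
      by (subst sum.atMost_Suc_shift) simp
    also have "(\<Sum>q\<le>Suc m. (-1) ^ q * real (m choose q) * pochhammer (a + real q) j) = S m j a"
      unfolding S_def by simp
    finally show ?thesis .
  qed
  show ?case
  proof (cases j)
    case 0
    then have "S m j a = S m j (a + 1)" by (simp add: S_def)
    with rec 0 show ?thesis by (simp add: S_def)
  next
    case (Suc i)
    have diff: "pochhammer x (Suc i) - pochhammer (x + 1) (Suc i) = - real (Suc i) * pochhammer (x + 1) i" for x :: real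
      unfolding pochhammer_rec[of x i] pochhammer_Suc[of "x + 1" i] by (simp add: algebra_simps)
    have "S m j a - S m j (a + 1) = - real (Suc i) * S m i (a + 1)"
      unfolding S_def Suc sum_subtractf[symmetric] sum_distrib_left
    proof (intro sum.cong refl)
      fix q
      have "a + 1 + real q = a + real q + 1" by simp
      then show "(- 1) ^ q * real (m choose q) * pochhammer (a + real q) (Suc i) -
          (- 1) ^ q * real (m choose q) * pochhammer (a + 1 + real q) (Suc i) =
          - real (Suc i) * ((- 1) ^ q * real (m choose q) * pochhammer (a + 1 + real q) i)"
        by (simp only: right_diff_distrib[symmetric] diff mult_ac)
    qed
    with rec have "S (Suc m) j a = - real (Suc i) * S m i (a + 1)" by simp
    also have "S m i (a + 1) = (if i = m then (-1) ^ m * fact m else 0)"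
      unfolding S_def using Suc.IH[of i "a + 1"] Suc.prems Suc by simp
    finally show ?thesis unfolding S_def[symmetric] using Suc by (auto simp: algebra_simps)
  qed
qed

text \<open>
  A multiple of the Laguerre polynomial \<open>L\<^sub>m\<close> with parameter \<open>a - 1\<close>, at \<open>u / s\<close>: the polynomial in
  \<open>u = \<bar>v\<bar>\<^sup>2 / 2\<close> that is orthogonal to all polynomials of lower degree when \<open>v\<close> is a centred Gaussian
  vector with covariance \<open>s\<close> times the identity in dimension \<open>2 a\<close>.
\<close>

definition laguerre :: "real \<Rightarrow> nat \<Rightarrow> real \<Rightarrow> real \<Rightarrow> real" where
  "laguerre a m s u = (\<Sum>q\<le>m. real (m choose q) * (-1) ^ q * s ^ (m - q) / pochhammer a q * u ^ q)"

lemma integral_laguerre: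
  fixes U \<Lambda> :: "'a \<Rightarrow> real"
  assumes int: "\<And>q. integrable M (\<lambda>\<omega>. \<Lambda> \<omega> * U \<omega> ^ q)"
  shows "integrable M (\<lambda>\<omega>. \<Lambda> \<omega> * laguerre a m s (U \<omega>))"
    and "(\<integral>\<omega>. \<Lambda> \<omega> * laguerre a m s (U \<omega>) \<partial>M) =
      (\<Sum>q\<le>m. real (m choose q) * (-1) ^ q * s ^ (m - q) / pochhammer a q * (\<integral>\<omega>. \<Lambda> \<omega> * U \<omega> ^ q \<partial>M))"
proof -
  have e: "\<Lambda> \<omega> * laguerre a m s (U \<omega>) =
      (\<Sum>q\<le>m. real (m choose q) * (-1) ^ q * s ^ (m - q) / pochhammer a q * (\<Lambda> \<omega> * U \<omega> ^ q))" for \<omega>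
    unfolding laguerre_def sum_distrib_left by (intro sum.cong) auto
  show "integrable M (\<lambda>\<omega>. \<Lambda> \<omega> * laguerre a m s (U \<omega>))"
    unfolding e by (intro Bochner_Integration.integrable_sum integrable_mult_right int)
  show "(\<integral>\<omega>. \<Lambda> \<omega> * laguerre a m s (U \<omega>) \<partial>M) =
      (\<Sum>q\<le>m. real (m choose q) * (-1) ^ q * s ^ (m - q) / pochhammer a q * (\<integral>\<omega>. \<Lambda> \<omega> * U \<omega> ^ q \<partial>M))"
    unfolding e by (simp add: Bochner_Integration.integral_sum int)
qed

text \<open>
  The polynomial annihilates Gamma distributions of its own scale with shapes \<open>a, ..., a + m - 1\<close>:
  since \<open>(a + j)\<^sub>q / (a)\<^sub>q = (a + q)\<^sub>j / (a)\<^sub>j\<close> for rising factorials, exchanging the sums produces the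
  \<open>m\<close>-th difference of a polynomial of degree \<open>j\<close>, and only \<open>j = m\<close> survives.
\<close>

lemma integral_laguerre_of_matching_scale:
  fixes U \<Lambda> :: "'a \<Rightarrow> real"
  assumes "U \<in> borel_measurable M" "\<Lambda> \<in> borel_measurable M" "\<And>\<omega>. U \<omega> \<ge> 0"
    and int: "\<And>q. integrable M (\<lambda>\<omega>. \<Lambda> \<omega> * U \<omega> ^ q)"
    and "s \<ge> 0" and a: "a > 0"
    and "\<And>\<tau>. \<tau> > 0 \<Longrightarrow> (\<integral>\<omega>. \<Lambda> \<omega> * exp (- (\<tau> * U \<omega>)) \<partial>M) = (\<Sum>j\<le>m. c j * (1 + \<tau> * s) powr (- (a + real j)))"
  shows "(\<integral>\<omega>. \<Lambda> \<omega> * laguerre a m s (U \<omega>) \<partial>M) = s ^ m * c m * (-1) ^ m * fact m / pochhammer a m"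
proof -
  have a0: "pochhammer a q > 0" for q using a by (rule pochhammer_pos)
  have mom: "(\<integral>\<omega>. \<Lambda> \<omega> * U \<omega> ^ q \<partial>M) = s ^ q * (\<Sum>j\<le>m. c j * pochhammer (a + real j) q)" for q
    by (rule moments_from_laplace_transform[OF assms(1-5,7)])
  have "(\<integral>\<omega>. \<Lambda> \<omega> * laguerre a m s (U \<omega>) \<partial>M) =
      (\<Sum>q\<le>m. real (m choose q) * (-1) ^ q * s ^ (m - q) / pochhammer a q * (s ^ q * (\<Sum>j\<le>m. c j * pochhammer (a + real j) q)))"
    by (simp only: integral_laguerre(2)[OF int] mom)
  also have "\<dots> = (\<Sum>q\<le>m. \<Sum>j\<le>m. s ^ m * c j / pochhammer a j * ((-1) ^ q * real (m choose q) * pochhammer (a + real q) j))"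
    unfolding sum_distrib_left
  proof (intro sum.cong refl)
    fix q j assume q: "q \<in> {..m}"
    have "pochhammer a q * pochhammer (a + real q) j = pochhammer a j * pochhammer (a + real j) q"
      using pochhammer_product'[of a q j] pochhammer_product'[of a j q] by (simp add: add.commute)
    then have "pochhammer (a + real j) q / pochhammer a q = pochhammer (a + real q) j / pochhammer a j"
      using a0[of q] a0[of j] by (simp add: field_simps)
    moreover have "s ^ m = s ^ (m - q) * s ^ q" using q by (simp add: power_add[symmetric])
    ultimately show "real (m choose q) * (- 1) ^ q * s ^ (m - q) / pochhammer a q * (s ^ q * (c j * pochhammer (a + real j) q)) =
         s ^ m * c j / pochhammer a j * ((- 1) ^ q * real (m choose q) * pochhammer (a + real q) j)"
      by (simp add: divide_inverse mult_ac)
  qed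
  also have "\<dots> = (\<Sum>j\<le>m. s ^ m * c j / pochhammer a j * (if j = m then (-1) ^ m * fact m else 0))"
  proof (subst sum.swap, intro sum.cong refl)
    fix j assume "j \<in> {..m}"
    then have "j \<le> m" by simp
    from alternating_binomial_sum_pochhammer[OF this, of a]
    show "(\<Sum>q\<le>m. s ^ m * c j / pochhammer a j * ((-1) ^ q * real (m choose q) * pochhammer (a + real q) j)) =
        s ^ m * c j / pochhammer a j * (if j = m then (-1) ^ m * fact m else 0)"
      by (simp only: sum_distrib_left[symmetric])
  qed
  also have "\<dots> = s ^ m * c m * (-1) ^ m * fact m / pochhammer a m"
    by (simp add: if_distrib sum.delta cong: if_cong)
  finally show ?thesis .
qed

text \<open>
  For shape \<open>a\<close> and another scale \<open>\<kappa>\<close> the rising factorials cancel and the binomial theorem remains.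
\<close>

lemma integral_laguerre_of_rescaled_gamma:
  fixes U \<Lambda> :: "'a \<Rightarrow> real"
  assumes "U \<in> borel_measurable M" "\<Lambda> \<in> borel_measurable M" "\<And>\<omega>. U \<omega> \<ge> 0"
    and int: "\<And>q. integrable M (\<lambda>\<omega>. \<Lambda> \<omega> * U \<omega> ^ q)"
    and "\<kappa> \<ge> 0" and a: "a > 0"
    and lap: "\<And>\<tau>. \<tau> > 0 \<Longrightarrow> (\<integral>\<omega>. \<Lambda> \<omega> * exp (- (\<tau> * U \<omega>)) \<partial>M) = C * (1 + \<tau> * \<kappa>) powr (- a)"
  shows "(\<integral>\<omega>. \<Lambda> \<omega> * laguerre a m s (U \<omega>) \<partial>M) = C * (s - \<kappa>) ^ m"
proof -
  have a0: "pochhammer a q \<noteq> 0" for q using pochhammer_pos[OF a, of q] by simp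
  have "(\<integral>\<omega>. \<Lambda> \<omega> * U \<omega> ^ q \<partial>M) = \<kappa> ^ q * (\<Sum>j\<le>0. C * pochhammer (a + real j) q)" for q
    by (rule moments_from_laplace_transform[OF assms(1-5)]) (simp add: lap)
  then have "(\<integral>\<omega>. \<Lambda> \<omega> * laguerre a m s (U \<omega>) \<partial>M) =
      (\<Sum>q\<le>m. real (m choose q) * (-1) ^ q * s ^ (m - q) / pochhammer a q * (\<kappa> ^ q * (C * pochhammer a q)))"
    unfolding integral_laguerre(2)[OF int] by simp
  also have "\<dots> = C * (\<Sum>q\<le>m. real (m choose q) * (- \<kappa>) ^ q * s ^ (m - q))"
    unfolding sum_distrib_left using a0 by (intro sum.cong refl) (simp add: power_minus[of \<kappa>] mult_ac)
  also have "(\<Sum>q\<le>m. real (m choose q) * (- \<kappa>) ^ q * s ^ (m - q)) = (- \<kappa> + s) ^ m"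
    by (rule binomial_ring[symmetric])
  finally show ?thesis by (simp add: add.commute)
qed

section \<open>Independent copies of a Gaussian field\<close>

text \<open>
  Elements of the Gaussian space, represented as functionals of the whole path, so that the same
  functional can be applied to \<open>X\<^sub>0\<close> and to each of its copies.
\<close>

definition linear_functionals :: "(('t \<Rightarrow> real) \<Rightarrow> real) set" where
  "linear_functionals = {f. \<exists>S a. finite S \<and> f = (\<lambda>x. \<Sum>t\<in>S. a t * x t)}"

lemma linear_functionals_eval: "(\<lambda>x. x t) \<in> linear_functionals"
  unfolding linear_functionals_def by (auto intro!: exI[of _ "{t}"] exI[of _ "\<lambda>_. 1"])

lemma linear_functionals_combination:
  assumes "f \<in> linear_functionals" "g \<in> linear_functionals"
  shows "(\<lambda>x. \<alpha> * f x + \<beta> * g x) \<in> linear_functionals"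
proof -
  obtain S a where S: "finite S" and f: "f = (\<lambda>x. \<Sum>t\<in>S. a t * x t)"
    using assms(1) by (auto simp: linear_functionals_def)
  obtain T b where T: "finite T" and g: "g = (\<lambda>x. \<Sum>t\<in>T. b t * x t)"
    using assms(2) by (auto simp: linear_functionals_def)
  let ?a = "\<lambda>t. if t \<in> S then a t else 0" and ?b = "\<lambda>t. if t \<in> T then b t else 0"
  have "f = (\<lambda>x. \<Sum>t\<in>S \<union> T. ?a t * x t)"
    unfolding f using S T by (intro ext sum.mono_neutral_cong_left) auto
  moreover have "g = (\<lambda>x. \<Sum>t\<in>S \<union> T. ?b t * x t)"
    unfolding g using S T by (intro ext sum.mono_neutral_cong_left) auto
  ultimately have "(\<lambda>x. \<alpha> * f x + \<beta> * g x) = (\<lambda>x. \<Sum>t\<in>S \<union> T. (\<alpha> * ?a t + \<beta> * ?b t) * x t)"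
    by (simp add: sum_distrib_left sum.distrib[symmetric] algebra_simps)
  moreover have "finite (S \<union> T)" using S T by simp
  ultimately show ?thesis
    unfolding linear_functionals_def mem_Collect_eq by (intro exI conjI)
qed

lemma linear_functionals_zero: "(\<lambda>x. 0) \<in> linear_functionals"
  using linear_functionals_combination[OF linear_functionals_eval linear_functionals_eval,
    of 0 undefined 0 undefined] by simp

lemma linear_functionals_diff:
  "f \<in> linear_functionals \<Longrightarrow> g \<in> linear_functionals \<Longrightarrow> (\<lambda>x. f x - g x) \<in> linear_functionals"
  by (drule (1) linear_functionals_combination[of f g 1 "-1"]) simp

lemma linear_functionals_measurable:
  "f \<in> linear_functionals \<Longrightarrow> f \<in> borel_measurable (Pi\<^sub>M UNIV (\<lambda>_. borel))"
proof -
  assume "f \<in> linear_functionals"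
  then obtain S a where f: "f = (\<lambda>x. \<Sum>t\<in>S. a t * x t)"
    unfolding linear_functionals_def by blast
  have "(\<lambda>x. x t) \<in> borel_measurable (Pi\<^sub>M UNIV (\<lambda>_. borel :: real measure))" for t
    by (rule measurable_component_singleton) simp
  then show ?thesis
    unfolding f by (intro borel_measurable_sum borel_measurable_times borel_measurable_const)
qed

text \<open>
  The class is closed under sums and products, so that all polynomial expressions in Gaussian
  variables are integrable without further estimates.
\<close>

definition finite_moments :: "'w measure \<Rightarrow> ('w \<Rightarrow> real) \<Rightarrow> bool" where
  "finite_moments M F \<longleftrightarrow> F \<in> borel_measurable M \<and> (\<forall>k. integrable M (\<lambda>\<omega>. F \<omega> ^ k))"

lemma finite_moments_measurable: "finite_moments M F \<Longrightarrow> F \<in> borel_measurable M"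
  by (simp add: finite_moments_def)

lemma finite_moments_integrable: "finite_moments M F \<Longrightarrow> integrable M F"
proof -
  assume "finite_moments M F"
  then have "integrable M (\<lambda>\<omega>. F \<omega> ^ 1)" unfolding finite_moments_def by blast
  then show ?thesis by simp
qed

lemma finite_moments_L2: "finite_moments M F \<Longrightarrow> F \<in> L2 M"
  by (simp add: finite_moments_def L2_def)

lemma finite_moments_power: "finite_moments M F \<Longrightarrow> finite_moments M (\<lambda>\<omega>. F \<omega> ^ n)"
proof -
  assume F: "finite_moments M F"
  have "integrable M (\<lambda>\<omega>. (F \<omega> ^ n) ^ k)" for k
    unfolding power_mult[symmetric] using F unfolding finite_moments_def by blast
  then show ?thesis
    using F by (auto simp: finite_moments_def)
qed

lemma finite_moments_mult:
  assumes "finite_moments M F" "finite_moments M G"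
  shows "finite_moments M (\<lambda>\<omega>. F \<omega> * G \<omega>)"
  unfolding finite_moments_def
proof (intro conjI allI)
  show "(\<lambda>\<omega>. F \<omega> * G \<omega>) \<in> borel_measurable M"
    by (intro borel_measurable_times finite_moments_measurable assms)
  fix k
  have "(\<lambda>\<omega>. F \<omega> ^ k) \<in> L2 M" "(\<lambda>\<omega>. G \<omega> ^ k) \<in> L2 M"
    using assms by (auto intro: finite_moments_L2 finite_moments_power)
  then show "integrable M (\<lambda>\<omega>. (F \<omega> * G \<omega>) ^ k)"
    unfolding power_mult_distrib by (rule L2_mult_integrable)
qed

lemma (in finite_measure) finite_moments_const: "finite_moments M (\<lambda>\<omega>. c)"
  by (simp add: finite_moments_def)

lemma (in finite_measure) finite_moments_scale: "finite_moments M F \<Longrightarrow> finite_moments M (\<lambda>\<omega>. c * F \<omega>)"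
  by (rule finite_moments_mult[OF finite_moments_const])

lemma finite_moments_add:
  assumes "finite_moments M F" "finite_moments M G"
  shows "finite_moments M (\<lambda>\<omega>. F \<omega> + G \<omega>)"
  unfolding finite_moments_def
proof (intro conjI allI)
  show "(\<lambda>\<omega>. F \<omega> + G \<omega>) \<in> borel_measurable M"
    by (intro borel_measurable_add finite_moments_measurable assms)
  fix k
  have int: "integrable M (\<lambda>\<omega>. F \<omega> ^ i * G \<omega> ^ (k - i))" for i
    by (rule L2_mult_integrable[OF finite_moments_L2[OF finite_moments_power[OF assms(1)]]
        finite_moments_L2[OF finite_moments_power[OF assms(2)]]])
  have "integrable M (\<lambda>\<omega>. \<Sum>i\<le>k. of_nat (k choose i) * (F \<omega> ^ i * G \<omega> ^ (k - i)))"
    using int by (intro Bochner_Integration.integrable_sum) (rule integrable_mult_right)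
  also have "(\<lambda>\<omega>. \<Sum>i\<le>k. of_nat (k choose i) * (F \<omega> ^ i * G \<omega> ^ (k - i))) = (\<lambda>\<omega>. (F \<omega> + G \<omega>) ^ k)"
    by (rule ext) (subst binomial_ring, simp only: mult.assoc)
  finally show "integrable M (\<lambda>\<omega>. (F \<omega> + G \<omega>) ^ k)" .
qed

lemma (in finite_measure) finite_moments_sum:
  "(\<And>i. i \<in> I \<Longrightarrow> finite_moments M (F i)) \<Longrightarrow> finite_moments M (\<lambda>\<omega>. \<Sum>i\<in>I. F i \<omega>)"
proof (induction I rule: infinite_finite_induct)
  case (insert i I)
  then have "finite_moments M (\<lambda>\<omega>. F i \<omega> + (\<Sum>i\<in>I. F i \<omega>))"
    by (intro finite_moments_add) blast+
  then show ?case using insert by simp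
qed (auto intro: finite_moments_const)

lemma (in finite_measure) finite_moments_bounded:
  assumes [measurable]: "G \<in> borel_measurable M" and "\<And>\<omega>. \<omega> \<in> space M \<Longrightarrow> \<bar>G \<omega>\<bar> \<le> B"
  shows "finite_moments M G"
  unfolding finite_moments_def
proof (intro conjI allI)
  fix k
  have "\<bar>G \<omega> ^ k\<bar> \<le> B ^ k" if "\<omega> \<in> space M" for \<omega>
    unfolding power_abs by (rule power_mono[OF assms(2)[OF that]]) simp
  then show "integrable M (\<lambda>\<omega>. G \<omega> ^ k)"
    by (intro integrable_const_bound[where B = "B ^ k"] AE_I2) auto
qed (rule assms(1))

lemma finite_moments_laguerre:
  assumes "prob_space M" "finite_moments M U"
  shows "finite_moments M (\<lambda>\<omega>. laguerre a m s (U \<omega>))"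
proof -
  interpret prob_space M by fact
  show ?thesis
    unfolding laguerre_def by (intro finite_moments_sum finite_moments_scale finite_moments_power assms)
qed

locale gaussian_copies = prob_space M + base: prob_space M0
  for M :: "'w measure" and M0 :: "'v measure" +
  fixes X :: "'t \<Rightarrow> 'w \<Rightarrow> real ^ 'd" and X0 :: "'t \<Rightarrow> 'v \<Rightarrow> real"
  assumes gaussian: "centered_gaussian_field M0 X0"
    and copies: "independent_copies M X M0 X0"
begin

definition cov :: "(('t \<Rightarrow> real) \<Rightarrow> real) \<Rightarrow> (('t \<Rightarrow> real) \<Rightarrow> real) \<Rightarrow> real" where
  "cov f g = (\<integral>\<omega>. f (\<lambda>t. X0 t \<omega>) * g (\<lambda>t. X0 t \<omega>) \<partial>M0)"

abbreviation coord :: "'d \<Rightarrow> 'w \<Rightarrow> 't \<Rightarrow> real" where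
  "coord i \<omega> \<equiv> (\<lambda>t. X t \<omega> $ i)"

lemma coord_measurable [measurable]: "coord i \<in> M \<rightarrow>\<^sub>M Pi\<^sub>M UNIV (\<lambda>_. borel)"
  using copies unfolding independent_copies_def indep_vars_def by blast

lemma X0_measurable [measurable]: "X0 t \<in> borel_measurable M0"
  using gaussian unfolding centered_gaussian_field_def by blast

lemma X0_path_measurable [measurable]: "(\<lambda>\<omega> t. X0 t \<omega>) \<in> M0 \<rightarrow>\<^sub>M Pi\<^sub>M UNIV (\<lambda>_. borel)"
  by (rule measurable_PiM_single') auto

lemma X_measurable [measurable]: "X t \<in> borel_measurable M"
  by (rule borel_measurable_euclidean_space[THEN iffD2])
    (auto simp: Basis_vec_def inner_axis)

lemma coord_functional_measurable: "f \<in> linear_functionals \<Longrightarrow> (\<lambda>\<omega>. f (coord i \<omega>)) \<in> borel_measurable M"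
  by (rule measurable_compose[OF coord_measurable linear_functionals_measurable])

lemma X0_functional_measurable: "f \<in> linear_functionals \<Longrightarrow> (\<lambda>\<omega>. f (\<lambda>t. X0 t \<omega>)) \<in> borel_measurable M0"
  by (rule measurable_compose[OF X0_path_measurable linear_functionals_measurable])

lemma coord_integrable_iff:
  fixes g :: "('t \<Rightarrow> real) \<Rightarrow> 'b :: {banach, second_countable_topology}"
  assumes [measurable]: "g \<in> borel_measurable (Pi\<^sub>M UNIV (\<lambda>_. borel))"
  shows "integrable M (\<lambda>\<omega>. g (coord i \<omega>)) \<longleftrightarrow> integrable M0 (\<lambda>\<omega>. g (\<lambda>t. X0 t \<omega>))"
proof -
  have "distr M (Pi\<^sub>M UNIV (\<lambda>_. borel)) (coord i) = distr M0 (Pi\<^sub>M UNIV (\<lambda>_. borel)) (\<lambda>\<omega> t. X0 t \<omega>)"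
    using copies unfolding independent_copies_def by blast
  from arg_cong[OF this, of "\<lambda>D. integrable D g"] show ?thesis
    by (simp add: integrable_distr_eq)
qed

lemma coord_integral:
  fixes g :: "('t \<Rightarrow> real) \<Rightarrow> 'b :: {banach, second_countable_topology}"
  assumes [measurable]: "g \<in> borel_measurable (Pi\<^sub>M UNIV (\<lambda>_. borel))"
  shows "(\<integral>\<omega>. g (coord i \<omega>) \<partial>M) = (\<integral>\<omega>. g (\<lambda>t. X0 t \<omega>) \<partial>M0)"
proof -
  have "distr M (Pi\<^sub>M UNIV (\<lambda>_. borel)) (coord i) = distr M0 (Pi\<^sub>M UNIV (\<lambda>_. borel)) (\<lambda>\<omega> t. X0 t \<omega>)"
    using copies unfolding independent_copies_def by blast
  from arg_cong[OF this, of "\<lambda>D. integral\<^sup>L D g"] show ?thesis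
    by (simp add: integral_distr)
qed

lemma integral_prod_coords:
  fixes g :: "'d \<Rightarrow> ('t \<Rightarrow> real) \<Rightarrow> 'b :: {real_normed_field, banach, second_countable_topology}"
  assumes g: "\<And>i. g i \<in> borel_measurable (Pi\<^sub>M UNIV (\<lambda>_. borel))"
    and int: "\<And>i. integrable M (\<lambda>\<omega>. g i (coord i \<omega>))"
  shows "(\<integral>\<omega>. (\<Prod>i\<in>UNIV. g i (coord i \<omega>)) \<partial>M) = (\<Prod>i\<in>UNIV. \<integral>\<omega>. g i (coord i \<omega>) \<partial>M)"
proof (rule indep_vars_lebesgue_integral)
  have "indep_vars (\<lambda>_. Pi\<^sub>M UNIV (\<lambda>_. borel)) (\<lambda>i \<omega>. coord i \<omega>) UNIV"
    using copies unfolding independent_copies_def by blast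
  from indep_vars_compose2[OF this, of g "\<lambda>_. borel"]
  show "indep_vars (\<lambda>_. borel) (\<lambda>i \<omega>. g i (coord i \<omega>)) UNIV"
    using g by simp
qed (use int in auto)

lemma functional_gaussian:
  assumes f: "f \<in> linear_functionals"
  shows "integrable M0 (\<lambda>\<omega>. f (\<lambda>t. X0 t \<omega>) ^ k)"
    and "(CLINT \<omega>|M0. iexp (\<theta> * f (\<lambda>t. X0 t \<omega>))) = of_real (exp (- (\<theta>\<^sup>2 * cov f f / 2)))"
proof -
  let ?Y = "\<lambda>\<omega>. f (\<lambda>t. X0 t \<omega>)"
  have [measurable]: "?Y \<in> borel_measurable M0" by (rule X0_functional_measurable[OF f])
  obtain S a where S: "finite S" and fS: "f = (\<lambda>x. \<Sum>t\<in>S. a t * x t)"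
    using f by (auto simp: linear_functionals_def)
  obtain \<sigma> where \<sigma>: "\<sigma> \<ge> 0" and distr:
    "distr M0 borel ?Y = (if \<sigma> = 0 then return borel 0 else density lborel (normal_density 0 \<sigma>))"
    using gaussian S unfolding centered_gaussian_field_def fS by blast
  have char: "(CLINT \<omega>|M0. iexp (\<theta> * ?Y \<omega>)) = of_real (exp (- (\<theta>\<^sup>2 * \<sigma>\<^sup>2 / 2)))" for \<theta>
  proof (cases "\<sigma> = 0")
    case True
    have "(CLINT \<omega>|M0. iexp (\<theta> * ?Y \<omega>)) = (CLINT x|distr M0 borel ?Y. iexp (\<theta> * x))"
      by (simp add: integral_distr)
    also have "\<dots> = 1" unfolding distr using True by (simp add: integral_return)
    finally show ?thesis using True by simp
  next
    case False
    then have \<sigma>': "\<sigma> > 0" using \<sigma> by simp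
    have "distributed M0 lborel ?Y (normal_density 0 \<sigma>)"
      unfolding distributed_def using distr False
      by (auto cong: distr_cong)
    then have "distributed M0 lborel (\<lambda>\<omega>. (?Y \<omega> - 0) / \<sigma>) std_normal_density"
      by (subst (asm) base.normal_standard_normal_convert[OF \<sigma>'])
    then have "distr M0 lborel (\<lambda>\<omega>. ?Y \<omega> / \<sigma>) = std_normal_distribution"
      unfolding distributed_def by simp
    then have "char std_normal_distribution (\<theta> * \<sigma>) = (CLINT x|distr M0 lborel (\<lambda>\<omega>. ?Y \<omega> / \<sigma>). iexp (\<theta> * \<sigma> * x))"
      by (simp add: char_def)
    also have "\<dots> = (CLINT \<omega>|M0. iexp (\<theta> * \<sigma> * (?Y \<omega> / \<sigma>)))"
      by (rule integral_distr) measurable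
    also have "\<dots> = (CLINT \<omega>|M0. iexp (\<theta> * ?Y \<omega>))" using False by simp
    finally show ?thesis by (simp add: char_std_normal_distribution power_mult_distrib)
  qed
  show "integrable M0 (\<lambda>\<omega>. ?Y \<omega> ^ k)"
    using base.gaussian_moments(1)[OF _ _ char] by simp
  have "cov f f = \<sigma>\<^sup>2"
    using base.gaussian_moments(2)[OF _ _ char, of 1] by (simp add: cov_def power2_eq_square)
  with char[of \<theta>] show "(CLINT \<omega>|M0. iexp (\<theta> * ?Y \<omega>)) = of_real (exp (- (\<theta>\<^sup>2 * cov f f / 2)))"
    by simp
qed

lemma functional_L2: "f \<in> linear_functionals \<Longrightarrow> (\<lambda>\<omega>. f (\<lambda>t. X0 t \<omega>)) \<in> L2 M0"
  unfolding L2_def using functional_gaussian(1)[of f 2] X0_functional_measurable[of f] by auto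

lemma functional_finite_moments: "f \<in> linear_functionals \<Longrightarrow> finite_moments M (\<lambda>\<omega>. f (coord i \<omega>))"
  unfolding finite_moments_def using functional_gaussian(1)[of f] linear_functionals_measurable[of f]
  by (auto simp: coord_integrable_iff[where g = "\<lambda>x. f x ^ k" for k] coord_functional_measurable)

lemma cov_commute: "cov f g = cov g f"
  by (simp add: cov_def mult.commute)

lemma cov_nonneg: "cov f f \<ge> 0"
  unfolding cov_def by (intro Bochner_Integration.integral_nonneg) auto

lemma cov_Cauchy_Schwarz:
  assumes "f \<in> linear_functionals" "g \<in> linear_functionals"
  shows "(cov f g)\<^sup>2 \<le> cov f f * cov g g"
  using L2_Cauchy_Schwarz[OF assms[THEN functional_L2]] by (simp add: cov_def power2_eq_square)

lemma cov_combination: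
  assumes "f \<in> linear_functionals" "g \<in> linear_functionals" "h \<in> linear_functionals"
  shows "cov (\<lambda>x. \<alpha> * f x + \<beta> * g x) h = \<alpha> * cov f h + \<beta> * cov g h"
proof -
  have i: "integrable M0 (\<lambda>\<omega>. f (\<lambda>t. X0 t \<omega>) * h (\<lambda>t. X0 t \<omega>))" "integrable M0 (\<lambda>\<omega>. g (\<lambda>t. X0 t \<omega>) * h (\<lambda>t. X0 t \<omega>))"
    using assms by (auto intro!: L2_mult_integrable functional_L2)
  have "cov (\<lambda>x. \<alpha> * f x + \<beta> * g x) h =
     (\<integral>\<omega>. \<alpha> * (f (\<lambda>t. X0 t \<omega>) * h (\<lambda>t. X0 t \<omega>)) + \<beta> * (g (\<lambda>t. X0 t \<omega>) * h (\<lambda>t. X0 t \<omega>)) \<partial>M0)"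
    by (simp add: cov_def algebra_simps)
  also have "\<dots> = \<alpha> * cov f h + \<beta> * cov g h"
    using i by (simp add: cov_def)
  finally show ?thesis .
qed

lemma cov_combination_self:
  assumes "f \<in> linear_functionals" "g \<in> linear_functionals"
  shows "cov (\<lambda>x. \<alpha> * f x + \<beta> * g x) (\<lambda>x. \<alpha> * f x + \<beta> * g x) =
    \<alpha>\<^sup>2 * cov f f + 2 * \<alpha> * \<beta> * cov f g + \<beta>\<^sup>2 * cov g g"
proof -
  let ?h = "\<lambda>x. \<alpha> * f x + \<beta> * g x"
  have h: "?h \<in> linear_functionals" by (rule linear_functionals_combination[OF assms])
  have "cov f ?h = \<alpha> * cov f f + \<beta> * cov g f"
    using cov_combination[OF assms assms(1), of \<alpha> \<beta>] cov_commute[of f ?h] by (simp only:)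
  moreover have "cov g ?h = \<alpha> * cov f g + \<beta> * cov g g"
    using cov_combination[OF assms assms(2), of \<alpha> \<beta>] cov_commute[of g ?h] by (simp only:)
  ultimately show ?thesis
    unfolding cov_combination[OF assms h] using cov_commute[of g f]
    by (simp add: power2_eq_square algebra_simps)
qed

lemma coord_pair_char:
  assumes "f \<in> linear_functionals" "g \<in> linear_functionals"
  shows "(CLINT \<omega>|M. iexp (\<alpha> * f (coord i \<omega>) + \<beta> * g (coord i \<omega>))) =
    of_real (exp (- ((\<alpha>\<^sup>2 * cov f f + 2 * \<alpha> * \<beta> * cov f g + \<beta>\<^sup>2 * cov g g) / 2)))"
proof -
  let ?h = "\<lambda>x. \<alpha> * f x + \<beta> * g x"
  have h: "?h \<in> linear_functionals" by (rule linear_functionals_combination[OF assms])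
  have m: "(\<lambda>x. iexp (?h x)) \<in> borel_measurable (Pi\<^sub>M UNIV (\<lambda>_. borel))"
    by (rule measurable_compose[OF linear_functionals_measurable[OF h]]) measurable
  have "(CLINT \<omega>|M. iexp (?h (coord i \<omega>))) = (CLINT \<omega>|M0. iexp (1 * ?h (\<lambda>t. X0 t \<omega>)))"
    unfolding coord_integral[OF m] by simp
  also have "\<dots> = of_real (exp (- (1\<^sup>2 * cov ?h ?h / 2)))"
    by (rule functional_gaussian(2)[OF h])
  finally show ?thesis unfolding cov_combination_self[OF assms] by simp
qed

definition half_sqnorm :: "(('t \<Rightarrow> real) \<Rightarrow> real) \<Rightarrow> 'w \<Rightarrow> real" where
  "half_sqnorm v \<omega> = (\<Sum>i\<in>UNIV. (v (coord i \<omega>))\<^sup>2) / 2"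

lemma half_sqnorm_nonneg: "half_sqnorm v \<omega> \<ge> 0"
  by (simp add: half_sqnorm_def sum_nonneg)

lemma half_sqnorm_measurable:
  "v \<in> linear_functionals \<Longrightarrow> half_sqnorm v \<in> borel_measurable M"
  unfolding half_sqnorm_def
  by (intro borel_measurable_divide borel_measurable_sum borel_measurable_power borel_measurable_const
      coord_functional_measurable)

lemma half_sqnorm_finite_moments:
  assumes "v \<in> linear_functionals" shows "finite_moments M (half_sqnorm v)"
proof -
  have "finite_moments M (\<lambda>\<omega>. (1/2) * (\<Sum>i\<in>UNIV. (v (coord i \<omega>))\<^sup>2))"
    by (intro finite_moments_scale finite_moments_sum finite_moments_power functional_finite_moments assms)
  then show ?thesis by (simp add: half_sqnorm_def[abs_def])
qed

lemma exp_half_sqnorm_prod: "exp (- (\<tau> * half_sqnorm v \<omega>)) = (\<Prod>i\<in>UNIV. exp (- (\<tau> * (v (coord i \<omega>))\<^sup>2 / 2)))"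
  unfolding half_sqnorm_def
  by (simp add: exp_sum[symmetric] sum_negf sum_distrib_left sum_divide_distrib)

lemma powr_neg_half_dim: "x > 0 \<Longrightarrow> (1 / sqrt x) ^ CARD('d) = x powr (- (real CARD('d) / 2))"
proof -
  assume x: "x > 0"
  have "1 / sqrt x = x powr (- 1 / 2)"
    using x by (simp add: powr_half_sqrt[symmetric] powr_minus_divide)
  then show ?thesis using x by (simp add: powr_powr powr_realpow[symmetric])
qed

text \<open>
  By independence of the coordinates this is a product of \<open>d\<close> copies of the formula for a Gaussian pair.
\<close>

lemma damped_char:
  assumes v: "v \<in> linear_functionals" and y: "\<And>i. y i \<in> linear_functionals" and \<tau>: "\<tau> \<ge> 0"
  shows "(CLINT \<omega>|M. of_real (exp (- (\<tau> * half_sqnorm v \<omega>))) * iexp (\<theta> * (\<Sum>i\<in>UNIV. y i (coord i \<omega>)))) =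
    of_real ((1 + \<tau> * cov v v) powr (- (real CARD('d) / 2)) *
      exp (- (\<theta>\<^sup>2 * ((\<Sum>i\<in>UNIV. cov (y i) (y i)) - \<tau> * (\<Sum>i\<in>UNIV. (cov v (y i))\<^sup>2) / (1 + \<tau> * cov v v)) / 2)))"
proof -
  have pos: "1 + \<tau> * cov v v > 0" using \<tau> cov_nonneg[of v] by (simp add: add_pos_nonneg)
  have prod_exp: "(\<Prod>i\<in>UNIV. exp (- (\<theta>\<^sup>2 * K i / 2))) = exp (- (\<theta>\<^sup>2 * (\<Sum>i\<in>UNIV. K i) / 2))" for K :: "'d \<Rightarrow> real"
    by (simp add: exp_sum[symmetric] sum_negf sum_distrib_left sum_divide_distrib)
  let ?g = "\<lambda>i x. complex_of_real (exp (- (\<tau> * (v x)\<^sup>2 / 2))) * iexp (\<theta> * y i x)"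
  have [measurable]: "v \<in> borel_measurable (Pi\<^sub>M UNIV (\<lambda>_. borel))" "y i \<in> borel_measurable (Pi\<^sub>M UNIV (\<lambda>_. borel))" for i
    using v y by (auto intro: linear_functionals_measurable)
  have meas: "?g i \<in> borel_measurable (Pi\<^sub>M UNIV (\<lambda>_. borel))" for i by measurable
  have vm [measurable]: "(\<lambda>\<omega>. v (coord i \<omega>)) \<in> borel_measurable M" "(\<lambda>\<omega>. y j (coord i \<omega>)) \<in> borel_measurable M" for i j
    using v y by (auto intro: coord_functional_measurable)
  have "of_real (exp (- (\<tau> * half_sqnorm v \<omega>))) * iexp (\<theta> * (\<Sum>i\<in>UNIV. y i (coord i \<omega>))) = (\<Prod>i\<in>UNIV. ?g i (coord i \<omega>))" for \<omega>
    unfolding exp_half_sqnorm_prod by (simp add: prod.distrib sum_distrib_left exp_sum)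
  then have "(CLINT \<omega>|M. of_real (exp (- (\<tau> * half_sqnorm v \<omega>))) * iexp (\<theta> * (\<Sum>i\<in>UNIV. y i (coord i \<omega>)))) =
      (CLINT \<omega>|M. (\<Prod>i\<in>UNIV. ?g i (coord i \<omega>)))"
    by simp
  also have "\<dots> = (\<Prod>i\<in>UNIV. CLINT \<omega>|M. ?g i (coord i \<omega>))"
    by (rule integral_prod_coords[OF meas])
      (rule integrable_const_bound[where B = 1], use \<tau> in \<open>auto simp: norm_mult\<close>)
  also have "\<dots> = (\<Prod>i\<in>UNIV. of_real (exp (- (\<theta>\<^sup>2 * (cov (y i) (y i) - \<tau> * (cov v (y i))\<^sup>2 / (1 + \<tau> * cov v v)) / 2)) / sqrt (1 + \<tau> * cov v v)))"
    by (intro prod.cong refl gaussian_pair_damped_char[OF vm coord_pair_char[OF v y] cov_nonneg \<tau>])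
  also have "\<dots> = of_real ((\<Prod>i\<in>UNIV. exp (- (\<theta>\<^sup>2 * (cov (y i) (y i) - \<tau> * (cov v (y i))\<^sup>2 / (1 + \<tau> * cov v v)) / 2))) * (1 / sqrt (1 + \<tau> * cov v v)) ^ CARD('d))"
    unfolding of_real_prod[symmetric] by (simp add: prod_dividef power_one_over)
  also have "(\<Prod>i\<in>UNIV. exp (- (\<theta>\<^sup>2 * (cov (y i) (y i) - \<tau> * (cov v (y i))\<^sup>2 / (1 + \<tau> * cov v v)) / 2))) =
      exp (- (\<theta>\<^sup>2 * ((\<Sum>i\<in>UNIV. cov (y i) (y i)) - \<tau> * (\<Sum>i\<in>UNIV. (cov v (y i))\<^sup>2) / (1 + \<tau> * cov v v)) / 2))"
    unfolding prod_exp by (simp add: sum_subtractf sum_distrib_left sum_divide_distrib)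
  finally show ?thesis using pos by (simp add: powr_neg_half_dim mult.commute)
qed

lemma damped_twice:
  assumes v: "v \<in> linear_functionals" and v': "v' \<in> linear_functionals" and \<tau>: "\<tau> \<ge> 0" "\<tau>' \<ge> 0"
  shows "(\<integral>\<omega>. exp (- (\<tau> * half_sqnorm v \<omega>)) * exp (- (\<tau>' * half_sqnorm v' \<omega>)) \<partial>M) =
    ((1 + \<tau> * cov v v) * (1 + \<tau>' * cov v' v') - \<tau> * \<tau>' * (cov v v')\<^sup>2) powr (- (real CARD('d) / 2))"
proof -
  let ?D = "(1 + \<tau> * cov v v) * (1 + \<tau>' * cov v' v') - \<tau> * \<tau>' * (cov v v')\<^sup>2"
  have "\<tau> * \<tau>' * (cov v v')\<^sup>2 \<le> \<tau> * \<tau>' * (cov v v * cov v' v')"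
    using \<tau> cov_Cauchy_Schwarz[OF v v'] by (intro mult_left_mono) auto
  moreover have "0 \<le> \<tau> * cov v v" "0 \<le> \<tau>' * cov v' v'" using \<tau> cov_nonneg by auto
  ultimately have pos: "?D > 0" by (simp add: algebra_simps)
  let ?g = "\<lambda>i x. exp (- (\<tau> * (v x)\<^sup>2 / 2)) * exp (- (\<tau>' * (v' x)\<^sup>2 / 2))"
  have [measurable]: "v \<in> borel_measurable (Pi\<^sub>M UNIV (\<lambda>_. borel))" "v' \<in> borel_measurable (Pi\<^sub>M UNIV (\<lambda>_. borel))"
    using v v' by (auto intro: linear_functionals_measurable)
  have vm [measurable]: "(\<lambda>\<omega>. v (coord i \<omega>)) \<in> borel_measurable M" "(\<lambda>\<omega>. v' (coord i \<omega>)) \<in> borel_measurable M" for i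
    using v v' by (auto intro: coord_functional_measurable)
  have "(\<integral>\<omega>. exp (- (\<tau> * half_sqnorm v \<omega>)) * exp (- (\<tau>' * half_sqnorm v' \<omega>)) \<partial>M) =
      (\<integral>\<omega>. (\<Prod>i\<in>UNIV. ?g i (coord i \<omega>)) \<partial>M)"
    unfolding exp_half_sqnorm_prod by (simp add: prod.distrib)
  also have "\<dots> = (\<Prod>i\<in>(UNIV :: 'd set). \<integral>\<omega>. ?g i (coord i \<omega>) \<partial>M)"
    by (rule integral_prod_coords, measurable)
      (rule integrable_const_bound[where B = 1], use \<tau> in \<open>auto simp: mult_le_one\<close>)
  also have "\<dots> = (\<Prod>i\<in>(UNIV :: 'd set). 1 / sqrt ?D)"
    by (intro prod.cong refl gaussian_pair_damped_twice[OF vm coord_pair_char[OF v v'] cov_nonneg cov_nonneg cov_Cauchy_Schwarz[OF v v'] \<tau>])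
  also have "\<dots> = (1 / sqrt ?D) ^ CARD('d)" by simp
  also have "\<dots> = ?D powr (- (real CARD('d) / 2))" by (rule powr_neg_half_dim[OF pos])
  finally show ?thesis .
qed

end

section \<open>Laguerre polynomials of Gaussian vectors\<close>

lemma laguerre_zero: "m > 0 \<Longrightarrow> laguerre a m 0 0 = 0"
  unfolding laguerre_def by (intro sum.neutral ballI) (auto simp: power_0_left)

lemma laguerre_0: "laguerre a 0 s u = 1"
  by (simp add: laguerre_def)

lemma powr_neg_add_nat:
  assumes "T > 0" shows "T powr (- (a + real l)) = (1 / T) ^ l * T powr (- a)"
proof -
  have "- (a + real l) = - a - real l" by simp
  then show ?thesis
    using assms by (simp only: powr_diff powr_realpow) (simp add: power_one_over)
qed

text \<open>
  In this form powers of the damped variance expand into the Gamma terms with shapes \<open>a + j\<close>.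
\<close>

lemma affine_in_inverse:
  fixes s :: real
  assumes "s > 0" "1 + \<tau> * s > 0"
  shows "w - \<tau> * C / (1 + \<tau> * s) = (C / s) * (1 / (1 + \<tau> * s)) + (w - C / s)"
proof -
  define D T where "D = C / s" and "T = 1 + \<tau> * s"
  have C: "C = s * D" using assms by (simp add: D_def)
  have "D * (1 / T) + \<tau> * (s * D) / T = D * T / T"
    unfolding T_def by (simp add: algebra_simps add_divide_distrib)
  also have "\<dots> = D" using assms by (simp add: T_def)
  finally show ?thesis unfolding T_def[symmetric] D_def[symmetric] C by simp
qed

context gaussian_copies
begin

lemma sum_functionals_finite_moments:
  "(\<And>i. y i \<in> linear_functionals) \<Longrightarrow> finite_moments M (\<lambda>\<omega>. \<Sum>i\<in>UNIV. y i (coord i \<omega>))"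
  by (intro finite_moments_sum functional_finite_moments)

lemma exp_half_sqnorm_finite_moments:
  assumes v: "v \<in> linear_functionals" and "\<tau> \<ge> 0"
  shows "finite_moments M (\<lambda>\<omega>. exp (- (\<tau> * half_sqnorm v \<omega>)))"
proof (rule finite_moments_bounded[where B = 1])
  have [measurable]: "half_sqnorm v \<in> borel_measurable M" using v by (rule half_sqnorm_measurable)
  show "(\<lambda>\<omega>. exp (- (\<tau> * half_sqnorm v \<omega>))) \<in> borel_measurable M" by measurable
qed (use assms half_sqnorm_nonneg in auto)

text \<open>
  Under the probability measure with density proportional to \<open>exp (- \<tau> U)\<close>, where \<open>U\<close> is half
  the squared norm of a Gaussian vector, the variable \<open>Y\<close> is still Gaussian, but with the smaller
  variance \<open>\<kappa>\<close>. This determines its damped moments.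
\<close>

lemma damped_moments:
  fixes v y \<tau>
  assumes v: "v \<in> linear_functionals" and y: "\<And>i. y i \<in> linear_functionals" and \<tau>: "\<tau> \<ge> 0"
  defines "Y \<equiv> \<lambda>\<omega>. \<Sum>i\<in>UNIV. y i (coord i \<omega>)"
  defines "\<kappa> \<equiv> (\<Sum>i\<in>UNIV. cov (y i) (y i)) - \<tau> * (\<Sum>i\<in>UNIV. (cov v (y i))\<^sup>2) / (1 + \<tau> * cov v v)"
  shows "(\<integral>\<omega>. Y \<omega> ^ (2 * k) * exp (- (\<tau> * half_sqnorm v \<omega>)) \<partial>M) =
      fact (2 * k) / (2 ^ k * fact k) * \<kappa> ^ k * (1 + \<tau> * cov v v) powr (- (real CARD('d) / 2))"
    and "(\<integral>\<omega>. Y \<omega> ^ (2 * k + 1) * exp (- (\<tau> * half_sqnorm v \<omega>)) \<partial>M) = 0"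
proof -
  let ?Z = "(1 + \<tau> * cov v v) powr (- (real CARD('d) / 2))"
  let ?D = "\<lambda>\<omega>. exp (- (\<tau> * half_sqnorm v \<omega>))"
  have pos: "1 + \<tau> * cov v v > 0" using \<tau> cov_nonneg[of v] by (simp add: add_pos_nonneg)
  then have Z: "?Z > 0" by simp
  have [measurable]: "half_sqnorm v \<in> borel_measurable M" using v by (rule half_sqnorm_measurable)
  have Yfm: "finite_moments M Y" unfolding Y_def by (rule sum_functionals_finite_moments[OF y])
  then have [measurable]: "Y \<in> borel_measurable M" by (rule finite_moments_measurable)
  have Dfm: "finite_moments M ?D" by (rule exp_half_sqnorm_finite_moments[OF v \<tau>])
  have char: "(CLINT \<omega>|M. of_real (?D \<omega>) * iexp (\<theta> * Y \<omega>)) = of_real (?Z * exp (- (\<theta>\<^sup>2 * \<kappa> / 2)))" for \<theta>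
    unfolding Y_def \<kappa>_def by (rule damped_char[OF v y \<tau>])
  have "complex_of_real (\<integral>\<omega>. ?D \<omega> \<partial>M) = of_real ?Z"
    using char[of 0] by simp
  then have DZ: "(\<integral>\<omega>. ?D \<omega> \<partial>M) = ?Z" by (simp only: of_real_eq_iff)
  \<comment> \<open>the damped probability measure, under which \<open>Y\<close> has variance \<open>\<kappa>\<close>\<close>
  define N where "N = density M (\<lambda>\<omega>. ennreal (?D \<omega> / ?Z))"
  have dens: "(\<integral>\<omega>. f \<omega> \<partial>N) = (\<integral>\<omega>. (?D \<omega> / ?Z) *\<^sub>R f \<omega> \<partial>M)"
    if "f \<in> borel_measurable M" for f :: "'w \<Rightarrow> 'b :: {banach, second_countable_topology}"
    unfolding N_def using that Z by (intro integral_density) auto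
  have "emeasure N (space N) = (\<integral>\<^sup>+\<omega>. ennreal (?D \<omega> / ?Z) \<partial>M)"
    unfolding N_def by (simp add: emeasure_density cong: nn_integral_cong)
  also have "\<dots> = ennreal (\<integral>\<omega>. ?D \<omega> / ?Z \<partial>M)"
    using Z finite_moments_integrable[OF Dfm] by (intro nn_integral_eq_integral) auto
  also have "\<dots> = 1" using Z by (simp add: DZ)
  finally interpret N: prob_space N by (rule prob_spaceI)
  have YN: "Y \<in> borel_measurable N" unfolding N_def by simp
  have charN: "(CLINT \<omega>|N. iexp (\<theta> * Y \<omega>)) = of_real (exp (- (\<theta>\<^sup>2 * \<kappa> / 2)))" for \<theta>
  proof -
    have "(CLINT \<omega>|N. iexp (\<theta> * Y \<omega>)) = (CLINT \<omega>|M. (?D \<omega> / ?Z) *\<^sub>R iexp (\<theta> * Y \<omega>))"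
      by (rule dens) measurable
    also have "\<dots> = (CLINT \<omega>|M. of_real (?D \<omega>) * iexp (\<theta> * Y \<omega>)) / of_real ?Z"
      unfolding integral_divide_zero[symmetric] by (simp add: scaleR_conv_of_real)
    also have "\<dots> = of_real (exp (- (\<theta>\<^sup>2 * \<kappa> / 2)))"
      unfolding char using Z by simp
    finally show ?thesis .
  qed
  have "\<kappa> \<ge> 0"
  proof -
    have "(\<Sum>i\<in>UNIV. (cov v (y i))\<^sup>2) \<le> (\<Sum>i\<in>UNIV. cov v v * cov (y i) (y i))"
      by (intro sum_mono cov_Cauchy_Schwarz v y)
    then have "\<tau> * (\<Sum>i\<in>UNIV. (cov v (y i))\<^sup>2) \<le> \<tau> * (cov v v * (\<Sum>i\<in>UNIV. cov (y i) (y i)))"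
      using \<tau> by (intro mult_left_mono) (auto simp: sum_distrib_left)
    also have "\<dots> \<le> (1 + \<tau> * cov v v) * (\<Sum>i\<in>UNIV. cov (y i) (y i))"
      using sum_nonneg[of UNIV "\<lambda>i. cov (y i) (y i)"] cov_nonneg by (simp add: algebra_simps)
    finally show ?thesis unfolding \<kappa>_def using pos by (simp add: pos_divide_le_eq mult.commute)
  qed
  note mom = N.gaussian_moments[OF YN this charN]
  have shift: "(\<integral>\<omega>. Y \<omega> ^ j * ?D \<omega> \<partial>M) = ?Z * (\<integral>\<omega>. Y \<omega> ^ j \<partial>N)" for j
  proof -
    have "(\<integral>\<omega>. Y \<omega> ^ j \<partial>N) = (\<integral>\<omega>. (Y \<omega> ^ j * ?D \<omega>) / ?Z \<partial>M)"
      by (subst dens) (auto simp: mult.commute)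
    then show ?thesis using Z by simp
  qed
  show "(\<integral>\<omega>. Y \<omega> ^ (2 * k) * ?D \<omega> \<partial>M) = fact (2 * k) / (2 ^ k * fact k) * \<kappa> ^ k * ?Z"
    unfolding shift mom(2) by simp
  show "(\<integral>\<omega>. Y \<omega> ^ (2 * k + 1) * ?D \<omega> \<partial>M) = 0"
    unfolding shift mom(3) by simp
qed

text \<open>
  Degenerate increments occur, for instance those over pairs on the diagonal of the cube.
\<close>

lemma half_sqnorm_eq_0_AE:
  assumes v: "v \<in> linear_functionals" and "cov v v = 0"
  shows "AE \<omega> in M. half_sqnorm v \<omega> = 0"
proof -
  have fm: "finite_moments M (\<lambda>\<omega>. v (coord i \<omega>))" for i by (rule functional_finite_moments[OF v])
  have "AE \<omega> in M. v (coord i \<omega>) = 0" for i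
  proof -
    have "(\<integral>\<omega>. (v (coord i \<omega>))\<^sup>2 \<partial>M) = cov v v"
    proof -
      have "(\<lambda>x. (v x)\<^sup>2) \<in> borel_measurable (Pi\<^sub>M UNIV (\<lambda>_. borel))"
        by (intro borel_measurable_power linear_functionals_measurable v)
      from coord_integral[OF this, of i] show ?thesis by (simp add: cov_def power2_eq_square)
    qed
    then have "AE \<omega> in M. (v (coord i \<omega>))\<^sup>2 = 0"
      using assms(2) L2_square_integrable[OF finite_moments_L2[OF fm]]
      by (subst integral_nonneg_eq_0_iff_AE[symmetric]) auto
    then show ?thesis by simp
  qed
  then have "AE \<omega> in M. \<forall>i. v (coord i \<omega>) = 0" by (simp add: AE_all_countable)
  then show ?thesis by eventually_elim (simp add: half_sqnorm_def)
qed

lemma laguerre_finite_moments: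
  "v \<in> linear_functionals \<Longrightarrow> finite_moments M (\<lambda>\<omega>. laguerre a m s (half_sqnorm v \<omega>))"
  by (rule finite_moments_laguerre[OF prob_space_axioms half_sqnorm_finite_moments])

text \<open>
  By lemma \<open>damped_moments\<close> the Laplace transform of \<open>U\<close> weighted by \<open>Y\<^sup>k\<close> involves only the Gamma
  shapes \<open>a, ..., a + k div 2\<close>, and the Laguerre polynomial annihilates all shapes below \<open>a + m\<close>.
\<close>

lemma laguerre_orthogonal_power:
  assumes v: "v \<in> linear_functionals" and y: "\<And>i. y i \<in> linear_functionals" and k: "k < 2 * m"
  shows "(\<integral>\<omega>. (\<Sum>i\<in>UNIV. y i (coord i \<omega>)) ^ k * laguerre (real CARD('d) / 2) m (cov v v) (half_sqnorm v \<omega>) \<partial>M) = 0"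
proof (cases "cov v v = 0")
  case True
  have "AE \<omega> in M. (\<Sum>i\<in>UNIV. y i (coord i \<omega>)) ^ k * laguerre (real CARD('d) / 2) m (cov v v) (half_sqnorm v \<omega>) = 0"
    using half_sqnorm_eq_0_AE[OF v True] by eventually_elim (use k in \<open>simp add: laguerre_zero True\<close>)
  then show ?thesis by (rule integral_eq_zero_AE)
next
  case False
  let ?Y = "\<lambda>\<omega>. \<Sum>i\<in>UNIV. y i (coord i \<omega>)" and ?s = "cov v v" and ?a = "real CARD('d) / 2"
  let ?w = "\<Sum>i\<in>UNIV. cov (y i) (y i)" and ?C = "\<Sum>i\<in>UNIV. (cov v (y i))\<^sup>2"
  have s: "?s > 0" using False cov_nonneg[of v] by simp
  define j where "j = k div 2"
  define F :: real where "F = (if even k then fact k / (2 ^ j * fact j) else 0)"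
  define c where "c l = F * (real (j choose l) * (?C / ?s) ^ l * (?w - ?C / ?s) ^ (j - l))" for l
  have jm: "j < m" using k by (simp add: j_def)
  have Yfm: "finite_moments M ?Y" by (rule sum_functionals_finite_moments[OF y])
  have "(\<integral>\<omega>. ?Y \<omega> ^ k * laguerre ?a m ?s (half_sqnorm v \<omega>) \<partial>M) = ?s ^ m * c m * (-1) ^ m * fact m / pochhammer ?a m"
  proof (rule integral_laguerre_of_matching_scale)
    show "half_sqnorm v \<in> borel_measurable M" by (rule half_sqnorm_measurable[OF v])
    show "(\<lambda>\<omega>. ?Y \<omega> ^ k) \<in> borel_measurable M"
      by (rule finite_moments_measurable[OF finite_moments_power[OF Yfm]])
    show "integrable M (\<lambda>\<omega>. ?Y \<omega> ^ k * half_sqnorm v \<omega> ^ q)" for q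
      by (rule finite_moments_integrable[OF finite_moments_mult[OF finite_moments_power[OF Yfm]
            finite_moments_power[OF half_sqnorm_finite_moments[OF v]]]])
    fix \<tau> :: real assume \<tau>: "\<tau> > 0"
    let ?T = "1 + \<tau> * ?s"
    have T: "?T > 0" using \<tau> s by (simp add: add_pos_pos)
    note shape = powr_neg_add_nat[OF T, of ?a]
    have "(\<integral>\<omega>. ?Y \<omega> ^ k * exp (- (\<tau> * half_sqnorm v \<omega>)) \<partial>M) = F * (?w - \<tau> * ?C / ?T) ^ j * ?T powr (- ?a)"
    proof (cases "even k")
      case True
      then have "k = 2 * j" by (simp add: j_def)
      then show ?thesis
        using damped_moments(1)[where v = v and y = y and \<tau> = \<tau> and k = j, OF v y] \<tau> by (simp add: F_def)
    next
      case False
      then have "k = 2 * j + 1" by (simp add: j_def)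
      then show ?thesis
        using damped_moments(2)[where v = v and y = y and \<tau> = \<tau> and k = j, OF v y] \<tau> False by (simp add: F_def)
    qed
    also have "?w - \<tau> * ?C / ?T = (?C / ?s) * (1 / ?T) + (?w - ?C / ?s)"
      by (rule affine_in_inverse[OF s T])
    also have "(\<dots>) ^ j = (\<Sum>l\<le>j. real (j choose l) * ((?C / ?s) * (1 / ?T)) ^ l * (?w - ?C / ?s) ^ (j - l))"
      by (rule binomial_ring)
    also have "F * \<dots> * ?T powr (- ?a) = (\<Sum>l\<le>j. c l * ?T powr (- (?a + real l)))"
      unfolding shape c_def sum_distrib_left sum_distrib_right power_mult_distrib
      by (intro sum.cong refl) (simp only: mult_ac)
    also have "\<dots> = (\<Sum>l\<le>m. c l * ?T powr (- (?a + real l)))"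
      by (intro sum.mono_neutral_left) (use jm in \<open>auto simp: c_def\<close>)
    finally show "(\<integral>\<omega>. ?Y \<omega> ^ k * exp (- (\<tau> * half_sqnorm v \<omega>)) \<partial>M) = (\<Sum>l\<le>m. c l * ?T powr (- (?a + real l)))" .
  qed (use half_sqnorm_nonneg s in auto)
  also have "c m = 0" using jm by (simp add: c_def)
  finally show ?thesis by simp
qed

text \<open>
  Damping in \<open>v'\<close> leaves a Laplace transform in \<open>v\<close> of Gamma type, of the same shape but of the
  smaller scale \<open>\<kappa> = s - \<tau> r\<^sup>2 / (1 + \<tau> s')\<close>, and the integral is proportional to \<open>(s - \<kappa>)\<^sup>m\<close>.
\<close>

lemma damped_laguerre:
  assumes v: "v \<in> linear_functionals" and v': "v' \<in> linear_functionals" and \<tau>: "\<tau> \<ge> 0"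
  shows "(\<integral>\<omega>. exp (- (\<tau> * half_sqnorm v' \<omega>)) * laguerre (real CARD('d) / 2) m (cov v v) (half_sqnorm v \<omega>) \<partial>M) =
    (1 + \<tau> * cov v' v') powr (- (real CARD('d) / 2)) * (\<tau> * (cov v v')\<^sup>2 / (1 + \<tau> * cov v' v')) ^ m"
proof -
  let ?s = "cov v v" and ?s' = "cov v' v'" and ?r = "cov v v'" and ?a = "real CARD('d) / 2"
  let ?T = "1 + \<tau> * ?s'"
  have T: "?T > 0" using \<tau> cov_nonneg[of v'] by (simp add: add_pos_nonneg)
  define \<kappa> where "\<kappa> = ?s - \<tau> * ?r\<^sup>2 / ?T"
  have "\<tau> * ?r\<^sup>2 \<le> \<tau> * (?s * ?s')"
    using \<tau> cov_Cauchy_Schwarz[OF v v'] by (intro mult_left_mono) auto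
  also have "\<dots> \<le> ?s * ?T" using cov_nonneg[of v] by (simp add: algebra_simps)
  finally have \<kappa>: "\<kappa> \<ge> 0" unfolding \<kappa>_def using T by (simp add: pos_divide_le_eq)
  have Dfm: "finite_moments M (\<lambda>\<omega>. exp (- (\<tau> * half_sqnorm v' \<omega>)))"
    by (rule exp_half_sqnorm_finite_moments[OF v' \<tau>])
  have "(\<integral>\<omega>. exp (- (\<tau> * half_sqnorm v' \<omega>)) * laguerre ?a m ?s (half_sqnorm v \<omega>) \<partial>M) = ?T powr (- ?a) * (?s - \<kappa>) ^ m"
  proof (rule integral_laguerre_of_rescaled_gamma)
    show "half_sqnorm v \<in> borel_measurable M" by (rule half_sqnorm_measurable[OF v])
    show "(\<lambda>\<omega>. exp (- (\<tau> * half_sqnorm v' \<omega>))) \<in> borel_measurable M"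
      by (rule finite_moments_measurable[OF Dfm])
    show "integrable M (\<lambda>\<omega>. exp (- (\<tau> * half_sqnorm v' \<omega>)) * half_sqnorm v \<omega> ^ q)" for q
      by (rule finite_moments_integrable[OF finite_moments_mult[OF Dfm
            finite_moments_power[OF half_sqnorm_finite_moments[OF v]]]])
    fix u :: real assume u: "u > 0"
    have "(1 + \<tau> * ?s') * (1 + u * ?s) - \<tau> * u * ?r\<^sup>2 = ?T * (1 + u * \<kappa>)"
      unfolding \<kappa>_def using T by (simp add: field_simps)
    then show "(\<integral>\<omega>. exp (- (\<tau> * half_sqnorm v' \<omega>)) * exp (- (u * half_sqnorm v \<omega>)) \<partial>M) = ?T powr (- ?a) * (1 + u * \<kappa>) powr (- ?a)"
      using damped_twice[OF v' v \<tau>, of u] u T \<kappa> by (simp add: cov_commute[of v' v] powr_mult)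
  qed (use half_sqnorm_nonneg \<kappa> in auto)
  then show ?thesis by (simp add: \<kappa>_def)
qed

text \<open>
  Lemma \<open>damped_laguerre\<close> is the Laplace transform in \<open>v'\<close> of the first polynomial. Expanded in powers
  of \<open>1 / (1 + \<tau> s')\<close> it is a combination of Gamma terms with shapes up to \<open>a + m\<close>, of which the second
  polynomial selects the last.
\<close>

lemma laguerre_inner:
  assumes v: "v \<in> linear_functionals" and v': "v' \<in> linear_functionals"
  shows "(\<integral>\<omega>. laguerre (real CARD('d) / 2) m (cov v v) (half_sqnorm v \<omega>) *
      laguerre (real CARD('d) / 2) m (cov v' v') (half_sqnorm v' \<omega>) \<partial>M) =
    (cov v v') ^ (2 * m) * fact m / pochhammer (real CARD('d) / 2) m"
proof (cases "cov v' v' = 0")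
  case True
  then have r: "cov v v' = 0" using cov_Cauchy_Schwarz[OF v v'] by simp
  show ?thesis
  proof (cases "m = 0")
    case True
    then show ?thesis by (simp add: laguerre_0 prob_space)
  next
    case False
    have "AE \<omega> in M. laguerre (real CARD('d) / 2) m (cov v v) (half_sqnorm v \<omega>) *
      laguerre (real CARD('d) / 2) m (cov v' v') (half_sqnorm v' \<omega>) = 0"
      using half_sqnorm_eq_0_AE[OF v' True] by eventually_elim (use False in \<open>simp add: laguerre_zero True\<close>)
    then have "(\<integral>\<omega>. laguerre (real CARD('d) / 2) m (cov v v) (half_sqnorm v \<omega>) *
      laguerre (real CARD('d) / 2) m (cov v' v') (half_sqnorm v' \<omega>) \<partial>M) = 0"
      by (rule integral_eq_zero_AE)
    then show ?thesis using False r by simp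
  qed
next
  case False
  let ?s = "cov v v" and ?s' = "cov v' v'" and ?r = "cov v v'" and ?a = "real CARD('d) / 2"
  let ?L = "\<lambda>\<omega>. laguerre ?a m ?s (half_sqnorm v \<omega>)"
  have s': "?s' > 0" using False cov_nonneg[of v'] by simp
  define c where "c l = (?r\<^sup>2 / ?s') ^ m * ((-1) ^ l * real (m choose l))" for l
  have Lfm: "finite_moments M ?L" by (rule laguerre_finite_moments[OF v])
  have "(\<integral>\<omega>. ?L \<omega> * laguerre ?a m ?s' (half_sqnorm v' \<omega>) \<partial>M) = ?s' ^ m * c m * (-1) ^ m * fact m / pochhammer ?a m"
  proof (rule integral_laguerre_of_matching_scale)
    show "half_sqnorm v' \<in> borel_measurable M" by (rule half_sqnorm_measurable[OF v'])
    show "?L \<in> borel_measurable M" by (rule finite_moments_measurable[OF Lfm])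
    show "integrable M (\<lambda>\<omega>. ?L \<omega> * half_sqnorm v' \<omega> ^ q)" for q
      by (rule finite_moments_integrable[OF finite_moments_mult[OF Lfm
            finite_moments_power[OF half_sqnorm_finite_moments[OF v']]]])
    fix \<tau> :: real assume \<tau>: "\<tau> > 0"
    let ?T = "1 + \<tau> * ?s'"
    have T: "?T > 0" using \<tau> s' by (simp add: add_pos_pos)
    note shape = powr_neg_add_nat[OF T, of ?a]
    have "(\<integral>\<omega>. ?L \<omega> * exp (- (\<tau> * half_sqnorm v' \<omega>)) \<partial>M) = ?T powr (- ?a) * (\<tau> * ?r\<^sup>2 / ?T) ^ m"
      using damped_laguerre[OF v v', of \<tau> m] \<tau> by (simp add: mult.commute)
    also have "\<tau> * ?r\<^sup>2 / ?T = (?r\<^sup>2 / ?s') * (- (1 / ?T) + 1)"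
      using s' T by (simp add: field_simps)
    also have "(\<dots>) ^ m = (?r\<^sup>2 / ?s') ^ m * (\<Sum>l\<le>m. real (m choose l) * (- (1 / ?T)) ^ l * 1 ^ (m - l))"
      by (simp only: power_mult_distrib binomial_ring)
    also have "?T powr (- ?a) * \<dots> = (\<Sum>l\<le>m. c l * ?T powr (- (?a + real l)))"
      unfolding shape c_def sum_distrib_left sum_distrib_right power_minus[of "1 / ?T"]
      by (intro sum.cong refl) (simp only: mult_ac power_one mult_1)
    finally show "(\<integral>\<omega>. ?L \<omega> * exp (- (\<tau> * half_sqnorm v' \<omega>)) \<partial>M) = (\<Sum>l\<le>m. c l * ?T powr (- (?a + real l)))" .
  qed (use half_sqnorm_nonneg s' in auto)
  also have "?s' ^ m * c m * (-1) ^ m = ?r ^ (2 * m)"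
  proof -
    have "?s' ^ m * (?r\<^sup>2 / ?s') ^ m = ?r ^ (2 * m)"
      unfolding power_mult_distrib[symmetric] power_mult using s' by simp
    moreover have "(-1 :: real) ^ m * (-1) ^ m = 1"
      unfolding power_mult_distrib[symmetric] by simp
    moreover have "?s' ^ m * c m * (-1) ^ m = (?s' ^ m * (?r\<^sup>2 / ?s') ^ m) * ((-1) ^ m * (-1) ^ m)"
      by (simp add: c_def)
    ultimately show ?thesis by simp
  qed
  finally show ?thesis .
qed

text \<open>
  Polarisation: a variable orthogonal to all powers \<open>Y\<^sup>k\<close>, \<open>k < n\<close>, of elements of the Gaussian space
  is orthogonal to all products of fewer than \<open>n\<close> such elements, because the expectation of
  \<open>(Y + \<theta> Z)\<^sup>k\<close> against it is a polynomial in \<open>\<theta>\<close> that vanishes identically.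
\<close>

lemma polarization:
  fixes \<Lambda> :: "'w \<Rightarrow> real"
  defines "Y \<equiv> \<lambda>y \<omega>. \<Sum>i\<in>UNIV. y i (coord i \<omega>)"
  assumes \<Lambda>: "finite_moments M \<Lambda>"
    and orth: "\<And>y k. (\<And>i. y i \<in> linear_functionals) \<Longrightarrow> k < n \<Longrightarrow> (\<integral>\<omega>. Y y \<omega> ^ k * \<Lambda> \<omega> \<partial>M) = 0"
  shows "\<lbrakk>\<And>i. y i \<in> linear_functionals; \<And>z i. z \<in> set zs \<Longrightarrow> z i \<in> linear_functionals; k + length zs < n\<rbrakk>
    \<Longrightarrow> (\<integral>\<omega>. Y y \<omega> ^ k * ((\<Prod>z\<leftarrow>zs. Y z \<omega>) * \<Lambda> \<omega>) \<partial>M) = 0"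
proof (induction zs arbitrary: y k)
  case Nil
  then show ?case using orth[of y k] by simp
next
  case (Cons z zs)
  have z: "\<And>i. z i \<in> linear_functionals" and y: "\<And>i. y i \<in> linear_functionals"
    using Cons.prems by auto
  have Yfm: "finite_moments M (Y u)" if "\<And>i. u i \<in> linear_functionals" for u
    unfolding Y_def using that by (rule sum_functionals_finite_moments)
  have "finite_moments M (\<lambda>\<omega>. \<Prod>u\<leftarrow>us. Y u \<omega>)" if "set us \<subseteq> set zs" for us
    using that
  proof (induction us)
    case Nil
    then show ?case by (simp add: finite_moments_const)
  next
    case (Cons u us)
    then have "finite_moments M (Y u)" using Cons.prems \<open>\<And>z i. z \<in> set (_ # zs) \<Longrightarrow> z i \<in> linear_functionals\<close> by (intro Yfm) auto
    then show ?case using Cons by (simp add: finite_moments_mult)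
  qed
  from finite_moments_mult[OF this[of zs] \<Lambda>]
  have P: "finite_moments M (\<lambda>\<omega>. (\<Prod>z\<leftarrow>zs. Y z \<omega>) * \<Lambda> \<omega>)" by simp
  let ?P = "\<lambda>\<omega>. (\<Prod>z\<leftarrow>zs. Y z \<omega>) * \<Lambda> \<omega>"
  let ?I = "\<lambda>i. \<integral>\<omega>. Y z \<omega> ^ i * (Y y \<omega> ^ (Suc k - i) * ?P \<omega>) \<partial>M"
  have int: "integrable M (\<lambda>\<omega>. Y z \<omega> ^ i * (Y y \<omega> ^ j * ?P \<omega>))" for i j
    by (rule finite_moments_integrable[OF finite_moments_mult[OF finite_moments_power[OF Yfm[OF z]]
          finite_moments_mult[OF finite_moments_power[OF Yfm[OF y]] P]]])
  have "(\<Sum>i\<le>Suc k. (real (Suc k choose i) * ?I i) * \<theta> ^ i) = 0" for \<theta>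
  proof -
    let ?u = "\<lambda>i x. 1 * y i x + \<theta> * z i x"
    have u: "?u i \<in> linear_functionals" for i by (rule linear_functionals_combination[OF y z])
    have "0 = (\<integral>\<omega>. Y ?u \<omega> ^ Suc k * ?P \<omega> \<partial>M)"
      using Cons.prems u by (intro Cons.IH[symmetric]) auto
    also have "\<dots> = (\<integral>\<omega>. (\<Sum>i\<le>Suc k. (real (Suc k choose i) * \<theta> ^ i) * (Y z \<omega> ^ i * (Y y \<omega> ^ (Suc k - i) * ?P \<omega>))) \<partial>M)"
    proof (rule Bochner_Integration.integral_cong[OF refl])
      fix \<omega>
      have "Y ?u \<omega> = \<theta> * Y z \<omega> + Y y \<omega>"
        by (simp add: Y_def sum.distrib sum_distrib_left)
      then have "Y ?u \<omega> ^ Suc k = (\<Sum>i\<le>Suc k. real (Suc k choose i) * (\<theta> * Y z \<omega>) ^ i * Y y \<omega> ^ (Suc k - i))"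
        by (simp only: binomial_ring)
      then show "Y ?u \<omega> ^ Suc k * ?P \<omega> = (\<Sum>i\<le>Suc k. (real (Suc k choose i) * \<theta> ^ i) * (Y z \<omega> ^ i * (Y y \<omega> ^ (Suc k - i) * ?P \<omega>)))"
        by (simp only: sum_distrib_right sum_distrib_left power_mult_distrib mult_ac)
    qed
    also have "\<dots> = (\<Sum>i\<le>Suc k. (real (Suc k choose i) * \<theta> ^ i) * ?I i)"
      by (subst Bochner_Integration.integral_sum) (simp_all only: integrable_mult_right int integral_mult_right_zero)
    finally show ?thesis by (simp only: mult_ac)
  qed
  then have "\<forall>i\<le>Suc k. real (Suc k choose i) * ?I i = 0"
    by (subst polyfun_eq_0[symmetric]) blast
  \<comment> \<open>the coefficient of \<open>\<theta>\<close> is the integral with one more factor \<open>Y z\<close>\<close>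
  then have "real (Suc k choose 1) * ?I 1 = 0" by (rule allE[of _ 1]) simp
  then have "?I 1 = 0" by simp
  then show ?case by (simp add: mult_ac)
qed

lemma field_polynomials_finite_moments:
  assumes "G \<in> field_polynomials X n"
  shows "finite_moments M G"
proof -
  obtain S a where G: "G = (\<lambda>\<omega>. \<Sum>m\<in>S. a m * (\<Prod>(t, i)\<in>#m. X t \<omega> $ i))"
    using assms unfolding field_polynomials_def by blast
  have "finite_moments M (\<lambda>\<omega>. \<Prod>(t, i)\<in>#m. X t \<omega> $ i)" for m
  proof (induction m)
    case empty
    then show ?case by (simp add: finite_moments_const)
  next
    case (add p m)
    obtain t i where p: "p = (t, i)" by force
    have "finite_moments M (\<lambda>\<omega>. X t \<omega> $ i)"
      using functional_finite_moments[OF linear_functionals_eval[of t], of i] by simp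
    from finite_moments_mult[OF this add] show ?case by (simp add: p)
  qed
  then show ?thesis unfolding G by (intro finite_moments_sum finite_moments_scale)
qed

text \<open>
  A monomial is a product of variables each of which depends on a single coordinate of the field, so
  lemma \<open>polarization\<close> applies to it.
\<close>

lemma laguerre_orthogonal_field_polynomials:
  assumes v: "v \<in> linear_functionals" and G: "G \<in> field_polynomials X n" and n: "n < 2 * m"
  shows "(\<integral>\<omega>. laguerre (real CARD('d) / 2) m (cov v v) (half_sqnorm v \<omega>) * G \<omega> \<partial>M) = 0"
proof -
  let ?L = "\<lambda>\<omega>. laguerre (real CARD('d) / 2) m (cov v v) (half_sqnorm v \<omega>)"
  let ?mono = "\<lambda>q \<omega>. \<Prod>(t, i)\<in>#q. X t \<omega> $ i"
  have Lfm: "finite_moments M ?L" by (rule laguerre_finite_moments[OF v])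
  obtain S a where Ge: "G = (\<lambda>\<omega>. \<Sum>q\<in>S. a q * ?mono q \<omega>)" and S: "finite S" "\<forall>q\<in>S. size q \<le> n"
    using G unfolding field_polynomials_def by blast
  let ?e = "\<lambda>(t, i) j. if j = i then (\<lambda>x :: 't \<Rightarrow> real. x t) else (\<lambda>x. 0)"
  have e: "?e p j \<in> linear_functionals" for p j
    by (cases p) (simp only: prod.case linear_functionals_eval linear_functionals_zero split: if_split, simp)
  have eY: "(\<Sum>j\<in>UNIV. ?e (t, i) j (coord j \<omega>)) = X t \<omega> $ i" for t i \<omega>
  proof -
    have "(\<Sum>j\<in>UNIV. ?e (t, i) j (coord j \<omega>)) = (\<Sum>j\<in>UNIV. if j = i then X t \<omega> $ j else 0)"
      by (intro sum.cong refl) simp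
    then show ?thesis by simp
  qed
  have mono: "(\<integral>\<omega>. ?mono q \<omega> * ?L \<omega> \<partial>M) = 0" if "size q < 2 * m" for q
  proof -
    obtain ps where ps: "q = mset ps" using ex_mset by metis
    have "(\<integral>\<omega>. (\<Sum>i\<in>UNIV. (\<lambda>i x. 0) i (coord i \<omega>)) ^ 0 * ((\<Prod>z\<leftarrow>map ?e ps. \<Sum>i\<in>UNIV. z i (coord i \<omega>)) * ?L \<omega>) \<partial>M) = 0"
    proof (rule polarization[where \<Lambda> = ?L and n = "2 * m" and y = "\<lambda>i x. 0" and k = 0 and zs = "map ?e ps", OF Lfm])
      show "(\<integral>\<omega>. (\<Sum>i\<in>UNIV. y i (coord i \<omega>)) ^ k * ?L \<omega> \<partial>M) = 0"
        if "\<And>i. y i \<in> linear_functionals" "k < 2 * m" for y k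
        by (rule laguerre_orthogonal_power[OF v that])
      show "z i \<in> linear_functionals" if "z \<in> set (map ?e ps)" for z i
        using that by (auto simp: linear_functionals_eval linear_functionals_zero)
      show "0 + length (map ?e ps) < 2 * m" using \<open>size q < 2 * m\<close> by (simp add: ps)
    qed (rule linear_functionals_zero)
    moreover have "(\<Prod>z\<leftarrow>map ?e ps. \<Sum>i\<in>UNIV. z i (coord i \<omega>)) = ?mono q \<omega>" for \<omega>
    proof -
      have "(\<Prod>z\<leftarrow>map ?e ps. \<Sum>i\<in>UNIV. z i (coord i \<omega>)) = (\<Prod>p\<leftarrow>ps. \<Sum>i\<in>UNIV. ?e p i (coord i \<omega>))"
        by (simp add: o_def)
      also have "\<dots> = (\<Prod>(t, i)\<leftarrow>ps. X t \<omega> $ i)"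
        by (rule arg_cong[where f = prod_list], rule map_cong[OF refl]) (use eY in \<open>auto simp: split_beta'\<close>)
      also have "\<dots> = ?mono q \<omega>" by (simp add: ps prod_mset_prod_list[symmetric])
      finally show ?thesis .
    qed
    ultimately show ?thesis by simp
  qed
  have mfm: "finite_moments M (?mono q)" for q
  proof -
    have "(\<lambda>\<omega>. \<Sum>m\<in>{q}. (\<lambda>_. 1) m * ?mono m \<omega>) \<in> field_polynomials X (size q)"
      unfolding field_polynomials_def by (intro CollectI exI[of _ "{q}"] exI[of _ "\<lambda>_. 1"]) auto
    from field_polynomials_finite_moments[OF this] show ?thesis by simp
  qed
  have "(\<integral>\<omega>. ?L \<omega> * G \<omega> \<partial>M) = (\<integral>\<omega>. (\<Sum>q\<in>S. a q * (?mono q \<omega> * ?L \<omega>)) \<partial>M)"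
    unfolding Ge by (intro Bochner_Integration.integral_cong refl) (simp only: sum_distrib_left sum_distrib_right mult_ac)
  also have "\<dots> = (\<Sum>q\<in>S. a q * (\<integral>\<omega>. ?mono q \<omega> * ?L \<omega> \<partial>M))"
    using finite_moments_integrable[OF finite_moments_mult[OF mfm Lfm]]
    by (subst Bochner_Integration.integral_sum) auto
  also have "\<dots> = 0" using S n by (intro sum.neutral ballI) (auto intro!: mono)
  finally show ?thesis .
qed

end

section \<open>Integrals of negative powers and anisotropic distances\<close>

text \<open>
  Sublevel sets of measure \<open>O (u\<^sup>p)\<close> of \<open>\<phi>\<close> make \<open>\<phi>\<^sup>-\<^sup>q\<close> integrable for \<open>q < p\<close>: on the dyadic shell
  \<open>\<phi> \<approx> 2\<^sup>-\<^sup>k\<close> the integral is of order \<open>2\<^sup>(\<^sup>q\<^sup>-\<^sup>p\<^sup>)\<^sup>k\<close>. The bound is explicit, hence uniform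
  in \<open>\<phi>\<close> and in the regularisation \<open>\<eta>\<close>.
\<close>

lemma nn_integral_negative_power_le:
  fixes \<phi> :: "'a \<Rightarrow> real"
  assumes [measurable]: "\<phi> \<in> borel_measurable N" and \<phi>: "\<And>x. \<phi> x \<ge> 0"
    and total: "emeasure N (space N) \<le> 1"
    and sub: "\<And>u. u > 0 \<Longrightarrow> emeasure N {x\<in>space N. \<phi> x \<le> u} \<le> ennreal (C * u powr p)"
    and C: "C \<ge> 0" and q: "0 \<le> q" "q < p" and \<eta>: "\<eta> > 0"
  shows "(\<integral>\<^sup>+x. ennreal ((\<eta> + \<phi> x) powr (- q)) \<partial>N) \<le> ennreal (1 + C * 2 powr q / (1 - 2 powr (q - p)))"
proof -
  let ?A = "\<lambda>k. {x\<in>space N. \<phi> x \<le> 2 powr (- real k)}"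
  let ?w = "\<lambda>k. 2 powr (real (Suc k) * q)"
  have pt: "ennreal ((\<eta> + \<phi> x) powr (- q)) \<le> 1 + (\<Sum>k. ennreal (?w k) * indicator (?A k) x)" if x: "x \<in> space N" for x
  proof (cases "\<eta> + \<phi> x \<ge> 1")
    case True
    then have "(\<eta> + \<phi> x) powr (- q) \<le> 1"
      using q powr_mono2'[of "- q" 1 "\<eta> + \<phi> x"] by simp
    then have "ennreal ((\<eta> + \<phi> x) powr (- q)) \<le> 1" by simp
    then show ?thesis by (rule order_trans) simp
  next
    case False
    define y where "y = \<eta> + \<phi> x"
    have y: "0 < y" "y < 1" using False \<phi>[of x] \<eta> by (auto simp: y_def)
    \<comment> \<open>the dyadic shell that contains \<open>x\<close>\<close>
    define k where "k = nat \<lfloor>- log 2 y\<rfloor>"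
    have "- log 2 y > 0" using y by simp
    then have k: "real k \<le> - log 2 y" "- log 2 y < real (Suc k)"
      unfolding k_def by linarith+
    have "2 powr (- real (Suc k)) \<le> 2 powr (log 2 y)" using k by (intro powr_mono) auto
    then have ylow: "2 powr (- real (Suc k)) \<le> y" using y by simp
    have "2 powr (log 2 y) \<le> 2 powr (- real k)" using k by (intro powr_mono) auto
    then have "y \<le> 2 powr (- real k)" using y by simp
    then have "\<phi> x \<le> 2 powr (- real k)" using \<eta> by (simp add: y_def)
    then have xA: "x \<in> ?A k" using x by simp
    have "y powr (- q) \<le> (2 powr (- real (Suc k))) powr (- q)"
      using ylow q by (intro powr_mono2') auto
    also have "(2 powr (- real (Suc k))) powr (- q) = ?w k" by (simp add: powr_powr algebra_simps)
    finally have "ennreal (y powr (- q)) \<le> ennreal (?w k) * indicator (?A k) x"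
      using xA by (simp add: ennreal_leI)
    also have "\<dots> \<le> (\<Sum>k. ennreal (?w k) * indicator (?A k) x)"
    proof -
      have "f k \<le> (\<Sum>k. f k)" for f :: "nat \<Rightarrow> ennreal"
        using sum_le_suminf[of f "{k}"] by simp
      then show ?thesis .
    qed
    finally show ?thesis unfolding y_def by (rule order_trans) simp
  qed
  have "(\<integral>\<^sup>+x. ennreal ((\<eta> + \<phi> x) powr (- q)) \<partial>N) \<le> (\<integral>\<^sup>+x. 1 + (\<Sum>k. ennreal (?w k) * indicator (?A k) x) \<partial>N)"
    by (rule nn_integral_mono) (rule pt)
  also have "\<dots> = emeasure N (space N) + (\<Sum>k. ennreal (?w k) * emeasure N (?A k))"
    by (subst nn_integral_add) (auto simp: nn_integral_suminf nn_integral_cmult_indicator)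
  also have "\<dots> \<le> 1 + (\<Sum>k. ennreal (C * 2 powr q * (2 powr (q - p)) ^ k))"
  proof (intro add_mono total suminf_le summableI)
    fix k
    have "ennreal (?w k) * emeasure N (?A k) \<le> ennreal (?w k) * ennreal (C * (2 powr (- real k)) powr p)"
      by (intro mult_left_mono sub) auto
    also have "\<dots> = ennreal (C * (?w k * (2 powr (- real k)) powr p))"
      using C by (simp add: ennreal_mult[symmetric] mult_ac)
    also have "?w k * (2 powr (- real k)) powr p = 2 powr q * (2 powr (q - p)) ^ k"
      by (simp add: powr_powr powr_realpow[symmetric] powr_add[symmetric] algebra_simps)
    finally show "ennreal (?w k) * emeasure N (?A k) \<le> ennreal (C * 2 powr q * (2 powr (q - p)) ^ k)"
      by (simp add: mult_ac)
  qed
  also have "(\<Sum>k. ennreal (C * 2 powr q * (2 powr (q - p)) ^ k)) = ennreal (\<Sum>k. C * 2 powr q * (2 powr (q - p)) ^ k)"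
    using q C by (intro suminf_ennreal2 summable_mult summable_geometric) (auto simp: powr_less_one)
  also have "(\<Sum>k. C * 2 powr q * (2 powr (q - p)) ^ k) = C * 2 powr q / (1 - 2 powr (q - p))"
    using q by (subst suminf_mult) (auto simp: suminf_geometric powr_less_one intro!: summable_geometric)
  also have "1 + ennreal (C * 2 powr q / (1 - 2 powr (q - p))) = ennreal (1 + C * 2 powr q / (1 - 2 powr (q - p)))"
  proof -
    have "2 powr (q - p) < 1" using q by (simp add: powr_less_one)
    then have "0 \<le> C * 2 powr q / (1 - 2 powr (q - p))" using C by simp
    then show ?thesis by (subst ennreal_plus) auto
  qed
  finally show ?thesis .
qed

text \<open>
  Conversely, sublevel sets of measure at least of order \<open>u\<^sup>p\<close> make the integral diverge as
  \<open>\<eta> \<rightarrow> 0\<close> when \<open>q \<ge> p\<close>: a geometric sum shows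
  \<open>\<Sum>\<^sub>k 2\<^sup>k\<^sup>q \<one>{\<phi> \<le> 2\<^sup>-\<^sup>k} = O ((2\<^sup>-\<^sup>K + \<phi>)\<^sup>-\<^sup>q)\<close> over \<open>k \<le> K\<close>, and every term on the left has integral
  bounded below.
\<close>

lemma nn_integral_negative_power_unbounded:
  fixes \<phi> :: "'a \<Rightarrow> real"
  assumes [measurable]: "\<phi> \<in> borel_measurable N" and \<phi>: "\<And>x. \<phi> x \<ge> 0"
    and sub: "\<And>u. 0 < u \<Longrightarrow> u \<le> u0 \<Longrightarrow> ennreal (c * u powr p) \<le> emeasure N {x\<in>space N. \<phi> x \<le> u}"
    and u0: "u0 > 0" and c: "c > 0" and q: "q > 0" "p \<le> q"
  shows "\<exists>\<eta>0>0. \<forall>\<eta>. 0 < \<eta> \<longrightarrow> \<eta> \<le> \<eta>0 \<longrightarrow> ennreal B < (\<integral>\<^sup>+x. ennreal ((\<eta> + \<phi> x) powr (- q)) \<partial>N)"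
proof -
  let ?A = "\<lambda>k. {x\<in>space N. \<phi> x \<le> 2 powr (- real k)}"
  define b where "b = 2 powr q"
  have b: "b > 1" using q by (simp add: b_def)
  \<comment> \<open>the constant of the geometric sum, with a further factor \<open>b\<close> for the doubling in \<open>\<eta>0 + \<phi> x \<le> 2 powr (1 - m)\<close>\<close>
  define D where "D = b\<^sup>2 / (b - 1)"
  have D: "D > 0" using b by (simp add: D_def)
  obtain k1 where k1: "(1/2) ^ k1 < u0" using real_arch_pow_inv[OF u0, of "1/2"] by auto
  define B' where "B' = max B 0 + 1"
  obtain n where n: "real n > D * B' / c" using reals_Archimedean2 by blast
  define K where "K = k1 + n"
  define \<eta>0 where "\<eta>0 = 2 powr (- real K)"
  have pw: "(2::real) powr (- real k) = (1/2) ^ k" for k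
    by (simp add: powr_minus powr_realpow power_one_over inverse_eq_divide)
  have le_u0: "2 powr (- real k) \<le> u0" if "k \<ge> k1" for k
  proof -
    have "(1/2 :: real) ^ k \<le> (1/2) ^ k1" using that by (intro power_decreasing) auto
    then show ?thesis unfolding pw using k1 by linarith
  qed
  have pt: "(\<Sum>k\<in>{k1..K}. ennreal (b ^ k) * indicator (?A k) x) \<le> ennreal (D * (\<eta>0 + \<phi> x) powr (- q))" if x: "x \<in> space N" for x
  proof -
    define S where "S = {k\<in>{k1..K}. \<phi> x \<le> 2 powr (- real k)}"
    have finS: "finite S" by (simp add: S_def)
    have "(\<Sum>k\<in>{k1..K}. ennreal (b ^ k) * indicator (?A k) x) = (\<Sum>k\<in>S. ennreal (b ^ k))"
      using x by (intro sum.mono_neutral_cong_right) (auto simp: S_def)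
    also have "\<dots> = ennreal (\<Sum>k\<in>S. b ^ k)" using b by (intro sum_ennreal) simp
    also have "(\<Sum>k\<in>S. b ^ k) \<le> D * (\<eta>0 + \<phi> x) powr (- q)"
    proof (cases "S = {}")
      case True
      then show ?thesis using D by simp
    next
      case False
      define m where "m = Max S"
      have mS: "m \<in> S" unfolding m_def using finS False by (rule Max_in)
      then have m: "m \<le> K" "\<phi> x \<le> 2 powr (- real m)" by (auto simp: S_def)
      have "(\<Sum>k\<in>S. b ^ k) \<le> (\<Sum>k<Suc m. b ^ k)"
        using b finS by (intro sum_mono2) (auto simp: m_def less_Suc_eq_le)
      also have "\<dots> = (b ^ Suc m - 1) / (b - 1)" using b by (intro geometric_sum) simp
      also have "\<dots> \<le> b ^ Suc m / (b - 1)" using b by (intro divide_right_mono) auto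
      also have "\<dots> = D * (b ^ m / b)" using b by (simp add: D_def power2_eq_square)
      also have "b ^ m / b \<le> (\<eta>0 + \<phi> x) powr (- q)"
      proof -
        have "\<eta>0 \<le> 2 powr (- real m)" unfolding \<eta>0_def using m by (intro powr_mono) auto
        then have "\<eta>0 + \<phi> x \<le> 2 powr (1 - real m)" using m by (simp add: powr_diff powr_minus_divide)
        moreover have "0 < \<eta>0 + \<phi> x" using \<phi>[of x] by (simp add: \<eta>0_def add_pos_nonneg)
        ultimately have "(2 powr (1 - real m)) powr (- q) \<le> (\<eta>0 + \<phi> x) powr (- q)"
          using q by (intro powr_mono2') auto
        moreover have "(2 powr (1 - real m)) powr (- q) = b ^ m / b"
        proof -
          have "b ^ m = 2 powr (q * real m)" by (simp add: b_def powr_realpow[symmetric] powr_powr)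
          then have "b ^ m / b = 2 powr (q * real m - q)" by (simp add: b_def powr_diff)
          also have "q * real m - q = (1 - real m) * - q" by (simp add: algebra_simps)
          finally show ?thesis by (simp add: powr_powr)
        qed
        ultimately show ?thesis by simp
      qed
      finally show ?thesis using D by simp
    qed
    finally show ?thesis by (simp add: ennreal_leI)
  qed
  have "0 \<le> D * B'" using D by (simp add: B'_def)
  moreover have "D * B' < c * real n" using n c by (simp add: pos_divide_less_eq mult.commute)
  ultimately have "ennreal (D * B') < ennreal (c * real n)" by (intro ennreal_lessI) auto
  also have "\<dots> \<le> ennreal (\<Sum>k\<in>{k1..K}. c)"
    using c by (intro ennreal_leI) (simp add: K_def algebra_simps)
  also have "\<dots> = (\<Sum>k\<in>{k1..K}. ennreal c)"
    using c by (intro sum_ennreal[symmetric]) simp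
  also have "\<dots> \<le> (\<Sum>k\<in>{k1..K}. ennreal (b ^ k) * emeasure N (?A k))"
  proof (rule sum_mono)
    fix k assume k: "k \<in> {k1..K}"
    have "c \<le> c * 2 powr (real k * (q - p))"
      using c q ge_one_powr_ge_zero[of 2 "real k * (q - p)"] by simp
    also have "2 powr (real k * (q - p)) = b ^ k * (2 powr (- real k)) powr p"
      by (simp add: b_def powr_realpow[symmetric] powr_powr powr_add[symmetric] algebra_simps)
    finally have "ennreal c \<le> ennreal (b ^ k * (c * (2 powr (- real k)) powr p))"
      by (intro ennreal_leI) (simp add: mult_ac)
    also have "\<dots> = ennreal (b ^ k) * ennreal (c * (2 powr (- real k)) powr p)"
      using b c by (intro ennreal_mult) auto
    also have "\<dots> \<le> ennreal (b ^ k) * emeasure N (?A k)"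
      using k le_u0 by (intro mult_left_mono sub) auto
    finally show "ennreal c \<le> ennreal (b ^ k) * emeasure N (?A k)" .
  qed
  also have "\<dots> = (\<integral>\<^sup>+x. (\<Sum>k\<in>{k1..K}. ennreal (b ^ k) * indicator (?A k) x) \<partial>N)"
    by (subst nn_integral_sum) (auto simp: nn_integral_cmult_indicator)
  also have "\<dots> \<le> (\<integral>\<^sup>+x. ennreal D * ennreal ((\<eta>0 + \<phi> x) powr (- q)) \<partial>N)"
    using D pt by (intro nn_integral_mono) (simp add: ennreal_mult[symmetric])
  also have "\<dots> = ennreal D * (\<integral>\<^sup>+x. ennreal ((\<eta>0 + \<phi> x) powr (- q)) \<partial>N)"
    by (rule nn_integral_cmult) measurable
  finally have "ennreal D * ennreal B' < ennreal D * (\<integral>\<^sup>+x. ennreal ((\<eta>0 + \<phi> x) powr (- q)) \<partial>N)"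
    using D by (subst ennreal_mult[symmetric]) (auto simp: B'_def)
  then have big: "ennreal B' < (\<integral>\<^sup>+x. ennreal ((\<eta>0 + \<phi> x) powr (- q)) \<partial>N)"
    by (metis mult_left_mono not_less zero_le)
  have "ennreal B < (\<integral>\<^sup>+x. ennreal ((\<eta> + \<phi> x) powr (- q)) \<partial>N)" if \<eta>: "0 < \<eta>" "\<eta> \<le> \<eta>0" for \<eta>
  proof -
    have "ennreal B \<le> ennreal B'" by (intro ennreal_leI) (simp add: B'_def)
    also note big
    also have "(\<integral>\<^sup>+x. ennreal ((\<eta>0 + \<phi> x) powr (- q)) \<partial>N) \<le> (\<integral>\<^sup>+x. ennreal ((\<eta> + \<phi> x) powr (- q)) \<partial>N)"
      using \<eta> q by (intro nn_integral_mono ennreal_leI powr_mono2') (auto simp: add_pos_nonneg \<phi>)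
    finally show ?thesis .
  qed
  moreover have "\<eta>0 > 0" by (simp add: \<eta>0_def)
  ultimately show ?thesis by blast
qed

text \<open>
  The scale in which conditions (C1) and (C3) measure increments of the parameter; its sublevel sets
  \<open>{\<le> u}\<close> have measure of order \<open>u\<close> to the power \<open>\<Sum>\<^sub>j 1 / (2 H\<^sub>j)\<close>.
\<close>

definition anisotropic_size :: "real ^ 'n \<Rightarrow> real ^ 'n \<Rightarrow> real" where
  "anisotropic_size H x = (\<Sum>j\<in>UNIV. \<bar>x $ j\<bar> powr (2 * H $ j))"

lemma anisotropic_size_nonneg: "anisotropic_size H x \<ge> 0"
  by (simp add: anisotropic_size_def sum_nonneg)

lemma anisotropic_size_measurable [measurable]: "anisotropic_size H \<in> borel_measurable borel"
proof -
  have "anisotropic_size H = (\<lambda>x. \<Sum>j\<in>UNIV. \<bar>x \<bullet> axis j 1\<bar> powr (2 * H $ j))"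
    by (simp add: fun_eq_iff anisotropic_size_def inner_axis)
  also have "\<dots> \<in> borel_measurable borel" by measurable
  finally show ?thesis .
qed

lemma emeasure_cbox_cart:
  fixes a b :: "real ^ 'n"
  assumes "\<And>j. a $ j \<le> b $ j"
  shows "emeasure lborel (cbox a b) = ennreal (\<Prod>j\<in>UNIV. b $ j - a $ j)"
proof -
  have "cbox a b \<noteq> {}" using assms by (simp add: interval_ne_empty_cart)
  then have "measure lborel (cbox a b) = (\<Prod>j\<in>UNIV. b $ j - a $ j)" by (rule content_cbox_cart)
  moreover have "emeasure lborel (cbox a b) = ennreal (measure lborel (cbox a b))"
    by (intro emeasure_eq_ennreal_measure) (use emeasure_lborel_cbox_finite[of a b] in auto)
  ultimately show ?thesis by simp
qed

lemma powr_le_iff_le_root: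
  fixes x u h :: real
  assumes "x \<ge> 0" "u \<ge> 0" "h > 0"
  shows "x powr h \<le> u \<longleftrightarrow> x \<le> u powr (1 / h)"
proof
  assume "x powr h \<le> u"
  then have "(x powr h) powr (1 / h) \<le> u powr (1 / h)" using assms by (intro powr_mono2) auto
  then show "x \<le> u powr (1 / h)" using assms by (simp add: powr_powr)
next
  assume "x \<le> u powr (1 / h)"
  then have "x powr h \<le> (u powr (1 / h)) powr h" using assms by (intro powr_mono2) auto
  then show "x powr h \<le> u" using assms by (simp add: powr_powr)
qed

lemma prod_powr_const:
  fixes H :: "real ^ 'n"
  assumes "u > 0"
  shows "(\<Prod>j\<in>UNIV. u powr (1 / (2 * H $ j))) = u powr ((\<Sum>j\<in>UNIV. 1 / H $ j) / 2)"
proof -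
  have "(\<Prod>j\<in>UNIV. u powr (1 / (2 * H $ j))) = u powr (\<Sum>j\<in>UNIV. 1 / (2 * H $ j))"
    using assms by (intro powr_sum[symmetric]) auto
  also have "(\<Sum>j\<in>UNIV. 1 / (2 * H $ j)) = (\<Sum>j\<in>UNIV. 1 / H $ j) / 2"
    by (simp add: sum_divide_distrib mult.commute)
  finally show ?thesis .
qed

text \<open>
  The lower bound in condition (C3): the nearest reference point is chosen separately in each
  coordinate.
\<close>

definition coordinate_dist :: "real ^ 'n \<Rightarrow> real ^ 'n \<Rightarrow> real ^ 'n \<Rightarrow> real ^ 'n \<Rightarrow> real ^ 'n \<Rightarrow> real" where
  "coordinate_dist H t1 t2 t3 u =
     (\<Sum>j\<in>UNIV. Min ((\<lambda>x. \<bar>u $ j - x\<bar> powr (2 * H $ j)) ` {0, t1 $ j, t2 $ j, t3 $ j}))"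

lemma coordinate_dist_nonneg: "coordinate_dist H t1 t2 t3 u \<ge> 0"
  unfolding coordinate_dist_def by (intro sum_nonneg) auto

lemma coordinate_dist_measurable [measurable (raw)]:
  assumes "f1 \<in> borel_measurable N" "f2 \<in> borel_measurable N" "f3 \<in> borel_measurable N" "g \<in> borel_measurable N"
  shows "(\<lambda>x. coordinate_dist H (f1 x) (f2 x) (f3 x) (g x)) \<in> borel_measurable N"
proof -
  have nth: "(\<lambda>x. f x $ j) \<in> borel_measurable N" if "f \<in> borel_measurable N" for f :: "_ \<Rightarrow> real ^ 'n" and j
  proof -
    have "(\<lambda>x. f x \<bullet> axis j 1) \<in> borel_measurable N" using that by measurable
    then show ?thesis by (simp add: inner_axis)
  qed
  note [measurable] = nth[OF assms(1)] nth[OF assms(2)] nth[OF assms(3)] nth[OF assms(4)]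
  show ?thesis unfolding coordinate_dist_def by (simp, measurable)
qed

text \<open>
  The four reference points produce, coordinatewise, at most \<open>4\<^sup>N\<close> boxes that cover the sublevel set.
\<close>

lemma coordinate_dist_sublevel:
  fixes H :: "real ^ 'n"
  assumes H: "\<And>j. H $ j > 0" and u: "u > 0"
  shows "emeasure lborel {x. coordinate_dist H t1 t2 t3 x \<le> u} \<le> ennreal (8 ^ CARD('n) * u powr ((\<Sum>j\<in>UNIV. 1 / H $ j) / 2))"
proof -
  let ?T = "\<lambda>j. {0, t1 $ j, t2 $ j, t3 $ j}"
  define w where "w j = u powr (1 / (2 * H $ j))" for j
  define pt where "pt k j = (if k = 0 then 0 else if k = 1 then t1 $ j else if k = 2 then t2 $ j else t3 $ j)" for k :: nat and j :: 'n
  let ?F = "(UNIV :: 'n set) \<rightarrow>\<^sub>E {..<4::nat}"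
  let ?box = "\<lambda>\<kappa>. cbox (\<chi> j. pt (\<kappa> j) j - w j) (\<chi> j. pt (\<kappa> j) j + w j)"
  have "finite ?F" by (intro finite_PiE) auto
  have "{x. coordinate_dist H t1 t2 t3 x \<le> u} \<subseteq> (\<Union>\<kappa>\<in>?F. ?box \<kappa>)"
  proof
    fix x assume "x \<in> {x. coordinate_dist H t1 t2 t3 x \<le> u}"
    then have le: "(\<Sum>j\<in>UNIV. Min ((\<lambda>y. \<bar>x $ j - y\<bar> powr (2 * H $ j)) ` ?T j)) \<le> u"
      by (simp add: coordinate_dist_def)
    have "\<exists>k<4. \<bar>x $ j - pt k j\<bar> \<le> w j" for j
    proof -
      define S where "S j = (\<lambda>y. \<bar>x $ j - y\<bar> powr (2 * H $ j)) ` ?T j" for j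
      have S: "finite (S j)" "S j \<noteq> {}" "S j \<subseteq> {0..}" for j by (auto simp: S_def)
      then have "0 \<le> Min (S j)" for j using Min_in[of "S j"] by auto
      then have "Min (S j) \<le> (\<Sum>j\<in>UNIV. Min (S j))"
        by (intro member_le_sum[where f = "\<lambda>j. Min (S j)"]) auto
      also have "\<dots> \<le> u" unfolding S_def by (rule le)
      finally have "Min (S j) \<le> u" .
      moreover have "Min (S j) \<in> S j" using S by (intro Min_in)
      ultimately obtain y where y: "y \<in> ?T j" "\<bar>x $ j - y\<bar> powr (2 * H $ j) \<le> u"
        unfolding S_def[of j] by (metis (no_types, lifting) imageE)
      have "\<bar>x $ j - y\<bar> \<le> w j"
        using y(2) powr_le_iff_le_root[of "\<bar>x $ j - y\<bar>" u "2 * H $ j"] H[of j] u by (simp add: w_def)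
      moreover have "\<exists>k\<in>{0, 1, 2, 3}. y = pt k j"
        using y(1) by (simp add: pt_def)
      then obtain k where "k \<in> {0, 1, 2, 3}" "y = pt k j" by blast
      moreover from \<open>k \<in> {0, 1, 2, 3}\<close> have "k < 4" by auto
      ultimately show ?thesis by blast
    qed
    then obtain \<kappa> where \<kappa>: "\<And>j. \<kappa> j < 4" "\<And>j. \<bar>x $ j - pt (\<kappa> j) j\<bar> \<le> w j" by metis
    have "pt (\<kappa> j) j - w j \<le> x $ j \<and> x $ j \<le> pt (\<kappa> j) j + w j" for j
      using \<kappa>(2)[of j] by linarith
    then have "x \<in> ?box \<kappa>" by (simp add: mem_box_cart)
    moreover have "\<kappa> \<in> ?F" using \<kappa>(1) by (auto simp: PiE_def extensional_def)
    ultimately show "x \<in> (\<Union>\<kappa>\<in>?F. ?box \<kappa>)" by blast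
  qed
  then have "emeasure lborel {x. coordinate_dist H t1 t2 t3 x \<le> u} \<le> emeasure lborel (\<Union>\<kappa>\<in>?F. ?box \<kappa>)"
    by (intro emeasure_mono) (auto intro!: sets.finite_UN \<open>finite ?F\<close>)
  also have "\<dots> \<le> (\<Sum>\<kappa>\<in>?F. emeasure lborel (?box \<kappa>))"
    by (intro emeasure_subadditive_finite \<open>finite ?F\<close>) auto
  also have "\<dots> = (\<Sum>\<kappa>\<in>?F. ennreal (2 ^ CARD('n) * u powr ((\<Sum>j\<in>UNIV. 1 / H $ j) / 2)))"
  proof (rule sum.cong[OF refl])
    fix \<kappa>
    have "emeasure lborel (?box \<kappa>) = ennreal (\<Prod>j\<in>UNIV. 2 * w j)"
      by (subst emeasure_cbox_cart) (auto simp: w_def)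
    also have "(\<Prod>j\<in>UNIV. 2 * w j) = 2 ^ CARD('n) * u powr ((\<Sum>j\<in>UNIV. 1 / H $ j) / 2)"
      unfolding w_def prod.distrib prod_powr_const[OF u] by simp
    finally show "emeasure lborel (?box \<kappa>) = ennreal (2 ^ CARD('n) * u powr ((\<Sum>j\<in>UNIV. 1 / H $ j) / 2))" .
  qed
  also have "\<dots> = ennreal (8 ^ CARD('n) * u powr ((\<Sum>j\<in>UNIV. 1 / H $ j) / 2))"
  proof -
    have "card ?F = 4 ^ CARD('n)" by (simp add: card_PiE)
    moreover have "(4::real) ^ CARD('n) * 2 ^ CARD('n) = 8 ^ CARD('n)" by (simp add: power_mult_distrib[symmetric])
    ultimately show ?thesis
      by (simp add: ennreal_of_nat_eq_real_of_nat ennreal_mult[symmetric] mult.assoc[symmetric])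
  qed
  finally show ?thesis .
qed

text \<open>A box inside the sublevel set \<open>{\<le> u}\<close> of \<open>anisotropic_size H\<close> whose measure has the same order.\<close>

definition anisotropic_box :: "real ^ 'n \<Rightarrow> real \<Rightarrow> (real ^ 'n) set" where
  "anisotropic_box H u = cbox 0 (\<chi> j. (u / real CARD('n)) powr (1 / (2 * H $ j)))"

lemma anisotropic_box_sublevel:
  fixes H :: "real ^ 'n"
  assumes H: "\<And>j. H $ j > 0" and "u > 0" and x: "x \<in> anisotropic_box H u"
  shows "anisotropic_size H x \<le> u"
proof -
  have "\<bar>x $ j\<bar> powr (2 * H $ j) \<le> u / real CARD('n)" for j
    using x H[of j] \<open>u > 0\<close> by (subst powr_le_iff_le_root) (auto simp: anisotropic_box_def mem_box_cart)
  then have "anisotropic_size H x \<le> (\<Sum>j\<in>(UNIV :: 'n set). u / real CARD('n))"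
    unfolding anisotropic_size_def by (intro sum_mono)
  then show ?thesis by simp
qed

lemma emeasure_anisotropic_box:
  fixes H :: "real ^ 'n"
  assumes "u > 0"
  shows "emeasure lborel (anisotropic_box H u) =
    ennreal ((1 / real CARD('n)) powr ((\<Sum>j\<in>UNIV. 1 / H $ j) / 2) * u powr ((\<Sum>j\<in>UNIV. 1 / H $ j) / 2))"
proof -
  have "emeasure lborel (anisotropic_box H u) = ennreal (\<Prod>j\<in>UNIV. (u / real CARD('n)) powr (1 / (2 * H $ j)))"
    unfolding anisotropic_box_def by (subst emeasure_cbox_cart) auto
  also have "(\<Prod>j\<in>UNIV. (u / real CARD('n)) powr (1 / (2 * H $ j))) = (u / real CARD('n)) powr ((\<Sum>j\<in>UNIV. 1 / H $ j) / 2)"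
    using assms by (intro prod_powr_const) simp
  also have "\<dots> = (1 / real CARD('n)) powr ((\<Sum>j\<in>UNIV. 1 / H $ j) / 2) * u powr ((\<Sum>j\<in>UNIV. 1 / H $ j) / 2)"
    using assms by (simp add: powr_mult[symmetric])
  finally show ?thesis .
qed

lemma anisotropic_box_small:
  fixes H :: "real ^ 'n"
  assumes H: "\<And>j. H $ j > 0" and "\<delta> > 0"
  shows "\<exists>u0>0. \<forall>u. 0 < u \<longrightarrow> u \<le> u0 \<longrightarrow> (\<forall>x\<in>anisotropic_box H u. \<forall>j. 0 \<le> x $ j \<and> x $ j \<le> \<delta>)"
proof -
  define u0 where "u0 = Min (range (\<lambda>j. \<delta> powr (2 * H $ j)))"
  have u0: "u0 > 0" unfolding u0_def using \<open>\<delta> > 0\<close> by (subst Min_gr_iff) auto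
  have "0 \<le> x $ j \<and> x $ j \<le> \<delta>" if u: "0 < u" "u \<le> u0" and x: "x \<in> anisotropic_box H u" for u x j
  proof -
    have x': "0 \<le> x $ j" "x $ j \<le> (u / real CARD('n)) powr (1 / (2 * H $ j))"
      using x by (auto simp: anisotropic_box_def mem_box_cart)
    have "1 \<le> real CARD('n)" by (simp add: Suc_le_eq)
    then have "u / real CARD('n) \<le> u" using u by (simp add: divide_le_eq)
    also have "u \<le> \<delta> powr (2 * H $ j)"
      using u(2) unfolding u0_def by (rule order_trans) (auto intro: Min_le)
    finally have "(u / real CARD('n)) powr (1 / (2 * H $ j)) \<le> (\<delta> powr (2 * H $ j)) powr (1 / (2 * H $ j))"
      using u H[of j] by (intro powr_mono2) auto
    also have "\<dots> = \<delta>" using H[of j] \<open>\<delta> > 0\<close> by (simp add: powr_powr)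
    finally show ?thesis using x' by simp
  qed
  with u0 show ?thesis by blast
qed

section \<open>Integrals of second-order processes over the cube\<close>

text \<open>
  Mean-square integrals of a second-order process \<open>\<Phi>\<close> over a parameter space of mass one.
\<close>

locale second_order_process = pair_prob_space N M for N :: "'r measure" and M :: "'w measure" +
  fixes \<Phi> :: "'r \<Rightarrow> 'w \<Rightarrow> real" and C :: real
  assumes joint [measurable]: "(\<lambda>(r, \<omega>). \<Phi> r \<omega>) \<in> borel_measurable (N \<Otimes>\<^sub>M M)"
    and section_L2: "\<And>r. r \<in> space N \<Longrightarrow> \<Phi> r \<in> L2 M"
    and second_moment: "\<And>r. r \<in> space N \<Longrightarrow> (\<integral>\<omega>. (\<Phi> r \<omega>)\<^sup>2 \<partial>M) \<le> C"
begin

sublocale swapped: pair_prob_space M N ..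

lemma joint_L2: "(\<lambda>(r, \<omega>). \<Phi> r \<omega>) \<in> L2 (N \<Otimes>\<^sub>M M)"
  unfolding L2_def
proof (intro CollectI conjI joint integrableI_bounded)
  have "(\<integral>\<^sup>+x. ennreal (norm ((case x of (r, \<omega>) \<Rightarrow> \<Phi> r \<omega>)\<^sup>2)) \<partial>(N \<Otimes>\<^sub>M M)) =
      (\<integral>\<^sup>+r. \<integral>\<^sup>+\<omega>. ennreal ((\<Phi> r \<omega>)\<^sup>2) \<partial>M \<partial>N)"
    by (subst M2.nn_integral_fst[symmetric]) (auto simp: split_beta')
  also have "\<dots> \<le> (\<integral>\<^sup>+r. ennreal C \<partial>N)"
  proof (rule nn_integral_mono)
    fix r assume r: "r \<in> space N"
    have "(\<integral>\<^sup>+\<omega>. ennreal ((\<Phi> r \<omega>)\<^sup>2) \<partial>M) = ennreal (\<integral>\<omega>. (\<Phi> r \<omega>)\<^sup>2 \<partial>M)"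
      by (intro nn_integral_eq_integral L2_square_integrable section_L2 r) simp
    then show "(\<integral>\<^sup>+\<omega>. ennreal ((\<Phi> r \<omega>)\<^sup>2) \<partial>M) \<le> ennreal C"
      using second_moment[OF r] by (simp add: ennreal_leI)
  qed
  also have "\<dots> < \<infinity>" by (simp add: M1.emeasure_space_1)
  finally show "(\<integral>\<^sup>+x. ennreal (norm ((case x of (r, \<omega>) \<Rightarrow> \<Phi> r \<omega>)\<^sup>2)) \<partial>(N \<Otimes>\<^sub>M M)) < \<infinity>" .
qed (simp add: split_beta')

lemma square_integrable_sections: "AE \<omega> in M. integrable N (\<lambda>r. (\<Phi> r \<omega>)\<^sup>2)"
proof -
  have "integrable (N \<Otimes>\<^sub>M M) (\<lambda>(r, \<omega>). (\<Phi> r \<omega>)\<^sup>2)"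
    using L2_square_integrable[OF joint_L2] by (simp add: split_beta')
  then have "integrable (M \<Otimes>\<^sub>M N) (\<lambda>(\<omega>, r). (\<Phi> r \<omega>)\<^sup>2)"
    by (subst (asm) integrable_product_swap_iff[symmetric]) (simp add: split_beta')
  from swapped.AE_integrable_fst'[OF this] show ?thesis by simp
qed

lemma integral_measurable [measurable]: "(\<lambda>\<omega>. \<integral>r. \<Phi> r \<omega> \<partial>N) \<in> borel_measurable M"
  by (rule M1.borel_measurable_lebesgue_integral) (use measurable_pair_swap[OF joint] in \<open>simp add: split_beta'\<close>)

lemma section_measurable: "\<omega> \<in> space M \<Longrightarrow> (\<lambda>r. \<Phi> r \<omega>) \<in> borel_measurable N"
  using measurable_Pair2[OF joint] by simp

lemma Jensen: "AE \<omega> in M. (\<integral>r. \<Phi> r \<omega> \<partial>N)\<^sup>2 \<le> (\<integral>r. (\<Phi> r \<omega>)\<^sup>2 \<partial>N)"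
  using square_integrable_sections AE_space
proof eventually_elim
  case (elim \<omega>)
  then have "(\<lambda>r. \<Phi> r \<omega>) \<in> L2 N" by (simp add: L2_def section_measurable)
  from L2_Cauchy_Schwarz[OF this M1.L2_const[of 1]] show ?case by (simp add: M1.prob_space)
qed

lemma integral_of_second_moments:
  "integrable M (\<lambda>\<omega>. \<integral>r. (\<Phi> r \<omega>)\<^sup>2 \<partial>N)"
  "(\<integral>\<omega>. \<integral>r. (\<Phi> r \<omega>)\<^sup>2 \<partial>N \<partial>M) = (\<integral>r. \<integral>\<omega>. (\<Phi> r \<omega>)\<^sup>2 \<partial>M \<partial>N)"
proof -
  have i: "integrable (N \<Otimes>\<^sub>M M) (\<lambda>(r, \<omega>). (\<Phi> r \<omega>)\<^sup>2)"
    using L2_square_integrable[OF joint_L2] by (simp add: split_beta')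
  show "(\<integral>\<omega>. \<integral>r. (\<Phi> r \<omega>)\<^sup>2 \<partial>N \<partial>M) = (\<integral>r. \<integral>\<omega>. (\<Phi> r \<omega>)\<^sup>2 \<partial>M \<partial>N)"
    by (rule Fubini_integral[OF i])
  have "integrable (M \<Otimes>\<^sub>M N) (\<lambda>(\<omega>, r). (\<Phi> r \<omega>)\<^sup>2)"
    using i by (subst (asm) integrable_product_swap_iff[symmetric]) (simp add: split_beta')
  from swapped.integrable_fst'[OF this] show "integrable M (\<lambda>\<omega>. \<integral>r. (\<Phi> r \<omega>)\<^sup>2 \<partial>N)" by simp
qed

lemma integral_L2: "(\<lambda>\<omega>. \<integral>r. \<Phi> r \<omega> \<partial>N) \<in> L2 M"
  unfolding L2_def
proof (intro CollectI conjI integral_measurable)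
  show "integrable M (\<lambda>\<omega>. (\<integral>r. \<Phi> r \<omega> \<partial>N)\<^sup>2)"
    by (rule Bochner_Integration.integrable_bound[OF integral_of_second_moments(1)])
      (use Jensen in \<open>auto elim!: eventually_mono\<close>)
qed

lemma integral_second_moment_le:
  "(\<integral>\<omega>. (\<integral>r. \<Phi> r \<omega> \<partial>N)\<^sup>2 \<partial>M) \<le> (\<integral>r. \<integral>\<omega>. (\<Phi> r \<omega>)\<^sup>2 \<partial>M \<partial>N)"
  unfolding integral_of_second_moments(2)[symmetric]
  by (rule integral_mono_AE[OF L2_square_integrable[OF integral_L2] integral_of_second_moments(1) Jensen])

lemma integral_inner:
  assumes G: "G \<in> L2 M"
  shows "(\<integral>\<omega>. G \<omega> * (\<integral>r. \<Phi> r \<omega> \<partial>N) \<partial>M) = (\<integral>r. \<integral>\<omega>. G \<omega> * \<Phi> r \<omega> \<partial>M \<partial>N)"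
proof -
  have [measurable]: "G \<in> borel_measurable M" using G by (rule L2_measurable)
  have "(\<lambda>(r, \<omega>). G \<omega>) \<in> L2 (N \<Otimes>\<^sub>M M)"
  proof -
    interpret G: second_order_process N M "\<lambda>_. G" "\<integral>\<omega>. (G \<omega>)\<^sup>2 \<partial>M"
      by unfold_locales (use G in auto)
    show ?thesis by (rule G.joint_L2)
  qed
  then have "integrable (N \<Otimes>\<^sub>M M) (\<lambda>(r, \<omega>). G \<omega> * \<Phi> r \<omega>)"
    using L2_mult_integrable[OF _ joint_L2] by (fastforce simp: split_beta')
  from Fubini_integral[OF this] show ?thesis by simp
qed

end

text \<open>
  The uniform distribution on the unit cube, which makes the parameters random variables.
\<close>

definition cube_measure :: "(real ^ 'n) measure" where
  "cube_measure = restrict_space lborel (cbox 0 1)"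

text \<open>Rounding down to the grid of mesh \<open>1 / (k + 1)\<close>, which maps the unit cube into itself.\<close>

definition grid :: "nat \<Rightarrow> real ^ 'n \<Rightarrow> real ^ 'n" where
  "grid k t = (\<chi> j. of_int \<lfloor>real (Suc k) * t $ j\<rfloor> / real (Suc k))"

lemma grid_in_cube:
  assumes "t \<in> cbox 0 1" shows "grid k t \<in> cbox 0 1"
proof -
  have "0 \<le> real_of_int \<lfloor>real (Suc k) * t $ j\<rfloor> / real (Suc k) \<and> real_of_int \<lfloor>real (Suc k) * t $ j\<rfloor> / real (Suc k) \<le> 1" for j
  proof -
    have t: "0 \<le> t $ j" "t $ j \<le> 1" using assms by (auto simp: mem_box_cart)
    have "real_of_int \<lfloor>real (Suc k) * t $ j\<rfloor> \<le> real (Suc k) * t $ j" by simp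
    also have "\<dots> \<le> real (Suc k) * 1" using t by (intro mult_left_mono) auto
    finally show ?thesis using t by (simp add: divide_le_eq)
  qed
  then show ?thesis by (simp add: grid_def mem_box_cart)
qed

lemma finite_grid_image: "finite (grid k ` cbox 0 (1 :: real ^ 'n))"
proof -
  let ?g = "\<lambda>f :: 'n \<Rightarrow> int. (\<chi> j. of_int (f j) / real (Suc k)) :: real ^ 'n"
  have "grid k ` cbox 0 (1 :: real ^ 'n) \<subseteq> ?g ` (UNIV \<rightarrow>\<^sub>E {0..int (Suc k)})"
  proof
    fix x assume "x \<in> grid k ` cbox 0 (1 :: real ^ 'n)"
    then obtain t where t: "t \<in> cbox 0 1" "x = grid k t" by auto
    have "\<lfloor>real (Suc k) * t $ j\<rfloor> \<in> {0..int (Suc k)}" for j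
    proof -
      have "0 \<le> t $ j" "t $ j \<le> 1" using t by (auto simp: mem_box_cart)
      then have "0 \<le> real (Suc k) * t $ j" "real (Suc k) * t $ j \<le> real (Suc k)"
        by (auto simp: mult_left_le)
      then show ?thesis using floor_mono[of "real (Suc k) * t $ j" "real (Suc k)"] by (simp only: floor_of_nat atLeastAtMost_iff zero_le_floor)
    qed
    then show "x \<in> ?g ` (UNIV \<rightarrow>\<^sub>E {0..int (Suc k)})"
      using t by (intro image_eqI[of _ _ "\<lambda>j. \<lfloor>real (Suc k) * t $ j\<rfloor>"]) (auto simp: grid_def)
  qed
  moreover have "finite (UNIV \<rightarrow>\<^sub>E {0..int (Suc k)} :: ('n \<Rightarrow> int) set)" by (intro finite_PiE) auto
  ultimately show ?thesis by (rule finite_subset[OF _ finite_imageI])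
qed

lemma grid_tendsto: "(\<lambda>k. grid k t) \<longlonglongrightarrow> t"
proof (rule vec_tendstoI)
  fix j
  have close: "\<bar>grid k t $ j - t $ j\<bar> \<le> 1 / real (Suc k)" for k
  proof -
    have "grid k t $ j - t $ j = (of_int \<lfloor>real (Suc k) * t $ j\<rfloor> - real (Suc k) * t $ j) / real (Suc k)"
      by (simp add: grid_def diff_divide_distrib)
    moreover have "\<bar>of_int \<lfloor>real (Suc k) * t $ j\<rfloor> - real (Suc k) * t $ j\<bar> \<le> 1" by linarith
    ultimately show ?thesis by (simp add: abs_divide divide_right_mono)
  qed
  have lim: "(\<lambda>k. 1 / real (Suc k)) \<longlonglongrightarrow> 0"
    using LIMSEQ_inverse_real_of_nat by (simp only: inverse_eq_divide)
  have "\<forall>\<^sub>F k in sequentially. norm (grid k t $ j - t $ j) \<le> 1 / real (Suc k)"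
    using close by (intro always_eventually allI) (simp only: real_norm_def)
  from Lim_null_comparison[OF this lim] have "(\<lambda>k. grid k t $ j - t $ j) \<longlonglongrightarrow> 0" .
  then show "(\<lambda>k. grid k t $ j) \<longlonglongrightarrow> t $ j" by (rule LIM_zero_cancel)
qed

lemma grid_measurable [measurable]: "grid k \<in> borel_measurable borel"
proof (rule borel_measurable_euclidean_space[THEN iffD2], rule ballI)
  fix b :: "real ^ 'n" assume "b \<in> Basis"
  then obtain j where b: "b = axis j 1" by (auto simp: Basis_vec_def)
  have "(\<lambda>t :: real ^ 'n. of_int \<lfloor>real (Suc k) * (t \<bullet> axis j 1)\<rfloor> / real (Suc k)) \<in> borel_measurable borel"
    by measurable
  then show "(\<lambda>t. grid k t \<bullet> b) \<in> borel_measurable borel"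
    by (simp add: b grid_def inner_axis)
qed

lemma sets_cube_measure [measurable_cong]: "sets cube_measure = sets (restrict_space borel (cbox 0 1))"
  unfolding cube_measure_def by (rule sets_restrict_space_cong) simp

lemma space_cube_measure: "space cube_measure = cbox 0 1"
  by (simp add: cube_measure_def space_restrict_space)

lemma prob_space_cube_measure: "prob_space (cube_measure :: (real ^ 'n) measure)"
proof (rule prob_spaceI)
  have "emeasure (cube_measure :: (real ^ 'n) measure) (space cube_measure) = emeasure lborel (cbox 0 (1 :: real ^ 'n))"
    unfolding space_cube_measure by (simp add: cube_measure_def emeasure_restrict_space)
  also have "\<dots> = 1" by (subst emeasure_cbox_cart) auto
  finally show "emeasure (cube_measure :: (real ^ 'n) measure) (space cube_measure) = 1" .
qed

lemma measurable_cube_measure: "f \<in> borel_measurable borel \<Longrightarrow> f \<in> borel_measurable cube_measure"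
  unfolding measurable_cong_sets[OF sets_cube_measure refl] by (rule measurable_restrict_space1)

lemma id_measurable_cube_measure [measurable]: "(\<lambda>x. x) \<in> borel_measurable cube_measure"
  by (rule measurable_cube_measure) simp

lemma cube_pair_measure_eq:
  "cube_measure \<Otimes>\<^sub>M cube_measure = restrict_space lborel (cbox 0 (1 :: real ^ 'n) \<times> cbox 0 (1 :: real ^ 'n))"
proof -
  let ?c = "cube_measure :: (real ^ 'n) measure" and ?I = "cbox 0 (1 :: real ^ 'n)"
  interpret prob_space ?c by (rule prob_space_cube_measure)
  have sf: "sigma_finite_measure ?c" by unfold_locales
  let ?R = "restrict_space (lborel :: ((real ^ 'n) \<times> (real ^ 'n)) measure) (?I \<times> ?I)"
  have II: "?I \<times> ?I \<in> sets (lborel :: ((real ^ 'n) \<times> (real ^ 'n)) measure)"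
    using borel_closed[OF closed_Times[OF closed_cbox closed_cbox], of 0 "1 :: real ^ 'n" 0 "1 :: real ^ 'n"] by simp
  have sets: "sets (?c \<Otimes>\<^sub>M ?c) = sets ?R"
  proof (intro equalityI subsetI)
    fix A assume A: "A \<in> sets (?c \<Otimes>\<^sub>M ?c)"
    have "fst \<in> ?R \<rightarrow>\<^sub>M ?c" "snd \<in> ?R \<rightarrow>\<^sub>M ?c"
      unfolding cube_measure_def
      by (rule measurable_restrict_space2, force simp: space_restrict_space,
          rule measurable_restrict_space1, simp add: measurable_lborel1 measurable_lborel2 borel_measurable_continuous_onI continuous_on_fst continuous_on_snd)+
    then have "(\<lambda>x. (fst x, snd x)) \<in> ?R \<rightarrow>\<^sub>M ?c \<Otimes>\<^sub>M ?c" by (rule measurable_Pair)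
    from measurable_sets[OF this A] have "A \<inter> space ?R \<in> sets ?R" by (simp add: vimage_def)
    moreover have "A \<subseteq> space ?R"
      using sets.sets_into_space[OF A] by (auto simp: space_pair_measure space_cube_measure space_restrict_space)
    ultimately show "A \<in> sets ?R" by (simp add: Int_absorb2)
  next
    fix A assume "A \<in> sets ?R"
    then obtain B where B: "B \<in> sets (lborel :: ((real ^ 'n) \<times> (real ^ 'n)) measure)" "A = (?I \<times> ?I) \<inter> B"
      by (auto simp: sets_restrict_space)
    have "(\<lambda>x. x) \<in> ?c \<Otimes>\<^sub>M ?c \<rightarrow>\<^sub>M lborel \<Otimes>\<^sub>M lborel"
    proof -
      have "(\<lambda>x. (fst x, snd x)) \<in> ?c \<Otimes>\<^sub>M ?c \<rightarrow>\<^sub>M lborel \<Otimes>\<^sub>M lborel"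
        by (intro measurable_Pair measurable_compose[OF measurable_fst] measurable_compose[OF measurable_snd])
          (simp_all add: measurable_lborel1)
      then show ?thesis by simp
    qed
    then have "(\<lambda>x. x) \<in> ?c \<Otimes>\<^sub>M ?c \<rightarrow>\<^sub>M lborel" by (simp add: lborel_prod)
    from measurable_sets[OF this B(1)] show "A \<in> sets (?c \<Otimes>\<^sub>M ?c)"
      unfolding B(2) by (simp add: space_pair_measure space_cube_measure Int_commute)
  qed
  have em: "emeasure ?c A * emeasure ?c B = emeasure ?R (A \<times> B)" if AB: "A \<in> sets ?c" "B \<in> sets ?c" for A B
  proof -
  from AB have I: "A \<subseteq> ?I" "B \<subseteq> ?I" "A \<in> sets lborel" "B \<in> sets lborel"
    by (auto simp: cube_measure_def sets_restrict_space)
  have "emeasure ?R (A \<times> B) = emeasure (lborel \<Otimes>\<^sub>M lborel) (A \<times> B)"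
    using II I by (subst emeasure_restrict_space) (auto simp: lborel_prod)
  also have "\<dots> = emeasure lborel A * emeasure lborel B"
    using I by (intro lborel.emeasure_pair_measure_Times)
  also have "\<dots> = emeasure ?c A * emeasure ?c B"
    using I by (simp add: cube_measure_def emeasure_restrict_space)
  finally show ?thesis ..
  qed
  show ?thesis by (rule pair_measure_eqI[OF sf sf sets em])
qed

lemma set_integral_square_of_cube:
  fixes f :: "(real ^ 'n) \<times> (real ^ 'n) \<Rightarrow> real"
  shows "(LINT r:cbox 0 1 \<times> cbox 0 1|lborel. f r) = (\<integral>r. f r \<partial>(cube_measure \<Otimes>\<^sub>M cube_measure))"
  unfolding cube_pair_measure_eq set_lebesgue_integral_def
proof (subst integral_restrict_space)
  show "cbox 0 1 \<times> cbox 0 1 \<inter> space lborel \<in> sets (lborel :: ((real ^ 'n) \<times> (real ^ 'n)) measure)"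
    using borel_closed[OF closed_Times[OF closed_cbox closed_cbox], of 0 "1 :: real ^ 'n" 0 "1 :: real ^ 'n"] by simp
qed simp

section \<open>The kernels of the approximations\<close>

lemma negative_binomial_sums:
  fixes a x :: real
  assumes "0 \<le> x" "x < 1"
  shows "(\<lambda>m. pochhammer a m / fact m * x ^ m) sums (1 - x) powr (- a)"
proof -
  have "(\<lambda>m. ((- a) gchoose m) * (- x) ^ m) sums (1 + (- x)) powr (- a)"
    using assms by (intro gen_binomial_real) auto
  moreover have "((- a) gchoose m) * (- x) ^ m = pochhammer a m / fact m * x ^ m" for m
  proof -
    have "((- a) gchoose m) * (- x) ^ m = ((-1) ^ m * (-1) ^ m) * (pochhammer a m / fact m * x ^ m)"
      by (simp add: gbinomial_pochhammer power_minus[of x] mult_ac)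
    also have "(-1 :: real) ^ m * (-1) ^ m = 1"
      unfolding power_mult_distrib[symmetric] by simp
    finally show ?thesis by simp
  qed
  ultimately show ?thesis by simp
qed

text \<open>
  Shifting the index turns the weight \<open>m\<close> into the parameter \<open>a + 1\<close>.
\<close>

lemma negative_binomial_weighted_sums:
  fixes a x :: real
  assumes "0 \<le> x" "x < 1"
  shows "(\<lambda>m. real m * (pochhammer a m / fact m * x ^ m)) sums (a * x * (1 - x) powr (- (a + 1)))"
proof -
  have "(\<lambda>m. a * x * (pochhammer (a + 1) m / fact m * x ^ m)) sums (a * x * (1 - x) powr (- (a + 1)))"
    by (intro sums_mult negative_binomial_sums assms)
  moreover have "a * x * (pochhammer (a + 1) m / fact m * x ^ m) =
      real (Suc m) * (pochhammer a (Suc m) / fact (Suc m) * x ^ Suc m)" for m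
    by (simp add: pochhammer_rec field_simps del: of_nat_Suc)
  ultimately have "(\<lambda>m. real (Suc m) * (pochhammer a (Suc m) / fact (Suc m) * x ^ Suc m)) sums (a * x * (1 - x) powr (- (a + 1)))"
    by (simp only:)
  then show ?thesis by (subst (asm) sums_Suc_iff) simp
qed

text \<open>The two series in the form in which they occur below, with \<open>x = r\<^sup>2 / P\<close>.\<close>

lemma kernel_series:
  fixes a P r :: real
  assumes P: "r\<^sup>2 < P"
  shows "(\<lambda>m. pochhammer a m / fact m * r ^ (2 * m) * P powr (- (a + real m))) sums (P - r\<^sup>2) powr (- a)"
    and "(\<lambda>m. real m * (pochhammer a m / fact m * r ^ (2 * m) * P powr (- (a + real m)))) sums
      (a * r\<^sup>2 * (P - r\<^sup>2) powr (- (a + 1)))"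
proof -
  define x where "x = r\<^sup>2 / P"
  have P0: "P > 0" using P by (rule le_less_trans[rotated]) simp
  have x: "0 \<le> x" "x < 1" using P P0 by (auto simp: x_def)
  have r: "r\<^sup>2 = P * x" using P0 by (simp add: x_def)
  have eq: "pochhammer a m / fact m * r ^ (2 * m) * P powr (- (a + real m)) = P powr (- a) * (pochhammer a m / fact m * x ^ m)" for m
  proof -
    have "r ^ (2 * m) * (1 / P) ^ m = x ^ m"
      unfolding power_mult power_mult_distrib[symmetric] using P0 by (simp add: x_def)
    then show ?thesis unfolding powr_neg_add_nat[OF P0]
      by (simp add: mult_ac) 
  qed
  have e1: "P powr (- a) * (1 - x) powr (- a) = (P - r\<^sup>2) powr (- a)"
    using P0 x by (simp add: powr_mult[symmetric] r algebra_simps)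
  show "(\<lambda>m. pochhammer a m / fact m * r ^ (2 * m) * P powr (- (a + real m))) sums (P - r\<^sup>2) powr (- a)"
    unfolding eq e1[symmetric] by (intro sums_mult negative_binomial_sums x)
  have e2: "P powr (- a) * (a * x * (1 - x) powr (- (a + 1))) = a * r\<^sup>2 * (P - r\<^sup>2) powr (- (a + 1))"
  proof -
    have "P powr (- a) = P * P powr (- (a + 1))"
      using P0 powr_mult_base[of P "- (a + 1)"] by simp
    moreover have "P powr (- (a + 1)) * (1 - x) powr (- (a + 1)) = (P - r\<^sup>2) powr (- (a + 1))"
      using P0 x by (simp add: powr_mult[symmetric] r algebra_simps)
    ultimately show ?thesis by (simp add: r[symmetric] mult_ac)
  qed
  have "real m * (pochhammer a m / fact m * r ^ (2 * m) * P powr (- (a + real m))) =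
      P powr (- a) * (real m * (pochhammer a m / fact m * x ^ m))" for m
    unfolding eq by (simp only: mult_ac)
  then show "(\<lambda>m. real m * (pochhammer a m / fact m * r ^ (2 * m) * P powr (- (a + real m)))) sums
      (a * r\<^sup>2 * (P - r\<^sup>2) powr (- (a + 1)))"
    unfolding e2[symmetric] by (simp only:) (intro sums_mult negative_binomial_weighted_sums x)
qed

context gaussian_copies
begin

definition increment :: "'t \<times> 't \<Rightarrow> ('t \<Rightarrow> real) \<Rightarrow> real" where
  "increment r = (\<lambda>x. x (fst r) - x (snd r))"

lemma increment_functional: "increment r \<in> linear_functionals"
  unfolding increment_def by (intro linear_functionals_diff linear_functionals_eval)

abbreviation icov :: "'t \<times> 't \<Rightarrow> 't \<times> 't \<Rightarrow> real" where
  "icov r r' \<equiv> cov (increment r) (increment r')"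

lemma icov_Cauchy_Schwarz: "(icov r r')\<^sup>2 \<le> icov r r * icov r' r'"
  by (rule cov_Cauchy_Schwarz[OF increment_functional increment_functional])

lemma icov_square_less:
  assumes "e > 0" "d > 0"
  shows "(icov r r')\<^sup>2 < (icov r r + e) * (icov r' r' + d)"
proof -
  have "0 \<le> icov r r * d" "0 \<le> icov r' r' * e" "0 < e * d"
    using assms cov_nonneg by auto
  then show ?thesis using icov_Cauchy_Schwarz[of r r'] by (simp add: algebra_simps)
qed

definition local_kernel :: "real \<Rightarrow> 't \<times> 't \<Rightarrow> 'w \<Rightarrow> real" where
  "local_kernel \<epsilon> r \<omega> = heat_kernel \<epsilon> (X (fst r) \<omega> - X (snd r) \<omega>)"

lemma half_sqnorm_increment: "half_sqnorm (increment r) \<omega> = (norm (X (fst r) \<omega> - X (snd r) \<omega>))\<^sup>2 / 2"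
  by (simp only: half_sqnorm_def increment_def power2_norm_eq_inner inner_vec_def) (simp add: power2_eq_square)

lemma local_kernel_eq:
  assumes "\<epsilon> > 0"
  shows "local_kernel \<epsilon> r \<omega> = (2 * pi) powr (- (real CARD('d) / 2)) * \<epsilon> powr (- (real CARD('d) / 2)) *
    exp (- (1 / \<epsilon> * half_sqnorm (increment r) \<omega>))"
proof -
  have "(2 * pi * \<epsilon>) powr (- real CARD('d) / 2) = (2 * pi) powr (- (real CARD('d) / 2)) * \<epsilon> powr (- (real CARD('d) / 2))"
    using assms by (simp add: powr_mult)
  moreover have "- (norm (X (fst r) \<omega> - X (snd r) \<omega>))\<^sup>2 / (2 * \<epsilon>) = - (1 / \<epsilon> * half_sqnorm (increment r) \<omega>)"
    unfolding half_sqnorm_increment by simp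
  ultimately show ?thesis unfolding local_kernel_def heat_kernel_def by (simp only:)
qed

lemma local_kernel_finite_moments:
  assumes "\<epsilon> > 0" shows "finite_moments M (local_kernel \<epsilon> r)"
proof -
  have "finite_moments M (\<lambda>\<omega>. ((2 * pi) powr (- (real CARD('d) / 2)) * \<epsilon> powr (- (real CARD('d) / 2))) *
      exp (- (1 / \<epsilon> * half_sqnorm (increment r) \<omega>)))"
    using assms by (intro finite_moments_scale exp_half_sqnorm_finite_moments increment_functional) simp
  also have "(\<lambda>\<omega>. ((2 * pi) powr (- (real CARD('d) / 2)) * \<epsilon> powr (- (real CARD('d) / 2))) *
      exp (- (1 / \<epsilon> * half_sqnorm (increment r) \<omega>))) = local_kernel \<epsilon> r"
    by (rule ext) (simp only: local_kernel_eq[OF assms])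
  finally show ?thesis .
qed

text \<open>
  The component of \<open>local_kernel \<epsilon> r\<close> in the chaos of order \<open>2 m\<close>. The increment enters only through
  its norm, which is why Laguerre polynomials occur and odd orders do not.
\<close>

definition chaos_density :: "nat \<Rightarrow> real \<Rightarrow> 't \<times> 't \<Rightarrow> 'w \<Rightarrow> real" where
  "chaos_density m \<epsilon> r \<omega> =
     (2 * pi) powr (- (real CARD('d) / 2)) * (icov r r + \<epsilon>) powr (- (real CARD('d) / 2 + real m)) *
     (pochhammer (real CARD('d) / 2) m / fact m) *
     laguerre (real CARD('d) / 2) m (icov r r) (half_sqnorm (increment r) \<omega>)"

lemma chaos_density_finite_moments: "finite_moments M (chaos_density m \<epsilon> r)"
  unfolding chaos_density_def[abs_def]
  by (intro finite_moments_scale laguerre_finite_moments increment_functional)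

text \<open>
  The density at the origin of the pair of increments over \<open>r\<close> and \<open>r'\<close>, regularised by independent
  Gaussian vectors with variances \<open>\<epsilon>\<close> and \<open>\<delta>\<close>.
\<close>

definition full_kernel :: "real \<Rightarrow> real \<Rightarrow> 't \<times> 't \<Rightarrow> 't \<times> 't \<Rightarrow> real" where
  "full_kernel \<epsilon> \<delta> r r' = ((2 * pi) powr (- (real CARD('d) / 2)))\<^sup>2 *
     ((icov r r + \<epsilon>) * (icov r' r' + \<delta>) - (icov r r')\<^sup>2) powr (- (real CARD('d) / 2))"

text \<open>
  The \<open>m\<close>-th term in the expansion of \<open>full_kernel\<close> in powers of the squared covariance.
\<close>

definition chaos_kernel :: "nat \<Rightarrow> real \<Rightarrow> real \<Rightarrow> 't \<times> 't \<Rightarrow> 't \<times> 't \<Rightarrow> real" where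
  "chaos_kernel m \<epsilon> \<delta> r r' = ((2 * pi) powr (- (real CARD('d) / 2)))\<^sup>2 *
     (pochhammer (real CARD('d) / 2) m / fact m * (icov r r') ^ (2 * m) *
      ((icov r r + \<epsilon>) * (icov r' r' + \<delta>)) powr (- (real CARD('d) / 2 + real m)))"

lemma local_kernel_inner:
  assumes "\<epsilon> > 0" "\<delta> > 0"
  shows "(\<integral>\<omega>. local_kernel \<epsilon> r \<omega> * local_kernel \<delta> r' \<omega> \<partial>M) = full_kernel \<epsilon> \<delta> r r'"
proof -
  let ?a = "real CARD('d) / 2" and ?c = "(2 * pi) powr (- (real CARD('d) / 2))"
  let ?D = "(1 + 1 / \<epsilon> * icov r r) * (1 + 1 / \<delta> * icov r' r') - 1 / \<epsilon> * (1 / \<delta>) * (icov r r')\<^sup>2"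
  have e: "\<epsilon> * \<delta> * ?D = (icov r r + \<epsilon>) * (icov r' r' + \<delta>) - (icov r r')\<^sup>2"
    using assms by (simp add: field_simps)
  have "(\<integral>\<omega>. local_kernel \<epsilon> r \<omega> * local_kernel \<delta> r' \<omega> \<partial>M) =
    (\<integral>\<omega>. (?c\<^sup>2 * (\<epsilon> powr (- ?a) * \<delta> powr (- ?a))) * (exp (- (1 / \<epsilon> * half_sqnorm (increment r) \<omega>)) *
      exp (- (1 / \<delta> * half_sqnorm (increment r') \<omega>))) \<partial>M)"
    by (intro Bochner_Integration.integral_cong refl)
      (simp only: local_kernel_eq[OF assms(1)] local_kernel_eq[OF assms(2)] power2_eq_square mult_ac)
  also have "\<dots> = ?c\<^sup>2 * (\<epsilon> powr (- ?a) * \<delta> powr (- ?a)) * ?D powr (- ?a)"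
    unfolding integral_mult_right_zero
    by (subst damped_twice[OF increment_functional increment_functional]) (use assms in auto)
  also have "\<dots> = ?c\<^sup>2 * (\<epsilon> * \<delta> * ?D) powr (- ?a)"
  proof -
    have "0 < \<epsilon> * \<delta> * ?D" unfolding e using icov_square_less[OF assms, of r r'] by simp
    then have "0 < ?D" using assms by (rule zero_less_mult_pos[OF _ mult_pos_pos])
    then have "(\<epsilon> * \<delta> * ?D) powr (- ?a) = (\<epsilon> powr (- ?a) * \<delta> powr (- ?a)) * ?D powr (- ?a)"
      using assms by (simp only: powr_mult)
    then show ?thesis by (simp only: mult.assoc)
  qed
  finally show ?thesis unfolding full_kernel_def e .
qed

lemma local_kernel_chaos_density_inner:
  assumes \<epsilon>: "\<epsilon> > 0" and \<delta>: "\<delta> > 0"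
  shows "(\<integral>\<omega>. local_kernel \<delta> r' \<omega> * chaos_density m \<epsilon> r \<omega> \<partial>M) = chaos_kernel m \<epsilon> \<delta> r r'"
proof -
  let ?a = "real CARD('d) / 2" and ?c = "(2 * pi) powr (- (real CARD('d) / 2))"
  let ?b = "pochhammer ?a m / fact m"
  let ?S = "icov r r + \<epsilon>" and ?S' = "icov r' r' + \<delta>"
  have S: "?S > 0" "?S' > 0" using assms cov_nonneg by (auto simp: add_nonneg_pos)
  have "(\<integral>\<omega>. local_kernel \<delta> r' \<omega> * chaos_density m \<epsilon> r \<omega> \<partial>M) =
    (\<integral>\<omega>. (?c\<^sup>2 * (?b * (\<delta> powr (- ?a) * ?S powr (- (?a + real m))))) * (exp (- (1 / \<delta> * half_sqnorm (increment r') \<omega>)) *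
      laguerre ?a m (icov r r) (half_sqnorm (increment r) \<omega>)) \<partial>M)"
    by (intro Bochner_Integration.integral_cong refl)
      (simp only: local_kernel_eq[OF \<delta>] chaos_density_def power2_eq_square mult_ac)
  also have "\<dots> = ?c\<^sup>2 * (?b * (\<delta> powr (- ?a) * ?S powr (- (?a + real m)))) *
      ((1 + 1 / \<delta> * icov r' r') powr (- ?a) * (1 / \<delta> * (icov r r')\<^sup>2 / (1 + 1 / \<delta> * icov r' r')) ^ m)"
    unfolding integral_mult_right_zero
    by (subst damped_laguerre[OF increment_functional increment_functional]) (use \<delta> in auto)
  also have "1 / \<delta> * (icov r r')\<^sup>2 / (1 + 1 / \<delta> * icov r' r') = (icov r r')\<^sup>2 * (1 / ?S')"
    using \<delta> by (simp add: field_simps)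
  also have "?c\<^sup>2 * (?b * (\<delta> powr (- ?a) * ?S powr (- (?a + real m)))) *
      ((1 + 1 / \<delta> * icov r' r') powr (- ?a) * ((icov r r')\<^sup>2 * (1 / ?S')) ^ m) =
      ?c\<^sup>2 * (?b * (icov r r') ^ (2 * m) * (?S powr (- (?a + real m)) *
        ((1 / ?S') ^ m * (\<delta> powr (- ?a) * (1 + 1 / \<delta> * icov r' r') powr (- ?a)))))"
    unfolding power_mult[of "icov r r'" 2 m] power_mult_distrib by (simp only: mult_ac)
  also have "\<delta> powr (- ?a) * (1 + 1 / \<delta> * icov r' r') powr (- ?a) = ?S' powr (- ?a)"
  proof -
    have "\<delta> * (1 + 1 / \<delta> * icov r' r') = ?S'" using \<delta> by (simp add: field_simps)
    moreover have "0 < 1 + 1 / \<delta> * icov r' r'" using \<delta> cov_nonneg[of "increment r'"] by (simp add: add_pos_nonneg)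
    ultimately show ?thesis using \<delta> by (simp only: powr_mult[symmetric])
  qed
  also have "(1 / ?S') ^ m * ?S' powr (- ?a) = ?S' powr (- (?a + real m))"
    by (rule powr_neg_add_nat[OF S(2), symmetric])
  also have "?S powr (- (?a + real m)) * ?S' powr (- (?a + real m)) = (?S * ?S') powr (- (?a + real m))"
    using S by (simp only: powr_mult)
  finally show ?thesis unfolding chaos_kernel_def .
qed

lemma chaos_density_inner:
  assumes \<epsilon>: "\<epsilon> > 0" and \<delta>: "\<delta> > 0"
  shows "(\<integral>\<omega>. chaos_density m \<epsilon> r \<omega> * chaos_density m \<delta> r' \<omega> \<partial>M) = chaos_kernel m \<epsilon> \<delta> r r'"
proof -
  let ?a = "real CARD('d) / 2" and ?c = "(2 * pi) powr (- (real CARD('d) / 2))"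
  let ?b = "pochhammer ?a m / fact m"
  let ?S = "icov r r + \<epsilon>" and ?S' = "icov r' r' + \<delta>"
  have S: "?S > 0" "?S' > 0" using assms cov_nonneg by (auto simp: add_nonneg_pos)
  have b: "?b > 0" by (simp add: pochhammer_pos)
  have "(\<integral>\<omega>. chaos_density m \<epsilon> r \<omega> * chaos_density m \<delta> r' \<omega> \<partial>M) =
    (\<integral>\<omega>. (?c\<^sup>2 * (?b\<^sup>2 * (?S powr (- (?a + real m)) * ?S' powr (- (?a + real m))))) *
      (laguerre ?a m (icov r r) (half_sqnorm (increment r) \<omega>) *
      laguerre ?a m (icov r' r') (half_sqnorm (increment r') \<omega>)) \<partial>M)"
    by (intro Bochner_Integration.integral_cong refl)
      (simp only: chaos_density_def power2_eq_square mult_ac)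
  also have "\<dots> = ?c\<^sup>2 * (?b\<^sup>2 * (?S powr (- (?a + real m)) * ?S' powr (- (?a + real m)))) *
      ((icov r r') ^ (2 * m) * fact m / pochhammer ?a m)"
    unfolding integral_mult_right_zero laguerre_inner[OF increment_functional increment_functional] ..
  also have "(icov r r') ^ (2 * m) * fact m / pochhammer ?a m = (icov r r') ^ (2 * m) / ?b"
    by simp
  also have "?S powr (- (?a + real m)) * ?S' powr (- (?a + real m)) = (?S * ?S') powr (- (?a + real m))"
    using S by (simp only: powr_mult)
  also have "?c\<^sup>2 * (?b\<^sup>2 * (?S * ?S') powr (- (?a + real m))) * ((icov r r') ^ (2 * m) / ?b) =
      ?c\<^sup>2 * ((?b\<^sup>2 / ?b) * (icov r r') ^ (2 * m) * (?S * ?S') powr (- (?a + real m)))"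
    by (simp only: divide_inverse mult_ac)
  also have "?b\<^sup>2 / ?b = ?b" using b by (simp only: power2_eq_square) simp
  finally show ?thesis unfolding chaos_kernel_def .
qed

lemma chaos_kernel_sums:
  assumes "\<epsilon> > 0" "\<delta> > 0"
  shows "(\<lambda>m. chaos_kernel m \<epsilon> \<delta> r r') sums full_kernel \<epsilon> \<delta> r r'"
  unfolding chaos_kernel_def full_kernel_def
  by (intro sums_mult kernel_series(1) icov_square_less assms)

text \<open>
  The weight \<open>m\<close> costs one further power of the determinant, which is what shifts the threshold for
  \<open>Q\<close> from \<open>d\<close> to \<open>d + 2\<close>.
\<close>

lemma chaos_kernel_weighted_sums:
  assumes "\<epsilon> > 0" "\<delta> > 0"
  shows "(\<lambda>m. real m * chaos_kernel m \<epsilon> \<delta> r r') sums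
    (((2 * pi) powr (- (real CARD('d) / 2)))\<^sup>2 * (real CARD('d) / 2 * (icov r r')\<^sup>2 *
      ((icov r r + \<epsilon>) * (icov r' r' + \<delta>) - (icov r r')\<^sup>2) powr (- (real CARD('d) / 2 + 1))))"
proof -
  let ?P = "(icov r r + \<epsilon>) * (icov r' r' + \<delta>)" and ?c = "(2 * pi) powr (- (real CARD('d) / 2))"
  let ?t = "\<lambda>m. pochhammer (real CARD('d) / 2) m / fact m * (icov r r') ^ (2 * m) * ?P powr (- (real CARD('d) / 2 + real m))"
  have "real m * chaos_kernel m \<epsilon> \<delta> r r' = ?c\<^sup>2 * (real m * ?t m)" for m
    unfolding chaos_kernel_def by (rule mult.left_commute)
  moreover have "(\<lambda>m. ?c\<^sup>2 * (real m * ?t m)) sums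
      (?c\<^sup>2 * (real CARD('d) / 2 * (icov r r')\<^sup>2 * (?P - (icov r r')\<^sup>2) powr (- (real CARD('d) / 2 + 1))))"
    by (rule sums_mult[OF kernel_series(2)[OF icov_square_less[OF assms]]])
  ultimately show ?thesis by (simp only:)
qed

lemma chaos_kernel_nonneg: "chaos_kernel m \<epsilon> \<delta> r r' \<ge> 0"
proof -
  have "0 \<le> (icov r r') ^ (2 * m)" by simp
  moreover have "0 < pochhammer (real CARD('d) / 2) m" by (simp add: pochhammer_pos)
  ultimately show ?thesis unfolding chaos_kernel_def by simp
qed

lemma full_kernel_nonneg: "full_kernel \<epsilon> \<delta> r r' \<ge> 0"
  unfolding full_kernel_def by simp

lemma full_kernel_antimono:
  assumes "0 < \<epsilon>'" "\<epsilon>' \<le> \<epsilon>" "0 < \<delta>'" "\<delta>' \<le> \<delta>"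
  shows "full_kernel \<epsilon> \<delta> r r' \<le> full_kernel \<epsilon>' \<delta>' r r'"
  unfolding full_kernel_def
proof (intro mult_left_mono powr_mono2')
  show "0 < (icov r r + \<epsilon>') * (icov r' r' + \<delta>') - (icov r r')\<^sup>2"
    using icov_square_less[of \<epsilon>' \<delta>' r r'] assms by simp
  show "(icov r r + \<epsilon>') * (icov r' r' + \<delta>') - (icov r r')\<^sup>2 \<le> (icov r r + \<epsilon>) * (icov r' r' + \<delta>) - (icov r r')\<^sup>2"
    using assms cov_nonneg by (intro diff_right_mono mult_mono add_mono) (auto simp: add_nonneg_nonneg)
qed auto

lemma chaos_kernel_antimono:
  assumes "0 < \<epsilon>'" "\<epsilon>' \<le> \<epsilon>" "0 < \<delta>'" "\<delta>' \<le> \<delta>"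
  shows "chaos_kernel m \<epsilon> \<delta> r r' \<le> chaos_kernel m \<epsilon>' \<delta>' r r'"
  unfolding chaos_kernel_def
proof (intro mult_left_mono powr_mono2')
  show "0 < (icov r r + \<epsilon>') * (icov r' r' + \<delta>')"
    using assms cov_nonneg by (intro mult_pos_pos) (auto simp: add_nonneg_pos)
  show "(icov r r + \<epsilon>') * (icov r' r' + \<delta>') \<le> (icov r r + \<epsilon>) * (icov r' r' + \<delta>)"
    using assms cov_nonneg by (intro mult_mono add_mono) (auto simp: add_nonneg_nonneg)
  have "0 < pochhammer (real CARD('d) / 2) m" by (simp add: pochhammer_pos)
  then show "0 \<le> pochhammer (real CARD('d) / 2) m / fact m * (icov r r') ^ (2 * m)" by simp
qed auto

end

section \<open>Approximations of the local time and their energies\<close>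

lemma laguerre_joint_measurable:
  assumes [measurable]: "f \<in> borel_measurable N" "g \<in> borel_measurable N"
  shows "(\<lambda>x. laguerre a m (f x) (g x)) \<in> borel_measurable N"
  unfolding laguerre_def by measurable

locale cube_field = gaussian_copies M M0 X X0
  for M :: "'w measure" and M0 :: "'v measure"
    and X :: "real ^ 'n \<Rightarrow> 'w \<Rightarrow> real ^ 'd" and X0 :: "real ^ 'n \<Rightarrow> 'v \<Rightarrow> real" +
  assumes cont_cov: "continuous_covariance M0 X0"
    and paths: "\<And>\<omega>. \<omega> \<in> space M \<Longrightarrow> continuous_on (cbox 0 1) (\<lambda>t. X t \<omega>)"
begin

abbreviation pairs :: "((real ^ 'n) \<times> (real ^ 'n)) measure" where
  "pairs \<equiv> cube_measure \<Otimes>\<^sub>M cube_measure"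

lemma space_pairs: "space pairs = cbox 0 1 \<times> cbox 0 1"
  by (simp add: space_pair_measure space_cube_measure)

lemma pair_prob_space_cubes: "pair_prob_space (cube_measure :: (real ^ 'n) measure) (cube_measure :: (real ^ 'n) measure)"
  by (intro pair_prob_space.intro pair_sigma_finite.intro prob_space_imp_sigma_finite prob_space_cube_measure)

lemma prob_space_pairs: "prob_space pairs"
proof -
  interpret C: pair_prob_space "cube_measure :: (real ^ 'n) measure" "cube_measure :: (real ^ 'n) measure"
    by (rule pair_prob_space_cubes)
  show ?thesis by (rule C.P.prob_space_axioms)
qed

sublocale process: pair_prob_space pairs M
  by (intro pair_prob_space.intro pair_sigma_finite.intro prob_space_imp_sigma_finite
      prob_space_pairs prob_space_axioms)

sublocale double: pair_prob_space pairs pairs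
  by (intro pair_prob_space.intro pair_sigma_finite.intro prob_space_imp_sigma_finite prob_space_pairs)

lemma id_measurable_pairs: "(\<lambda>r. r) \<in> pairs \<rightarrow>\<^sub>M borel"
proof -
  have "(\<lambda>r. (fst r, snd r)) \<in> pairs \<rightarrow>\<^sub>M borel \<Otimes>\<^sub>M borel"
    by (intro measurable_Pair measurable_compose[OF measurable_fst id_measurable_cube_measure]
        measurable_compose[OF measurable_snd id_measurable_cube_measure])
  then show ?thesis by (simp add: borel_prod)
qed

lemma increments_cov_continuous: "continuous_on UNIV (\<lambda>(r, r'). icov r r')"
proof -
  let ?R = "\<lambda>(s, t). \<integral>\<omega>. X0 s \<omega> * X0 t \<omega> \<partial>M0"
  have R: "continuous_on UNIV ?R" using cont_cov unfolding continuous_covariance_def .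
  have ev: "cov (\<lambda>x. x s) (\<lambda>x. x t) = ?R (s, t)" for s t by (simp add: cov_def)
  have diff: "cov (\<lambda>x. f x - g x) h = cov f h - cov g h"
    if "f \<in> linear_functionals" "g \<in> linear_functionals" "h \<in> linear_functionals" for f g h
    using cov_combination[OF that, of 1 "-1"] by simp
  have "icov r r' = ?R (fst r', fst r) - ?R (snd r', fst r) - (?R (fst r', snd r) - ?R (snd r', snd r))" for r r'
  proof -
    have *: "cov (\<lambda>x. x s) (increment r') = ?R (fst r', s) - ?R (snd r', s)" for s
    proof -
      have "cov (\<lambda>x. x s) (increment r') = cov (increment r') (\<lambda>x. x s)" by (rule cov_commute)
      also have "\<dots> = cov (\<lambda>x. x (fst r')) (\<lambda>x. x s) - cov (\<lambda>x. x (snd r')) (\<lambda>x. x s)"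
        unfolding increment_def by (intro diff linear_functionals_eval)
      finally show ?thesis by (simp only: ev)
    qed
    have "icov r r' = cov (\<lambda>x. x (fst r)) (increment r') - cov (\<lambda>x. x (snd r)) (increment r')"
      unfolding increment_def[of r] by (intro diff linear_functionals_eval increment_functional)
    then show ?thesis by (simp only: *)
  qed
  moreover have "continuous_on UNIV (\<lambda>z :: ((real ^ 'n) \<times> (real ^ 'n)) \<times> ((real ^ 'n) \<times> (real ^ 'n)).
      ?R (fst (snd z), fst (fst z)) - ?R (snd (snd z), fst (fst z)) -
      (?R (fst (snd z), snd (fst z)) - ?R (snd (snd z), snd (fst z))))"
    by (intro continuous_on_diff continuous_on_compose2[OF R]) (auto intro!: continuous_intros)
  ultimately show ?thesis by (simp add: split_beta')
qed

lemma icov_measurable: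
  assumes "f \<in> borel_measurable N" "g \<in> borel_measurable N"
  shows "(\<lambda>x. icov (f x) (g x)) \<in> borel_measurable N"
proof -
  have "(\<lambda>(r, r'). icov r r') \<in> borel_measurable borel"
    by (rule borel_measurable_continuous_onI[OF increments_cov_continuous])
  then have "(\<lambda>(r, r'). icov r r') \<in> borel_measurable (borel \<Otimes>\<^sub>M borel)" by (simp add: borel_prod)
  from measurable_compose[OF measurable_Pair[OF assms] this] show ?thesis by simp
qed

lemma icov_diagonal_measurable [measurable]: "(\<lambda>r. icov r r) \<in> borel_measurable pairs"
  by (rule icov_measurable[OF id_measurable_pairs id_measurable_pairs])

lemma icov_double_measurable [measurable]: "(\<lambda>z. icov (fst z) (snd z)) \<in> borel_measurable (pairs \<Otimes>\<^sub>M pairs)"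
  by (rule icov_measurable[OF measurable_compose[OF measurable_fst id_measurable_pairs]
        measurable_compose[OF measurable_snd id_measurable_pairs]])

text \<open>
  Path continuity makes the field jointly measurable on the cube, as the limit of its values at the
  grid points.
\<close>

lemma X_jointly_measurable: "(\<lambda>z. X (fst z) (snd z)) \<in> borel_measurable (cube_measure \<Otimes>\<^sub>M M)"
proof (rule borel_measurable_LIMSEQ_metric)
  fix k
  let ?I = "grid k ` cbox 0 (1 :: real ^ 'n)"
  have I: "countable ?I" by (rule countable_finite[OF finite_grid_image])
  have "grid k \<in> cube_measure \<rightarrow>\<^sub>M count_space ?I"
    unfolding measurable_count_space_eq_countable[OF I]
  proof (intro conjI ballI)
    show "grid k \<in> space cube_measure \<rightarrow> ?I" by (auto simp: space_cube_measure)
    fix a :: "real ^ 'n"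
    have "{a} \<in> sets borel" by simp
    from measurable_sets[OF measurable_cube_measure[OF grid_measurable] this]
    show "grid k -` {a} \<inter> space cube_measure \<in> sets cube_measure" .
  qed
  from measurable_compose[OF measurable_fst this]
  have g: "(\<lambda>z. grid k (fst z)) \<in> cube_measure \<Otimes>\<^sub>M M \<rightarrow>\<^sub>M count_space ?I" .
  have f: "(\<lambda>z. X p (snd z)) \<in> borel_measurable (cube_measure \<Otimes>\<^sub>M M)" for p
    by (rule measurable_compose[OF measurable_snd X_measurable])
  show "(\<lambda>z. X (grid k (fst z)) (snd z)) \<in> borel_measurable (cube_measure \<Otimes>\<^sub>M M)"
    by (rule measurable_compose_countable'[where f = "\<lambda>p z. X p (snd z)", OF f g I])
next
  fix z :: "(real ^ 'n) \<times> 'w" assume "z \<in> space (cube_measure \<Otimes>\<^sub>M M)"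
  then have z: "fst z \<in> cbox 0 1" "snd z \<in> space M" by (auto simp: space_pair_measure space_cube_measure)
  show "(\<lambda>k. X (grid k (fst z)) (snd z)) \<longlonglongrightarrow> X (fst z) (snd z)"
    by (rule continuous_on_tendsto_compose[OF paths[OF z(2)] grid_tendsto z(1)])
      (simp add: grid_in_cube[OF z(1)])
qed

lemma half_sqnorm_jointly_measurable [measurable]:
  "(\<lambda>z. half_sqnorm (increment (fst z)) (snd z)) \<in> borel_measurable (pairs \<Otimes>\<^sub>M M)"
proof -
  have 1: "(\<lambda>z. (fst (fst z), snd z)) \<in> pairs \<Otimes>\<^sub>M M \<rightarrow>\<^sub>M cube_measure \<Otimes>\<^sub>M M" by measurable
  have 2: "(\<lambda>z. (snd (fst z), snd z)) \<in> pairs \<Otimes>\<^sub>M M \<rightarrow>\<^sub>M cube_measure \<Otimes>\<^sub>M M" by measurable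
  have [measurable]: "(\<lambda>z. X (fst (fst z)) (snd z)) \<in> borel_measurable (pairs \<Otimes>\<^sub>M M)"
    "(\<lambda>z. X (snd (fst z)) (snd z)) \<in> borel_measurable (pairs \<Otimes>\<^sub>M M)"
    using measurable_compose[OF 1 X_jointly_measurable] measurable_compose[OF 2 X_jointly_measurable] by simp_all
  show ?thesis unfolding half_sqnorm_increment by measurable
qed

lemma local_kernel_jointly_measurable:
  "\<epsilon> > 0 \<Longrightarrow> (\<lambda>(r, \<omega>). local_kernel \<epsilon> r \<omega>) \<in> borel_measurable (pairs \<Otimes>\<^sub>M M)"
  by (simp add: local_kernel_eq split_beta')

lemma chaos_density_jointly_measurable:
  "(\<lambda>(r, \<omega>). chaos_density m \<epsilon> r \<omega>) \<in> borel_measurable (pairs \<Otimes>\<^sub>M M)"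
proof -
  have [measurable]: "(\<lambda>z. icov (fst z) (fst z)) \<in> borel_measurable (pairs \<Otimes>\<^sub>M M)"
    by (rule measurable_compose[OF measurable_fst icov_diagonal_measurable])
  have [measurable]: "(\<lambda>z. laguerre (real CARD('d) / 2) m (icov (fst z) (fst z)) (half_sqnorm (increment (fst z)) (snd z)))
      \<in> borel_measurable (pairs \<Otimes>\<^sub>M M)"
    by (intro laguerre_joint_measurable) measurable
  show ?thesis unfolding chaos_density_def split_beta' by measurable
qed

text \<open>
  The value of \<open>full_kernel\<close> when both increments vanish, which is its maximum.
\<close>

definition kernel_bound :: "real \<Rightarrow> real \<Rightarrow> real" where
  "kernel_bound \<epsilon> \<delta> = ((2 * pi) powr (- (real CARD('d) / 2)))\<^sup>2 * (\<epsilon> * \<delta>) powr (- (real CARD('d) / 2))"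

lemma full_kernel_le:
  assumes "\<epsilon> > 0" "\<delta> > 0" shows "full_kernel \<epsilon> \<delta> r r' \<le> kernel_bound \<epsilon> \<delta>"
  unfolding full_kernel_def kernel_bound_def
proof (intro mult_left_mono powr_mono2')
  have "0 \<le> icov r r * \<delta>" "0 \<le> icov r' r' * \<epsilon>" using assms cov_nonneg by auto
  then show "\<epsilon> * \<delta> \<le> (icov r r + \<epsilon>) * (icov r' r' + \<delta>) - (icov r r')\<^sup>2"
    using icov_Cauchy_Schwarz[of r r'] by (simp add: algebra_simps)
qed (use assms in auto)

text \<open>
  All terms of the series are nonnegative, since only even powers of the covariance occur.
\<close>

lemma chaos_kernel_le_full:
  assumes "\<epsilon> > 0" "\<delta> > 0" shows "chaos_kernel m \<epsilon> \<delta> r r' \<le> full_kernel \<epsilon> \<delta> r r'"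
proof -
  have "sum (\<lambda>m. chaos_kernel m \<epsilon> \<delta> r r') {m} \<le> (\<Sum>m. chaos_kernel m \<epsilon> \<delta> r r')"
    using chaos_kernel_sums[OF assms, of r r'] by (intro sum_le_suminf) (auto simp: sums_iff chaos_kernel_nonneg)
  then show ?thesis using chaos_kernel_sums[OF assms, of r r'] by (simp add: sums_iff)
qed

lemma local_kernel_process:
  assumes "\<epsilon> > 0" shows "second_order_process pairs M (local_kernel \<epsilon>) (kernel_bound \<epsilon> \<epsilon>)"
proof unfold_locales
  show "(\<lambda>(r, \<omega>). local_kernel \<epsilon> r \<omega>) \<in> borel_measurable (pairs \<Otimes>\<^sub>M M)"
    by (rule local_kernel_jointly_measurable[OF assms])
  show "local_kernel \<epsilon> r \<in> L2 M" for r
    by (rule finite_moments_L2[OF local_kernel_finite_moments[OF assms]])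
  show "(\<integral>\<omega>. (local_kernel \<epsilon> r \<omega>)\<^sup>2 \<partial>M) \<le> kernel_bound \<epsilon> \<epsilon>" for r
    unfolding power2_eq_square local_kernel_inner[OF assms assms] by (rule full_kernel_le[OF assms assms])
qed

lemma chaos_density_process:
  assumes "\<epsilon> > 0" shows "second_order_process pairs M (chaos_density m \<epsilon>) (kernel_bound \<epsilon> \<epsilon>)"
proof unfold_locales
  show "(\<lambda>(r, \<omega>). chaos_density m \<epsilon> r \<omega>) \<in> borel_measurable (pairs \<Otimes>\<^sub>M M)"
    by (rule chaos_density_jointly_measurable)
  show "chaos_density m \<epsilon> r \<in> L2 M" for r
    by (rule finite_moments_L2[OF chaos_density_finite_moments])
  show "(\<integral>\<omega>. (chaos_density m \<epsilon> r \<omega>)\<^sup>2 \<partial>M) \<le> kernel_bound \<epsilon> \<epsilon>" for r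
    unfolding power2_eq_square chaos_density_inner[OF assms assms]
    by (rule order_trans[OF chaos_kernel_le_full[OF assms assms] full_kernel_le[OF assms assms]])
qed

definition approx_time :: "real \<Rightarrow> 'w \<Rightarrow> real" where
  "approx_time \<epsilon> \<omega> = (\<integral>r. local_kernel \<epsilon> r \<omega> \<partial>pairs)"

definition approx_component :: "nat \<Rightarrow> real \<Rightarrow> 'w \<Rightarrow> real" where
  "approx_component m \<epsilon> \<omega> = (\<integral>r. chaos_density m \<epsilon> r \<omega> \<partial>pairs)"

lemma approx_time_L2: "\<epsilon> > 0 \<Longrightarrow> approx_time \<epsilon> \<in> L2 M"
  using second_order_process.integral_L2[OF local_kernel_process] by (simp add: approx_time_def[abs_def])

lemma approx_component_L2: "\<epsilon> > 0 \<Longrightarrow> approx_component m \<epsilon> \<in> L2 M"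
  using second_order_process.integral_L2[OF chaos_density_process] by (simp add: approx_component_def[abs_def])

definition total_energy :: "real \<Rightarrow> real \<Rightarrow> real" where
  "total_energy \<epsilon> \<delta> = (\<integral>z. full_kernel \<epsilon> \<delta> (fst z) (snd z) \<partial>(pairs \<Otimes>\<^sub>M pairs))"

definition chaos_energy :: "nat \<Rightarrow> real \<Rightarrow> real \<Rightarrow> real" where
  "chaos_energy m \<epsilon> \<delta> = (\<integral>z. chaos_kernel m \<epsilon> \<delta> (fst z) (snd z) \<partial>(pairs \<Otimes>\<^sub>M pairs))"

lemma full_kernel_measurable [measurable]:
  "(\<lambda>z. full_kernel \<epsilon> \<delta> (fst z) (snd z)) \<in> borel_measurable (pairs \<Otimes>\<^sub>M pairs)"
  unfolding full_kernel_def by measurable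

lemma chaos_kernel_measurable [measurable]:
  "(\<lambda>z. chaos_kernel m \<epsilon> \<delta> (fst z) (snd z)) \<in> borel_measurable (pairs \<Otimes>\<^sub>M pairs)"
  unfolding chaos_kernel_def by measurable

lemma full_kernel_integrable:
  assumes "\<epsilon> > 0" "\<delta> > 0"
  shows "integrable (pairs \<Otimes>\<^sub>M pairs) (\<lambda>z. full_kernel \<epsilon> \<delta> (fst z) (snd z))"
  using full_kernel_le[OF assms]
  by (intro double.P.integrable_const_bound[where B = "kernel_bound \<epsilon> \<delta>"] AE_I2 full_kernel_measurable)
    (simp add: full_kernel_nonneg)

lemma chaos_kernel_integrable:
  assumes "\<epsilon> > 0" "\<delta> > 0"
  shows "integrable (pairs \<Otimes>\<^sub>M pairs) (\<lambda>z. chaos_kernel m \<epsilon> \<delta> (fst z) (snd z))"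
proof (rule Bochner_Integration.integrable_bound[OF full_kernel_integrable[OF assms]])
  show "AE z in pairs \<Otimes>\<^sub>M pairs. norm (chaos_kernel m \<epsilon> \<delta> (fst z) (snd z)) \<le> norm (full_kernel \<epsilon> \<delta> (fst z) (snd z))"
    using chaos_kernel_le_full[OF assms] by (simp add: chaos_kernel_nonneg full_kernel_nonneg)
qed measurable

lemma approx_time_inner:
  assumes "\<epsilon> > 0" "\<delta> > 0"
  shows "(\<integral>\<omega>. approx_time \<epsilon> \<omega> * approx_time \<delta> \<omega> \<partial>M) = total_energy \<epsilon> \<delta>"
proof -
  interpret E: second_order_process pairs M "local_kernel \<epsilon>" "kernel_bound \<epsilon> \<epsilon>" by (rule local_kernel_process[OF assms(1)])
  interpret D: second_order_process pairs M "local_kernel \<delta>" "kernel_bound \<delta> \<delta>" by (rule local_kernel_process[OF assms(2)])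
  have "(\<integral>\<omega>. approx_time \<epsilon> \<omega> * approx_time \<delta> \<omega> \<partial>M) = (\<integral>\<omega>. approx_time \<delta> \<omega> * (\<integral>r. local_kernel \<epsilon> r \<omega> \<partial>pairs) \<partial>M)"
    by (simp add: approx_time_def mult.commute)
  also have "\<dots> = (\<integral>r. \<integral>\<omega>. approx_time \<delta> \<omega> * local_kernel \<epsilon> r \<omega> \<partial>M \<partial>pairs)"
    by (rule E.integral_inner[OF approx_time_L2[OF assms(2)]])
  also have "\<dots> = (\<integral>r. \<integral>r'. full_kernel \<epsilon> \<delta> r r' \<partial>pairs \<partial>pairs)"
  proof (rule Bochner_Integration.integral_cong[OF refl])
    fix r
    have "(\<integral>\<omega>. approx_time \<delta> \<omega> * local_kernel \<epsilon> r \<omega> \<partial>M) = (\<integral>\<omega>. local_kernel \<epsilon> r \<omega> * (\<integral>r'. local_kernel \<delta> r' \<omega> \<partial>pairs) \<partial>M)"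
      by (simp add: approx_time_def mult.commute)
    also have "\<dots> = (\<integral>r'. \<integral>\<omega>. local_kernel \<epsilon> r \<omega> * local_kernel \<delta> r' \<omega> \<partial>M \<partial>pairs)"
      by (rule D.integral_inner[OF finite_moments_L2[OF local_kernel_finite_moments[OF assms(1)]]])
    finally show "(\<integral>\<omega>. approx_time \<delta> \<omega> * local_kernel \<epsilon> r \<omega> \<partial>M) = (\<integral>r'. full_kernel \<epsilon> \<delta> r r' \<partial>pairs)"
      by (simp only: local_kernel_inner[OF assms])
  qed
  also have "\<dots> = total_energy \<epsilon> \<delta>"
    unfolding total_energy_def using double.integral_fst'[OF full_kernel_integrable[OF assms]] by simp
  finally show ?thesis .
qed

lemma approx_time_component_inner:
  assumes "\<epsilon> > 0" "\<delta> > 0"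
  shows "(\<integral>\<omega>. approx_time \<delta> \<omega> * approx_component m \<epsilon> \<omega> \<partial>M) = chaos_energy m \<epsilon> \<delta>"
proof -
  interpret E: second_order_process pairs M "chaos_density m \<epsilon>" "kernel_bound \<epsilon> \<epsilon>" by (rule chaos_density_process[OF assms(1)])
  interpret D: second_order_process pairs M "local_kernel \<delta>" "kernel_bound \<delta> \<delta>" by (rule local_kernel_process[OF assms(2)])
  have "(\<integral>\<omega>. approx_time \<delta> \<omega> * approx_component m \<epsilon> \<omega> \<partial>M) = (\<integral>r. \<integral>\<omega>. approx_time \<delta> \<omega> * chaos_density m \<epsilon> r \<omega> \<partial>M \<partial>pairs)"
    unfolding approx_component_def by (rule E.integral_inner[OF approx_time_L2[OF assms(2)]])
  also have "\<dots> = (\<integral>r. \<integral>r'. chaos_kernel m \<epsilon> \<delta> r r' \<partial>pairs \<partial>pairs)"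
  proof (rule Bochner_Integration.integral_cong[OF refl])
    fix r
    have "(\<integral>\<omega>. approx_time \<delta> \<omega> * chaos_density m \<epsilon> r \<omega> \<partial>M) = (\<integral>\<omega>. chaos_density m \<epsilon> r \<omega> * (\<integral>r'. local_kernel \<delta> r' \<omega> \<partial>pairs) \<partial>M)"
      by (simp add: approx_time_def mult.commute)
    also have "\<dots> = (\<integral>r'. \<integral>\<omega>. chaos_density m \<epsilon> r \<omega> * local_kernel \<delta> r' \<omega> \<partial>M \<partial>pairs)"
      by (rule D.integral_inner[OF finite_moments_L2[OF chaos_density_finite_moments]])
    finally show "(\<integral>\<omega>. approx_time \<delta> \<omega> * chaos_density m \<epsilon> r \<omega> \<partial>M) = (\<integral>r'. chaos_kernel m \<epsilon> \<delta> r r' \<partial>pairs)"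
      by (simp only: mult.commute[of "chaos_density m \<epsilon> r _"] local_kernel_chaos_density_inner[OF assms])
  qed
  also have "\<dots> = chaos_energy m \<epsilon> \<delta>"
    unfolding chaos_energy_def using double.integral_fst'[OF chaos_kernel_integrable[OF assms]] by simp
  finally show ?thesis .
qed

lemma approx_component_inner:
  assumes "\<epsilon> > 0" "\<delta> > 0"
  shows "(\<integral>\<omega>. approx_component m \<epsilon> \<omega> * approx_component m \<delta> \<omega> \<partial>M) = chaos_energy m \<epsilon> \<delta>"
proof -
  interpret E: second_order_process pairs M "chaos_density m \<epsilon>" "kernel_bound \<epsilon> \<epsilon>" by (rule chaos_density_process[OF assms(1)])
  interpret D: second_order_process pairs M "chaos_density m \<delta>" "kernel_bound \<delta> \<delta>" by (rule chaos_density_process[OF assms(2)])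
  have "(\<integral>\<omega>. approx_component m \<epsilon> \<omega> * approx_component m \<delta> \<omega> \<partial>M) = (\<integral>\<omega>. approx_component m \<delta> \<omega> * (\<integral>r. chaos_density m \<epsilon> r \<omega> \<partial>pairs) \<partial>M)"
    by (simp add: approx_component_def mult.commute)
  also have "\<dots> = (\<integral>r. \<integral>\<omega>. approx_component m \<delta> \<omega> * chaos_density m \<epsilon> r \<omega> \<partial>M \<partial>pairs)"
    by (rule E.integral_inner[OF approx_component_L2[OF assms(2)]])
  also have "\<dots> = (\<integral>r. \<integral>r'. chaos_kernel m \<epsilon> \<delta> r r' \<partial>pairs \<partial>pairs)"
  proof (rule Bochner_Integration.integral_cong[OF refl])
    fix r
    have "(\<integral>\<omega>. approx_component m \<delta> \<omega> * chaos_density m \<epsilon> r \<omega> \<partial>M) = (\<integral>\<omega>. chaos_density m \<epsilon> r \<omega> * (\<integral>r'. chaos_density m \<delta> r' \<omega> \<partial>pairs) \<partial>M)"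
      by (simp add: approx_component_def mult.commute)
    also have "\<dots> = (\<integral>r'. \<integral>\<omega>. chaos_density m \<epsilon> r \<omega> * chaos_density m \<delta> r' \<omega> \<partial>M \<partial>pairs)"
      by (rule D.integral_inner[OF finite_moments_L2[OF chaos_density_finite_moments]])
    finally show "(\<integral>\<omega>. approx_component m \<delta> \<omega> * chaos_density m \<epsilon> r \<omega> \<partial>M) = (\<integral>r'. chaos_kernel m \<epsilon> \<delta> r r' \<partial>pairs)"
      by (simp only: chaos_density_inner[OF assms])
  qed
  also have "\<dots> = chaos_energy m \<epsilon> \<delta>"
    unfolding chaos_energy_def using double.integral_fst'[OF chaos_kernel_integrable[OF assms]] by simp
  finally show ?thesis .
qed

lemma total_energy_antimono:
  assumes "0 < \<epsilon>'" "\<epsilon>' \<le> \<epsilon>" "0 < \<delta>'" "\<delta>' \<le> \<delta>"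
  shows "total_energy \<epsilon> \<delta> \<le> total_energy \<epsilon>' \<delta>'"
  unfolding total_energy_def using assms
  by (intro integral_mono full_kernel_integrable full_kernel_antimono) auto

lemma chaos_energy_antimono:
  assumes "0 < \<epsilon>'" "\<epsilon>' \<le> \<epsilon>" "0 < \<delta>'" "\<delta>' \<le> \<delta>"
  shows "chaos_energy m \<epsilon> \<delta> \<le> chaos_energy m \<epsilon>' \<delta>'"
  unfolding chaos_energy_def using assms
  by (intro integral_mono chaos_kernel_integrable chaos_kernel_antimono) auto

lemma chaos_energy_nonneg: "chaos_energy m \<epsilon> \<delta> \<ge> 0"
  unfolding chaos_energy_def by (intro Bochner_Integration.integral_nonneg chaos_kernel_nonneg)

lemma chaos_energy_sums:
  assumes "\<epsilon> > 0" "\<delta> > 0"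
  shows "(\<lambda>m. chaos_energy m \<epsilon> \<delta>) sums total_energy \<epsilon> \<delta>"
proof -
  have "(\<lambda>k. \<integral>z. (\<Sum>m<k. chaos_kernel m \<epsilon> \<delta> (fst z) (snd z)) \<partial>(pairs \<Otimes>\<^sub>M pairs)) \<longlonglongrightarrow> total_energy \<epsilon> \<delta>"
    unfolding total_energy_def
  proof (rule integral_dominated_convergence[where w = "\<lambda>z. full_kernel \<epsilon> \<delta> (fst z) (snd z)"])
    show "AE z in pairs \<Otimes>\<^sub>M pairs. (\<lambda>k. \<Sum>m<k. chaos_kernel m \<epsilon> \<delta> (fst z) (snd z)) \<longlonglongrightarrow> full_kernel \<epsilon> \<delta> (fst z) (snd z)"
      using chaos_kernel_sums[OF assms] by (simp add: sums_def)
    show "AE z in pairs \<Otimes>\<^sub>M pairs. norm (\<Sum>m<k. chaos_kernel m \<epsilon> \<delta> (fst z) (snd z)) \<le> full_kernel \<epsilon> \<delta> (fst z) (snd z)" for k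
    proof (rule AE_I2)
      fix z :: "((real ^ 'n) \<times> (real ^ 'n)) \<times> ((real ^ 'n) \<times> (real ^ 'n))"
      have "(\<Sum>m<k. chaos_kernel m \<epsilon> \<delta> (fst z) (snd z)) \<le> (\<Sum>m. chaos_kernel m \<epsilon> \<delta> (fst z) (snd z))"
        using chaos_kernel_sums[OF assms, of "fst z" "snd z"]
        by (intro sum_le_suminf) (auto simp: sums_iff chaos_kernel_nonneg)
      also have "\<dots> = full_kernel \<epsilon> \<delta> (fst z) (snd z)"
        using chaos_kernel_sums[OF assms, of "fst z" "snd z"] by (simp add: sums_iff)
      finally show "norm (\<Sum>m<k. chaos_kernel m \<epsilon> \<delta> (fst z) (snd z)) \<le> full_kernel \<epsilon> \<delta> (fst z) (snd z)"
        by (simp add: sum_nonneg chaos_kernel_nonneg)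
    qed
  qed (use full_kernel_integrable[OF assms] in measurable)
  moreover have "(\<integral>z. (\<Sum>m<k. chaos_kernel m \<epsilon> \<delta> (fst z) (snd z)) \<partial>(pairs \<Otimes>\<^sub>M pairs)) = (\<Sum>m<k. chaos_energy m \<epsilon> \<delta>)" for k
    unfolding chaos_energy_def by (intro Bochner_Integration.integral_sum chaos_kernel_integrable assms)
  ultimately show ?thesis by (simp add: sums_def)
qed

end

section \<open>The chaos components of the approximations\<close>

lemma field_polynomials_zero: "(\<lambda>\<omega>. 0) \<in> field_polynomials X n"
  unfolding field_polynomials_def by (intro CollectI exI[of _ "{}"]) auto

lemma field_polynomials_monomial:
  assumes "size q \<le> n" shows "(\<lambda>\<omega>. \<Prod>(t, i)\<in>#q. X t \<omega> $ i) \<in> field_polynomials X n"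
  unfolding field_polynomials_def
  using assms by (intro CollectI exI[of _ "{q}"] exI[of _ "\<lambda>_. 1"]) auto

lemma field_polynomials_scale:
  assumes "F \<in> field_polynomials X n" shows "(\<lambda>\<omega>. c * F \<omega>) \<in> field_polynomials X n"
proof -
  obtain S a where "finite S" "\<forall>m\<in>S. size m \<le> n" "F = (\<lambda>\<omega>. \<Sum>m\<in>S. a m * (\<Prod>(t, i)\<in>#m. X t \<omega> $ i))"
    using assms unfolding field_polynomials_def by blast
  then show ?thesis unfolding field_polynomials_def
    by (intro CollectI exI[of _ S] exI[of _ "\<lambda>m. c * a m"]) (auto simp: sum_distrib_left mult.assoc)
qed

lemma field_polynomials_add:
  assumes "F \<in> field_polynomials X n" "G \<in> field_polynomials X n"
  shows "(\<lambda>\<omega>. F \<omega> + G \<omega>) \<in> field_polynomials X n"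
proof -
  let ?p = "\<lambda>m \<omega>. \<Prod>(t, i)\<in>#m. X t \<omega> $ i"
  obtain S a where S: "finite S" "\<forall>m\<in>S. size m \<le> n" and F: "F = (\<lambda>\<omega>. \<Sum>m\<in>S. a m * ?p m \<omega>)"
    using assms(1) unfolding field_polynomials_def by blast
  obtain T b where T: "finite T" "\<forall>m\<in>T. size m \<le> n" and G: "G = (\<lambda>\<omega>. \<Sum>m\<in>T. b m * ?p m \<omega>)"
    using assms(2) unfolding field_polynomials_def by blast
  let ?a = "\<lambda>m. if m \<in> S then a m else 0" and ?b = "\<lambda>m. if m \<in> T then b m else 0"
  have "F \<omega> = (\<Sum>m\<in>S \<union> T. ?a m * ?p m \<omega>)" for \<omega>
    unfolding F using S T by (intro sum.mono_neutral_cong_left) auto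
  moreover have "G \<omega> = (\<Sum>m\<in>S \<union> T. ?b m * ?p m \<omega>)" for \<omega>
    unfolding G using S T by (intro sum.mono_neutral_cong_left) auto
  ultimately have "(\<lambda>\<omega>. F \<omega> + G \<omega>) = (\<lambda>\<omega>. \<Sum>m\<in>S \<union> T. (?a m + ?b m) * ?p m \<omega>)"
    by (simp only: sum.distrib[symmetric] distrib_right)
  moreover have "finite (S \<union> T)" "\<forall>m\<in>S \<union> T. size m \<le> n" using S T by auto
  ultimately show ?thesis unfolding field_polynomials_def by (intro CollectI exI conjI)
qed

lemma field_polynomials_sum:
  "(\<And>i. i \<in> I \<Longrightarrow> F i \<in> field_polynomials X n) \<Longrightarrow> (\<lambda>\<omega>. \<Sum>i\<in>I. F i \<omega>) \<in> field_polynomials X n"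
proof (induction I rule: infinite_finite_induct)
  case (insert i I)
  then have "(\<lambda>\<omega>. F i \<omega> + (\<Sum>i\<in>I. F i \<omega>)) \<in> field_polynomials X n"
    by (intro field_polynomials_add) auto
  then show ?case using insert by simp
qed (auto simp: field_polynomials_zero)

lemma field_polynomials_mult:
  assumes "F \<in> field_polynomials X m" "G \<in> field_polynomials X n"
  shows "(\<lambda>\<omega>. F \<omega> * G \<omega>) \<in> field_polynomials X (m + n)"
proof -
  let ?p = "\<lambda>m \<omega>. \<Prod>(t, i)\<in>#m. X t \<omega> $ i"
  obtain S a where S: "finite S" "\<forall>q\<in>S. size q \<le> m" and F: "F = (\<lambda>\<omega>. \<Sum>m\<in>S. a m * ?p m \<omega>)"
    using assms(1) unfolding field_polynomials_def by blast
  obtain T b where T: "finite T" "\<forall>q\<in>T. size q \<le> n" and G: "G = (\<lambda>\<omega>. \<Sum>m\<in>T. b m * ?p m \<omega>)"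
    using assms(2) unfolding field_polynomials_def by blast
  have "(\<lambda>\<omega>. F \<omega> * G \<omega>) = (\<lambda>\<omega>. \<Sum>q\<in>S. \<Sum>q'\<in>T. (a q * b q') * ?p (q + q') \<omega>)"
    unfolding F G sum_product by (simp add: mult_ac)
  moreover have "(\<lambda>\<omega>. \<Sum>q\<in>S. \<Sum>q'\<in>T. (a q * b q') * ?p (q + q') \<omega>) \<in> field_polynomials X (m + n)"
    using S T by (intro field_polynomials_sum field_polynomials_scale field_polynomials_monomial) (simp add: add_mono)
  ultimately show ?thesis by simp
qed

lemma field_polynomials_mono:
  "m \<le> n \<Longrightarrow> field_polynomials X m \<subseteq> field_polynomials X n"
  unfolding field_polynomials_def by (fastforce intro: order_trans)

lemma field_polynomials_const: "(\<lambda>\<omega>. c) \<in> field_polynomials X n"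
  using field_polynomials_scale[OF field_polynomials_monomial[of "{#}" n X], of c] by simp

lemma field_polynomials_power:
  assumes "F \<in> field_polynomials X m" shows "(\<lambda>\<omega>. F \<omega> ^ k) \<in> field_polynomials X (m * k)"
proof (induction k)
  case 0
  then show ?case by (simp add: field_polynomials_const)
next
  case (Suc k)
  from field_polynomials_mult[OF assms Suc] show ?case by simp
qed

lemma poly_closure_mono: "m \<le> n \<Longrightarrow> poly_closure M X m \<subseteq> poly_closure M X n"
  unfolding poly_closure_def using field_polynomials_mono[of m n X] by blast

lemma chaos_L2: "F \<in> chaos M X n \<Longrightarrow> F \<in> L2 M"
  by (auto simp: chaos_def poly_closure_def split: if_splits)

lemma (in prob_space) chaos_subset_poly_closure: "k \<le> n \<Longrightarrow> chaos M X k \<subseteq> poly_closure M X n"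
proof
  fix F assume kn: "k \<le> n" and F: "F \<in> chaos M X k"
  show "F \<in> poly_closure M X n"
  proof (cases "k = 0")
    case True
    then obtain c where c: "F \<in> L2 M" "AE \<omega> in M. F \<omega> = c" using F by (auto simp: chaos_def)
    have "L2_sqdist M F (\<lambda>\<omega>. c) = (\<integral>\<^sup>+\<omega>. 0 \<partial>M)"
      unfolding L2_sqdist_def by (rule nn_integral_cong_AE) (use c(2) in eventually_elim, simp)
    then have d: "L2_sqdist M F (\<lambda>\<omega>. c) = 0" by simp
    show ?thesis unfolding poly_closure_def
    proof (intro CollectI conjI c(1) allI impI)
      fix e :: ennreal assume "e > 0"
      then show "\<exists>G\<in>field_polynomials X n. L2_sqdist M F G < e"
        using d by (intro bexI[OF _ field_polynomials_const[of c]]) simp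
    qed
  next
    case False
    then have "F \<in> poly_closure M X k" using F by (simp add: chaos_def)
    then show ?thesis using poly_closure_mono[OF kn] by blast
  qed
qed

lemma (in prob_space) chaos_orthogonal:
  assumes F: "F \<in> chaos M X n" and G: "G \<in> chaos M X k" and "n \<noteq> k"
  shows "(\<integral>\<omega>. F \<omega> * G \<omega> \<partial>M) = 0"
proof -
  have *: "(\<integral>\<omega>. F \<omega> * G \<omega> \<partial>M) = 0" if "F \<in> chaos M X n" "G \<in> chaos M X k" "k < n" for F G n k
  proof -
    have "k \<le> n - 1" using that(3) by simp
    from chaos_subset_poly_closure[OF this] that(2) have "G \<in> poly_closure M X (n - 1)" by blast
    then show ?thesis using that by (simp add: chaos_def)
  qed
  show ?thesis
  proof (cases "k < n")
    case True
    then show ?thesis using *[OF F G] by simp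
  next
    case False
    then show ?thesis using *[OF G F] \<open>n \<noteq> k\<close> by (simp add: mult.commute)
  qed
qed

text \<open>
  The closure of polynomials and orthogonality pass to limits. In order zero the variance, being the least
  squared distance to a constant, vanishes in the limit.
\<close>

lemma (in prob_space) chaos_closed:
  fixes f :: "nat \<Rightarrow> 'a \<Rightarrow> real"
  assumes f: "\<And>k. f k \<in> chaos M X n" and F: "F \<in> L2 M" and lim: "(\<lambda>k. L2_sqdist M (f k) F) \<longlonglongrightarrow> 0"
    and polys: "\<And>G k. G \<in> field_polynomials X k \<Longrightarrow> G \<in> L2 M"
  shows "F \<in> chaos M X n"
proof -
  have fL2: "f k \<in> L2 M" for k by (rule chaos_L2[OF f])
  have rlim: "(\<lambda>k. \<integral>\<omega>. (f k \<omega> - F \<omega>)\<^sup>2 \<partial>M) \<longlonglongrightarrow> 0"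
    using lim by (subst (asm) L2_tendsto_iff) (auto simp: fL2 F)
  show ?thesis
  proof (cases "n = 0")
    case True
    let ?c = "\<integral>\<omega>. F \<omega> \<partial>M"
    have iF: "integrable M F" "integrable M (\<lambda>\<omega>. (F \<omega>)\<^sup>2)"
      using F by (auto intro: L2_integrable L2_square_integrable)
    have var: "(\<integral>\<omega>. (F \<omega> - ?c)\<^sup>2 \<partial>M) \<le> (\<integral>\<omega>. (f k \<omega> - F \<omega>)\<^sup>2 \<partial>M)" for k
    proof -
      obtain c where c: "AE \<omega> in M. f k \<omega> = c" using f[of k] True by (auto simp: chaos_def)
      have m: "(\<integral>\<omega>. (F \<omega> - b)\<^sup>2 \<partial>M) = (\<integral>\<omega>. (F \<omega>)\<^sup>2 \<partial>M) - 2 * b * ?c + b\<^sup>2" for b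
        using iF by (simp add: power2_diff prob_space mult_ac)
      have "(\<integral>\<omega>. (f k \<omega> - F \<omega>)\<^sup>2 \<partial>M) = (\<integral>\<omega>. (F \<omega> - c)\<^sup>2 \<partial>M)"
        using c fL2[of k] F by (intro integral_cong_AE) (auto simp: power2_commute elim!: eventually_mono dest: L2_measurable)
      moreover have "0 \<le> (?c - c)\<^sup>2" by simp
      ultimately show ?thesis unfolding m by (simp add: power2_eq_square algebra_simps)
    qed
    have "(\<integral>\<omega>. (F \<omega> - ?c)\<^sup>2 \<partial>M) \<le> 0"
      by (rule LIMSEQ_le_const[OF rlim]) (use var in blast)
    moreover have "0 \<le> (\<integral>\<omega>. (F \<omega> - ?c)\<^sup>2 \<partial>M)" by (intro Bochner_Integration.integral_nonneg) simp
    ultimately have "(\<integral>\<omega>. (F \<omega> - ?c)\<^sup>2 \<partial>M) = 0" by (rule antisym)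
    then have "AE \<omega> in M. (F \<omega> - ?c)\<^sup>2 = 0"
      using L2_square_integrable[OF L2_diff[OF F L2_const]] by (subst (asm) integral_nonneg_eq_0_iff_AE) auto
    then have "AE \<omega> in M. F \<omega> = ?c" by eventually_elim simp
    then show ?thesis using True F by (auto simp: chaos_def)
  next
    case False
    have "F \<in> poly_closure M X n"
      unfolding poly_closure_def
    proof (intro CollectI conjI F allI impI)
      fix e :: ennreal assume "e > 0"
      then obtain e' :: real where e': "e' > 0" "ennreal e' < e"
        by (metis dense ennreal_cases ennreal_less_zero_iff not_less_iff_gr_or_eq order_less_imp_not_eq2 top.not_eq_extremum)
      from LIMSEQ_D[OF rlim, of "e' / 4"] e' obtain k where k: "norm ((\<integral>\<omega>. (f k \<omega> - F \<omega>)\<^sup>2 \<partial>M) - 0) < e' / 4"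
        by auto
      have "f k \<in> poly_closure M X n" using f[of k] False by (simp add: chaos_def)
      moreover have "ennreal (e' / 4) > 0" using e' by simp
      ultimately obtain G where G: "G \<in> field_polynomials X n" "L2_sqdist M (f k) G < ennreal (e' / 4)"
        unfolding poly_closure_def by blast
      have GL2: "G \<in> L2 M" by (rule polys[OF G(1)])
      have "(\<integral>\<omega>. (f k \<omega> - G \<omega>)\<^sup>2 \<partial>M) < e' / 4"
        using G(2) e' by (simp add: L2_sqdist_eq[OF fL2 GL2] ennreal_less_iff)
      moreover have "(\<integral>\<omega>. (F \<omega> - f k \<omega>)\<^sup>2 \<partial>M) < e' / 4"
        using k by (simp add: power2_commute)
      ultimately have "(\<integral>\<omega>. (F \<omega> - G \<omega>)\<^sup>2 \<partial>M) < e'"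
        using L2_triangle2[OF F fL2[of k] GL2] by linarith
      then have "L2_sqdist M F G < ennreal e'"
        using e' by (simp add: L2_sqdist_eq[OF F GL2] ennreal_less_iff)
      then show "\<exists>G\<in>field_polynomials X n. L2_sqdist M F G < e" using G(1) e'(2) by (meson less_trans)
    qed
    moreover have "(\<integral>\<omega>. F \<omega> * G \<omega> \<partial>M) = 0" if G: "G \<in> poly_closure M X (n - 1)" for G
    proof -
      have GL2: "G \<in> L2 M" using G by (simp add: poly_closure_def)
      have "(\<lambda>k. \<integral>\<omega>. f k \<omega> * G \<omega> \<partial>M) \<longlonglongrightarrow> (\<integral>\<omega>. F \<omega> * G \<omega> \<partial>M)"
        by (rule L2_tendsto_inner[OF _ F _ GL2 lim]) (auto simp: fL2 GL2 L2_sqdist_def)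
      moreover have "(\<integral>\<omega>. f k \<omega> * G \<omega> \<partial>M) = 0" for k
        using f[of k] G False by (simp add: chaos_def)
      ultimately show ?thesis by (simp add: LIMSEQ_const_iff)
    qed
    ultimately show ?thesis using False by (simp add: chaos_def)
  qed
qed

text \<open>
  By orthogonality of the chaoses, all partial sums beyond \<open>n\<close> have the same inner product with \<open>G\<close>.
\<close>

lemma (in prob_space) chaos_expansion_component_inner:
  assumes F: "F \<in> L2 M" and Fs: "is_chaos_expansion M X F Fs" and G: "G \<in> chaos M X n"
  shows "(\<integral>\<omega>. Fs n \<omega> * G \<omega> \<partial>M) = (\<integral>\<omega>. F \<omega> * G \<omega> \<partial>M)"
proof -
  have Fsn: "Fs i \<in> chaos M X i" for i using Fs by (simp add: is_chaos_expansion_def)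
  have FsL2: "Fs i \<in> L2 M" for i by (rule chaos_L2[OF Fsn])
  have GL2: "G \<in> L2 M" by (rule chaos_L2[OF G])
  have lim: "(\<lambda>k. \<integral>\<omega>. (\<Sum>i<k. Fs i \<omega>) * G \<omega> \<partial>M) \<longlonglongrightarrow> (\<integral>\<omega>. F \<omega> * G \<omega> \<partial>M)"
  proof (rule L2_tendsto_inner[OF _ F _ GL2])
    show "\<forall>\<^sub>F k in sequentially. (\<lambda>\<omega>. \<Sum>i<k. Fs i \<omega>) \<in> L2 M" by (intro always_eventually allI L2_sum FsL2)
    show "(\<lambda>k. L2_sqdist M (\<lambda>\<omega>. \<Sum>i<k. Fs i \<omega>) F) \<longlonglongrightarrow> 0"
      using Fs by (simp add: is_chaos_expansion_def L2_sqdist_commute[of M _ F])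
  qed (auto simp: GL2 L2_sqdist_def)
  have "(\<integral>\<omega>. (\<Sum>i<k. Fs i \<omega>) * G \<omega> \<partial>M) = (\<integral>\<omega>. Fs n \<omega> * G \<omega> \<partial>M)" if "k > n" for k
  proof -
    have "(\<integral>\<omega>. (\<Sum>i<k. Fs i \<omega>) * G \<omega> \<partial>M) = (\<integral>\<omega>. (\<Sum>i<k. Fs i \<omega> * G \<omega>) \<partial>M)"
      by (simp add: sum_distrib_right)
    also have "\<dots> = (\<Sum>i<k. \<integral>\<omega>. Fs i \<omega> * G \<omega> \<partial>M)"
      by (intro Bochner_Integration.integral_sum L2_mult_integrable FsL2 GL2)
    also have "\<dots> = (\<Sum>i<k. if i = n then \<integral>\<omega>. Fs n \<omega> * G \<omega> \<partial>M else 0)"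
      by (intro sum.cong refl) (auto simp: chaos_orthogonal[OF Fsn G])
    also have "\<dots> = (\<integral>\<omega>. Fs n \<omega> * G \<omega> \<partial>M)" using that by simp
    finally show ?thesis .
  qed
  then have "(\<lambda>k. \<integral>\<omega>. (\<Sum>i<k. Fs i \<omega>) * G \<omega> \<partial>M) \<longlonglongrightarrow> (\<integral>\<omega>. Fs n \<omega> * G \<omega> \<partial>M)"
    by (intro tendsto_eventually eventually_sequentiallyI[of "Suc n"]) auto
  with lim show ?thesis by (rule LIMSEQ_unique[symmetric])
qed

context cube_field
begin

lemma field_polynomials_L2: "G \<in> field_polynomials X n \<Longrightarrow> G \<in> L2 M"
  by (rule finite_moments_L2[OF field_polynomials_finite_moments])

lemma chaos_density_field_polynomial: "chaos_density m \<epsilon> r \<in> field_polynomials X (2 * m)"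
proof -
  have lin: "(\<lambda>\<omega>. X t \<omega> $ i) \<in> field_polynomials X 1" for t i
    using field_polynomials_monomial[of "{#(t, i)#}" 1 X] by simp
  have "(\<lambda>\<omega>. X (fst r) \<omega> $ i + (-1) * X (snd r) \<omega> $ i) \<in> field_polynomials X 1" for i
    by (intro field_polynomials_add field_polynomials_scale lin)
  from field_polynomials_power[OF this, where k = 2]
  have "(\<lambda>\<omega>. (1 / 2) * (\<Sum>i\<in>UNIV. (X (fst r) \<omega> $ i + (-1) * X (snd r) \<omega> $ i)\<^sup>2)) \<in> field_polynomials X 2"
    by (intro field_polynomials_scale field_polynomials_sum) simp
  then have u: "half_sqnorm (increment r) \<in> field_polynomials X 2"
    by (simp add: half_sqnorm_def[abs_def] increment_def)
  have "(\<lambda>\<omega>. half_sqnorm (increment r) \<omega> ^ q) \<in> field_polynomials X (2 * m)" if "q \<le> m" for q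
    using field_polynomials_power[OF u, of q] field_polynomials_mono[of "2 * q" "2 * m" X] that by auto
  then have "(\<lambda>\<omega>. laguerre (real CARD('d) / 2) m (icov r r) (half_sqnorm (increment r) \<omega>)) \<in> field_polynomials X (2 * m)"
    unfolding laguerre_def by (intro field_polynomials_sum field_polynomials_scale) auto
  then show ?thesis
    unfolding chaos_density_def[abs_def] by (intro field_polynomials_scale)
qed

lemma chaos_density_orthogonal:
  assumes G: "G \<in> poly_closure M X n" and n: "n < 2 * m"
  shows "(\<integral>\<omega>. G \<omega> * chaos_density m \<epsilon> r \<omega> \<partial>M) = 0"
proof -
  let ?L = "chaos_density m \<epsilon> r"
  have L: "?L \<in> L2 M" by (rule finite_moments_L2[OF chaos_density_finite_moments])
  have GL2: "G \<in> L2 M" using G by (simp add: poly_closure_def)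
  have poly: "(\<integral>\<omega>. P \<omega> * ?L \<omega> \<partial>M) = 0" if P: "P \<in> field_polynomials X n" for P
  proof -
    let ?c = "(2 * pi) powr (- (real CARD('d) / 2)) * (icov r r + \<epsilon>) powr (- (real CARD('d) / 2 + real m)) *
     (pochhammer (real CARD('d) / 2) m / fact m)"
    have "(\<integral>\<omega>. P \<omega> * ?L \<omega> \<partial>M) = (\<integral>\<omega>. ?c * (laguerre (real CARD('d) / 2) m (icov r r) (half_sqnorm (increment r) \<omega>) * P \<omega>) \<partial>M)"
      by (intro Bochner_Integration.integral_cong refl) (simp only: chaos_density_def mult_ac)
    also have "\<dots> = 0"
      unfolding integral_mult_right_zero laguerre_orthogonal_field_polynomials[OF increment_functional P n] by simp
    finally show ?thesis .
  qed
  have "(\<integral>\<omega>. G \<omega> * ?L \<omega> \<partial>M)\<^sup>2 \<le> e * (\<integral>\<omega>. (?L \<omega>)\<^sup>2 \<partial>M)" if "e > 0" for e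
  proof -
    have "ennreal e > 0" using that by simp
    then obtain P where P: "P \<in> field_polynomials X n" "L2_sqdist M G P < ennreal e"
      using G unfolding poly_closure_def by blast
    have PL2: "P \<in> L2 M" by (rule field_polynomials_L2[OF P(1)])
    have small: "(\<integral>\<omega>. (G \<omega> - P \<omega>)\<^sup>2 \<partial>M) < e"
      using P(2) that by (simp add: L2_sqdist_eq[OF GL2 PL2] ennreal_less_iff)
    have "(\<integral>\<omega>. G \<omega> * ?L \<omega> \<partial>M) = (\<integral>\<omega>. (G \<omega> - P \<omega>) * ?L \<omega> \<partial>M)"
      using L2_mult_integrable[OF GL2 L] L2_mult_integrable[OF PL2 L] poly[OF P(1)] by (simp add: left_diff_distrib)
    then have "(\<integral>\<omega>. G \<omega> * ?L \<omega> \<partial>M)\<^sup>2 \<le> (\<integral>\<omega>. (G \<omega> - P \<omega>)\<^sup>2 \<partial>M) * (\<integral>\<omega>. (?L \<omega>)\<^sup>2 \<partial>M)"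
      using L2_Cauchy_Schwarz[OF L2_diff[OF GL2 PL2] L] by simp
    also have "\<dots> \<le> e * (\<integral>\<omega>. (?L \<omega>)\<^sup>2 \<partial>M)"
      using small by (intro mult_right_mono Bochner_Integration.integral_nonneg) auto
    finally show ?thesis .
  qed
  then have "(\<integral>\<omega>. G \<omega> * ?L \<omega> \<partial>M)\<^sup>2 \<le> 0"
  proof -
    assume le: "\<And>e. e > 0 \<Longrightarrow> (\<integral>\<omega>. G \<omega> * ?L \<omega> \<partial>M)\<^sup>2 \<le> e * (\<integral>\<omega>. (?L \<omega>)\<^sup>2 \<partial>M)"
    have "(\<lambda>k. 1 / real (Suc k) * (\<integral>\<omega>. (?L \<omega>)\<^sup>2 \<partial>M)) \<longlonglongrightarrow> 0 * (\<integral>\<omega>. (?L \<omega>)\<^sup>2 \<partial>M)"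
      using LIMSEQ_inverse_real_of_nat by (intro tendsto_mult tendsto_const) (simp only: inverse_eq_divide)
    then have "(\<integral>\<omega>. G \<omega> * ?L \<omega> \<partial>M)\<^sup>2 \<le> 0 * (\<integral>\<omega>. (?L \<omega>)\<^sup>2 \<partial>M)"
      by (rule LIMSEQ_le_const) (intro exI allI impI le, simp)
    then show ?thesis by simp
  qed
  then show ?thesis by simp
qed

definition pair_grid :: "nat \<Rightarrow> (real ^ 'n) \<times> (real ^ 'n) \<Rightarrow> (real ^ 'n) \<times> (real ^ 'n)" where
  "pair_grid k r = (grid k (fst r), grid k (snd r))"

lemma grid_measurable_cube: "grid k \<in> cube_measure \<rightarrow>\<^sub>M cube_measure"
proof -
  have "grid k \<in> cube_measure \<rightarrow>\<^sub>M restrict_space borel (cbox 0 1)"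
    by (rule measurable_restrict_space2[OF _ measurable_cube_measure[OF grid_measurable]])
      (auto simp: space_cube_measure grid_in_cube)
  then show ?thesis unfolding measurable_cong_sets[OF refl sets_cube_measure] .
qed

lemma pair_grid_measurable: "pair_grid k \<in> pairs \<rightarrow>\<^sub>M pairs"
  unfolding pair_grid_def[abs_def]
  by (intro measurable_Pair measurable_compose[OF measurable_fst grid_measurable_cube]
      measurable_compose[OF measurable_snd grid_measurable_cube])

lemma pair_grid_tendsto: "(\<lambda>k. pair_grid k r) \<longlonglongrightarrow> r"
  using tendsto_Pair[OF grid_tendsto[of "fst r"] grid_tendsto[of "snd r"]] by (simp add: pair_grid_def)

lemma icov_tendsto:
  assumes "(f \<longlongrightarrow> a) \<F>" "(g \<longlongrightarrow> b) \<F>" shows "((\<lambda>x. icov (f x) (g x)) \<longlongrightarrow> icov a b) \<F>"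
  using continuous_on_tendsto_compose[OF increments_cov_continuous tendsto_Pair[OF assms]] by simp

lemma chaos_kernel_tendsto:
  assumes "\<epsilon> > 0" "(f \<longlongrightarrow> a) \<F>" "(g \<longlongrightarrow> b) \<F>"
  shows "((\<lambda>x. chaos_kernel m \<epsilon> \<epsilon> (f x) (g x)) \<longlongrightarrow> chaos_kernel m \<epsilon> \<epsilon> a b) \<F>"
proof -
  have "(icov a a + \<epsilon>) * (icov b b + \<epsilon>) \<noteq> 0"
    using assms(1) cov_nonneg by (simp add: add_nonneg_pos less_imp_neq[symmetric])
  then show ?thesis
    unfolding chaos_kernel_def using assms(2,3)
    by (intro tendsto_mult tendsto_const tendsto_power tendsto_powr tendsto_add icov_tendsto)
qed

text \<open>
  The grid has finitely many points in the cube, so the integral is a finite sum.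
\<close>

lemma grid_average_field_polynomial:
  "(\<lambda>\<omega>. \<integral>r. chaos_density m \<epsilon> (pair_grid k r) \<omega> \<partial>pairs) \<in> field_polynomials X (2 * m)"
proof -
  let ?I = "grid k ` cbox 0 (1 :: real ^ 'n)"
  let ?P = "?I \<times> ?I"
  let ?A = "\<lambda>p. {r \<in> space pairs. pair_grid k r = p}"
  have fin: "finite ?P" using finite_grid_image by auto
  have meas: "?A p \<in> sets pairs" for p
  proof -
    have "(\<lambda>r. pair_grid k r) \<in> pairs \<rightarrow>\<^sub>M borel" by (rule measurable_compose[OF pair_grid_measurable id_measurable_pairs])
    moreover have "{p} \<in> sets borel" by simp
    ultimately have "(\<lambda>r. pair_grid k r) -` {p} \<inter> space pairs \<in> sets pairs" by (rule measurable_sets)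
    moreover have "(\<lambda>r. pair_grid k r) -` {p} \<inter> space pairs = ?A p" by auto
    ultimately show ?thesis by simp
  qed
  have "(\<integral>r. chaos_density m \<epsilon> (pair_grid k r) \<omega> \<partial>pairs) = (\<Sum>p\<in>?P. measure pairs (?A p) * chaos_density m \<epsilon> p \<omega>)" for \<omega>
  proof -
    have "(\<integral>r. chaos_density m \<epsilon> (pair_grid k r) \<omega> \<partial>pairs) =
        (\<integral>r. (\<Sum>p\<in>?P. indicator (?A p) r * chaos_density m \<epsilon> p \<omega>) \<partial>pairs)"
    proof (rule Bochner_Integration.integral_cong[OF refl])
      fix r assume r: "r \<in> space pairs"
      then have "pair_grid k r \<in> ?P" by (auto simp: pair_grid_def space_pairs)
      then have "(\<Sum>p\<in>?P. if p = pair_grid k r then chaos_density m \<epsilon> p \<omega> else 0) = chaos_density m \<epsilon> (pair_grid k r) \<omega>"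
        using fin by simp
      moreover have "(\<Sum>p\<in>?P. indicator (?A p) r * chaos_density m \<epsilon> p \<omega>) = (\<Sum>p\<in>?P. if p = pair_grid k r then chaos_density m \<epsilon> p \<omega> else 0)"
        using r by (intro sum.cong refl) (auto simp: indicator_def)
      ultimately show "chaos_density m \<epsilon> (pair_grid k r) \<omega> = (\<Sum>p\<in>?P. indicator (?A p) r * chaos_density m \<epsilon> p \<omega>)"
        by simp
    qed
    also have "\<dots> = (\<Sum>p\<in>?P. \<integral>r. indicator (?A p) r * chaos_density m \<epsilon> p \<omega> \<partial>pairs)"
      using meas by (intro Bochner_Integration.integral_sum integrable_mult_left integrable_real_indicator)
        (auto simp: less_top[symmetric] process.M1.emeasure_finite)
    also have "\<dots> = (\<Sum>p\<in>?P. measure pairs (?A p) * chaos_density m \<epsilon> p \<omega>)"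
      using meas by (intro sum.cong refl) simp
    finally show ?thesis .
  qed
  then show ?thesis
    by (simp only:) (intro field_polynomials_sum field_polynomials_scale chaos_density_field_polynomial)
qed

text \<open>
  The averages over the grid are polynomials of degree \<open>2 m\<close> and approximate the integral in mean
  square, because the covariance of \<open>chaos_density\<close> is continuous.
\<close>

lemma approx_component_poly_closure:
  assumes \<epsilon>: "\<epsilon> > 0"
  shows "approx_component m \<epsilon> \<in> poly_closure M X (2 * m)"
  unfolding poly_closure_def
proof (intro CollectI conjI approx_component_L2[OF \<epsilon>] allI impI)
  fix e :: ennreal assume e: "e > 0"
  let ?K = "chaos_kernel m \<epsilon> \<epsilon>" and ?B = "kernel_bound \<epsilon> \<epsilon>"
  interpret P: second_order_process pairs M "chaos_density m \<epsilon>" ?B by (rule chaos_density_process[OF \<epsilon>])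
  define D where "D k r \<omega> = chaos_density m \<epsilon> r \<omega> - chaos_density m \<epsilon> (pair_grid k r) \<omega>" for k r \<omega>
  define Q where "Q k r = ?K r r - 2 * ?K r (pair_grid k r) + ?K (pair_grid k r) (pair_grid k r)" for k r
  have L: "chaos_density m \<epsilon> r \<in> L2 M" for r by (rule finite_moments_L2[OF chaos_density_finite_moments])
  have DL2: "D k r \<in> L2 M" for k r unfolding D_def[abs_def] by (intro L2_diff L)
  have D2: "(\<integral>\<omega>. (D k r \<omega>)\<^sup>2 \<partial>M) = Q k r" for k r
  proof -
    let ?f = "chaos_density m \<epsilon> r" and ?g = "chaos_density m \<epsilon> (pair_grid k r)"
    have "(\<integral>\<omega>. (D k r \<omega>)\<^sup>2 \<partial>M) = (\<integral>\<omega>. ?f \<omega> * ?f \<omega> - 2 * (?f \<omega> * ?g \<omega>) + ?g \<omega> * ?g \<omega> \<partial>M)"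
      by (intro Bochner_Integration.integral_cong refl) (simp add: D_def power2_eq_square algebra_simps)
    also have "\<dots> = (\<integral>\<omega>. ?f \<omega> * ?f \<omega> \<partial>M) - 2 * (\<integral>\<omega>. ?f \<omega> * ?g \<omega> \<partial>M) + (\<integral>\<omega>. ?g \<omega> * ?g \<omega> \<partial>M)"
      using L2_mult_integrable[OF L L] by simp
    finally show ?thesis by (simp only: chaos_density_inner[OF \<epsilon> \<epsilon>] Q_def)
  qed
  have K_le: "0 \<le> ?K r r'" "?K r r' \<le> ?B" for r r'
    using chaos_kernel_nonneg order_trans[OF chaos_kernel_le_full[OF \<epsilon> \<epsilon>] full_kernel_le[OF \<epsilon> \<epsilon>]] by blast+
  have Q_le: "Q k r \<le> 2 * ?B" for k r
    unfolding Q_def using K_le(1)[of r "pair_grid k r"] K_le(2)[of r r] K_le(2)[of "pair_grid k r" "pair_grid k r"] by linarith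
  have Q_nonneg: "0 \<le> Q k r" for k r
    unfolding D2[symmetric] by (intro Bochner_Integration.integral_nonneg) simp
  have joint: "(\<lambda>(r, \<omega>). chaos_density m \<epsilon> (pair_grid k r) \<omega>) \<in> borel_measurable (pairs \<Otimes>\<^sub>M M)" for k
  proof -
    have "(\<lambda>z. (pair_grid k (fst z), snd z)) \<in> pairs \<Otimes>\<^sub>M M \<rightarrow>\<^sub>M pairs \<Otimes>\<^sub>M M"
      by (intro measurable_Pair measurable_compose[OF measurable_fst pair_grid_measurable] measurable_snd)
    from measurable_compose[OF this P.joint] show ?thesis by (simp add: split_beta')
  qed
  have proc: "second_order_process pairs M (D k) (2 * ?B)" for k
  proof unfold_locales
    show "(\<lambda>(r, \<omega>). D k r \<omega>) \<in> borel_measurable (pairs \<Otimes>\<^sub>M M)"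
      using borel_measurable_diff[OF P.joint joint[of k]] by (simp add: D_def split_beta')
  qed (use DL2 D2 Q_le in auto)
  have proc': "second_order_process pairs M (\<lambda>r. chaos_density m \<epsilon> (pair_grid k r)) ?B" for k
    by unfold_locales (use joint L K_le in \<open>auto simp: power2_eq_square chaos_density_inner[OF \<epsilon> \<epsilon>]\<close>)
  have le: "(\<integral>\<omega>. (\<integral>r. D k r \<omega> \<partial>pairs)\<^sup>2 \<partial>M) \<le> (\<integral>r. Q k r \<partial>pairs)" for k
    using second_order_process.integral_second_moment_le[OF proc[of k]] by (simp only: D2)
  have Q_meas: "Q k \<in> borel_measurable pairs" for k
  proof -
    have [measurable]: "(\<lambda>r. icov (f r) (g r)) \<in> borel_measurable pairs"
      if "f \<in> pairs \<rightarrow>\<^sub>M pairs" "g \<in> pairs \<rightarrow>\<^sub>M pairs" for f g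
      using that by (intro icov_measurable) (auto intro: measurable_compose[OF _ id_measurable_pairs])
    have [measurable]: "(\<lambda>r. icov r (pair_grid k r)) \<in> borel_measurable pairs" "(\<lambda>r. icov (pair_grid k r) (pair_grid k r)) \<in> borel_measurable pairs"
      using pair_grid_measurable[of k] by (auto intro!: icov_measurable id_measurable_pairs measurable_compose[OF pair_grid_measurable id_measurable_pairs])
    show ?thesis unfolding Q_def[abs_def] chaos_kernel_def by measurable
  qed
  have "(\<lambda>k. \<integral>r. Q k r \<partial>pairs) \<longlonglongrightarrow> (\<integral>r. 0 \<partial>pairs)"
  proof (rule integral_dominated_convergence[where w = "\<lambda>_. 2 * ?B"])
    show "AE r in pairs. (\<lambda>k. Q k r) \<longlonglongrightarrow> 0"
    proof (rule AE_I2)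
      fix r
      have "(\<lambda>k. Q k r) \<longlonglongrightarrow> ?K r r - 2 * ?K r r + ?K r r"
        unfolding Q_def by (intro tendsto_intros chaos_kernel_tendsto \<epsilon> pair_grid_tendsto)
      then show "(\<lambda>k. Q k r) \<longlonglongrightarrow> 0" by simp
    qed
    show "AE r in pairs. norm (Q k r) \<le> 2 * ?B" for k using Q_le Q_nonneg by simp
  qed (use Q_meas in auto)
  then have lim: "(\<lambda>k. \<integral>r. Q k r \<partial>pairs) \<longlonglongrightarrow> 0" by simp
  obtain e' :: real where e': "e' > 0" "ennreal e' < e"
    using e by (metis dense ennreal_cases ennreal_less_zero_iff not_less_iff_gr_or_eq order_less_imp_not_eq2 top.not_eq_extremum)
  from LIMSEQ_D[OF lim e'(1)] obtain k where "norm ((\<integral>r. Q k r \<partial>pairs) - 0) < e'" by auto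
  with le[of k] have small: "(\<integral>\<omega>. (\<integral>r. D k r \<omega> \<partial>pairs)\<^sup>2 \<partial>M) < e'" by auto
  let ?G = "\<lambda>\<omega>. \<integral>r. chaos_density m \<epsilon> (pair_grid k r) \<omega> \<partial>pairs"
  have G: "?G \<in> field_polynomials X (2 * m)" by (rule grid_average_field_polynomial)
  have int: "AE \<omega> in M. integrable pairs (\<lambda>r. \<Phi> r \<omega>)" if "second_order_process pairs M \<Phi> C" for \<Phi> C
  proof -
    interpret S: second_order_process pairs M \<Phi> C by (rule that)
    show ?thesis using S.square_integrable_sections AE_space
    proof eventually_elim
      case (elim \<omega>)
      then have "(\<lambda>r. \<Phi> r \<omega>) \<in> L2 pairs" by (simp add: L2_def S.section_measurable)
      then show ?case by (rule process.M1.L2_integrable)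
    qed
  qed
  have "AE \<omega> in M. (\<integral>r. D k r \<omega> \<partial>pairs) = approx_component m \<epsilon> \<omega> - ?G \<omega>"
    using int[OF chaos_density_process[OF \<epsilon>, of m]] int[OF proc'[of k]]
    by eventually_elim (simp add: D_def approx_component_def)
  then have "(\<integral>\<omega>. (approx_component m \<epsilon> \<omega> - ?G \<omega>)\<^sup>2 \<partial>M) = (\<integral>\<omega>. (\<integral>r. D k r \<omega> \<partial>pairs)\<^sup>2 \<partial>M)"
    using L2_measurable[OF approx_component_L2[OF \<epsilon>]] L2_measurable[OF field_polynomials_L2[OF G]]
      second_order_process.integral_measurable[OF proc[of k]]
    by (intro integral_cong_AE) (auto elim!: eventually_mono)
  with small have "L2_sqdist M (approx_component m \<epsilon>) ?G < ennreal e'"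
    using e' by (simp add: L2_sqdist_eq[OF approx_component_L2[OF \<epsilon>] field_polynomials_L2[OF G]] ennreal_less_iff)
  then show "\<exists>G\<in>field_polynomials X (2 * m). L2_sqdist M (approx_component m \<epsilon>) G < e"
    using G e'(2) by (intro bexI[of _ ?G]) auto
qed

lemma approx_component_chaos:
  assumes \<epsilon>: "\<epsilon> > 0"
  shows "approx_component m \<epsilon> \<in> chaos M X (2 * m)"
proof (cases "m = 0")
  case True
  have "approx_component 0 \<epsilon> \<omega> = (\<integral>r. (2 * pi) powr (- (real CARD('d) / 2)) * (icov r r + \<epsilon>) powr (- (real CARD('d) / 2)) \<partial>pairs)" for \<omega>
    by (simp add: approx_component_def chaos_density_def laguerre_0)
  then show ?thesis using True approx_component_L2[OF \<epsilon>, of 0] by (auto simp: chaos_def)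
next
  case False
  interpret P: second_order_process pairs M "chaos_density m \<epsilon>" "kernel_bound \<epsilon> \<epsilon>" by (rule chaos_density_process[OF \<epsilon>])
  have "(\<integral>\<omega>. approx_component m \<epsilon> \<omega> * G \<omega> \<partial>M) = 0" if G: "G \<in> poly_closure M X (2 * m - 1)" for G
  proof -
    have GL2: "G \<in> L2 M" using G by (simp add: poly_closure_def)
    have "(\<integral>\<omega>. approx_component m \<epsilon> \<omega> * G \<omega> \<partial>M) = (\<integral>\<omega>. G \<omega> * (\<integral>r. chaos_density m \<epsilon> r \<omega> \<partial>pairs) \<partial>M)"
      by (simp add: approx_component_def mult.commute)
    also have "\<dots> = (\<integral>r. \<integral>\<omega>. G \<omega> * chaos_density m \<epsilon> r \<omega> \<partial>M \<partial>pairs)"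
      by (rule P.integral_inner[OF GL2])
    also have "\<dots> = 0" using False by (simp add: chaos_density_orthogonal[OF G])
    finally show ?thesis .
  qed
  then show ?thesis using False approx_component_poly_closure[OF \<epsilon>, of m] by (simp add: chaos_def)
qed

end

section \<open>Convergent determinant integrals\<close>

text \<open>
  The conditional variance is a residual variance: it cannot exceed, in mean, the mean square error of any
  predictor that is a function of the conditioning variable.
\<close>

lemma (in prob_space) cond_variance_le_prediction_error:
  assumes Y: "Y \<in> L2 M" and Z: "Z \<in> borel_measurable M" and h: "h \<in> borel_measurable borel"
    and hZ: "(\<lambda>\<omega>. h (Z \<omega>)) \<in> L2 M"
    and le: "AE \<omega> in M. cond_variance M Y Z \<omega> \<ge> K"
  shows "K \<le> (\<integral>\<omega>. (Y \<omega> - h (Z \<omega>))\<^sup>2 \<partial>M)"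
proof -
  define G where "G = vimage_algebra (space M) Z borel"
  have "subalgebra M G"
    unfolding subalgebra_def G_def using Z by (auto simp: sets_vimage_algebra2 intro!: measurable_sets)
  then interpret G: finite_measure_subalgebra M G by unfold_locales
  let ?P = "real_cond_exp M G Y" and ?W = "\<lambda>\<omega>. h (Z \<omega>)"
  have [measurable]: "Y \<in> borel_measurable M" using Y by (rule L2_measurable)
  have PG: "?P \<in> borel_measurable G" by (rule borel_measurable_cond_exp)
  have [measurable]: "?P \<in> borel_measurable M" by (rule borel_measurable_cond_exp2)
  have WG: "?W \<in> borel_measurable G"
    unfolding G_def by (rule measurable_compose[OF measurable_vimage_algebra1 h]) simp
  have "integrable M (\<lambda>\<omega>. (\<lambda>x. x\<^sup>2) (?P \<omega>))"
    by (rule G.integrable_convex_cond_exp[where I = UNIV])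
      (use L2_integrable[OF Y] L2_square_integrable[OF Y] convex_power2 in \<open>auto simp: emeasure_space_1\<close>)
  then have P: "?P \<in> L2 M" by (simp add: L2_def)
  have PW: "(\<lambda>\<omega>. ?P \<omega> - ?W \<omega>) \<in> L2 M" and YP: "(\<lambda>\<omega>. Y \<omega> - ?P \<omega>) \<in> L2 M"
    using P hZ Y by (auto intro: L2_diff)
  have res: "integrable M (\<lambda>\<omega>. (Y \<omega> - ?P \<omega>)\<^sup>2)" by (rule L2_square_integrable[OF YP])
  have "K = (\<integral>\<omega>. K \<partial>M)" by (simp add: prob_space)
  also have "\<dots> \<le> (\<integral>\<omega>. cond_variance M Y Z \<omega> \<partial>M)"
    using le G.real_cond_exp_int(1)[OF res]
    by (intro integral_mono_AE) (auto simp: cond_variance_def G_def Let_def)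
  also have "\<dots> = (\<integral>\<omega>. (Y \<omega> - ?P \<omega>)\<^sup>2 \<partial>M)"
    using G.real_cond_exp_int(2)[OF res] by (simp add: cond_variance_def G_def Let_def)
  also have "\<dots> \<le> (\<integral>\<omega>. (Y \<omega> - ?W \<omega>)\<^sup>2 \<partial>M)"
  proof -
    have cross: "(\<integral>\<omega>. (?P \<omega> - ?W \<omega>) * (Y \<omega> - ?P \<omega>) \<partial>M) = 0"
    proof -
      have "(\<integral>\<omega>. (?P \<omega> - ?W \<omega>) * ?P \<omega> \<partial>M) = (\<integral>\<omega>. (?P \<omega> - ?W \<omega>) * Y \<omega> \<partial>M)"
        using L2_mult_integrable[OF PW Y] PG WG by (intro G.real_cond_exp_intg(2)) auto
      then show ?thesis
        using L2_mult_integrable[OF PW Y] L2_mult_integrable[OF PW P] by (simp add: right_diff_distrib)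
    qed
    have "(\<integral>\<omega>. (Y \<omega> - ?W \<omega>)\<^sup>2 \<partial>M) =
        (\<integral>\<omega>. (Y \<omega> - ?P \<omega>)\<^sup>2 + 2 * ((?P \<omega> - ?W \<omega>) * (Y \<omega> - ?P \<omega>)) + (?P \<omega> - ?W \<omega>)\<^sup>2 \<partial>M)"
      by (intro Bochner_Integration.integral_cong refl) (simp add: power2_eq_square algebra_simps)
    also have "\<dots> = (\<integral>\<omega>. (Y \<omega> - ?P \<omega>)\<^sup>2 \<partial>M) + 2 * (\<integral>\<omega>. (?P \<omega> - ?W \<omega>) * (Y \<omega> - ?P \<omega>) \<partial>M) + (\<integral>\<omega>. (?P \<omega> - ?W \<omega>)\<^sup>2 \<partial>M)"
      using res L2_mult_integrable[OF PW YP] L2_square_integrable[OF PW] by simp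
    finally show ?thesis using cross Bochner_Integration.integral_nonneg[of M "\<lambda>\<omega>. (?P \<omega> - ?W \<omega>)\<^sup>2"] by simp
  qed
  finally show ?thesis .
qed

lemma emeasure_lborel_translate:
  fixes D :: "'a :: euclidean_space set"
  assumes "D \<in> sets borel"
  shows "emeasure lborel {y. y - x \<in> D} = emeasure lborel D"
proof -
  have "emeasure (distr lborel borel ((+) (- x))) D = emeasure lborel ((+) (- x) -` D \<inter> space lborel)"
    using assms by (intro emeasure_distr) simp_all
  moreover have "(+) (- x) -` D \<inter> space lborel = {y. y - x \<in> D}" by (auto simp: algebra_simps)
  ultimately show ?thesis by (simp add: lborel_distr_plus)
qed

text \<open>
  The fibre of the set over \<open>x\<close> is a translate of \<open>D\<close>, which does not leave \<open>I\<close>.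
\<close>

lemma emeasure_translated_fibres_restrict:
  fixes I W D :: "'a :: euclidean_space set"
  assumes I: "I \<in> sets borel" and W: "W \<in> sets borel" "W \<subseteq> I" and D: "D \<in> sets borel"
    and into: "\<And>x d. x \<in> W \<Longrightarrow> d \<in> D \<Longrightarrow> x + d \<in> I"
    and ps: "prob_space (restrict_space lborel I)"
  shows "{(x, y). x \<in> W \<and> y - x \<in> D} \<in> sets (restrict_space lborel I \<Otimes>\<^sub>M restrict_space lborel I)"
    and "emeasure (restrict_space lborel I \<Otimes>\<^sub>M restrict_space lborel I) {(x, y). x \<in> W \<and> y - x \<in> D} =
      emeasure lborel W * emeasure lborel D"
proof -
  let ?N = "restrict_space lborel I"
  let ?A = "{(x, y). x \<in> W \<and> y - x \<in> D}"
  interpret N: prob_space ?N by (rule ps)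
  have spN: "space ?N = I" by (simp add: space_restrict_space)
  have [measurable]: "(\<lambda>x. x) \<in> borel_measurable ?N" by (rule measurable_restrict_space1) simp
  have [measurable]: "W \<in> sets borel" "D \<in> sets borel" by fact+
  have "?A = {z \<in> space (?N \<Otimes>\<^sub>M ?N). fst z \<in> W \<and> snd z - fst z \<in> D}"
    using W(2) into by (auto simp: space_pair_measure spN) (metis add.commute diff_add_cancel)
  also have "\<dots> \<in> sets (?N \<Otimes>\<^sub>M ?N)"
  proof -
    have [measurable]: "fst \<in> borel_measurable (?N \<Otimes>\<^sub>M ?N)" "snd \<in> borel_measurable (?N \<Otimes>\<^sub>M ?N)"
      using measurable_compose[OF measurable_fst[of ?N ?N], of "\<lambda>x. x" borel]
        measurable_compose[OF measurable_snd[of ?N ?N], of "\<lambda>x. x" borel] by simp_all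
    show ?thesis by measurable
  qed
  finally show A: "?A \<in> sets (?N \<Otimes>\<^sub>M ?N)" .
  have "emeasure (?N \<Otimes>\<^sub>M ?N) ?A = (\<integral>\<^sup>+x. emeasure ?N (Pair x -` ?A) \<partial>?N)"
    by (rule N.emeasure_pair_measure_alt[OF A])
  also have "\<dots> = (\<integral>\<^sup>+x. emeasure lborel D * indicator W x \<partial>?N)"
  proof (rule nn_integral_cong)
    fix x
    show "emeasure ?N (Pair x -` ?A) = emeasure lborel D * indicator W x"
    proof (cases "x \<in> W")
      case True
      have "{y. y - x \<in> D} \<subseteq> I"
      proof
        fix y assume "y \<in> {y. y - x \<in> D}"
        then have "x + (y - x) \<in> I" by (intro into True) simp
        then show "y \<in> I" by simp
      qed
      then have "emeasure ?N {y. y - x \<in> D} = emeasure lborel {y. y - x \<in> D}"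
        using I by (intro emeasure_restrict_space) auto
      also have "\<dots> = emeasure lborel D" by (rule emeasure_lborel_translate[OF D])
      finally show ?thesis using True by (simp add: vimage_def)
    qed (simp add: vimage_def)
  qed
  also have "\<dots> = emeasure lborel D * emeasure ?N W"
  proof (rule nn_integral_cmult_indicator)
    show "W \<in> sets ?N" using W I by (auto simp: sets_restrict_space)
  qed
  also have "emeasure ?N W = emeasure lborel W"
    using I W by (intro emeasure_restrict_space) auto
  finally show "emeasure (?N \<Otimes>\<^sub>M ?N) ?A = emeasure lborel W * emeasure lborel D" by (simp add: mult.commute)
qed

locale anisotropic_field = cube_field M M0 X X0
  for M :: "'w measure" and M0 :: "'v measure"
    and X :: "real ^ 'n \<Rightarrow> 'w \<Rightarrow> real ^ 'd" and X0 :: "real ^ 'n \<Rightarrow> 'v \<Rightarrow> real" +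
  fixes H :: "real ^ 'n"
  assumes H_pos: "\<And>j. H $ j > 0"
    and C1: "cond_C1 M0 X0 H" and C3: "cond_C3 M0 X0 H"
begin

abbreviation Q :: real where
  "Q \<equiv> (\<Sum>j\<in>UNIV. 1 / H $ j)"

lemma increment_variance_le:
  obtains c1 where "c1 > 0"
    "\<And>s t. s \<in> cbox 0 1 \<Longrightarrow> t \<in> cbox 0 1 \<Longrightarrow> icov (s, t) (s, t) \<le> c1 * anisotropic_size H (t - s)"
proof -
  obtain c where c: "c > 0" and le: "\<And>s t. s \<in> cbox 0 1 \<Longrightarrow> t \<in> cbox 0 1 \<Longrightarrow>
      (\<integral>\<omega>. (X0 s \<omega> - X0 t \<omega>)\<^sup>2 \<partial>M0) \<le> c * (\<Sum>j\<in>UNIV. \<bar>s $ j - t $ j\<bar> powr (2 * H $ j))"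
    using C1 unfolding cond_C1_def by blast
  have "icov (s, t) (s, t) \<le> c * anisotropic_size H (t - s)" if "s \<in> cbox 0 1" "t \<in> cbox 0 1" for s t
    using le[OF that] by (simp add: cov_def increment_def anisotropic_size_def power2_eq_square abs_minus_commute)
  with c show ?thesis by (rule that)
qed

text \<open>
  Conditional variances are compared with the errors of linear predictors, for which covariances suffice.
\<close>

lemma prediction_error_ge:
  obtains c where "c > 0"
    "\<And>u t1 t2 t3 b1 b2 b3. u \<in> cbox 0 1 \<Longrightarrow> t1 \<in> cbox 0 1 \<Longrightarrow> t2 \<in> cbox 0 1 \<Longrightarrow> t3 \<in> cbox 0 1 \<Longrightarrow>
      c * coordinate_dist H t1 t2 t3 u \<le>
        (\<integral>\<omega>. (X0 u \<omega> - (b1 * X0 t1 \<omega> + b2 * X0 t2 \<omega> + b3 * X0 t3 \<omega>))\<^sup>2 \<partial>M0)"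
proof -
  obtain c where c: "c > 0" and ae: "\<And>u t1 t2 t3. u \<in> cbox 0 1 \<Longrightarrow> t1 \<in> cbox 0 1 \<Longrightarrow> t2 \<in> cbox 0 1 \<Longrightarrow> t3 \<in> cbox 0 1 \<Longrightarrow>
      AE \<omega> in M0. cond_variance M0 (X0 u) (\<lambda>\<omega>. (X0 t1 \<omega>, X0 t2 \<omega>, X0 t3 \<omega>)) \<omega> \<ge> c * coordinate_dist H t1 t2 t3 u"
    using C3 unfolding cond_C3_def coordinate_dist_def by blast
  have L: "X0 t \<in> L2 M0" for t using functional_L2[OF linear_functionals_eval[of t]] by simp
  have "c * coordinate_dist H t1 t2 t3 u \<le>
      (\<integral>\<omega>. (X0 u \<omega> - (b1 * X0 t1 \<omega> + b2 * X0 t2 \<omega> + b3 * X0 t3 \<omega>))\<^sup>2 \<partial>M0)"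
    if "u \<in> cbox 0 1" "t1 \<in> cbox 0 1" "t2 \<in> cbox 0 1" "t3 \<in> cbox 0 1" for u t1 t2 t3 b1 b2 b3
  proof -
    let ?Z = "\<lambda>\<omega>. (X0 t1 \<omega>, X0 t2 \<omega>, X0 t3 \<omega>)"
    let ?h = "\<lambda>z :: real \<times> real \<times> real. b1 * fst z + b2 * fst (snd z) + b3 * snd (snd z)"
    have "?h \<in> borel_measurable borel" by (intro borel_measurable_continuous_onI continuous_intros)
    moreover have "?Z \<in> borel_measurable M0" by (intro borel_measurable_Pair X0_measurable)
    moreover have "(\<lambda>\<omega>. ?h (?Z \<omega>)) \<in> L2 M0" by simp (intro L2_add L2_scale L)
    ultimately have "c * coordinate_dist H t1 t2 t3 u \<le> (\<integral>\<omega>. (X0 u \<omega> - ?h (?Z \<omega>))\<^sup>2 \<partial>M0)"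
      using ae[OF that] L by (intro base.cond_variance_le_prediction_error)
    then show ?thesis by simp
  qed
  with c show ?thesis by (rule that)
qed

text \<open>
  With \<open>b\<close> the regularised regression coefficient of the second increment on the first,
  the regularised covariance determinant is bounded below by a product of two prediction errors.
\<close>

lemma determinant_ge:
  obtains c where "c > 0"
    "\<And>\<epsilon> s t s' t'. \<epsilon> > 0 \<Longrightarrow> s \<in> cbox 0 1 \<Longrightarrow> t \<in> cbox 0 1 \<Longrightarrow> s' \<in> cbox 0 1 \<Longrightarrow> t' \<in> cbox 0 1 \<Longrightarrow>
      (c * coordinate_dist H t t t s + \<epsilon>) * (c * coordinate_dist H t' s t s' + \<epsilon>) \<le>
      (icov (s, t) (s, t) + \<epsilon>) * (icov (s', t') (s', t') + \<epsilon>) - (icov (s, t) (s', t'))\<^sup>2"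
    "\<And>s t. s \<in> cbox 0 1 \<Longrightarrow> t \<in> cbox 0 1 \<Longrightarrow> c * coordinate_dist H t t t s \<le> icov (s, t) (s, t)"
proof -
  obtain c where c: "c > 0" and pe: "\<And>u t1 t2 t3 b1 b2 b3. u \<in> cbox 0 1 \<Longrightarrow> t1 \<in> cbox 0 1 \<Longrightarrow> t2 \<in> cbox 0 1 \<Longrightarrow> t3 \<in> cbox 0 1 \<Longrightarrow>
      c * coordinate_dist H t1 t2 t3 u \<le>
        (\<integral>\<omega>. (X0 u \<omega> - (b1 * X0 t1 \<omega> + b2 * X0 t2 \<omega> + b3 * X0 t3 \<omega>))\<^sup>2 \<partial>M0)"
    by (rule prediction_error_ge) blast
  have one: "c * coordinate_dist H t t t s \<le> icov (s, t) (s, t)" if "s \<in> cbox 0 1" "t \<in> cbox 0 1" for s t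
    using pe[OF that(1) that(2) that(2) that(2), of 1 0 0]
    by (simp add: cov_def increment_def power2_eq_square)
  have two: "(c * coordinate_dist H t t t s + \<epsilon>) * (c * coordinate_dist H t' s t s' + \<epsilon>) \<le>
      (icov (s, t) (s, t) + \<epsilon>) * (icov (s', t') (s', t') + \<epsilon>) - (icov (s, t) (s', t'))\<^sup>2"
    if \<epsilon>: "\<epsilon> > 0" and mem: "s \<in> cbox 0 1" "t \<in> cbox 0 1" "s' \<in> cbox 0 1" "t' \<in> cbox 0 1" for \<epsilon> s t s' t'
  proof -
    let ?v = "icov (s, t) (s, t)" and ?v' = "icov (s', t') (s', t')" and ?r = "icov (s, t) (s', t')"
    \<comment> \<open>\<open>b\<close> minimises \<open>?v' - 2 b ?r + b\<^sup>2 P\<close>, with minimum \<open>?v' - ?r\<^sup>2 / P\<close>\<close>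
    define P b where "P = ?v + \<epsilon>" and "b = ?r / P"
    have v: "?v \<ge> 0" by (rule cov_nonneg)
    have P: "P > 0" using v \<epsilon> by (simp add: P_def add_nonneg_pos)
    have "c * coordinate_dist H t' s t s' \<le>
        (\<integral>\<omega>. (X0 s' \<omega> - (1 * X0 t' \<omega> + b * X0 s \<omega> + (- b) * X0 t \<omega>))\<^sup>2 \<partial>M0)"
      by (rule pe) (use mem in auto)
    also have "\<dots> = cov (\<lambda>x. 1 * increment (s', t') x + (- b) * increment (s, t) x) (\<lambda>x. 1 * increment (s', t') x + (- b) * increment (s, t) x)"
      unfolding cov_def
      by (intro Bochner_Integration.integral_cong refl) (simp add: increment_def power2_eq_square algebra_simps)
    also have "\<dots> = ?v' - 2 * b * ?r + b\<^sup>2 * ?v"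
      using cov_combination_self[OF increment_functional increment_functional, of 1 "(s', t')" "- b" "(s, t)"]
      by (simp add: cov_commute[of "increment (s', t')" "increment (s, t)"])
    also have "\<dots> \<le> ?v' - 2 * b * ?r + b\<^sup>2 * P"
      using \<epsilon> by (simp add: P_def mult_left_mono)
    also have "\<dots> = ?v' - ?r\<^sup>2 / P"
      using P by (simp add: b_def power2_eq_square field_simps)
    finally have "P * (c * coordinate_dist H t' s t s' + \<epsilon>) \<le> P * (?v' - ?r\<^sup>2 / P + \<epsilon>)"
      using P by (intro mult_left_mono) auto
    also have "\<dots> = P * (?v' + \<epsilon>) - ?r\<^sup>2" using P by (simp add: field_simps)
    finally have "P * (c * coordinate_dist H t' s t s' + \<epsilon>) \<le> P * (?v' + \<epsilon>) - ?r\<^sup>2" .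
    moreover have "(c * coordinate_dist H t t t s + \<epsilon>) * (c * coordinate_dist H t' s t s' + \<epsilon>) \<le> P * (c * coordinate_dist H t' s t s' + \<epsilon>)"
      using one[OF mem(1,2)] c \<epsilon> coordinate_dist_nonneg[of H t' s t s'] unfolding P_def
      by (intro mult_right_mono) auto
    ultimately show ?thesis unfolding P_def by linarith
  qed
  show ?thesis by (rule that[OF c two one])
qed

text \<open>
  The bound does not depend on the reference points, so that these may be integrated afterwards.
\<close>

lemma coordinate_dist_integral_le:
  assumes c: "c > 0" and q: "0 \<le> q" "q < Q / 2"
  obtains b where "b \<ge> 0"
    "\<And>\<epsilon> t1 t2 t3. \<epsilon> > 0 \<Longrightarrow> (\<integral>\<^sup>+u. ennreal ((c * coordinate_dist H t1 t2 t3 u + \<epsilon>) powr (- q)) \<partial>cube_measure) \<le> ennreal b"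
proof -
  define C :: real where "C = 8 ^ CARD('n)"
  define b where "b = c powr (- q) * (1 + C * 2 powr q / (1 - 2 powr (q - Q / 2)))"
  have lt: "2 powr (q - Q / 2) < 1" using q by (simp add: powr_less_one)
  then have b: "b \<ge> 0" by (simp add: b_def C_def)
  have "(\<integral>\<^sup>+u. ennreal ((c * coordinate_dist H t1 t2 t3 u + \<epsilon>) powr (- q)) \<partial>cube_measure) \<le> ennreal b"
    if \<epsilon>: "\<epsilon> > 0" for \<epsilon> t1 t2 t3
  proof -
    let ?g = "coordinate_dist H t1 t2 t3"
    have g [measurable]: "?g \<in> borel_measurable borel" by (intro coordinate_dist_measurable) auto
    have gc [measurable]: "?g \<in> borel_measurable cube_measure" by (rule measurable_cube_measure[OF g])
    have bound: "(\<integral>\<^sup>+u. ennreal ((\<epsilon> / c + ?g u) powr (- q)) \<partial>cube_measure) \<le> ennreal (1 + C * 2 powr q / (1 - 2 powr (q - Q / 2)))"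
    proof (rule nn_integral_negative_power_le[OF gc coordinate_dist_nonneg])
      show "emeasure cube_measure (space (cube_measure :: (real ^ 'n) measure)) \<le> 1"
        by (simp add: prob_space.emeasure_space_1[OF prob_space_cube_measure])
      fix u :: real assume u: "u > 0"
      have "emeasure cube_measure {x \<in> space cube_measure. ?g x \<le> u} = emeasure lborel {x \<in> space cube_measure. ?g x \<le> u}"
        unfolding cube_measure_def by (intro emeasure_restrict_space) (auto simp: space_restrict_space)
      also have "\<dots> \<le> emeasure lborel {x. ?g x \<le> u}" by (intro emeasure_mono) auto
      also have "\<dots> \<le> ennreal (C * u powr (Q / 2))"
        unfolding C_def by (rule coordinate_dist_sublevel[OF H_pos u])
      finally show "emeasure cube_measure {x \<in> space cube_measure. ?g x \<le> u} \<le> ennreal (C * u powr (Q / 2))" .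
    qed (use q c \<epsilon> in \<open>auto simp: C_def\<close>)
    have "(c * ?g u + \<epsilon>) powr (- q) = c powr (- q) * (\<epsilon> / c + ?g u) powr (- q)" for u
    proof -
      have "0 \<le> \<epsilon> / c + ?g u" using c \<epsilon> coordinate_dist_nonneg[of H t1 t2 t3 u] by simp
      moreover have "c * ?g u + \<epsilon> = c * (\<epsilon> / c + ?g u)" using c by (simp add: field_simps)
      ultimately show ?thesis using c by (simp only: powr_mult)
    qed
    then have "(\<integral>\<^sup>+u. ennreal ((c * ?g u + \<epsilon>) powr (- q)) \<partial>cube_measure) =
        (\<integral>\<^sup>+u. ennreal (c powr (- q)) * ennreal ((\<epsilon> / c + ?g u) powr (- q)) \<partial>cube_measure)"
      by (simp add: ennreal_mult[symmetric])
    also have "\<dots> = ennreal (c powr (- q)) * (\<integral>\<^sup>+u. ennreal ((\<epsilon> / c + ?g u) powr (- q)) \<partial>cube_measure)"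
      by (rule nn_integral_cmult) measurable
    also have "\<dots> \<le> ennreal (c powr (- q)) * ennreal (1 + C * 2 powr q / (1 - 2 powr (q - Q / 2)))"
      by (intro mult_left_mono bound) simp
    also have "\<dots> = ennreal b" unfolding b_def using lt by (subst ennreal_mult) (auto simp: C_def)
    finally show ?thesis .
  qed
  with b show ?thesis by (rule that)
qed

definition determinant :: "real \<Rightarrow> ((real ^ 'n) \<times> (real ^ 'n)) \<times> ((real ^ 'n) \<times> (real ^ 'n)) \<Rightarrow> real" where
  "determinant \<epsilon> z = (icov (fst z) (fst z) + \<epsilon>) * (icov (snd z) (snd z) + \<epsilon>) - (icov (fst z) (snd z))\<^sup>2"

lemma determinant_measurable [measurable]: "determinant \<epsilon> \<in> borel_measurable (pairs \<Otimes>\<^sub>M pairs)"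
  unfolding determinant_def[abs_def] by measurable

lemma determinant_pos: "\<epsilon> > 0 \<Longrightarrow> determinant \<epsilon> z > 0"
  using icov_square_less[of \<epsilon> \<epsilon> "fst z" "snd z"] by (simp add: determinant_def)

text \<open>
  In the product of the two prediction errors, \<open>s'\<close> occurs only in the second. It is integrated first,
  with the reference points \<open>t'\<close>, \<open>s\<close>, \<open>t\<close> fixed, and then \<open>s\<close>.
\<close>

lemma determinant_power_integral_bounded:
  assumes q: "0 \<le> q" "q < Q / 2"
  obtains B where "B \<ge> 0"
    "\<And>\<epsilon>. \<epsilon> > 0 \<Longrightarrow> (\<integral>\<^sup>+z. ennreal (determinant \<epsilon> z powr (- q)) \<partial>(pairs \<Otimes>\<^sub>M pairs)) \<le> ennreal B"
proof -
  obtain c where c: "c > 0" and det: "\<And>\<epsilon> s t s' t'. \<epsilon> > 0 \<Longrightarrow> s \<in> cbox 0 1 \<Longrightarrow> t \<in> cbox 0 1 \<Longrightarrow> s' \<in> cbox 0 1 \<Longrightarrow> t' \<in> cbox 0 1 \<Longrightarrow>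
      (c * coordinate_dist H t t t s + \<epsilon>) * (c * coordinate_dist H t' s t s' + \<epsilon>) \<le>
      (icov (s, t) (s, t) + \<epsilon>) * (icov (s', t') (s', t') + \<epsilon>) - (icov (s, t) (s', t'))\<^sup>2"
    and "\<And>s t. s \<in> cbox 0 1 \<Longrightarrow> t \<in> cbox 0 1 \<Longrightarrow> c * coordinate_dist H t t t s \<le> icov (s, t) (s, t)"
    by (rule determinant_ge) blast
  obtain b where b: "b \<ge> 0" and int: "\<And>\<epsilon> t1 t2 t3. \<epsilon> > 0 \<Longrightarrow>
      (\<integral>\<^sup>+u. ennreal ((c * coordinate_dist H t1 t2 t3 u + \<epsilon>) powr (- q)) \<partial>cube_measure) \<le> ennreal b"
    by (rule coordinate_dist_integral_le[OF c q]) blast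
  interpret C: pair_prob_space "cube_measure :: (real ^ 'n) measure" "cube_measure :: (real ^ 'n) measure"
    by (rule pair_prob_space_cubes)
  note [measurable] = id_measurable_cube_measure
  have "(\<integral>\<^sup>+z. ennreal (determinant \<epsilon> z powr (- q)) \<partial>(pairs \<Otimes>\<^sub>M pairs)) \<le> ennreal (b * b)" if \<epsilon>: "\<epsilon> > 0" for \<epsilon>
  proof -
    define A where "A t1 t2 t3 u = ennreal ((c * coordinate_dist H t1 t2 t3 u + \<epsilon>) powr (- q))" for t1 t2 t3 u
    have A_meas: "(\<lambda>x. A (f1 x) (f2 x) (f3 x) (g x)) \<in> borel_measurable N"
      if "f1 \<in> borel_measurable N" "f2 \<in> borel_measurable N" "f3 \<in> borel_measurable N" "g \<in> borel_measurable N"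
      for f1 f2 f3 g and N :: "'z measure"
    proof -
      have [measurable]: "(\<lambda>x. coordinate_dist H (f1 x) (f2 x) (f3 x) (g x)) \<in> borel_measurable N"
        using that by (rule coordinate_dist_measurable)
      show ?thesis unfolding A_def by measurable
    qed
    have comp: "fst \<in> borel_measurable pairs" "snd \<in> borel_measurable pairs"
      using measurable_compose[OF measurable_fst id_measurable_cube_measure]
        measurable_compose[OF measurable_snd id_measurable_cube_measure] by auto
    have "(\<integral>\<^sup>+z. ennreal (determinant \<epsilon> z powr (- q)) \<partial>(pairs \<Otimes>\<^sub>M pairs)) =
        (\<integral>\<^sup>+r. \<integral>\<^sup>+r'. ennreal (determinant \<epsilon> (r, r') powr (- q)) \<partial>pairs \<partial>pairs)"
      by (rule process.M1.nn_integral_fst[symmetric]) measurable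
    also have "\<dots> \<le> (\<integral>\<^sup>+r. \<integral>\<^sup>+r'. A (snd r) (snd r) (snd r) (fst r) * A (snd r') (fst r) (snd r) (fst r') \<partial>pairs \<partial>pairs)"
    proof (intro nn_integral_mono)
      fix r r' assume "r \<in> space pairs" "r' \<in> space pairs"
      then obtain s t s' t' where r: "r = (s, t)" "r' = (s', t')" and mem: "s \<in> cbox 0 1" "t \<in> cbox 0 1" "s' \<in> cbox 0 1" "t' \<in> cbox 0 1"
        by (auto simp: space_pairs)
      let ?x = "c * coordinate_dist H t t t s + \<epsilon>" and ?y = "c * coordinate_dist H t' s t s' + \<epsilon>"
      have xy: "?x > 0" "?y > 0" using c \<epsilon> coordinate_dist_nonneg by (auto intro!: add_nonneg_pos mult_nonneg_nonneg)
      then have "0 < ?x * ?y" by simp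
      then have "determinant \<epsilon> (r, r') powr (- q) \<le> (?x * ?y) powr (- q)"
        using det[OF \<epsilon> mem] q(1) by (intro powr_mono2') (auto simp: determinant_def r)
      also have "\<dots> = ?x powr (- q) * ?y powr (- q)" using xy by (simp only: powr_mult)
      finally show "ennreal (determinant \<epsilon> (r, r') powr (- q)) \<le> A (snd r) (snd r) (snd r) (fst r) * A (snd r') (fst r) (snd r) (fst r')"
        by (simp add: A_def r ennreal_mult[symmetric] ennreal_leI)
    qed
    also have "\<dots> = (\<integral>\<^sup>+r. A (snd r) (snd r) (snd r) (fst r) * (\<integral>\<^sup>+r'. A (snd r') (fst r) (snd r) (fst r') \<partial>pairs) \<partial>pairs)"
      by (intro nn_integral_cong nn_integral_cmult A_meas comp) auto
    also have "\<dots> \<le> (\<integral>\<^sup>+r. A (snd r) (snd r) (snd r) (fst r) * ennreal b \<partial>pairs)"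
    proof (intro nn_integral_mono mult_left_mono)
      fix r
      have "(\<integral>\<^sup>+r'. A (snd r') (fst r) (snd r) (fst r') \<partial>pairs) = (\<integral>\<^sup>+t'. \<integral>\<^sup>+s'. A t' (fst r) (snd r) s' \<partial>cube_measure \<partial>cube_measure)"
        using C.nn_integral_snd[of "\<lambda>r'. A (snd r') (fst r) (snd r) (fst r')"] A_meas[OF comp(2) _ _ comp(1)] by simp
      also have "\<dots> \<le> (\<integral>\<^sup>+(t' :: real ^ 'n). ennreal b \<partial>cube_measure)"
        unfolding A_def by (intro nn_integral_mono int \<epsilon>)
      also have "\<dots> = ennreal b" by (simp add: C.M1.emeasure_space_1)
      finally show "(\<integral>\<^sup>+r'. A (snd r') (fst r) (snd r) (fst r') \<partial>pairs) \<le> ennreal b" .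
    qed simp
    also have "\<dots> = (\<integral>\<^sup>+r. A (snd r) (snd r) (snd r) (fst r) \<partial>pairs) * ennreal b"
      by (intro nn_integral_multc A_meas comp)
    also have "(\<integral>\<^sup>+r. A (snd r) (snd r) (snd r) (fst r) \<partial>pairs) = (\<integral>\<^sup>+t. \<integral>\<^sup>+s. A t t t s \<partial>cube_measure \<partial>cube_measure)"
      using C.nn_integral_snd[of "\<lambda>r. A (snd r) (snd r) (snd r) (fst r)"] A_meas[OF comp(2) comp(2) comp(2) comp(1)] by simp
    also have "\<dots> * ennreal b \<le> ennreal b * ennreal b"
    proof (rule mult_right_mono)
      have "(\<integral>\<^sup>+t. \<integral>\<^sup>+s. A t t t s \<partial>cube_measure \<partial>cube_measure) \<le> (\<integral>\<^sup>+(t :: real ^ 'n). ennreal b \<partial>cube_measure)"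
        unfolding A_def by (intro nn_integral_mono int \<epsilon>)
      then show "(\<integral>\<^sup>+t. \<integral>\<^sup>+s. A t t t s \<partial>cube_measure \<partial>cube_measure) \<le> ennreal b" by (simp add: C.M1.emeasure_space_1)
    qed simp
    also have "\<dots> = ennreal (b * b)" using b by (simp add: ennreal_mult)
    finally show ?thesis .
  qed
  moreover have "b * b \<ge> 0" by simp
  ultimately show ?thesis using that by blast
qed

lemma increment_variance_bounded:
  obtains S where "S > 0" "\<And>r. r \<in> space pairs \<Longrightarrow> icov r r \<le> S"
proof -
  obtain c1 where c1: "c1 > 0" and le: "\<And>s t. s \<in> cbox 0 1 \<Longrightarrow> t \<in> cbox 0 1 \<Longrightarrow> icov (s, t) (s, t) \<le> c1 * anisotropic_size H (t - s)"
    by (rule increment_variance_le) blast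
  have "icov r r \<le> c1 * real CARD('n)" if rp: "r \<in> space pairs" for r
  proof -
    obtain s t where r: "r = (s, t)" "s \<in> cbox 0 1" "t \<in> cbox 0 1" using rp by (auto simp: space_pairs)
    have "\<bar>(t - s) $ j\<bar> powr (2 * H $ j) \<le> 1" for j
    proof -
      have "\<bar>(t - s) $ j\<bar> \<le> 1"
      proof -
        have "0 \<le> s $ j" "s $ j \<le> 1" "0 \<le> t $ j" "t $ j \<le> 1" using r by (auto simp: mem_box_cart)
        then show ?thesis by simp
      qed
      then show ?thesis using H_pos[of j] powr_mono2[of "2 * H $ j" "\<bar>(t - s) $ j\<bar>" 1] by simp
    qed
    then have "anisotropic_size H (t - s) \<le> (\<Sum>j\<in>(UNIV :: 'n set). 1)" unfolding anisotropic_size_def by (intro sum_mono)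
    then have "c1 * anisotropic_size H (t - s) \<le> c1 * real CARD('n)" using c1 by (intro mult_left_mono) auto
    with le[OF r(2,3)] show ?thesis by (simp add: r)
  qed
  moreover have "c1 * real CARD('n) > 0" using c1 by simp
  ultimately show ?thesis using that by blast
qed

end

section \<open>Divergent determinant integrals\<close>

context anisotropic_field
begin

lemma anisotropic_box_constant:
  obtains k where "k > 0" "\<And>u. u > 0 \<Longrightarrow> emeasure lborel (anisotropic_box H u) = ennreal (k * u powr (Q / 2))"
  using emeasure_anisotropic_box[of _ H] by (intro that[of "(1 / real CARD('n)) powr (Q / 2)"]) auto

lemma anisotropic_box_borel: "anisotropic_box H u \<in> sets borel"
  by (simp add: anisotropic_box_def)

text \<open>
  By (C1) the variance is small near the diagonal \<open>s = t\<close>: translates of \<open>anisotropic_box H u\<close> by the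
  points \<open>s\<close> of half of the cube in each direction stay in the cube and give sublevel sets of measure
  of order \<open>u\<close> to the power \<open>Q / 2\<close>.
\<close>

lemma increment_variance_power_integral_unbounded:
  assumes q: "q > 0" "Q / 2 \<le> q"
  shows "\<exists>\<epsilon>>0. ennreal B < (\<integral>\<^sup>+r. ennreal ((icov r r + \<epsilon>) powr (- q)) \<partial>pairs)"
proof -
  let ?\<phi> = "\<lambda>r :: (real ^ 'n) \<times> (real ^ 'n). anisotropic_size H (snd r - fst r)"
  obtain c1 where c1: "c1 > 0" and var: "\<And>s t. s \<in> cbox 0 1 \<Longrightarrow> t \<in> cbox 0 1 \<Longrightarrow> icov (s, t) (s, t) \<le> c1 * anisotropic_size H (t - s)"
    by (rule increment_variance_le) blast
  obtain k where k: "k > 0" and box: "\<And>u. u > 0 \<Longrightarrow> emeasure lborel (anisotropic_box H u) = ennreal (k * u powr (Q / 2))"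
    by (rule anisotropic_box_constant) blast
  obtain u0 where u0: "u0 > 0" and small: "\<forall>u. 0 < u \<longrightarrow> u \<le> u0 \<longrightarrow> (\<forall>x\<in>anisotropic_box H u. \<forall>j. 0 \<le> x $ j \<and> x $ j \<le> 1 / 2)"
    using anisotropic_box_small[OF H_pos, of "1/2"] by auto
  let ?W = "cbox 0 (\<chi> j. 1 / 2) :: (real ^ 'n) set"
  have W: "emeasure lborel ?W = ennreal ((1 / 2) ^ CARD('n))"
    by (subst emeasure_cbox_cart) auto
  have fs: "fst \<in> borel_measurable pairs" "snd \<in> borel_measurable pairs"
    using measurable_compose[OF measurable_fst id_measurable_cube_measure]
      measurable_compose[OF measurable_snd id_measurable_cube_measure] by auto
  have \<phi>_meas: "?\<phi> \<in> borel_measurable pairs"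
    by (rule measurable_compose[OF borel_measurable_diff[OF fs(2) fs(1)] anisotropic_size_measurable])
  have "\<exists>\<eta>0>0. \<forall>\<eta>. 0 < \<eta> \<longrightarrow> \<eta> \<le> \<eta>0 \<longrightarrow>
      ennreal (max B 0 * c1 powr q) < (\<integral>\<^sup>+r. ennreal ((\<eta> + ?\<phi> r) powr (- q)) \<partial>pairs)"
  proof (rule nn_integral_negative_power_unbounded[OF \<phi>_meas anisotropic_size_nonneg _ u0 _ q])
    show "(1 / 2) ^ CARD('n) * k > 0" using k by simp
    fix u :: real assume u: "0 < u" "u \<le> u0"
    have into: "x + d \<in> cbox 0 1" if "x \<in> ?W" "d \<in> anisotropic_box H u" for x d
    proof -
      have "0 \<le> x $ j \<and> x $ j \<le> 1 / 2" "0 \<le> d $ j \<and> d $ j \<le> 1 / 2" for j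
        using that small u by (auto simp: mem_box_cart)
      then have "0 \<le> x $ j + d $ j \<and> x $ j + d $ j \<le> 1" for j by (smt (verit) field_sum_of_halves)
      then show ?thesis by (simp add: mem_box_cart)
    qed
    have sub: "?W \<subseteq> cbox 0 1"
    proof
      fix x assume "x \<in> ?W"
      then have half: "0 \<le> x $ j \<and> x $ j \<le> 1 / 2" for j by (simp add: mem_box_cart)
      have "0 \<le> x $ j \<and> x $ j \<le> 1" for j using half[of j] order_trans[of "x $ j" "1 / 2" 1] by auto
      then show "x \<in> cbox 0 1" by (simp add: mem_box_cart)
    qed
    note fib = emeasure_translated_fibres_restrict[of "cbox 0 (1 :: real ^ 'n)" ?W "anisotropic_box H u",
        OF _ _ sub anisotropic_box_borel into prob_space_cube_measure[unfolded cube_measure_def]]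
    have "ennreal ((1 / 2) ^ CARD('n) * k * u powr (Q / 2)) = emeasure lborel ?W * emeasure lborel (anisotropic_box H u)"
      unfolding W box[OF u(1)] using k by (simp add: ennreal_mult[symmetric] mult.assoc)
    also have "\<dots> = emeasure pairs {(x, y). x \<in> ?W \<and> y - x \<in> anisotropic_box H u}"
      unfolding cube_measure_def by (rule fib(2)[symmetric]) auto
    also have "\<dots> \<le> emeasure pairs {r \<in> space pairs. ?\<phi> r \<le> u}"
    proof (rule emeasure_mono)
      show "{(x, y). x \<in> ?W \<and> y - x \<in> anisotropic_box H u} \<subseteq> {r \<in> space pairs. ?\<phi> r \<le> u}"
      proof clarify
        fix x y assume xy: "x \<in> ?W" "y - x \<in> anisotropic_box H u"
        have "y \<in> cbox 0 1" using into[OF xy] by simp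
        then show "(x, y) \<in> space pairs \<and> ?\<phi> (x, y) \<le> u"
          using sub xy anisotropic_box_sublevel[OF H_pos u(1) xy(2)] by (auto simp: space_pairs)
      qed
      show "{r \<in> space pairs. ?\<phi> r \<le> u} \<in> sets pairs" using \<phi>_meas by measurable
    qed
    finally show "ennreal ((1 / 2) ^ CARD('n) * k * u powr (Q / 2)) \<le> emeasure pairs {r \<in> space pairs. ?\<phi> r \<le> u}" .
  qed
  then obtain \<eta> where \<eta>: "\<eta> > 0" and big: "ennreal (max B 0 * c1 powr q) < (\<integral>\<^sup>+r. ennreal ((\<eta> + ?\<phi> r) powr (- q)) \<partial>pairs)"
    by auto
  define \<epsilon> where "\<epsilon> = c1 * \<eta>"
  have \<epsilon>: "\<epsilon> > 0" using c1 \<eta> by (simp add: \<epsilon>_def)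
  have "ennreal B \<le> ennreal (c1 powr (- q) * (max B 0 * c1 powr q))"
    using c1 by (intro ennreal_leI) (simp add: powr_minus field_simps)
  also have "\<dots> = ennreal (c1 powr (- q)) * ennreal (max B 0 * c1 powr q)"
    by (rule ennreal_mult) auto
  also have "\<dots> < ennreal (c1 powr (- q)) * (\<integral>\<^sup>+r. ennreal ((\<eta> + ?\<phi> r) powr (- q)) \<partial>pairs)"
    using c1 by (intro ennreal_mult_strict_left_mono big) auto
  also have "\<dots> = (\<integral>\<^sup>+r. ennreal (c1 powr (- q)) * ennreal ((\<eta> + ?\<phi> r) powr (- q)) \<partial>pairs)"
    using \<phi>_meas by (intro nn_integral_cmult[symmetric]) measurable
  also have "\<dots> \<le> (\<integral>\<^sup>+r. ennreal ((icov r r + \<epsilon>) powr (- q)) \<partial>pairs)"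
  proof (rule nn_integral_mono)
    fix r assume "r \<in> space pairs"
    then obtain s t where r: "r = (s, t)" "s \<in> cbox 0 1" "t \<in> cbox 0 1" by (auto simp: space_pairs)
    have "icov r r + \<epsilon> \<le> c1 * (\<eta> + ?\<phi> r)"
      using var[OF r(2,3)] by (simp add: r(1) \<epsilon>_def algebra_simps)
    then have "(c1 * (\<eta> + ?\<phi> r)) powr (- q) \<le> (icov r r + \<epsilon>) powr (- q)"
      using \<epsilon> cov_nonneg[of "increment r"] q by (intro powr_mono2') (auto simp: add_nonneg_pos)
    moreover have "(c1 * (\<eta> + ?\<phi> r)) powr (- q) = c1 powr (- q) * (\<eta> + ?\<phi> r) powr (- q)"
      by (simp only: powr_mult)
    ultimately show "ennreal (c1 powr (- q)) * ennreal ((\<eta> + ?\<phi> r) powr (- q)) \<le> ennreal ((icov r r + \<epsilon>) powr (- q))"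
      by (simp add: ennreal_mult[symmetric] ennreal_leI)
  qed
  finally show ?thesis using \<epsilon> by blast
qed

text \<open>
  Near the diagonal the determinant vanishes at the rate of the second-order increments:
  \<open>v v' - r\<^sup>2 \<le> v (v - 2 r + v')\<close>, the last factor being the variance of the difference of the
  two increments.
\<close>

lemma determinant_le:
  obtains C where "C > 0"
    "\<And>\<epsilon> s t s' t'. 0 < \<epsilon> \<Longrightarrow> \<epsilon> \<le> 1 \<Longrightarrow> s \<in> cbox 0 1 \<Longrightarrow> t \<in> cbox 0 1 \<Longrightarrow> s' \<in> cbox 0 1 \<Longrightarrow> t' \<in> cbox 0 1 \<Longrightarrow>
      determinant \<epsilon> ((s, t), (s', t')) \<le> C * (\<epsilon> + (anisotropic_size H (s' - s) + anisotropic_size H (t' - t)))"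
proof -
  obtain c1 where c1: "c1 > 0" and var: "\<And>s t. s \<in> cbox 0 1 \<Longrightarrow> t \<in> cbox 0 1 \<Longrightarrow> icov (s, t) (s, t) \<le> c1 * anisotropic_size H (t - s)"
    by (rule increment_variance_le) blast
  obtain S where S: "S > 0" and le_S: "\<And>r. r \<in> space pairs \<Longrightarrow> icov r r \<le> S"
    by (rule increment_variance_bounded) blast
  \<comment> \<open>the first term bounds the determinant without \<open>\<epsilon>\<close>, the others the terms with a factor \<open>\<epsilon>\<close>\<close>
  define C where "C = 2 * S * c1 + 2 * S + 1"
  have C: "C > 0" using S c1 by (simp add: C_def add_pos_pos)
  have "determinant \<epsilon> ((s, t), (s', t')) \<le> C * (\<epsilon> + (anisotropic_size H (s' - s) + anisotropic_size H (t' - t)))"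
    if \<epsilon>: "0 < \<epsilon>" "\<epsilon> \<le> 1" and mem: "s \<in> cbox 0 1" "t \<in> cbox 0 1" "s' \<in> cbox 0 1" "t' \<in> cbox 0 1" for \<epsilon> s t s' t'
  proof -
    let ?v = "icov (s, t) (s, t)" and ?v' = "icov (s', t') (s', t')" and ?r = "icov (s, t) (s', t')"
    let ?a = "increment (s, s')" and ?b = "increment (t, t')" and ?G = "anisotropic_size H (s' - s) + anisotropic_size H (t' - t)"
    have G: "?G \<ge> 0" by (intro add_nonneg_nonneg anisotropic_size_nonneg)
    have v: "0 \<le> ?v" "?v \<le> S" "0 \<le> ?v'" "?v' \<le> S"
      using cov_nonneg le_S[of "(s, t)"] le_S[of "(s', t')"] mem by (auto simp: space_pairs)
    have "?v - 2 * ?r + ?v' = cov (\<lambda>x. 1 * increment (s, t) x + (-1) * increment (s', t') x) (\<lambda>x. 1 * increment (s, t) x + (-1) * increment (s', t') x)"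
      unfolding cov_combination_self[OF increment_functional increment_functional] by simp
    also have "(\<lambda>x. 1 * increment (s, t) x + (-1) * increment (s', t') x) = (\<lambda>x. 1 * ?a x + (-1) * ?b x)"
      by (rule ext) (simp add: increment_def)
    also have "cov (\<lambda>x. 1 * ?a x + (-1) * ?b x) (\<lambda>x. 1 * ?a x + (-1) * ?b x) = cov ?a ?a - 2 * cov ?a ?b + cov ?b ?b"
      unfolding cov_combination_self[OF increment_functional increment_functional] by simp
    also have "\<dots> \<le> 2 * cov ?a ?a + 2 * cov ?b ?b"
    proof -
      have "0 \<le> cov (\<lambda>x. 1 * ?a x + 1 * ?b x) (\<lambda>x. 1 * ?a x + 1 * ?b x)" by (rule cov_nonneg)
      then show ?thesis unfolding cov_combination_self[OF increment_functional increment_functional] by simp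
    qed
    also have "\<dots> \<le> 2 * (c1 * ?G)"
      using var[OF mem(1,3)] var[OF mem(2,4)] by (simp add: algebra_simps)
    finally have inc: "?v - 2 * ?r + ?v' \<le> 2 * (c1 * ?G)" .
    have "?v * ?v' - ?r\<^sup>2 \<le> ?v * (?v - 2 * ?r + ?v')"
    proof -
      have "0 \<le> (?v - ?r)\<^sup>2" by simp
      then show ?thesis by (simp add: power2_eq_square algebra_simps)
    qed
    also have "\<dots> \<le> ?v * (2 * (c1 * ?G))" using inc v by (intro mult_left_mono) auto
    also have "\<dots> \<le> S * (2 * (c1 * ?G))" using v c1 G by (intro mult_right_mono) auto
    finally have main: "?v * ?v' - ?r\<^sup>2 \<le> 2 * S * c1 * ?G" by (simp add: mult_ac)
    have "\<epsilon> * ?v \<le> \<epsilon> * S" "\<epsilon> * ?v' \<le> \<epsilon> * S" "\<epsilon> * \<epsilon> \<le> \<epsilon> * 1"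
      using \<epsilon> v by (auto intro!: mult_left_mono)
    then have "determinant \<epsilon> ((s, t), (s', t')) \<le> 2 * S * c1 * ?G + (2 * S + 1) * \<epsilon>"
      using main unfolding determinant_def by (simp add: algebra_simps)
    also have "\<dots> \<le> C * ?G + C * \<epsilon>"
      using S c1 G \<epsilon> by (intro add_mono mult_right_mono) (auto simp: C_def)
    also have "\<dots> = C * (\<epsilon> + ?G)" by (simp add: algebra_simps)
    finally show ?thesis .
  qed
  with C show ?thesis by (rule that)
qed

text \<open>
  By (C3) the increment over the pair of \<open>s = (1/2, ..., 1/2)\<close> and \<open>t = 0\<close> has positive variance, and by
  continuity increments over nearby pairs stay positively correlated.
\<close>

lemma positively_correlated_neighbourhood:
  obtains v0 \<delta> where "v0 > 0" "0 < \<delta>" "\<delta> \<le> 1 / 4"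
    "\<And>s t s' t'. (\<And>j. 1/2 \<le> s $ j \<and> s $ j \<le> 1/2 + \<delta> \<and> 0 \<le> t $ j \<and> t $ j \<le> \<delta>) \<Longrightarrow>
      (\<And>j. 0 \<le> (s' - s) $ j \<and> (s' - s) $ j \<le> \<delta> \<and> 0 \<le> (t' - t) $ j \<and> (t' - t) $ j \<le> \<delta>) \<Longrightarrow>
      v0 \<le> icov (s, t) (s', t')"
proof -
  obtain c where c: "c > 0" and ge: "\<And>s t. s \<in> cbox 0 1 \<Longrightarrow> t \<in> cbox 0 1 \<Longrightarrow> c * coordinate_dist H t t t s \<le> icov (s, t) (s, t)"
    by (rule determinant_ge) blast
  let ?h = "(\<chi> j. 1 / 2) :: real ^ 'n"
  let ?r0 = "(?h, 0 :: real ^ 'n)"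
  define w where "w = icov ?r0 ?r0"
  have "coordinate_dist H 0 0 0 ?h > 0"
    unfolding coordinate_dist_def by (intro sum_pos) auto
  moreover have "c * coordinate_dist H 0 0 0 ?h \<le> w"
    unfolding w_def by (rule ge) (auto simp: mem_box_cart)
  ultimately have w: "w > 0" using c by (meson less_le_trans mult_pos_pos)
  have "isCont (\<lambda>(r, r'). icov r r') (?r0, ?r0)"
    using increments_cov_continuous by (simp add: continuous_on_eq_continuous_at)
  then obtain d where d: "d > 0" and close: "\<And>z. dist z (?r0, ?r0) < d \<Longrightarrow> dist (icov (fst z) (snd z)) w < w / 2"
    using w unfolding continuous_at_eps_delta w_def by (metis (no_types, lifting) case_prod_beta' fst_conv half_gt_zero snd_conv)
  define n where "n = real CARD('n)"
  have n: "n \<ge> 1" by (simp add: n_def Suc_le_eq)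
  define \<delta> where "\<delta> = min (1 / 4) (d / (8 * n))"
  have \<delta>: "0 < \<delta>" "\<delta> \<le> 1 / 4" "8 * n * \<delta> \<le> d"
    using d n by (auto simp: \<delta>_def min_def field_simps)
  have vec: "dist x y \<le> n * e" if "\<And>j. \<bar>x $ j - y $ j\<bar> \<le> e" for x y :: "real ^ 'n" and e
  proof -
    have "dist x y \<le> (\<Sum>j\<in>UNIV. \<bar>(x - y) $ j\<bar>)" unfolding dist_norm by (rule norm_le_l1_cart)
    also have "\<dots> \<le> (\<Sum>j\<in>(UNIV :: 'n set). e)" using that by (intro sum_mono) simp
    finally show ?thesis by (simp add: n_def)
  qed
  have pair: "dist (a, b) (a', b') \<le> dist a a' + dist b b'" for a a' :: "'p :: metric_space" and b b' :: "'q :: metric_space"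
    unfolding dist_Pair_Pair by (intro sqrt_sum_squares_le_sum) auto
  have "w / 2 \<le> icov (s, t) (s', t')"
    if st: "\<And>j. 1/2 \<le> s $ j \<and> s $ j \<le> 1/2 + \<delta> \<and> 0 \<le> t $ j \<and> t $ j \<le> \<delta>"
      and inc: "\<And>j. 0 \<le> (s' - s) $ j \<and> (s' - s) $ j \<le> \<delta> \<and> 0 \<le> (t' - t) $ j \<and> (t' - t) $ j \<le> \<delta>" for s t s' t'
  proof -
    have "\<bar>s $ j - ?h $ j\<bar> \<le> \<delta>" for j using st[of j] by auto
    then have "dist s ?h \<le> n * \<delta>" by (rule vec)
    moreover have "\<bar>t $ j - 0 $ j\<bar> \<le> \<delta>" for j using st[of j] by auto
    then have "dist t 0 \<le> n * \<delta>" by (rule vec)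
    moreover have "\<bar>s' $ j - ?h $ j\<bar> \<le> 2 * \<delta>" for j using st[of j] inc[of j] by auto
    then have "dist s' ?h \<le> n * (2 * \<delta>)" by (rule vec)
    moreover have "\<bar>t' $ j - 0 $ j\<bar> \<le> 2 * \<delta>" for j using st[of j] inc[of j] by auto
    then have "dist t' 0 \<le> n * (2 * \<delta>)" by (rule vec)
    moreover have "dist ((s, t), (s', t')) (?r0, ?r0) \<le> (dist s ?h + dist t 0) + (dist s' ?h + dist t' 0)"
      by (intro order_trans[OF pair] add_mono pair)
    moreover have "n * \<delta> > 0" using n \<delta> by simp
    ultimately have "dist ((s, t), (s', t')) (?r0, ?r0) < d" using \<delta>(3) by (simp add: mult_ac)
    from close[OF this] show ?thesis by (simp add: dist_real_def abs_if split: if_splits)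
  qed
  with w \<delta> show ?thesis by (intro that[of "w / 2" \<delta>]) auto
qed

text \<open>
  Both components \<open>s' - s\<close> and \<open>t' - t\<close> have to be small for the determinant to be small, so here the
  sublevel sets have measure of order \<open>u\<^sup>Q\<close>.
\<close>

lemma weighted_determinant_power_integral_unbounded:
  assumes q: "q > 0" "Q \<le> q"
  shows "\<exists>\<epsilon>>0. ennreal B < (\<integral>\<^sup>+z. ennreal ((icov (fst z) (snd z))\<^sup>2 * determinant \<epsilon> z powr (- q)) \<partial>(pairs \<Otimes>\<^sub>M pairs))"
proof -
  let ?I = "cbox 0 (1 :: real ^ 'n)"
  obtain v0 \<delta> where v0: "v0 > 0" and \<delta>: "0 < \<delta>" "\<delta> \<le> 1 / 4" and corr:
    "\<And>s t s' t'. (\<And>j. 1/2 \<le> s $ j \<and> s $ j \<le> 1/2 + \<delta> \<and> 0 \<le> t $ j \<and> t $ j \<le> \<delta>) \<Longrightarrow>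
      (\<And>j. 0 \<le> (s' - s) $ j \<and> (s' - s) $ j \<le> \<delta> \<and> 0 \<le> (t' - t) $ j \<and> (t' - t) $ j \<le> \<delta>) \<Longrightarrow>
      v0 \<le> icov (s, t) (s', t')"
    by (rule positively_correlated_neighbourhood) blast
  obtain C where C: "C > 0" and det: "\<And>\<epsilon> s t s' t'. 0 < \<epsilon> \<Longrightarrow> \<epsilon> \<le> 1 \<Longrightarrow> s \<in> ?I \<Longrightarrow> t \<in> ?I \<Longrightarrow> s' \<in> ?I \<Longrightarrow> t' \<in> ?I \<Longrightarrow>
      determinant \<epsilon> ((s, t), (s', t')) \<le> C * (\<epsilon> + (anisotropic_size H (s' - s) + anisotropic_size H (t' - t)))"
    by (rule determinant_le) blast
  obtain k where k: "k > 0" and box: "\<And>u. u > 0 \<Longrightarrow> emeasure lborel (anisotropic_box H u) = ennreal (k * u powr (Q / 2))"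
    by (rule anisotropic_box_constant) blast
  obtain u1 where u1: "u1 > 0" and small: "\<forall>u. 0 < u \<longrightarrow> u \<le> u1 \<longrightarrow> (\<forall>x\<in>anisotropic_box H u. \<forall>j. 0 \<le> x $ j \<and> x $ j \<le> \<delta>)"
    using anisotropic_box_small[OF H_pos \<delta>(1)] by auto
  define W :: "((real ^ 'n) \<times> (real ^ 'n)) set" where
    "W = cbox (\<chi> j. 1 / 2) (\<chi> j. 1 / 2 + \<delta>) \<times> cbox 0 (\<chi> j. \<delta>)"
  define D :: "((real ^ 'n) \<times> (real ^ 'n)) set" where
    "D = cbox 0 (\<chi> j. \<delta>) \<times> cbox 0 (\<chi> j. \<delta>)"
  \<comment> \<open>pairs of parameters near the diagonal, based at a pair of points that are apart\<close>
  define E where "E = {(x, y). x \<in> W \<and> y - x \<in> D}"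
  define \<phi> where "\<phi> z = anisotropic_size H (fst (snd z) - fst (fst z)) + anisotropic_size H (snd (snd z) - snd (fst z))" for z :: "((real ^ 'n) \<times> (real ^ 'n)) \<times> ((real ^ 'n) \<times> (real ^ 'n))"
  have prod_borel: "A \<times> B \<in> sets borel" if "A \<in> sets borel" "B \<in> sets borel" for A B :: "(real ^ 'n) set"
    using pair_measureI[OF that] by (simp only: borel_prod)
  have WD: "W \<in> sets borel" "D \<in> sets borel" by (auto simp: W_def D_def intro!: prod_borel)
  have W_I: "W \<subseteq> ?I \<times> ?I"
  proof
    fix r assume r: "r \<in> W"
    have h: "1 / 2 \<le> fst r $ j \<and> fst r $ j \<le> 1 / 2 + \<delta> \<and> 0 \<le> snd r $ j \<and> snd r $ j \<le> \<delta>" for j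
      using r by (auto simp: W_def mem_box_cart)
    have "0 \<le> fst r $ j \<and> fst r $ j \<le> 1 \<and> 0 \<le> snd r $ j \<and> snd r $ j \<le> 1" for j
      using h[of j] \<delta>(2) by (elim conjE, intro conjI, linarith+)
    then show "r \<in> ?I \<times> ?I" by (cases r) (simp add: mem_box_cart)
  qed
  have II: "?I \<times> ?I \<in> sets borel" by (intro prod_borel) auto
  have into: "x + d \<in> ?I \<times> ?I" if "x \<in> W" "d \<in> D" for x d
  proof -
    have h: "1/2 \<le> fst x $ j \<and> fst x $ j \<le> 1/2 + \<delta> \<and> 0 \<le> snd x $ j \<and> snd x $ j \<le> \<delta>"
      "0 \<le> fst d $ j \<and> fst d $ j \<le> \<delta> \<and> 0 \<le> snd d $ j \<and> snd d $ j \<le> \<delta>" for j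
      using that by (auto simp: W_def D_def mem_box_cart)
    have "0 \<le> fst x $ j + fst d $ j \<and> fst x $ j + fst d $ j \<le> 1 \<and> 0 \<le> snd x $ j + snd d $ j \<and> snd x $ j + snd d $ j \<le> 1" for j
      using h(1)[of j] h(2)[of j] \<delta>(2) by (elim conjE, intro conjI, linarith+)
    then show ?thesis by (cases x; cases d) (simp add: mem_box_cart)
  qed
  have ps: "prob_space (restrict_space lborel (?I \<times> ?I))"
    using prob_space_pairs by (simp add: cube_pair_measure_eq)
  have pairs_eq: "pairs = restrict_space lborel (?I \<times> ?I)" by (rule cube_pair_measure_eq)
  have E_sets: "E \<in> sets (pairs \<Otimes>\<^sub>M pairs)"
    unfolding E_def pairs_eq by (rule emeasure_translated_fibres_restrict(1)[OF II WD(1) W_I WD(2) into ps])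
  have W_meas: "emeasure lborel W = ennreal (\<delta> ^ CARD('n) * \<delta> ^ CARD('n))"
  proof -
    let ?A = "cbox (\<chi> j. 1 / 2) (\<chi> j. 1 / 2 + \<delta>) :: (real ^ 'n) set"
    let ?B = "cbox 0 (\<chi> j. \<delta>) :: (real ^ 'n) set"
    have "emeasure lborel W = emeasure lborel ?A * emeasure lborel ?B"
      unfolding W_def lborel_prod[symmetric] by (rule lborel.emeasure_pair_measure_Times) auto
    also have "\<dots> = ennreal (\<delta> ^ CARD('n)) * ennreal (\<delta> ^ CARD('n))"
      using \<delta> by (simp add: emeasure_cbox_cart)
    also have "\<dots> = ennreal (\<delta> ^ CARD('n) * \<delta> ^ CARD('n))"
      using \<delta> by (simp add: ennreal_mult)
    finally show ?thesis .
  qed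
  let ?N = "restrict_space (pairs \<Otimes>\<^sub>M pairs) E"
  define c where "c = (\<delta> ^ CARD('n) * \<delta> ^ CARD('n)) * (k * (1 / 2) powr (Q / 2))\<^sup>2"
  have c: "c > 0" using \<delta> k by (simp add: c_def)
  have comps: "(\<lambda>z. fst (fst z)) \<in> borel_measurable (pairs \<Otimes>\<^sub>M pairs)" "(\<lambda>z. snd (fst z)) \<in> borel_measurable (pairs \<Otimes>\<^sub>M pairs)"
    "(\<lambda>z. fst (snd z)) \<in> borel_measurable (pairs \<Otimes>\<^sub>M pairs)" "(\<lambda>z. snd (snd z)) \<in> borel_measurable (pairs \<Otimes>\<^sub>M pairs)"
    by (intro measurable_compose[OF _ id_measurable_cube_measure]
        measurable_compose[OF measurable_fst measurable_fst] measurable_compose[OF measurable_fst measurable_snd]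
        measurable_compose[OF measurable_snd measurable_fst] measurable_compose[OF measurable_snd measurable_snd])+
  have \<phi>_meas: "\<phi> \<in> borel_measurable (pairs \<Otimes>\<^sub>M pairs)"
    unfolding \<phi>_def[abs_def] using comps
    by (intro borel_measurable_add measurable_compose[OF borel_measurable_diff anisotropic_size_measurable])
  have \<phi>_nonneg: "\<phi> z \<ge> 0" for z by (simp add: \<phi>_def anisotropic_size_nonneg add_nonneg_nonneg)
  have "\<exists>\<eta>0>0. \<forall>\<eta>. 0 < \<eta> \<longrightarrow> \<eta> \<le> \<eta>0 \<longrightarrow>
      ennreal (max B 0 * (C powr q / v0\<^sup>2)) < (\<integral>\<^sup>+z. ennreal ((\<eta> + \<phi> z) powr (- q)) \<partial>?N)"
  proof (rule nn_integral_negative_power_unbounded[OF measurable_restrict_space1[OF \<phi>_meas] \<phi>_nonneg _ u1 c q])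
    fix u :: real assume u: "0 < u" "u \<le> u1"
    let ?b = "anisotropic_box H (u / 2)"
    have b: "0 \<le> x $ j" "x $ j \<le> \<delta>" if "x \<in> ?b" for x j
      using small[rule_format, of "u / 2", OF _ _ that] u by auto
    have bD: "?b \<times> ?b \<subseteq> D" using b by (auto simp: D_def mem_box_cart)
    have b_sets: "?b \<times> ?b \<in> sets borel" by (intro prod_borel anisotropic_box_borel)
    have into': "x + d \<in> ?I \<times> ?I" if "x \<in> W" "d \<in> ?b \<times> ?b" for x d
      using that bD by (intro into) auto
    have fib: "emeasure (restrict_space lborel (?I \<times> ?I) \<Otimes>\<^sub>M restrict_space lborel (?I \<times> ?I)) {(x, y). x \<in> W \<and> y - x \<in> ?b \<times> ?b} =
        emeasure lborel W * emeasure lborel (?b \<times> ?b)"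
      by (rule emeasure_translated_fibres_restrict(2)[of "?I \<times> ?I" W "?b \<times> ?b"]) (fact II WD(1) W_I b_sets into' ps)+
    have "emeasure lborel (?b \<times> ?b) = emeasure lborel ?b * emeasure lborel ?b"
      unfolding lborel_prod[symmetric] using anisotropic_box_borel by (intro lborel.emeasure_pair_measure_Times) auto
    also have "\<dots> = ennreal ((k * (u / 2) powr (Q / 2))\<^sup>2)"
      using u k by (simp add: box power2_eq_square ennreal_mult)
    also have "(k * (u / 2) powr (Q / 2))\<^sup>2 = (k * (1 / 2) powr (Q / 2))\<^sup>2 * u powr Q"
    proof -
      have "(u / 2) powr (Q / 2) = (1 / 2) powr (Q / 2) * u powr (Q / 2)"
        using u by (simp add: powr_mult[symmetric])
      moreover have "(u powr (Q / 2))\<^sup>2 = u powr Q"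
        using u by (simp add: powr_power)
      ultimately show ?thesis by (simp add: power_mult_distrib)
    qed
    finally have bb: "emeasure lborel (?b \<times> ?b) = ennreal ((k * (1 / 2) powr (Q / 2))\<^sup>2 * u powr Q)" .
    have "ennreal (c * u powr Q) = emeasure lborel W * emeasure lborel (?b \<times> ?b)"
      unfolding W_meas bb using \<delta> k by (simp add: c_def ennreal_mult mult.assoc)
    then have vol: "ennreal (c * u powr Q) = emeasure (pairs \<Otimes>\<^sub>M pairs) {(x, y). x \<in> W \<and> y - x \<in> ?b \<times> ?b}"
      using fib by (simp only: pairs_eq)
    have le: "emeasure (pairs \<Otimes>\<^sub>M pairs) {(x, y). x \<in> W \<and> y - x \<in> ?b \<times> ?b} \<le>
        emeasure (pairs \<Otimes>\<^sub>M pairs) {z \<in> space ?N. \<phi> z \<le> u}"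
    proof (rule emeasure_mono)
      show "{(x, y). x \<in> W \<and> y - x \<in> ?b \<times> ?b} \<subseteq> {z \<in> space ?N. \<phi> z \<le> u}"
      proof (rule subsetI)
        fix z assume "z \<in> {(x, y). x \<in> W \<and> y - x \<in> ?b \<times> ?b}"
        then have z: "fst z \<in> W" "snd z - fst z \<in> ?b \<times> ?b" by (simp_all only: mem_Collect_eq split_beta)
        have "snd z - fst z \<in> D" by (rule subsetD[OF bD z(2)])
        then have zE: "z \<in> E" unfolding E_def mem_Collect_eq split_beta using z(1) by (rule conjI[rotated])
        have "fst (snd z) - fst (fst z) \<in> ?b" "snd (snd z) - snd (fst z) \<in> ?b"
          using z(2) by (simp_all only: mem_Times_iff fst_diff snd_diff)
        then have "anisotropic_size H (fst (snd z) - fst (fst z)) \<le> u / 2" "anisotropic_size H (snd (snd z) - snd (fst z)) \<le> u / 2"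
          using u(1) by (intro anisotropic_box_sublevel[OF H_pos]; simp only: half_gt_zero)+
        then have "\<phi> z \<le> u" unfolding \<phi>_def by linarith
        moreover have "z \<in> space (pairs \<Otimes>\<^sub>M pairs)" by (rule subsetD[OF sets.sets_into_space[OF E_sets] zE])
        ultimately show "z \<in> {z \<in> space ?N. \<phi> z \<le> u}"
          using zE by (simp only: mem_Collect_eq space_restrict_space Int_iff simp_thms)
      qed
      have "{z \<in> space ?N. \<phi> z \<le> u} = E \<inter> {z \<in> space (pairs \<Otimes>\<^sub>M pairs). \<phi> z \<le> u}"
        by (auto simp: space_restrict_space)
      also have "\<dots> \<in> sets (pairs \<Otimes>\<^sub>M pairs)" using E_sets \<phi>_meas by measurable
      finally show "{z \<in> space ?N. \<phi> z \<le> u} \<in> sets (pairs \<Otimes>\<^sub>M pairs)" .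
    qed
    have "emeasure ?N {z \<in> space ?N. \<phi> z \<le> u} = emeasure (pairs \<Otimes>\<^sub>M pairs) {z \<in> space ?N. \<phi> z \<le> u}"
      using E_sets by (intro emeasure_restrict_space) (auto simp: space_restrict_space)
    then show "ennreal (c * u powr Q) \<le> emeasure ?N {z \<in> space ?N. \<phi> z \<le> u}"
      using vol le by (simp only:)
  qed
  then obtain \<eta>0 where \<eta>0: "\<eta>0 > 0" and big0: "\<And>\<eta>. 0 < \<eta> \<Longrightarrow> \<eta> \<le> \<eta>0 \<Longrightarrow>
      ennreal (max B 0 * (C powr q / v0\<^sup>2)) < (\<integral>\<^sup>+z. ennreal ((\<eta> + \<phi> z) powr (- q)) \<partial>?N)"
    by blast
  define \<epsilon> where "\<epsilon> = min \<eta>0 1"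
  have \<epsilon>: "0 < \<epsilon>" "\<epsilon> \<le> 1" "\<epsilon> \<le> \<eta>0" using \<eta>0 by (auto simp: \<epsilon>_def)
  define K where "K = v0\<^sup>2 * C powr (- q)"
  have K: "K > 0" using v0 C by (simp add: K_def)
  have "ennreal B \<le> ennreal (K * (max B 0 * (C powr q / v0\<^sup>2)))"
    using v0 C by (intro ennreal_leI) (simp add: K_def powr_minus field_simps)
  also have "\<dots> = ennreal K * ennreal (max B 0 * (C powr q / v0\<^sup>2))"
    using K by (intro ennreal_mult) auto
  also have "\<dots> < ennreal K * (\<integral>\<^sup>+z. ennreal ((\<epsilon> + \<phi> z) powr (- q)) \<partial>?N)"
    using K by (intro ennreal_mult_strict_left_mono big0 \<epsilon>) auto
  also have "\<dots> = (\<integral>\<^sup>+z. ennreal K * ennreal ((\<epsilon> + \<phi> z) powr (- q)) \<partial>?N)"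
  proof (rule nn_integral_cmult[symmetric])
    have "(\<lambda>z. ennreal ((\<epsilon> + \<phi> z) powr (- q))) \<in> borel_measurable (pairs \<Otimes>\<^sub>M pairs)" using \<phi>_meas by measurable
    then show "(\<lambda>z. ennreal ((\<epsilon> + \<phi> z) powr (- q))) \<in> borel_measurable ?N" by (rule measurable_restrict_space1)
  qed
  also have "\<dots> = (\<integral>\<^sup>+z. ennreal K * ennreal ((\<epsilon> + \<phi> z) powr (- q)) * indicator E z \<partial>(pairs \<Otimes>\<^sub>M pairs))"
    using E_sets by (intro nn_integral_restrict_space) auto
  also have "\<dots> \<le> (\<integral>\<^sup>+z. ennreal ((icov (fst z) (snd z))\<^sup>2 * determinant \<epsilon> z powr (- q)) \<partial>(pairs \<Otimes>\<^sub>M pairs))"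
  proof (rule nn_integral_mono)
    fix z :: "((real ^ 'n) \<times> (real ^ 'n)) \<times> ((real ^ 'n) \<times> (real ^ 'n))"
    assume zs: "z \<in> space (pairs \<Otimes>\<^sub>M pairs)"
    show "ennreal K * ennreal ((\<epsilon> + \<phi> z) powr (- q)) * indicator E z \<le> ennreal ((icov (fst z) (snd z))\<^sup>2 * determinant \<epsilon> z powr (- q))"
    proof (cases "z \<in> E")
      case True
      obtain s t s' t' where z: "z = ((s, t), (s', t'))" by (metis prod.exhaust)
      have mem: "s \<in> ?I" "t \<in> ?I" "s' \<in> ?I" "t' \<in> ?I"
        using zs by (auto simp: z space_pair_measure space_cube_measure)
      have zW: "(s, t) \<in> W" "(s', t') - (s, t) \<in> D" using True by (auto simp: E_def z)
      have "v0 \<le> icov (s, t) (s', t')"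
        using zW by (intro corr) (auto simp: W_def D_def mem_box_cart)
      then have "v0\<^sup>2 \<le> (icov (fst z) (snd z))\<^sup>2" using v0 by (simp add: z power_mono)
      moreover have "(C * (\<epsilon> + \<phi> z)) powr (- q) \<le> determinant \<epsilon> z powr (- q)"
        using det[OF \<epsilon>(1,2) mem] determinant_pos[OF \<epsilon>(1), of z] q by (intro powr_mono2') (auto simp: z \<phi>_def)
      ultimately have "v0\<^sup>2 * (C * (\<epsilon> + \<phi> z)) powr (- q) \<le> (icov (fst z) (snd z))\<^sup>2 * determinant \<epsilon> z powr (- q)"
        by (intro mult_mono) auto
      moreover have "(C * (\<epsilon> + \<phi> z)) powr (- q) = C powr (- q) * (\<epsilon> + \<phi> z) powr (- q)"
        by (simp only: powr_mult)
      ultimately show ?thesis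
        using True K by (simp add: ennreal_mult[symmetric] K_def mult.assoc ennreal_leI)
    qed simp
  qed
  finally show ?thesis using \<epsilon>(1) by blast
qed

end

section \<open>Existence of the local time and its chaos expansion\<close>

context cube_field
begin

lemma self_intersection_local_time_iff:
  "is_self_intersection_local_time M X (cbox 0 1) F \<longleftrightarrow>
    F \<in> L2 M \<and> ((\<lambda>\<epsilon>. L2_sqdist M (approx_time \<epsilon>) F) \<longlongrightarrow> 0) (at_right 0)"
proof -
  have "(LINT r:cbox 0 1 \<times> cbox 0 1|lborel. heat_kernel \<epsilon> ((case r of (s, t) \<Rightarrow> \<lambda>\<omega>. X s \<omega> - X t \<omega>) \<omega>)) = approx_time \<epsilon> \<omega>" for \<epsilon> \<omega>
    unfolding set_integral_square_of_cube approx_time_def local_kernel_def by (simp add: split_beta')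
  then show ?thesis
    unfolding is_self_intersection_local_time_def is_local_time_at_0_def by simp
qed

lemma eventually_at_right_L2:
  fixes f :: "real \<Rightarrow> 'w \<Rightarrow> real"
  assumes "\<And>\<epsilon>. \<epsilon> > 0 \<Longrightarrow> f \<epsilon> \<in> L2 M"
  shows "\<forall>\<^sub>F \<epsilon> in at_right 0. f \<epsilon> \<in> L2 M"
  using eventually_at_right_less[of "0 :: real"] by eventually_elim (rule assms)

lemma approx_time_inner_tendsto:
  assumes F: "F \<in> L2 M" "((\<lambda>\<epsilon>. L2_sqdist M (approx_time \<epsilon>) F) \<longlongrightarrow> 0) (at_right 0)" and G: "G \<in> L2 M"
  shows "((\<lambda>\<epsilon>. \<integral>\<omega>. approx_time \<epsilon> \<omega> * G \<omega> \<partial>M) \<longlongrightarrow> (\<integral>\<omega>. F \<omega> * G \<omega> \<partial>M)) (at_right 0)"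
  by (rule L2_tendsto_inner[OF eventually_at_right_L2[OF approx_time_L2] F(1) _ G F(2)])
    (simp_all add: G L2_sqdist_def)

lemma total_energy_tendsto:
  assumes F: "F \<in> L2 M" "((\<lambda>\<epsilon>. L2_sqdist M (approx_time \<epsilon>) F) \<longlongrightarrow> 0) (at_right 0)"
  shows "((\<lambda>\<epsilon>. total_energy \<epsilon> \<epsilon>) \<longlongrightarrow> (\<integral>\<omega>. (F \<omega>)\<^sup>2 \<partial>M)) (at_right 0)"
proof -
  have "((\<lambda>\<epsilon>. \<integral>\<omega>. approx_time \<epsilon> \<omega> * approx_time \<epsilon> \<omega> \<partial>M) \<longlongrightarrow> (\<integral>\<omega>. F \<omega> * F \<omega> \<partial>M)) (at_right 0)"
    by (rule L2_tendsto_inner[OF eventually_at_right_L2[OF approx_time_L2] F(1) eventually_at_right_L2[OF approx_time_L2] F(1) F(2) F(2)])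
  moreover have "\<forall>\<^sub>F \<epsilon> in at_right 0. (\<integral>\<omega>. approx_time \<epsilon> \<omega> * approx_time \<epsilon> \<omega> \<partial>M) = total_energy \<epsilon> \<epsilon>"
    using eventually_at_right_less[of "0 :: real"] by eventually_elim (simp add: approx_time_inner)
  ultimately show ?thesis by (simp add: power2_eq_square tendsto_cong)
qed

text \<open>
  The energies increase to the second moment of the limit.
\<close>

lemma total_energy_le_limit:
  assumes F: "F \<in> L2 M" "((\<lambda>\<epsilon>. L2_sqdist M (approx_time \<epsilon>) F) \<longlongrightarrow> 0) (at_right 0)" and \<epsilon>: "\<epsilon> > 0"
  shows "total_energy \<epsilon> \<epsilon> \<le> (\<integral>\<omega>. (F \<omega>)\<^sup>2 \<partial>M)"
proof (rule tendsto_lowerbound[OF total_energy_tendsto[OF F]])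
  show "\<forall>\<^sub>F \<delta> in at_right 0. total_energy \<epsilon> \<epsilon> \<le> total_energy \<delta> \<delta>"
    using \<epsilon> unfolding eventually_at_right_field
    by (intro exI[of _ \<epsilon>]) (auto intro!: total_energy_antimono)
qed simp

lemma chaos_energy_le_total:
  assumes "\<epsilon> > 0" shows "chaos_energy m \<epsilon> \<epsilon> \<le> total_energy \<epsilon> \<epsilon>"
  unfolding chaos_energy_def total_energy_def using assms
  by (intro integral_mono chaos_kernel_integrable full_kernel_integrable chaos_kernel_le_full) auto

lemma full_kernel_nn_integral:
  assumes "\<epsilon> > 0"
  shows "(\<integral>\<^sup>+z. ennreal (full_kernel \<epsilon> \<epsilon> (fst z) (snd z)) \<partial>(pairs \<Otimes>\<^sub>M pairs)) = ennreal (total_energy \<epsilon> \<epsilon>)"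
  unfolding total_energy_def
  by (intro nn_integral_eq_integral full_kernel_integrable assms AE_I2 full_kernel_nonneg)

lemma chaos_kernel_nn_integral:
  assumes "\<epsilon> > 0"
  shows "(\<integral>\<^sup>+z. ennreal (chaos_kernel m \<epsilon> \<epsilon> (fst z) (snd z)) \<partial>(pairs \<Otimes>\<^sub>M pairs)) = ennreal (chaos_energy m \<epsilon> \<epsilon>)"
  unfolding chaos_energy_def
  by (intro nn_integral_eq_integral chaos_kernel_integrable assms AE_I2 chaos_kernel_nonneg)

text \<open>
  The inner product of \<open>F\<close> with \<open>approx_component m \<epsilon>\<close> is the limit of \<open>chaos_energy m \<epsilon> \<delta>\<close> as \<open>\<delta>\<close> tends
  to \<open>0\<close>, hence at least \<open>chaos_energy m \<epsilon> \<epsilon>\<close>, which is also the squared norm of the component; the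
  Cauchy--Schwarz inequality does the rest.
\<close>

lemma chaos_energy_le_component:
  assumes F: "F \<in> L2 M" "((\<lambda>\<epsilon>. L2_sqdist M (approx_time \<epsilon>) F) \<longlongrightarrow> 0) (at_right 0)"
    and Fs: "is_chaos_expansion M X F Fs" and \<epsilon>: "\<epsilon> > 0"
  shows "chaos_energy m \<epsilon> \<epsilon> \<le> (\<integral>\<omega>. (Fs (2 * m) \<omega>)\<^sup>2 \<partial>M)"
proof -
  let ?G = "approx_component m \<epsilon>" and ?a = "chaos_energy m \<epsilon> \<epsilon>"
  have G: "?G \<in> L2 M" by (rule approx_component_L2[OF \<epsilon>])
  have FsL2: "Fs (2 * m) \<in> L2 M" using Fs by (auto simp: is_chaos_expansion_def intro: chaos_L2)
  have "?a \<le> (\<integral>\<omega>. F \<omega> * ?G \<omega> \<partial>M)"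
  proof (rule tendsto_lowerbound[OF approx_time_inner_tendsto[OF F G]])
    have "?a \<le> (\<integral>\<omega>. approx_time \<delta> \<omega> * ?G \<omega> \<partial>M)" if "0 < \<delta>" "\<delta> < \<epsilon>" for \<delta>
      unfolding approx_time_component_inner[OF \<epsilon> that(1)] using that by (intro chaos_energy_antimono) auto
    then show "\<forall>\<^sub>F \<delta> in at_right 0. ?a \<le> (\<integral>\<omega>. approx_time \<delta> \<omega> * ?G \<omega> \<partial>M)"
      using \<epsilon> unfolding eventually_at_right_field by blast
  qed simp
  also have "\<dots> = (\<integral>\<omega>. Fs (2 * m) \<omega> * ?G \<omega> \<partial>M)"
    by (rule chaos_expansion_component_inner[OF F(1) Fs approx_component_chaos[OF \<epsilon>], symmetric])
  finally have le: "?a \<le> (\<integral>\<omega>. Fs (2 * m) \<omega> * ?G \<omega> \<partial>M)" .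
  have a: "?a \<ge> 0" by (rule chaos_energy_nonneg)
  have "?a\<^sup>2 \<le> (\<integral>\<omega>. Fs (2 * m) \<omega> * ?G \<omega> \<partial>M)\<^sup>2" using le a by (rule power_mono)
  also have "\<dots> \<le> (\<integral>\<omega>. (Fs (2 * m) \<omega>)\<^sup>2 \<partial>M) * (\<integral>\<omega>. (?G \<omega>)\<^sup>2 \<partial>M)"
    by (rule L2_Cauchy_Schwarz[OF FsL2 G])
  also have "(\<integral>\<omega>. (?G \<omega>)\<^sup>2 \<partial>M) = ?a"
    unfolding power2_eq_square by (rule approx_component_inner[OF \<epsilon> \<epsilon>])
  finally have sq: "?a * ?a \<le> (\<integral>\<omega>. (Fs (2 * m) \<omega>)\<^sup>2 \<partial>M) * ?a" by (simp add: power2_eq_square)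
  show ?thesis
  proof (cases "?a = 0")
    case True
    then show ?thesis by (simp add: Bochner_Integration.integral_nonneg)
  next
    case False
    then show ?thesis using a sq by (intro mult_right_le_imp_le[OF sq]) simp
  qed
qed

end

context anisotropic_field
begin

text \<open>
  The sum is taken in the extended nonnegative reals, so that it may be exchanged with the integral without
  knowing that it is finite.
\<close>

lemma weighted_energy:
  assumes \<epsilon>: "\<epsilon> > 0"
  shows "(\<Sum>m. ennreal (real m * chaos_energy m \<epsilon> \<epsilon>)) =
    ennreal (((2 * pi) powr (- (real CARD('d) / 2)))\<^sup>2 * (real CARD('d) / 2)) *
    (\<integral>\<^sup>+z. ennreal ((icov (fst z) (snd z))\<^sup>2 * determinant \<epsilon> z powr (- (real CARD('d) / 2 + 1))) \<partial>(pairs \<Otimes>\<^sub>M pairs))"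
proof -
  let ?c = "((2 * pi) powr (- (real CARD('d) / 2)))\<^sup>2 * (real CARD('d) / 2)"
  let ?w = "\<lambda>z. (icov (fst z) (snd z))\<^sup>2 * determinant \<epsilon> z powr (- (real CARD('d) / 2 + 1))"
  have "(\<Sum>m. ennreal (real m * chaos_energy m \<epsilon> \<epsilon>)) =
      (\<Sum>m. \<integral>\<^sup>+z. ennreal (real m * chaos_kernel m \<epsilon> \<epsilon> (fst z) (snd z)) \<partial>(pairs \<Otimes>\<^sub>M pairs))"
  proof (rule suminf_cong)
    fix m
    have "(\<integral>\<^sup>+z. ennreal (real m * chaos_kernel m \<epsilon> \<epsilon> (fst z) (snd z)) \<partial>(pairs \<Otimes>\<^sub>M pairs)) =
        (\<integral>\<^sup>+z. ennreal (real m) * ennreal (chaos_kernel m \<epsilon> \<epsilon> (fst z) (snd z)) \<partial>(pairs \<Otimes>\<^sub>M pairs))"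
      by (simp add: ennreal_mult chaos_kernel_nonneg)
    also have "\<dots> = ennreal (real m) * ennreal (chaos_energy m \<epsilon> \<epsilon>)"
      unfolding chaos_kernel_nn_integral[OF \<epsilon>, symmetric] by (rule nn_integral_cmult) measurable
    finally show "ennreal (real m * chaos_energy m \<epsilon> \<epsilon>) = (\<integral>\<^sup>+z. ennreal (real m * chaos_kernel m \<epsilon> \<epsilon> (fst z) (snd z)) \<partial>(pairs \<Otimes>\<^sub>M pairs))"
      by (simp add: ennreal_mult chaos_energy_nonneg)
  qed
  also have "\<dots> = (\<integral>\<^sup>+z. (\<Sum>m. ennreal (real m * chaos_kernel m \<epsilon> \<epsilon> (fst z) (snd z))) \<partial>(pairs \<Otimes>\<^sub>M pairs))"
    by (rule nn_integral_suminf[symmetric]) measurable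
  also have "\<dots> = (\<integral>\<^sup>+z. ennreal ?c * ennreal (?w z) \<partial>(pairs \<Otimes>\<^sub>M pairs))"
  proof (rule nn_integral_cong)
    fix z :: "((real ^ 'n) \<times> (real ^ 'n)) \<times> ((real ^ 'n) \<times> (real ^ 'n))"
    have c0: "0 \<le> ?c" and w0: "0 \<le> ?w z" by auto
    have "(\<Sum>m. ennreal (real m * chaos_kernel m \<epsilon> \<epsilon> (fst z) (snd z))) = ennreal (?c * ?w z)"
      using chaos_kernel_weighted_sums[OF \<epsilon> \<epsilon>, of "fst z" "snd z"]
      by (intro suminf_ennreal_eq) (auto simp: chaos_kernel_nonneg determinant_def mult_ac)
    then show "(\<Sum>m. ennreal (real m * chaos_kernel m \<epsilon> \<epsilon> (fst z) (snd z))) = ennreal ?c * ennreal (?w z)"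
      by (simp only: ennreal_mult[of ?c "?w z", OF c0 w0])
  qed
  also have "\<dots> = ennreal ?c * (\<integral>\<^sup>+z. ennreal (?w z) \<partial>(pairs \<Otimes>\<^sub>M pairs))"
    by (rule nn_integral_cmult) measurable
  finally show ?thesis .
qed

lemma total_energy_bounded:
  assumes "real CARD('d) < Q"
  obtains B where "\<And>\<epsilon>. \<epsilon> > 0 \<Longrightarrow> total_energy \<epsilon> \<epsilon> \<le> B"
proof -
  let ?c = "((2 * pi) powr (- (real CARD('d) / 2)))\<^sup>2" and ?q = "real CARD('d) / 2"
  obtain B where B: "B \<ge> 0" and int: "\<And>\<epsilon>. \<epsilon> > 0 \<Longrightarrow> (\<integral>\<^sup>+z. ennreal (determinant \<epsilon> z powr (- ?q)) \<partial>(pairs \<Otimes>\<^sub>M pairs)) \<le> ennreal B"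
    by (rule determinant_power_integral_bounded[of ?q]) (use assms in auto)
  have "total_energy \<epsilon> \<epsilon> \<le> ?c * B" if \<epsilon>: "\<epsilon> > 0" for \<epsilon>
  proof -
    have "ennreal (total_energy \<epsilon> \<epsilon>) = (\<integral>\<^sup>+z. ennreal ?c * ennreal (determinant \<epsilon> z powr (- ?q)) \<partial>(pairs \<Otimes>\<^sub>M pairs))"
      unfolding full_kernel_nn_integral[OF \<epsilon>, symmetric]
      by (simp add: full_kernel_def determinant_def ennreal_mult)
    also have "\<dots> = ennreal ?c * (\<integral>\<^sup>+z. ennreal (determinant \<epsilon> z powr (- ?q)) \<partial>(pairs \<Otimes>\<^sub>M pairs))"
      by (rule nn_integral_cmult) measurable
    also have "\<dots> \<le> ennreal ?c * ennreal B" by (intro mult_left_mono int \<epsilon>) simp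
    also have "\<dots> = ennreal (?c * B)" using B by (simp add: ennreal_mult)
    finally show ?thesis using B by (simp add: ennreal_le_iff)
  qed
  then show ?thesis by (rule that)
qed

lemma local_time_exists:
  assumes "real CARD('d) < Q"
  obtains F where "F \<in> L2 M" "((\<lambda>\<epsilon>. L2_sqdist M (approx_time \<epsilon>) F) \<longlongrightarrow> 0) (at_right 0)"
proof -
  obtain B where B: "\<And>\<epsilon>. \<epsilon> > 0 \<Longrightarrow> total_energy \<epsilon> \<epsilon> \<le> B" by (rule total_energy_bounded[OF assms]) blast
  show ?thesis
    by (rule L2_limit_of_monotone_inner_products[OF approx_time_L2 approx_time_inner total_energy_antimono B that])
qed

text \<open>
  The term \<open>m = 0\<close> of the energy factorises, and by itself it is unbounded as \<open>\<epsilon>\<close> tends to \<open>0\<close>.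
\<close>

lemma local_time_exists_imp:
  assumes F: "F \<in> L2 M" "((\<lambda>\<epsilon>. L2_sqdist M (approx_time \<epsilon>) F) \<longlongrightarrow> 0) (at_right 0)"
  shows "real CARD('d) < Q"
proof (rule ccontr)
  assume "\<not> real CARD('d) < Q"
  then have q: "Q / 2 \<le> real CARD('d) / 2" by simp
  let ?c = "((2 * pi) powr (- (real CARD('d) / 2)))\<^sup>2" and ?q = "real CARD('d) / 2"
  \<comment> \<open>as \<open>B \<ge> 1\<close>, a lower bound \<open>B\<close> for the integral is also one for its square\<close>
  define B where "B = (\<integral>\<omega>. (F \<omega>)\<^sup>2 \<partial>M) / ?c + 1"
  have c: "?c > 0" by simp
  have B: "B \<ge> 1" unfolding B_def using c by (simp add: Bochner_Integration.integral_nonneg)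
  obtain \<epsilon> where \<epsilon>: "\<epsilon> > 0" and big: "ennreal B < (\<integral>\<^sup>+r. ennreal ((icov r r + \<epsilon>) powr (- ?q)) \<partial>pairs)" (is "_ < ?I")
    using increment_variance_power_integral_unbounded[of ?q B] q by auto
  have "ennreal (?c * B) \<le> ennreal ?c * (ennreal B * ennreal B)"
    using B c by (simp add: ennreal_mult[symmetric])
  also have "\<dots> \<le> ennreal ?c * (?I * ?I)"
    using big by (intro mult_left_mono mult_mono) auto
  also have "?I * ?I = (\<integral>\<^sup>+r. \<integral>\<^sup>+r'. ennreal ((icov r r + \<epsilon>) powr (- ?q)) * ennreal ((icov r' r' + \<epsilon>) powr (- ?q)) \<partial>pairs \<partial>pairs)"
    by (simp add: nn_integral_cmult nn_integral_multc)
  also have "\<dots> = (\<integral>\<^sup>+z. ennreal ((icov (fst z) (fst z) + \<epsilon>) powr (- ?q)) * ennreal ((icov (snd z) (snd z) + \<epsilon>) powr (- ?q)) \<partial>(pairs \<Otimes>\<^sub>M pairs))"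
    by (subst process.M1.nn_integral_fst[symmetric]) auto
  also have "ennreal ?c * \<dots> = (\<integral>\<^sup>+z. ennreal ?c * (ennreal ((icov (fst z) (fst z) + \<epsilon>) powr (- ?q)) * ennreal ((icov (snd z) (snd z) + \<epsilon>) powr (- ?q))) \<partial>(pairs \<Otimes>\<^sub>M pairs))"
    by (rule nn_integral_cmult[symmetric]) measurable
  also have "\<dots> = (\<integral>\<^sup>+z. ennreal (chaos_kernel 0 \<epsilon> \<epsilon> (fst z) (snd z)) \<partial>(pairs \<Otimes>\<^sub>M pairs))"
    by (simp add: chaos_kernel_def ennreal_mult[symmetric] powr_mult)
  also have "\<dots> = ennreal (chaos_energy 0 \<epsilon> \<epsilon>)" by (rule chaos_kernel_nn_integral[OF \<epsilon>])
  also have "\<dots> \<le> ennreal (\<integral>\<omega>. (F \<omega>)\<^sup>2 \<partial>M)"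
    by (intro ennreal_leI order_trans[OF chaos_energy_le_total[OF \<epsilon>] total_energy_le_limit[OF F \<epsilon>]])
  finally have "?c * B \<le> (\<integral>\<omega>. (F \<omega>)\<^sup>2 \<partial>M)"
    by (simp add: ennreal_le_iff Bochner_Integration.integral_nonneg)
  then show False using c by (simp add: B_def field_simps)
qed

text \<open>
  Whatever the chaos expansion, the energies of its components of even order dominate those of the
  approximations, whose weighted sum is unbounded.
\<close>

lemma not_D1:
  assumes F: "F \<in> L2 M" "((\<lambda>\<epsilon>. L2_sqdist M (approx_time \<epsilon>) F) \<longlongrightarrow> 0) (at_right 0)"
    and Q: "Q \<le> (real CARD('d) + 2) / 2"
  shows "F \<notin> D1 M X"
proof
  assume "F \<in> D1 M X"
  then obtain Fs where Fs: "is_chaos_expansion M X F Fs" and sum: "summable (\<lambda>n. real n * (\<integral>\<omega>. (Fs n \<omega>)\<^sup>2 \<partial>M))"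
    unfolding D1_def by blast
  let ?c = "((2 * pi) powr (- (real CARD('d) / 2)))\<^sup>2 * (real CARD('d) / 2)"
  define S where "S = (\<Sum>n. real n * (\<integral>\<omega>. (Fs n \<omega>)\<^sup>2 \<partial>M))"
  have nonneg: "0 \<le> real n * (\<integral>\<omega>. (Fs n \<omega>)\<^sup>2 \<partial>M)" for n
    by (intro mult_nonneg_nonneg Bochner_Integration.integral_nonneg) auto
  have c: "?c > 0" by simp
  obtain \<epsilon> where \<epsilon>: "\<epsilon> > 0" and big: "ennreal (S / ?c) <
      (\<integral>\<^sup>+z. ennreal ((icov (fst z) (snd z))\<^sup>2 * determinant \<epsilon> z powr (- (real CARD('d) / 2 + 1))) \<partial>(pairs \<Otimes>\<^sub>M pairs))" (is "_ < ?I")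
    using weighted_determinant_power_integral_unbounded[of "real CARD('d) / 2 + 1" "S / ?c"] Q by (auto simp: add_divide_distrib)
  have "ennreal S = ennreal ?c * ennreal (S / ?c)"
  proof -
    have "S \<ge> 0" unfolding S_def by (intro suminf_nonneg sum nonneg)
    then show ?thesis using c by (subst ennreal_mult[symmetric]) auto
  qed
  also have "\<dots> < ennreal ?c * ?I" using c by (intro ennreal_mult_strict_left_mono big) auto
  also have "\<dots> = (\<Sum>m. ennreal (real m * chaos_energy m \<epsilon> \<epsilon>))" by (rule weighted_energy[OF \<epsilon>, symmetric])
  also have "\<dots> \<le> ennreal S"
  proof (rule suminf_le_const)
    fix k
    have "(\<Sum>m<k. real m * chaos_energy m \<epsilon> \<epsilon>) \<le> (\<Sum>m<k. real (2 * m) * (\<integral>\<omega>. (Fs (2 * m) \<omega>)\<^sup>2 \<partial>M))"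
      by (intro sum_mono mult_mono chaos_energy_le_component[OF F Fs \<epsilon>] chaos_energy_nonneg) auto
    also have "\<dots> = (\<Sum>n\<in>(*) 2 ` {..<k}. real n * (\<integral>\<omega>. (Fs n \<omega>)\<^sup>2 \<partial>M))"
      by (subst sum.reindex) (auto simp: inj_on_def)
    also have "\<dots> \<le> S" unfolding S_def by (intro sum_le_suminf sum nonneg) auto
    finally have "ennreal (\<Sum>m<k. real m * chaos_energy m \<epsilon> \<epsilon>) \<le> ennreal S" by (rule ennreal_leI)
    then show "(\<Sum>m<k. ennreal (real m * chaos_energy m \<epsilon> \<epsilon>)) \<le> ennreal S"
      by (subst sum_ennreal) (auto simp: chaos_energy_nonneg)
  qed simp
  finally show False by simp
qed

text \<open>
  The components of the approximations converge by monotonicity, just as the approximations do. Their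
  limits carry the whole second moment of \<open>F\<close>, because the energies of the approximations do,
  so that they form a chaos expansion of \<open>F\<close>.
\<close>

lemma in_D1:
  assumes F: "F \<in> L2 M" "((\<lambda>\<epsilon>. L2_sqdist M (approx_time \<epsilon>) F) \<longlongrightarrow> 0) (at_right 0)"
    and Q: "real CARD('d) + 2 < Q"
  shows "F \<in> D1 M X"
proof -
  define E where "E = (\<lambda>k. 1 / real (Suc k))"
  have E: "E k > 0" for k by (simp add: E_def)
  have E_lim: "filterlim E (at_right 0) sequentially"
    unfolding filterlim_at
  proof (intro conjI)
    show "E \<longlonglongrightarrow> 0" unfolding E_def inverse_eq_divide[symmetric] by (rule LIMSEQ_inverse_real_of_nat)
    show "\<forall>\<^sub>F k in sequentially. E k \<in> {0<..} \<and> E k \<noteq> 0"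
      by (intro always_eventually allI) (simp add: E less_imp_neq[symmetric])
  qed
  have "\<exists>G. G \<in> L2 M \<and> ((\<lambda>\<epsilon>. L2_sqdist M (approx_component m \<epsilon>) G) \<longlongrightarrow> 0) (at_right 0)" for m
  proof (rule L2_limit_of_monotone_inner_products[of "approx_component m" "chaos_energy m" "\<integral>\<omega>. (F \<omega>)\<^sup>2 \<partial>M"])
    show "chaos_energy m \<epsilon> \<epsilon> \<le> (\<integral>\<omega>. (F \<omega>)\<^sup>2 \<partial>M)" if "0 < \<epsilon>" for \<epsilon>
      by (rule order_trans[OF chaos_energy_le_total[OF that] total_energy_le_limit[OF F that]])
  qed (use approx_component_L2 approx_component_inner chaos_energy_antimono in blast)+
  then obtain G where GL2: "\<And>m. G m \<in> L2 M"
    and G_lim: "\<And>m. ((\<lambda>\<epsilon>. L2_sqdist M (approx_component m \<epsilon>) (G m)) \<longlongrightarrow> 0) (at_right 0)"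
    by metis
  have G_seq: "(\<lambda>k. L2_sqdist M (approx_component m (E k)) (G m)) \<longlonglongrightarrow> 0" for m
    by (rule filterlim_compose[OF G_lim E_lim])
  have F_seq: "(\<lambda>k. L2_sqdist M (approx_time (E k)) F) \<longlonglongrightarrow> 0"
    by (rule filterlim_compose[OF F(2) E_lim])
  have G_chaos: "G m \<in> chaos M X (2 * m)" for m
    by (rule chaos_closed[OF approx_component_chaos[OF E] GL2 G_seq field_polynomials_L2])
  define A where "A m = (\<integral>\<omega>. (G m \<omega>)\<^sup>2 \<partial>M)" for m
  have A_nonneg: "A m \<ge> 0" for m unfolding A_def by (intro Bochner_Integration.integral_nonneg) simp
  have ev: "\<forall>\<^sub>F k in sequentially. approx_component m (E k) \<in> L2 M" "\<forall>\<^sub>F k in sequentially. approx_time (E k) \<in> L2 M" for m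
    by (intro always_eventually allI approx_component_L2 approx_time_L2 E)+
  have A_lim: "(\<lambda>k. chaos_energy m (E k) (E k)) \<longlonglongrightarrow> A m" for m
    using L2_tendsto_inner[OF ev(1) GL2 ev(1) GL2 G_seq G_seq, of m m]
    by (simp add: approx_component_inner E A_def power2_eq_square)
  have FG: "(\<integral>\<omega>. F \<omega> * G m \<omega> \<partial>M) = A m" for m
  proof -
    have "(\<lambda>k. chaos_energy m (E k) (E k)) \<longlonglongrightarrow> (\<integral>\<omega>. F \<omega> * G m \<omega> \<partial>M)"
      using L2_tendsto_inner[OF ev(2) F(1) ev(1) GL2 F_seq G_seq, of m]
      by (simp add: approx_time_component_inner E)
    then show ?thesis using A_lim by (rule LIMSEQ_unique)
  qed
  have T_lim: "(\<lambda>k. total_energy (E k) (E k)) \<longlonglongrightarrow> (\<integral>\<omega>. (F \<omega>)\<^sup>2 \<partial>M)"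
    by (rule filterlim_compose[OF total_energy_tendsto[OF F] E_lim])
  have E_mono: "E k' \<le> E k" if "k \<le> k'" for k k' using that by (simp add: E_def frac_le)
  have energy_le: "chaos_energy m (E k) (E k) \<le> A m" for m k
  proof (rule LIMSEQ_le_const[OF A_lim])
    show "\<exists>N. \<forall>n\<ge>N. chaos_energy m (E k) (E k) \<le> chaos_energy m (E n) (E n)"
      by (intro exI[of _ k] allI impI chaos_energy_antimono E E_mono)
  qed
  have A_sums: "A sums (\<integral>\<omega>. (F \<omega>)\<^sup>2 \<partial>M)"
  proof -
    have partial: "(\<Sum>m<n. A m) \<le> (\<integral>\<omega>. (F \<omega>)\<^sup>2 \<partial>M)" for n
    proof (rule LIMSEQ_le_const2)
      show "(\<lambda>k. \<Sum>m<n. chaos_energy m (E k) (E k)) \<longlonglongrightarrow> (\<Sum>m<n. A m)" by (intro tendsto_sum A_lim)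
      have "(\<Sum>m<n. chaos_energy m (E k) (E k)) \<le> (\<integral>\<omega>. (F \<omega>)\<^sup>2 \<partial>M)" for k
      proof -
        have "(\<Sum>m<n. chaos_energy m (E k) (E k)) \<le> (\<Sum>m. chaos_energy m (E k) (E k))"
          using chaos_energy_sums[OF E E, of k k] by (intro sum_le_suminf) (auto simp: sums_iff chaos_energy_nonneg)
        also have "\<dots> = total_energy (E k) (E k)" using chaos_energy_sums[OF E E, of k k] by (simp add: sums_iff)
        also have "\<dots> \<le> (\<integral>\<omega>. (F \<omega>)\<^sup>2 \<partial>M)" by (rule total_energy_le_limit[OF F E])
        finally show ?thesis .
      qed
      then show "\<exists>N. \<forall>k\<ge>N. (\<Sum>m<n. chaos_energy m (E k) (E k)) \<le> (\<integral>\<omega>. (F \<omega>)\<^sup>2 \<partial>M)" by blast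
    qed
    have summ: "summable A"
      by (rule summableI_nonneg_bounded[OF A_nonneg partial])
    have "total_energy (E k) (E k) \<le> suminf A" for k
      using chaos_energy_sums[OF E E, of k k] summ energy_le suminf_le[of "\<lambda>m. chaos_energy m (E k) (E k)" A]
      by (auto simp: sums_iff)
    then have "(\<integral>\<omega>. (F \<omega>)\<^sup>2 \<partial>M) \<le> suminf A"
      by (intro LIMSEQ_le_const2[OF T_lim]) blast
    moreover have "suminf A \<le> (\<integral>\<omega>. (F \<omega>)\<^sup>2 \<partial>M)" by (rule suminf_le_const[OF summ partial])
    ultimately show ?thesis using summ by (simp add: sums_iff)
  qed
  have A_weighted: "summable (\<lambda>m. real m * A m)"
  proof -
    obtain S where S: "S > 0" and le_S: "\<And>r. r \<in> space pairs \<Longrightarrow> icov r r \<le> S"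
      by (rule increment_variance_bounded) blast
    let ?c = "((2 * pi) powr (- (real CARD('d) / 2)))\<^sup>2 * (real CARD('d) / 2)" and ?q = "real CARD('d) / 2 + 1"
    obtain B where B: "B \<ge> 0" and int: "\<And>\<epsilon>. \<epsilon> > 0 \<Longrightarrow> (\<integral>\<^sup>+z. ennreal (determinant \<epsilon> z powr (- ?q)) \<partial>(pairs \<Otimes>\<^sub>M pairs)) \<le> ennreal B"
      by (rule determinant_power_integral_bounded[of ?q]) (use Q in auto)
    have bound: "(\<Sum>m<n. real m * chaos_energy m (E k) (E k)) \<le> ?c * (S\<^sup>2 * B)" for n k
    proof -
      have "ennreal (\<Sum>m<n. real m * chaos_energy m (E k) (E k)) = (\<Sum>m<n. ennreal (real m * chaos_energy m (E k) (E k)))"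
        by (intro sum_ennreal[symmetric]) (simp add: chaos_energy_nonneg)
      also have "\<dots> \<le> (\<Sum>m. ennreal (real m * chaos_energy m (E k) (E k)))"
        by (rule sum_le_suminf) auto
      also have "\<dots> = ennreal ?c * (\<integral>\<^sup>+z. ennreal ((icov (fst z) (snd z))\<^sup>2 * determinant (E k) z powr (- ?q)) \<partial>(pairs \<Otimes>\<^sub>M pairs))"
        by (rule weighted_energy[OF E])
      also have "\<dots> \<le> ennreal ?c * (\<integral>\<^sup>+z. ennreal (S\<^sup>2) * ennreal (determinant (E k) z powr (- ?q)) \<partial>(pairs \<Otimes>\<^sub>M pairs))"
      proof (intro mult_left_mono nn_integral_mono)
        fix z assume "z \<in> space (pairs \<Otimes>\<^sub>M pairs)"
        then have "fst z \<in> space pairs" "snd z \<in> space pairs" by (auto simp: space_pair_measure)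
        then have "icov (fst z) (fst z) * icov (snd z) (snd z) \<le> S * S"
          using le_S cov_nonneg S by (intro mult_mono) auto
        then have "(icov (fst z) (snd z))\<^sup>2 \<le> S\<^sup>2"
          using icov_Cauchy_Schwarz[of "fst z" "snd z"] by (simp add: power2_eq_square)
        then show "ennreal ((icov (fst z) (snd z))\<^sup>2 * determinant (E k) z powr (- ?q)) \<le> ennreal (S\<^sup>2) * ennreal (determinant (E k) z powr (- ?q))"
          by (simp add: ennreal_mult[symmetric] ennreal_leI mult_right_mono)
      qed simp
      also have "(\<integral>\<^sup>+z. ennreal (S\<^sup>2) * ennreal (determinant (E k) z powr (- ?q)) \<partial>(pairs \<Otimes>\<^sub>M pairs)) =
          ennreal (S\<^sup>2) * (\<integral>\<^sup>+z. ennreal (determinant (E k) z powr (- ?q)) \<partial>(pairs \<Otimes>\<^sub>M pairs))"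
        by (rule nn_integral_cmult) measurable
      also have "ennreal ?c * \<dots> \<le> ennreal ?c * (ennreal (S\<^sup>2) * ennreal B)"
        by (intro mult_left_mono int E) auto
      also have "\<dots> = ennreal (?c * (S\<^sup>2 * B))"
      proof -
        have "ennreal (?c * (S\<^sup>2 * B)) = ennreal ?c * ennreal (S\<^sup>2 * B)" by (rule ennreal_mult) (use B in auto)
        moreover have "ennreal (S\<^sup>2 * B) = ennreal (S\<^sup>2) * ennreal B" by (rule ennreal_mult) (use B in auto)
        ultimately show ?thesis by (simp only:)
      qed
      finally show ?thesis using B by (simp add: ennreal_le_iff)
    qed
    have "(\<Sum>m<n. real m * A m) \<le> ?c * (S\<^sup>2 * B)" for n
    proof (rule LIMSEQ_le_const2)
      show "(\<lambda>k. \<Sum>m<n. real m * chaos_energy m (E k) (E k)) \<longlonglongrightarrow> (\<Sum>m<n. real m * A m)"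
        by (intro tendsto_sum tendsto_mult tendsto_const A_lim)
      show "\<exists>N. \<forall>k\<ge>N. (\<Sum>m<n. real m * chaos_energy m (E k) (E k)) \<le> ?c * (S\<^sup>2 * B)" using bound by blast
    qed
    then show ?thesis by (rule summableI_nonneg_bounded[rotated]) (simp add: A_nonneg)
  qed
  \<comment> \<open>the components of odd order vanish\<close>
  define Fs where "Fs n = (if even n then G (n div 2) else (\<lambda>\<omega>. 0))" for n
  have Fs_even: "Fs (2 * m) = G m" for m by (simp add: Fs_def)
  have Fs_chaos: "Fs n \<in> chaos M X n" for n
  proof (cases "even n")
    case True
    then show ?thesis using G_chaos[of "n div 2"] by (simp add: Fs_def)
  next
    case False
    then have "n \<noteq> 0" by (metis even_zero)
    moreover have "(\<lambda>\<omega>. 0) \<in> poly_closure M X n"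
      unfolding poly_closure_def using field_polynomials_zero[of X n] by (auto simp: L2_const L2_sqdist_def intro!: bexI[of _ "\<lambda>\<omega>. 0"])
    ultimately show ?thesis using False by (simp add: Fs_def chaos_def)
  qed
  have FsL2: "Fs n \<in> L2 M" for n by (rule chaos_L2[OF Fs_chaos])
  define b where "b n = (\<integral>\<omega>. (Fs n \<omega>)\<^sup>2 \<partial>M)" for n
  have b_even: "b (2 * m) = A m" for m by (simp add: b_def A_def Fs_even)
  have b_odd: "b n = 0" if "n \<notin> range (\<lambda>m. 2 * m)" for n
  proof -
    have "odd n" using that by (metis dvdE rangeI)
    then show ?thesis by (simp add: b_def Fs_def)
  qed
  have sm: "strict_mono (\<lambda>m. 2 * m :: nat)" by (auto simp: strict_mono_def)
  have b_sums: "b sums (\<integral>\<omega>. (F \<omega>)\<^sup>2 \<partial>M)"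
    using A_sums by (subst sums_mono_reindex[OF sm b_odd, symmetric]) (simp_all add: b_even)
  have "(\<lambda>m. real (2 * m) * b (2 * m)) = (\<lambda>m. 2 * (real m * A m))" by (simp add: b_even fun_eq_iff)
  then have "summable (\<lambda>m. real (2 * m) * b (2 * m))" using summable_mult[OF A_weighted, of 2] by simp
  then have weighted: "summable (\<lambda>n. real n * b n)"
    using b_odd by (subst summable_mono_reindex[OF sm, symmetric, where f = "\<lambda>n. real n * b n"]) auto
  have Fb: "(\<integral>\<omega>. F \<omega> * Fs n \<omega> \<partial>M) = b n" for n
    using FG[of "n div 2"] by (simp add: Fs_def b_def A_def)
  have dist: "(\<integral>\<omega>. (F \<omega> - (\<Sum>n<k. Fs n \<omega>))\<^sup>2 \<partial>M) = (\<integral>\<omega>. (F \<omega>)\<^sup>2 \<partial>M) - (\<Sum>n<k. b n)" for k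
  proof -
    let ?S = "\<lambda>\<omega>. \<Sum>n<k. Fs n \<omega>"
    have SL2: "?S \<in> L2 M" by (rule L2_sum[OF FsL2])
    have inner: "(\<integral>\<omega>. K \<omega> * ?S \<omega> \<partial>M) = (\<Sum>n<k. \<integral>\<omega>. K \<omega> * Fs n \<omega> \<partial>M)" if "K \<in> L2 M" for K
      unfolding sum_distrib_left by (intro Bochner_Integration.integral_sum L2_mult_integrable that FsL2)
    have "(\<integral>\<omega>. F \<omega> * ?S \<omega> \<partial>M) = (\<Sum>n<k. b n)" unfolding inner[OF F(1)] Fb ..
    moreover have "(\<integral>\<omega>. ?S \<omega> * ?S \<omega> \<partial>M) = (\<Sum>n<k. b n)"
    proof -
      have "(\<integral>\<omega>. ?S \<omega> * Fs n \<omega> \<partial>M) = b n" if n: "n < k" for n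
      proof -
        have "(\<integral>\<omega>. ?S \<omega> * Fs n \<omega> \<partial>M) = (\<Sum>i<k. \<integral>\<omega>. Fs n \<omega> * Fs i \<omega> \<partial>M)"
          using inner[OF FsL2[of n]] by (simp add: mult.commute)
        also have "\<dots> = (\<Sum>i<k. if i = n then b n else 0)"
          by (intro sum.cong refl) (auto simp: b_def power2_eq_square chaos_orthogonal[OF Fs_chaos Fs_chaos])
        finally show ?thesis using n by simp
      qed
      then show ?thesis unfolding inner[OF SL2] by simp
    qed
    moreover have "(\<integral>\<omega>. (F \<omega> - ?S \<omega>)\<^sup>2 \<partial>M) = (\<integral>\<omega>. (F \<omega>)\<^sup>2 \<partial>M) - 2 * (\<integral>\<omega>. F \<omega> * ?S \<omega> \<partial>M) + (\<integral>\<omega>. ?S \<omega> * ?S \<omega> \<partial>M)"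
    proof -
      have "(\<integral>\<omega>. (F \<omega> - ?S \<omega>)\<^sup>2 \<partial>M) = (\<integral>\<omega>. (F \<omega>)\<^sup>2 - 2 * (F \<omega> * ?S \<omega>) + ?S \<omega> * ?S \<omega> \<partial>M)"
        by (intro Bochner_Integration.integral_cong refl) (simp add: power2_eq_square algebra_simps)
      then show ?thesis
        using L2_square_integrable[OF F(1)] L2_mult_integrable[OF F(1) SL2] L2_mult_integrable[OF SL2 SL2] by simp
    qed
    ultimately show ?thesis by simp
  qed
  have "(\<lambda>k. \<integral>\<omega>. ((\<Sum>n<k. Fs n \<omega>) - F \<omega>)\<^sup>2 \<partial>M) \<longlonglongrightarrow> (\<integral>\<omega>. (F \<omega>)\<^sup>2 \<partial>M) - (\<integral>\<omega>. (F \<omega>)\<^sup>2 \<partial>M)"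
    unfolding power2_commute[of _ "F _"] dist using b_sums unfolding sums_def by (intro tendsto_diff tendsto_const)
  then have "(\<lambda>k. L2_sqdist M (\<lambda>\<omega>. \<Sum>n<k. Fs n \<omega>) F) \<longlonglongrightarrow> 0"
    by (subst L2_tendsto_iff) (auto simp: F(1) intro!: always_eventually L2_sum FsL2)
  then have "is_chaos_expansion M X F Fs"
    unfolding is_chaos_expansion_def using Fs_chaos by (simp add: L2_sqdist_commute[of M F])
  then show ?thesis
    unfolding D1_def using F(1) weighted by (auto simp: b_def)
qed

end

theorem theorem3p5:
  fixes M :: "'w measure" and M0 :: "'v measure"
    and X :: "real ^ 'n \<Rightarrow> 'w \<Rightarrow> real ^ 'd"
    and X0 :: "real ^ 'n \<Rightarrow> 'v \<Rightarrow> real"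
    and H :: "real ^ 'n"
  assumes "prob_space M" and "prob_space M0"
    and "centered_gaussian_field M0 X0"
    and "continuous_covariance M0 X0"
    and "independent_copies M X M0 X0"
    and "\<forall>\<omega>\<in>space M. continuous_on (cbox 0 1) (\<lambda>t. X t \<omega>)"
    and "\<forall>j. 0 < H $ j \<and> H $ j < 1"
    and "cond_C1 M0 X0 H"
    and "cond_C3 M0 X0 H"
  shows "((\<exists>F. is_self_intersection_local_time M X (cbox 0 1) F) \<longleftrightarrow>
            (\<Sum>j\<in>UNIV. 1 / H $ j) > real CARD('d)) \<and>
         ((\<Sum>j\<in>UNIV. 1 / H $ j) > real CARD('d) + 2 \<longrightarrow>
            (\<exists>F. is_self_intersection_local_time M X (cbox 0 1) F \<and> F \<in> D1 M X)) \<and>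
         ((\<Sum>j\<in>UNIV. 1 / H $ j) \<le> max ((real CARD('d) + 2) / 2) (2 * real CARD('d) / 3) \<longrightarrow>
            \<not> (\<exists>F. is_self_intersection_local_time M X (cbox 0 1) F \<and> F \<in> D1 M X))"
proof -
  interpret prob_space M by fact
  interpret base: prob_space M0 by fact
  interpret anisotropic_field M M0 X X0 H
    by unfold_locales (use assms in auto)
  let ?loc = "\<lambda>F. F \<in> L2 M \<and> ((\<lambda>\<epsilon>. L2_sqdist M (approx_time \<epsilon>) F) \<longlongrightarrow> 0) (at_right 0)"
  have exists: "(\<exists>F. ?loc F) \<longleftrightarrow> real CARD('d) < Q"
  proof
    assume "\<exists>F. ?loc F"
    then show "real CARD('d) < Q" using local_time_exists_imp by blast
  next
    assume "real CARD('d) < Q"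
    then obtain F where "?loc F" by (rule local_time_exists) blast
    then show "\<exists>F. ?loc F" by blast
  qed
  moreover have "\<exists>F. ?loc F \<and> F \<in> D1 M X" if Q: "real CARD('d) + 2 < Q"
  proof -
    have "real CARD('d) < Q" using Q by linarith
    then obtain F where "?loc F" using exists by blast
    then show ?thesis using in_D1[OF _ _ Q] by blast
  qed
  moreover have "\<not> (\<exists>F. ?loc F \<and> F \<in> D1 M X)" if Q: "Q \<le> max ((real CARD('d) + 2) / 2) (2 * real CARD('d) / 3)"
  proof (cases "Q \<le> (real CARD('d) + 2) / 2")
    case True
    then show ?thesis using not_D1 by blast
  next
    case False
    then have "Q \<le> 2 * real CARD('d) / 3" using Q by (auto simp: max_def split: if_splits)
    also have "\<dots> \<le> real CARD('d)" by simp
    finally show ?thesis using exists by force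
  qed
  ultimately show ?thesis unfolding self_intersection_local_time_iff by blast
qed

end
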